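(* Let $0<p,q\le\infty$ and let $\mu\in C^2(\mathbb{R}^n)$ be real-valued such that, for some $s>0$ and $\epsilon>0$, $\langle\xi\rangle^{-s}\partial_j\mu(\xi)\in W^{\infty,\infty}_{n/(\dot p\wedge\dot q)+\epsilon}$ for $j=1,\dots,n$, and $\partial^\gamma\mu\in W^{\infty,\infty}_{n/\dot p+\epsilon}$ for all multi-indices $|\gamma|=2$. Then $e^{i\mu(D)}:W^{p,q}_\delta\to W^{p,q}$ is bounded for every $\delta\ge sn|1/p-1/q|$, where the inequality is required to be strict when $p\neq q$.
   Context: Fourier transform: $\hat f(\xi)=\int f(x)e^{-2\pi i x\cdot\xi}dx$. $\langle x\rangle=(1+|x|^2)^{1/2}$. For a fixed nonzero Schwartz window $\phi$, $V_\phi f(x,\xi)=\int f(y)\overline{\phi(y-x)}e^{-2\pi i y\cdot\xi}dy$. For $0<p,q\le\infty$, $s\in\mathbb{R}$, the Wiener amalgam space $W^{p,q}_s$ consists of $f\in\mathcal S'$ with $\|f\|_{W^{p,q}_s}=\big\|\,\|V_\phi f(x,\xi)\langle\xi\rangle^s\|_{L^q_\xi}\big\|_{L^p_x}<\infty$ (independent of $\phi$ up to equivalence); $W^{p,q}=W^{p,q}_0$. $\dot p=\min\{1,p\}$, $\dot q=\min\{1,q\}$, $\dot p\wedge\dot q=\min\{\dot p,\dot q\}$. $e^{i\mu(D)}f=\mathcal F^{-1}(e^{i\mu}\hat f)$; boundedness $W^{p,q}_\delta\to W^{p,q}$ means $\|e^{i\mu(D)}f\|_{W^{p,q}}\le C\|f\|_{W^{p,q}_\delta}$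 for all Schwartz $f$. *)

theory Defs
  imports "HOL-Analysis.Analysis" "HOL-Probability.Essential_Supremum"
begin

definition jbr :: "real ^ 'n \<Rightarrow> real" where
  "jbr \<xi> = sqrt (1 + (norm \<xi>)\<^sup>2)"

definition pd :: "'n::finite \<Rightarrow> (real ^ 'n \<Rightarrow> 'b::real_normed_vector) \<Rightarrow> real ^ 'n \<Rightarrow> 'b" where
  "pd j f x = vector_derivative (\<lambda>t. f (x + t *\<^sub>R axis j 1)) (at 0)"

definition has_pd :: "'n::finite \<Rightarrow> (real ^ 'n \<Rightarrow> 'b::real_normed_vector) \<Rightarrow> real ^ 'n \<Rightarrow> bool" where
  "has_pd j f x \<longleftrightarrow> (\<lambda>t. f (x + t *\<^sub>R axis j 1)) differentiable (at 0)"

fun pds :: "'n::finite list \<Rightarrow> (real ^ 'n \<Rightarrow> 'b::real_normed_vector) \<Rightarrow> real ^ 'n \<Rightarrow> 'b" where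
  "pds [] f = f"
| "pds (j # js) f = pd j (pds js f)"

definition C2 :: "(real ^ 'n::finite \<Rightarrow> real) \<Rightarrow> bool" where
  "C2 \<mu> \<longleftrightarrow> \<mu> differentiable_on UNIV \<and>
     (\<forall>j. pd j \<mu> differentiable_on UNIV) \<and>
     (\<forall>i j. continuous_on UNIV (pd i (pd j \<mu>)))"

definition schwartz :: "(real ^ 'n::finite \<Rightarrow> complex) \<Rightarrow> bool" where
  "schwartz f \<longleftrightarrow>
     (\<forall>js j x. has_pd j (pds js f) x) \<and>
     (\<forall>js. continuous_on UNIV (pds js f)) \<and>
     (\<forall>js (k::nat). bounded (range (\<lambda>x. (norm x) ^ k * norm (pds js f x))))"

definition fourier :: "(real ^ 'n::finite \<Rightarrow> complex) \<Rightarrow> real ^ 'n \<Rightarrow> complex" where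
  "fourier f \<xi> = (LINT x|lborel. f x * cis (- 2 * pi * (x \<bullet> \<xi>)))"

definition mult_op :: "(real ^ 'n::finite \<Rightarrow> real) \<Rightarrow> (real ^ 'n \<Rightarrow> complex) \<Rightarrow> real ^ 'n \<Rightarrow> complex" where
  "mult_op \<mu> f x = (LINT \<xi>|lborel. cis (\<mu> \<xi>) * fourier f \<xi> * cis (2 * pi * (x \<bullet> \<xi>)))"

text \<open>Fixed window: the Gaussian (nonzero Schwartz, phi(0) /= 0).\<close>

definition window :: "real ^ 'n::finite \<Rightarrow> complex" where
  "window x = complex_of_real (exp (- pi * (norm x)\<^sup>2))"

definition stft :: "(real ^ 'n::finite \<Rightarrow> complex) \<Rightarrow> real ^ 'n \<Rightarrow> real ^ 'n \<Rightarrow> complex" where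
  "stft f x \<xi> = (LINT y|lborel. f y * cnj (window (y - x)) * cis (- 2 * pi * (y \<bullet> \<xi>)))"

definition epow :: "ennreal \<Rightarrow> real \<Rightarrow> ennreal" where
  "epow a r = (if a = top then top else ennreal (enn2real a powr r))"

definition Lnorm :: "'a measure \<Rightarrow> ereal \<Rightarrow> ('a \<Rightarrow> ennreal) \<Rightarrow> ennreal" where
  "Lnorm M p g = (if p = \<infinity> then esssup M g
     else epow (\<integral>\<^sup>+ x. epow (g x) (real_of_ereal p) \<partial>M) (1 / real_of_ereal p))"

definition Wnorm :: "ereal \<Rightarrow> ereal \<Rightarrow> real \<Rightarrow> (real ^ 'n::finite \<Rightarrow> complex) \<Rightarrow> ennreal" where
  "Wnorm p q s f = Lnorm lborel p (\<lambda>x. Lnorm lborel q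
      (\<lambda>\<xi>. ennreal (norm (stft f x \<xi>) * jbr \<xi> powr s)))"

text \<open>Membership of a function in W^{infinity,infinity}_t, with V_phi g given by the absolutely
  convergent integral.\<close>

definition in_Winf :: "real \<Rightarrow> (real ^ 'n::finite \<Rightarrow> complex) \<Rightarrow> bool" where
  "in_Winf t g \<longleftrightarrow> (\<forall>x. integrable lborel (\<lambda>y. g y * cnj (window (y - x))))
      \<and> Wnorm \<infinity> \<infinity> t g < top"

definition dotexp :: "ereal \<Rightarrow> real" where
  "dotexp p = real_of_ereal (min 1 p)"

definition recip :: "ereal \<Rightarrow> real" where
  "recip p = (if p = \<infinity> then 0 else 1 / real_of_ereal p)"

end

theory Submission
  imports Defs "HOL-Real_Asymp.Real_Asymp" "HOL-Probability.Characteristic_Functions"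
begin

text \<open>
  With a Gaussian window, $|V_\phi f(x,\xi)|$ is the windowed transform of $\hat f$ near $\xi$, and
  passing to $e^{i\mu(D)}f$ multiplies $\hat f$ by $e^{i\mu}$. Integration by parts together with an
  absorption argument shows that the windowed transform of $e^{i\mu}$ at $\omega$ is bounded by
  $\langle x-a(\omega)\rangle^{-t}(1+|x|/\langle\omega\rangle^s)^{-(t'-t)}$, where
  $a=\nabla\mu/2\pi=O(\langle\omega\rangle^s)$ and $t$, $t'$ are the decay orders of the second and
  first derivatives of $\mu$. So $V_\phi(e^{i\mu(D)}f)(\cdot,\xi)$ is dominated by the average, against
  this kernel, of Peetre's maximal function of $V_\phi f$, and the latter has the same mixed norms as
  $V_\phi f$ itself.

  For $p=q$ Fubini's theorem finishes the proof. For $p\neq q$ the kernel at distance much larger than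
  $\langle\xi\rangle^s$ is $\langle\xi\rangle^{s(t'-t)}\leq\langle\xi\rangle^\delta$ times a fixed
  convolution kernel. The rest moves mass by at most $R\sim 2^{js}$ on the shell
  $\langle\xi\rangle\sim 2^j$; on balls of radius $R$ the $L^p_x$ and $L^q_\xi$ norms can be exchanged
  at the cost of $R^{n|1/p-1/q|}$, and since $\delta>sn|1/p-1/q|$ the losses are summable over $j$.
\<close>

section \<open>Brackets and Gaussians\<close>

text \<open>The obstacle in the first half: with \<mu> only C^2, one integration by parts is
  available, gaining a single power of the distance to the stationary point, while order t > n is
  required. So the gain is used to form a circular inequality: the transform of e^{i \<mu>} is
  bounded by its own average divided by a large distance. Three devices close it. Products narrow a
  Gaussian window, and \<open>fourier_widen\<close> undoes this. The kernel is reproduced by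
  averaging against the transforms of the derivatives, which is why its second factor takes effect
  only for |x| beyond <\<omega>>^s. And it changes by at most a power of <\<tau>> when the frequency
  moves by \<tau>, by the Lipschitz bound on the gradient. In the second half, exponents below 1
  leave neither Minkowski's nor Jensen's inequality. The substitute is slow variation: functions
  comparable on unit balls embed from local L^r into L^1, r < 1, as sequences do. The price is that
  r-th powers of the kernels must remain integrable, which is the origin of the orders n / r in the
  hypotheses.\<close>

abbreviation lborel_nn_integral :: "('a::euclidean_space \<Rightarrow> ennreal) \<Rightarrow> ennreal" (binder "\<integral>" 10) where
  "lborel_nn_integral f \<equiv> integral\<^sup>N lborel f"

section \<open>Affine changes of variables\<close>

lemma nn_integral_shift:
  fixes f :: "real ^ 'n::finite \<Rightarrow> ennreal"
  assumes [measurable]: "f \<in> borel_measurable borel"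
  shows "(\<integral>x. f (c + x)) = (\<integral>x. f x)"
  by (subst (2) lborel_distr_plus[of c, symmetric]) (simp add: nn_integral_distr)

lemma nn_integral_reflect:
  fixes f :: "real ^ 'n::finite \<Rightarrow> ennreal"
  assumes [measurable]: "f \<in> borel_measurable borel"
  shows "(\<integral>x. f (c - x)) = (\<integral>x. f x)"
  by (subst (2) lborel_affine[of "-1" c])
     (simp_all add: nn_integral_density nn_integral_distr)

lemma integral_shift:
  fixes f :: "real ^ 'n::finite \<Rightarrow> 'b::{banach, second_countable_topology}"
  assumes [measurable]: "f \<in> borel_measurable borel"
  shows "(LINT x|lborel. f (c + x)) = (LINT x|lborel. f x)"
  by (subst (2) lborel_distr_plus[of c, symmetric]) (simp add: integral_distr)

lemma integrable_shift:
  fixes f :: "real ^ 'n::finite \<Rightarrow> 'b::{banach, second_countable_topology}"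
  assumes "integrable lborel f"
  shows "integrable lborel (\<lambda>x. f (c + x))"
proof -
  have [measurable]: "f \<in> borel_measurable borel"
    using assms by (simp add: borel_measurable_integrable[of lborel f, simplified])
  have "integrable (distr lborel borel ((+) c)) f"
    using assms by (simp add: lborel_distr_plus)
  then show ?thesis
    by (subst (asm) integrable_distr_eq) auto
qed

lemma integral_dilate:
  fixes f :: "real ^ 'n::finite \<Rightarrow> 'b::{banach, second_countable_topology}"
  assumes [measurable]: "f \<in> borel_measurable borel" and "r > 0"
  shows "(r ^ CARD('n)) *\<^sub>R (LINT x|lborel. f (r *\<^sub>R x)) = (LINT x|lborel. f x)"
  using assms(2)
  by (subst (2) lborel_affine[of r 0])
     (simp_all add: integral_density integral_distr)

section \<open>The Japanese bracket\<close>

lemma jbr_ge_1: "1 \<le> jbr x"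
  by (simp add: jbr_def)

lemma jbr_pos [simp]: "0 < jbr x"
  using jbr_ge_1[of x] by linarith

lemma jbr_nonneg [simp]: "0 \<le> jbr x"
  using jbr_pos[of x] by linarith

lemma jbr_ne_0 [simp]: "jbr x \<noteq> 0"
  using jbr_pos[of x] by linarith

lemma jbr_minus [simp]: "jbr (- x) = jbr x"
  by (simp add: jbr_def)

lemma norm_le_jbr: "norm x \<le> jbr x"
  unfolding jbr_def by (rule real_le_rsqrt) simp

lemma jbr_le_norm: "jbr x \<le> 1 + norm x"
  unfolding jbr_def by (rule real_le_lsqrt) (auto simp: power2_eq_square algebra_simps)

lemma jbr_add: "jbr (x + y) \<le> 2 * jbr x * jbr y"
proof -
  have "jbr (x + y) \<le> 1 + norm (x + y)" by (rule jbr_le_norm)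
  also have "\<dots> \<le> 1 + norm x + norm y" using norm_triangle_ineq[of x y] by simp
  also have "\<dots> \<le> jbr x * jbr y + jbr x * jbr y"
  proof (rule add_mono[of "1" _ "norm x + norm y", unfolded add.assoc[symmetric]])
    show "1 \<le> jbr x * jbr y" using jbr_ge_1[of x] jbr_ge_1[of y] using mult_mono[of 1 "jbr x" 1 "jbr y"] by simp
    have "(norm x + norm y)\<^sup>2 \<le> (1 + (norm x)\<^sup>2) * (1 + (norm y)\<^sup>2)"
    proof -
      have "0 \<le> (1 - norm x * norm y)\<^sup>2" by simp
      then show ?thesis by (simp add: power2_eq_square algebra_simps)
    qed
    then have "norm x + norm y \<le> sqrt ((1 + (norm x)\<^sup>2) * (1 + (norm y)\<^sup>2))"
      by (rule real_le_rsqrt)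
    then show "norm x + norm y \<le> jbr x * jbr y" by (simp add: jbr_def real_sqrt_mult)
  qed
  finally show ?thesis by simp
qed

lemma jbr_diff: "jbr (x - y) \<le> 2 * jbr x * jbr y"
  using jbr_add[of x "- y"] by simp

lemma continuous_on_jbr [continuous_intros]:
  "continuous_on S f \<Longrightarrow> continuous_on S (\<lambda>x. jbr (f x))"
  unfolding jbr_def by (intro continuous_intros)

lemma measurable_jbr [measurable]: "jbr \<in> borel_measurable borel"
  by (intro borel_measurable_continuous_onI continuous_intros)

text \<open>Peetre's inequality: <x> <= 2 <x + y> <y>, raised to the power \<open>t\<close> and
  divided through.\<close>

lemma jbr_powr_add:
  assumes "0 \<le> t"
  shows "jbr (x + y) powr (- t) \<le> 2 powr t * jbr x powr (- t) * jbr y powr t"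
proof -
  have "jbr x \<le> 2 * jbr (x + y) * jbr y"
    using jbr_diff[of "x + y" y] by simp
  then have "jbr x powr t \<le> (2 * jbr (x + y) * jbr y) powr t"
    by (intro powr_mono2 assms) auto
  then show ?thesis
    by (simp add: powr_mult powr_minus field_simps)
qed

lemma jbr_powr_add_pos:
  assumes "0 \<le> t"
  shows "jbr (x + y) powr t \<le> 2 powr t * jbr x powr t * jbr y powr t"
proof -
  have "jbr (x + y) powr t \<le> (2 * jbr x * jbr y) powr t"
    using jbr_add[of x y] by (intro powr_mono2 assms) auto
  then show ?thesis
    by (simp add: powr_mult)
qed

text \<open>Dyadic layers: where <x> is about 2^j the integrand is about 2^(-t j), on a ball of
  volume about 2^(n j), so the sum over j is geometric with ratio 2^(n - t).\<close>

lemma nn_integral_jbr_powr_finite: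
  assumes t: "real CARD('n) < t"
  shows "(\<integral>(x::real^'n::finite). ennreal (jbr x powr (- t))) < \<infinity>"
proof -
  let ?n = "CARD('n)"
  let ?B = "\<lambda>j::nat. ball (0::real^'n) (2 ^ Suc j)"
  let ?c = "unit_ball_vol (real ?n)"
  have t0: "0 < t" using t by linarith
  have bound: "ennreal (jbr x powr (- t)) \<le> (\<Sum>j. ennreal (2 powr (- t * real j)) * indicator (?B j) x)" for x :: "real^'n"
  proof -
    define j where "j = nat \<lfloor>log 2 (jbr x)\<rfloor>"
    have l0: "0 \<le> log 2 (jbr x)" using jbr_ge_1[of x] by simp
    have jl: "real j \<le> log 2 (jbr x)" "log 2 (jbr x) < real j + 1"
      unfolding j_def using l0 by linarith+
    have "2 powr real j \<le> jbr x" using jl(1) by (simp add: le_log_iff)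
    then have 1: "jbr x powr (-t) \<le> 2 powr (- t * real j)"
      using powr_mono2'[of "-t" "2 powr real j" "jbr x"] t0 by (simp add: powr_powr mult.commute)
    have "jbr x < 2 powr (real j + 1)" using jl(2) by (simp add: log_less_iff)
    then have "norm x < 2 ^ Suc j" using norm_le_jbr[of x]
      by (simp add: powr_add powr_realpow)
    define g where "g = (\<lambda>i. ennreal (2 powr (- t * real i)) * indicator (?B i) x)"
    have "ennreal (jbr x powr (-t)) \<le> g j"
      unfolding g_def using 1 \<open>norm x < 2 ^ Suc j\<close> by (simp add: ennreal_leI)
    also have "g j = sum g {j}" by simp
    also have "\<dots> \<le> suminf g" by (intro sum_le_suminf) auto
    finally have "ennreal (jbr x powr (-t)) \<le> suminf g" .
    then show ?thesis unfolding g_def .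
  qed
  define f where "f = (\<lambda>j (x::real^'n). ennreal (2 powr (- t * real j)) * indicator (?B j) x)"
  have [measurable]: "f j \<in> borel_measurable lborel" for j
    unfolding f_def
    by (intro borel_measurable_times_ennreal borel_measurable_const borel_measurable_indicator) simp
  have fj: "integral\<^sup>N lborel (f j) = ennreal (?c * 2 ^ ?n * (2 powr (real ?n - t)) ^ j)" for j
  proof -
    have e: "(2 powr (real ?n - t)) ^ j = 2 powr ((real ?n - t) * real j)"
      using powr_realpow[of "2 powr (real ?n - t)" j] powr_powr[of 2 "real ?n - t" "real j"] by simp
    have e2: "(2 ^ Suc j) ^ ?n = (2::real) ^ ?n * 2 powr (real ?n * real j)"
      using powr_realpow[of "2::real" "?n * j"] by (simp add: power_mult_distrib power_mult mult.commute)
    have e3: "2 powr ((real ?n - t) * real j) = 2 powr (real ?n * real j) * 2 powr (- t * real j)"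
      unfolding powr_add[symmetric] by (simp add: algebra_simps)
    have "integral\<^sup>N lborel (f j) = ennreal (2 powr (- t * real j)) * emeasure lborel (?B j)"
      unfolding f_def by (rule nn_integral_cmult_indicator) simp
    also have "emeasure lborel (?B j) = ennreal (?c * (2 ^ Suc j) ^ ?n)"
      by (subst emeasure_ball) auto
    also have "ennreal (2 powr (- t * real j)) * ennreal (?c * (2 ^ Suc j) ^ ?n) = ennreal (2 powr (- t * real j) * (?c * (2 ^ Suc j) ^ ?n))"
      by (rule ennreal_mult[symmetric]) auto
    also have "2 powr (- t * real j) * (?c * (2 ^ Suc j) ^ ?n) = ?c * 2 ^ ?n * (2 powr (real ?n - t)) ^ j"
      unfolding e e2 e3 by simp
    finally show ?thesis .
  qed
  have "(\<integral>(x::real^'n). ennreal (jbr x powr (- t))) \<le> (\<integral>x. (\<Sum>j. f j x))"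
    unfolding f_def by (rule nn_integral_mono) (rule bound)
  moreover have "(\<integral>x. (\<Sum>j. f j x)) = (\<Sum>j. integral\<^sup>N lborel (f j))"
    by (rule nn_integral_suminf) simp
  moreover have "(\<Sum>j. integral\<^sup>N lborel (f j)) < \<infinity>"
  proof -
    have "2 powr (real ?n - t) < 2 powr 0" using t by (intro powr_less_mono) auto
    then have "summable (\<lambda>j. ?c * 2 ^ ?n * (2 powr (real ?n - t)) ^ j)"
      by (intro summable_mult summable_geometric) auto
    then show ?thesis
      unfolding fj by (subst suminf_ennreal2) auto
  qed
  ultimately show ?thesis by (metis order_le_less_trans)
qed

lemma integrable_jbr_powr:
  assumes t: "real CARD('n) < t"
  shows "integrable lborel (\<lambda>x::real^'n::finite. jbr x powr (- t))"
  using nn_integral_jbr_powr_finite[OF t] by (intro integrableI_nonneg) auto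

lemma exp_le_jbr_powr:
  assumes "c > 0"
  shows "\<exists>C>0. \<forall>x::real^'n::finite. exp (- c * norm x) \<le> C * jbr x powr (- t)"
proof -
  obtain m :: nat where m: "t \<le> real m" using real_arch_simple by blast
  have "((\<lambda>u::real. (1 + u) ^ m * exp (- c * u)) \<longlongrightarrow> 0) at_top"
    using assms by real_asymp
  then have "eventually (\<lambda>u. (1 + u) ^ m * exp (- c * u) < 1) at_top"
    by (rule order_tendstoD) simp
  then obtain U where U: "\<And>u. u \<ge> U \<Longrightarrow> (1 + u) ^ m * exp (- c * u) < 1"
    by (auto simp: eventually_at_top_linorder)
  define C where "C = max 1 ((1 + \<bar>U\<bar>) ^ m)"
  have bd: "(1 + u) ^ m * exp (- c * u) \<le> C" if "u \<ge> 0" for u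
  proof (cases "u \<ge> U")
    case True then show ?thesis
      using U[of u] max.cobounded1[of 1 "(1 + \<bar>U\<bar>) ^ m"] unfolding C_def by linarith
  next
    case False
    have "(1 + u) ^ m * exp (- c * u) \<le> (1 + \<bar>U\<bar>) ^ m * 1"
      using that False assms by (intro mult_mono power_mono) auto
    then show ?thesis by (simp add: C_def)
  qed
  have "exp (- c * norm x) \<le> C * jbr x powr (- t)" for x :: "real^'n"
  proof -
    have "jbr x powr t \<le> jbr x powr real m" using m jbr_ge_1[of x] by (intro powr_mono) auto
    also have "\<dots> = jbr x ^ m" by (simp add: powr_realpow)
    also have "\<dots> \<le> (1 + norm x) ^ m" using jbr_le_norm[of x] by (intro power_mono) auto
    finally have "jbr x powr t * exp (- c * norm x) \<le> (1 + norm x) ^ m * exp (- c * norm x)"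
      by (intro mult_right_mono) auto
    also have "\<dots> \<le> C" by (rule bd) simp
    finally show ?thesis by (simp add: powr_minus field_simps)
  qed
  moreover have "C > 0" by (simp add: C_def)
  ultimately show ?thesis by blast
qed

text \<open>The parameter is the coefficient of |x|^2: \<open>gau pi\<close> is the fixed window,
  equal to its own Fourier transform, and \<open>gau (2 * pi)\<close> is the product of two
  windows.\<close>

abbreviation gau :: "real \<Rightarrow> real ^ 'n::finite \<Rightarrow> real" where
  "gau c x \<equiv> exp (- (c * (norm x)\<^sup>2))"

abbreviation cgau :: "real \<Rightarrow> real ^ 'n::finite \<Rightarrow> complex" where
  "cgau c x \<equiv> complex_of_real (gau c x)"

text \<open>Completing the square in |x|; the rate \<open>b\<close> is arbitrary, at the price of
  the constant exp(b^2 / 4c).\<close>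

lemma gau_le_exp:
  assumes "c > 0"
  shows "\<exists>C>0. \<forall>x::real^'n::finite. gau c x \<le> C * exp (- b * norm x)"
proof -
  have "gau c x \<le> exp (b\<^sup>2 / (4 * c)) * exp (- b * norm x)" for x :: "real^'n"
  proof -
    have "0 \<le> (2 * c * norm x - b)\<^sup>2 / (4 * c)" using assms by simp
    also have "\<dots> = c * (norm x)\<^sup>2 - b * norm x + b\<^sup>2 / (4 * c)"
      using assms by (simp add: power2_eq_square field_simps)
    finally show ?thesis by (simp add: exp_add[symmetric])
  qed
  then show ?thesis by (intro exI[of _ "exp (b\<^sup>2 / (4 * c))"]) auto
qed

lemma gau_le_jbr_powr:
  assumes "c > 0"
  shows "\<exists>C>0. \<forall>x::real^'n::finite. gau c x \<le> C * jbr x powr (- t)"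
proof -
  obtain C1 where C1: "C1 > 0" "\<And>x::real^'n. gau c x \<le> C1 * exp (- 1 * norm x)"
    using gau_le_exp[OF assms, of 1] by blast
  obtain C2 where C2: "C2 > 0" "\<And>x::real^'n. exp (- 1 * norm x) \<le> C2 * jbr x powr (- t)"
    using exp_le_jbr_powr[of 1 t] by auto
  have "gau c x \<le> C1 * C2 * jbr x powr (- t)" for x :: "real^'n"
  proof -
    have "C1 * exp (- 1 * norm x) \<le> C1 * (C2 * jbr x powr (- t))"
      using C2(2)[of x] C1(1) by (intro mult_left_mono) auto
    then show ?thesis using C1(2)[of x] by (simp add: mult.assoc)
  qed
  then show ?thesis using C1(1) C2(1) by (intro exI[of _ "C1 * C2"]) auto
qed

lemma integrable_exp_norm:
  assumes "c > 0"
  shows "integrable lborel (\<lambda>x::real^'n::finite. exp (- c * norm x))"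
proof -
  obtain C where C: "C > 0" "\<And>x::real^'n. exp (- c * norm x) \<le> C * jbr x powr (- (real CARD('n) + 1))"
    using exp_le_jbr_powr[OF assms] by blast
  have I: "integrable lborel (\<lambda>x::real^'n. C * jbr x powr (- (real CARD('n) + 1)))"
    by (intro integrable_mult_right integrable_jbr_powr) simp
  show ?thesis
    by (rule Bochner_Integration.integrable_bound[OF I]) (use C in auto)
qed

lemma integrable_jbr_gau:
  assumes "c > 0"
  shows "integrable lborel (\<lambda>x::real^'n::finite. jbr x powr t * gau c x)"
proof -
  obtain C where C: "C > 0" "\<And>x::real^'n. gau c x \<le> C * jbr x powr (- (\<bar>t\<bar> + real CARD('n) + 1))"
    using gau_le_jbr_powr[OF assms] by blast
  have *: "jbr x powr t * gau c x \<le> C * jbr x powr (- (real CARD('n) + 1))" for x :: "real^'n"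
  proof -
    have "jbr x powr t * gau c x \<le> jbr x powr \<bar>t\<bar> * (C * jbr x powr (- (\<bar>t\<bar> + real CARD('n) + 1)))"
      using C jbr_ge_1[of x] by (intro mult_mono powr_mono) auto
    also have "\<dots> = C * jbr x powr (- (real CARD('n) + 1))"
      by (simp add: powr_add[symmetric] mult.left_commute)
    finally show ?thesis .
  qed
  have I: "integrable lborel (\<lambda>x::real^'n. C * jbr x powr (- (real CARD('n) + 1)))"
    by (intro integrable_mult_right integrable_jbr_powr) simp
  show ?thesis
    by (rule Bochner_Integration.integrable_bound[OF I]) (use C * in auto)
qed

lemma integrable_gau: "c > 0 \<Longrightarrow> integrable lborel (gau c :: real^'n::finite \<Rightarrow> real)"
  using integrable_jbr_gau[of c 0] by simp

lemma measurable_cis [measurable]: "cis \<in> borel_measurable borel"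
  by (intro borel_measurable_continuous_onI continuous_intros)

section \<open>The Fourier transform\<close>

text \<open>Fubini along the standard basis, in complex-valued form; it factors the Gaussian
  transform into one-dimensional ones.\<close>

lemma integral_lborel_prod_complex:
  fixes f :: "'a::euclidean_space \<Rightarrow> real \<Rightarrow> complex"
  assumes f: "\<And>b. b \<in> Basis \<Longrightarrow> integrable lborel (f b)"
  shows "(LINT x|lborel. (\<Prod>b\<in>Basis. f b (x \<bullet> b))) = (\<Prod>b\<in>Basis. LINT t|lborel. f b t)"
proof -
  interpret product_sigma_finite "\<lambda>_::'a. lborel::real measure" ..
  have [measurable]: "\<And>b. b \<in> Basis \<Longrightarrow> f b \<in> borel_measurable borel"
    using f by (auto dest: borel_measurable_integrable)
  have m: "(\<lambda>x. \<Prod>b\<in>Basis. f b (x \<bullet> b)) \<in> borel_measurable borel" by measurable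
  have "(LINT x|lborel. (\<Prod>b\<in>Basis. f b (x \<bullet> b)))
     = (LINT y|(\<Pi>\<^sub>M b\<in>Basis. lborel). (\<Prod>b\<in>Basis. f b ((\<Sum>b\<in>Basis. y b *\<^sub>R b) \<bullet> b)))"
    by (subst lborel_eq) (subst integral_distr, auto intro: m)
  also have "\<dots> = (LINT y|(\<Pi>\<^sub>M b\<in>Basis. lborel). (\<Prod>b\<in>Basis. f b (y b)))"
    by (intro Bochner_Integration.integral_cong refl prod.cong) auto
  also have "\<dots> = (\<Prod>b\<in>Basis. LINT t|lborel. f b t)"
    by (rule product_integral_prod) (auto intro: f)
  finally show ?thesis .
qed

text \<open>The characteristic function of the standard normal law, dilated by a = sqrt(2 pi c) so
  that x^2 / 2 becomes pi c x^2.\<close>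

lemma integral_gau_1d:
  assumes c: "c > 0"
  shows "(LINT x|lborel. complex_of_real (exp (- (pi * c * x\<^sup>2))) * cis (- 2 * pi * (x * y)))
      = complex_of_real (c powr (- 1 / 2) * exp (- (pi / c * y\<^sup>2)))"
proof -
  define a where "a = sqrt (2 * pi * c)"
  have a: "a > 0" "a\<^sup>2 = 2 * pi * c" using c by (auto simp: a_def)
  define t where "t = - 2 * pi * y / a"
  have "complex_of_real (exp (- t\<^sup>2 / 2)) = char std_normal_distribution t"
    by (simp add: char_std_normal_distribution)
  also have "\<dots> = (LINT x|lborel. std_normal_density x *\<^sub>R iexp (t * x))"
    unfolding char_def by (subst integral_density) auto
  also have "\<dots> = \<bar>a\<bar> *\<^sub>R (LINT x|lborel. std_normal_density (0 + a * x) *\<^sub>R iexp (t * (0 + a * x)))"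
    using a by (intro lborel_integral_real_affine) auto
  also have "(\<lambda>x. std_normal_density (0 + a * x) *\<^sub>R iexp (t * (0 + a * x)))
      = (\<lambda>x. complex_of_real (1 / sqrt (2 * pi)) * (complex_of_real (exp (- (pi * c * x\<^sup>2))) * cis (- 2 * pi * (x * y))))"
  proof
    fix x
    have 1: "- (0 + a * x)\<^sup>2 / 2 = - (pi * c * x\<^sup>2)" using a by (simp add: power_mult_distrib)
    have 2: "t * (0 + a * x) = - 2 * pi * (x * y)" using a by (simp add: t_def field_simps)
    have "std_normal_density (0 + a * x) = 1 / sqrt (2 * pi) * exp (- (pi * c * x\<^sup>2))"
      unfolding std_normal_density_def 1 ..
    moreover have "iexp (t * (0 + a * x)) = cis (- 2 * pi * (x * y))"
      unfolding 2 by (simp add: cis_conv_exp)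
    ultimately show "std_normal_density (0 + a * x) *\<^sub>R iexp (t * (0 + a * x))
      = complex_of_real (1 / sqrt (2 * pi)) * (complex_of_real (exp (- (pi * c * x\<^sup>2))) * cis (- 2 * pi * (x * y)))"
      by (simp add: scaleR_conv_of_real)
  qed
  also have "\<bar>a\<bar> *\<^sub>R (LINT x|lborel. complex_of_real (1 / sqrt (2 * pi)) * (complex_of_real (exp (- (pi * c * x\<^sup>2))) * cis (- 2 * pi * (x * y))))
      = complex_of_real (\<bar>a\<bar> * (1 / sqrt (2 * pi))) * (LINT x|lborel. (complex_of_real (exp (- (pi * c * x\<^sup>2))) * cis (- 2 * pi * (x * y))))"
    by (subst integral_mult_right_zero) (simp add: scaleR_conv_of_real)
  also have "\<bar>a\<bar> * (1 / sqrt (2 * pi)) = sqrt c" using a(1) by (simp add: a_def real_sqrt_mult)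
  finally have e: "complex_of_real (exp (- t\<^sup>2 / 2)) = complex_of_real (sqrt c) * (LINT x|lborel. (complex_of_real (exp (- (pi * c * x\<^sup>2))) * cis (- 2 * pi * (x * y))))" .
  have t2: "- t\<^sup>2 / 2 = - (pi / c * y\<^sup>2)"
    using c a by (simp add: t_def power_divide power_mult_distrib field_simps power2_eq_square)
  have s: "c powr (- 1 / 2) = 1 / sqrt c" using c by (simp add: powr_minus_divide powr_half_sqrt)
  show ?thesis
    using c unfolding s of_real_mult using e[unfolded t2] by (simp add: field_simps)
qed

lemma fourier_gau:
  fixes y :: "real ^ 'n::finite"
  assumes c: "c > 0"
  shows "fourier (\<lambda>x. cgau (pi * c) x) y
    = complex_of_real (c powr (- real CARD('n) / 2) * gau (pi / c) y)"
proof -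
  have n2: "(norm x)\<^sup>2 = (\<Sum>b\<in>Basis. (x \<bullet> b)\<^sup>2)" for x :: "real^'n"
    unfolding power2_norm_eq_inner by (subst euclidean_inner) (simp add: power2_eq_square)
  have cis_sum: "cis (\<Sum>b\<in>S. g b) = (\<Prod>b\<in>S. cis (g b))" if "finite S" for g :: "real^'n \<Rightarrow> real" and S
    using that by induct (auto simp: cis_mult[symmetric])
  have "fourier (\<lambda>x. cgau (pi * c) x) y
    = (LINT x|lborel. (\<Prod>b\<in>Basis. complex_of_real (exp (- (pi * c * (x \<bullet> b)\<^sup>2))) * cis (- 2 * pi * ((x \<bullet> b) * (y \<bullet> b)))))"
    unfolding fourier_def
  proof (intro Bochner_Integration.integral_cong refl)
    fix x :: "real^'n"
    have "gau (pi * c) x = (\<Prod>b\<in>Basis. exp (- (pi * c * (x \<bullet> b)\<^sup>2)))"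
      by (simp add: n2 exp_sum[symmetric] sum_distrib_left sum_negf)
    moreover have "cis (- 2 * pi * (x \<bullet> y)) = (\<Prod>b\<in>Basis. cis (- 2 * pi * ((x \<bullet> b) * (y \<bullet> b))))"
      by (subst euclidean_inner) (simp add: cis_sum[symmetric] sum_distrib_left)
    ultimately show "cgau (pi * c) x * cis (- 2 * pi * (x \<bullet> y))
       = (\<Prod>b\<in>Basis. complex_of_real (exp (- (pi * c * (x \<bullet> b)\<^sup>2))) * cis (- 2 * pi * ((x \<bullet> b) * (y \<bullet> b))))"
      by (simp add: prod.distrib)
  qed
  also have "\<dots> = (\<Prod>b\<in>Basis. LINT t|lborel. complex_of_real (exp (- (pi * c * t\<^sup>2))) * cis (- 2 * pi * (t * (y \<bullet> b))))"
  proof (rule integral_lborel_prod_complex)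
    fix b :: "real^'n"
    show "integrable lborel (\<lambda>t. complex_of_real (exp (- (pi * c * t\<^sup>2))) * cis (- 2 * pi * (t * (y \<bullet> b))))"
    \<comment> \<open>A non-integrable function has Bochner integral 0, whereas
      \<open>integral_gau_1d\<close> gives a nonzero value.\<close>
    proof (rule ccontr)
      assume n: "\<not> ?thesis"
      have "(LINT t|lborel. complex_of_real (exp (- (pi * c * t\<^sup>2))) * cis (- 2 * pi * (t * (y \<bullet> b)))) = 0"
        by (rule not_integrable_integral_eq[OF n])
      then show False unfolding integral_gau_1d[OF c] using c by simp
    qed
  qed
  also have "\<dots> = complex_of_real (\<Prod>b\<in>(Basis::(real^'n) set). c powr (- 1 / 2) * exp (- (pi / c * (y \<bullet> b)\<^sup>2)))"
    unfolding integral_gau_1d[OF c] by simp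
  also have "(\<Prod>b\<in>(Basis::(real^'n) set). c powr (- 1 / 2) * exp (- (pi / c * (y \<bullet> b)\<^sup>2)))
      = c powr (- real CARD('n) / 2) * gau (pi / c) y"
    using c by (simp add: prod.distrib n2 exp_sum[symmetric] sum_distrib_left sum_negf powr_realpow[symmetric] powr_powr)
  finally show ?thesis .
qed

section \<open>Fubini with an oscillating factor, Fourier inversion and the convolution
  theorem\<close>

lemma integrable_pair_prod:
  fixes f :: "'a::euclidean_space \<Rightarrow> complex" and g :: "'b::euclidean_space \<Rightarrow> complex"
  assumes f: "integrable lborel f" and g: "integrable lborel g"
    and k [measurable]: "(\<lambda>(x, y). k x y) \<in> borel_measurable (borel \<Otimes>\<^sub>M borel)"
    and k1: "\<And>x y. norm (k x y) \<le> 1"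
  shows "integrable (lborel \<Otimes>\<^sub>M lborel) (\<lambda>(x, y). f x * g y * k x y)"
proof -
  have [measurable]: "f \<in> borel_measurable borel" "g \<in> borel_measurable borel"
    using f g by (auto dest: borel_measurable_integrable)
  have [measurable]: "k x \<in> borel_measurable borel" for x
    using measurable_Pair2[OF k, of x] by simp
  have "integrable (lborel \<Otimes>\<^sub>M lborel) (\<lambda>(x, y). f x * g y)"
  proof (rule lborel_pair.Fubini_integrable)
    show "(\<lambda>(x, y). f x * g y) \<in> borel_measurable (lborel \<Otimes>\<^sub>M lborel)" by measurable
    show "integrable lborel (\<lambda>x. LINT y|lborel. norm (case (x, y) of (x, y) \<Rightarrow> f x * g y))"
      using f g by (auto simp: norm_mult)
    show "AE x in lborel. integrable lborel (\<lambda>y. case (x, y) of (x, y) \<Rightarrow> f x * g y)"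
      using g by auto
  qed
  then show ?thesis
  proof (rule Bochner_Integration.integrable_bound)
    show "(\<lambda>(x, y). f x * g y * k x y) \<in> borel_measurable (lborel \<Otimes>\<^sub>M lborel)" by measurable
    show "AE x in lborel \<Otimes>\<^sub>M lborel. norm (case x of (x, y) \<Rightarrow> f x * g y * k x y) \<le> norm (case x of (x, y) \<Rightarrow> f x * g y)"
      by (intro AE_I2) (auto simp: norm_mult k1 intro!: mult_left_le)
  qed
qed

lemma Fubini_pair_prod:
  fixes f :: "'a::euclidean_space \<Rightarrow> complex" and g :: "'b::euclidean_space \<Rightarrow> complex"
  assumes "integrable lborel f" and "integrable lborel g"
    and "(\<lambda>(x, y). k x y) \<in> borel_measurable (borel \<Otimes>\<^sub>M borel)"
    and "\<And>x y. norm (k x y) \<le> 1"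
  shows "(LINT x|lborel. LINT y|lborel. f x * g y * k x y) = (LINT y|lborel. LINT x|lborel. f x * g y * k x y)"
  using lborel_pair.Fubini_integral[OF integrable_pair_prod[OF assms]] by simp

lemma measurable_fourier [measurable]:
  assumes [measurable]: "f \<in> borel_measurable borel"
  shows "fourier f \<in> borel_measurable borel"
  unfolding fourier_def by measurable

lemma norm_fourier_le:
  "integrable lborel f \<Longrightarrow> norm (fourier f x) \<le> (LINT y|lborel. norm (f y))"
  unfolding fourier_def
  by (rule order_trans[OF integral_norm_bound]) (simp add: norm_mult)

lemma integrable_mult_cis:
  fixes f :: "real ^ 'n::finite \<Rightarrow> complex"
  assumes "integrable lborel f" and [measurable]: "g \<in> borel_measurable borel"
  shows "integrable lborel (\<lambda>x. f x * cis (g x))"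
proof -
  have [measurable]: "f \<in> borel_measurable borel"
    using assms by (auto dest: borel_measurable_integrable)
  show ?thesis
    by (rule Bochner_Integration.integrable_bound[OF assms(1)]) (auto simp: norm_mult)
qed

text \<open>The dilated Gaussians are an approximate identity. As \<open>f\<close> may be unbounded,
  the unit ball around \<open>x\<close>, where compactness bounds \<open>f\<close>, is separated
  from the rest, where the kernel tends to 0 uniformly and \<open>f\<close> is integrable.\<close>

lemma integral_gau_scaled_tendsto:
  fixes f :: "real ^ 'n::finite \<Rightarrow> complex"
  assumes c: "continuous_on UNIV f" and f: "integrable lborel f"
  shows "(\<lambda>k. LINT u|lborel. f (x + u) * complex_of_real (real (Suc k) ^ CARD('n) * gau (pi * (real (Suc k))\<^sup>2) u))
           \<longlonglongrightarrow> f x"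
proof -
  let ?n = "CARD('n)"
  have [measurable]: "f \<in> borel_measurable borel" using c by (rule borel_measurable_continuous_onI)
  define I where "I = (\<lambda>u::real^'n. indicator (cball 0 1) u :: real)"
  have [measurable]: "I \<in> borel_measurable borel" unfolding I_def by (intro borel_measurable_indicator) simp
  have I01: "0 \<le> I u" "I u \<le> 1" for u by (auto simp: I_def indicator_def)
  define g where "g = (\<lambda>k u. real (Suc k) ^ ?n * gau (pi * (real (Suc k))\<^sup>2) (u::real^'n))"
  have fs: "integrable lborel (\<lambda>u. f (x + u))" by (rule integrable_shift[OF f])
  have gb: "\<bar>g k u\<bar> \<le> real (Suc k) ^ ?n" for k u unfolding g_def by (auto intro!: mult_left_le)
  have [measurable]: "g k \<in> borel_measurable borel" for k unfolding g_def by measurable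
  have int: "integrable lborel (\<lambda>u. f (x + u) * complex_of_real (h u * g k u))"
    if h: "\<And>u. \<bar>h u\<bar> \<le> 1" "h \<in> borel_measurable borel" for k h
  proof (rule Bochner_Integration.integrable_bound)
    show "integrable lborel (\<lambda>u. complex_of_real (real (Suc k) ^ ?n) * f (x + u))" using fs by auto
    show "(\<lambda>u. f (x + u) * complex_of_real (h u * g k u)) \<in> borel_measurable lborel" using h(2) by measurable
    have "\<bar>h u\<bar> * \<bar>g k u\<bar> \<le> real (Suc k) ^ ?n" for u
      using mult_mono[OF h(1)[of u] gb[of k u]] by simp
    then have "norm (f (x + u)) * (\<bar>h u\<bar> * \<bar>g k u\<bar>) \<le> norm (f (x + u)) * real (Suc k) ^ ?n" for u
      by (intro mult_left_mono) auto
    then show "AE u in lborel. norm (f (x + u) * complex_of_real (h u * g k u)) \<le> norm (complex_of_real (real (Suc k) ^ ?n) * f (x + u))"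
      by (auto simp: norm_mult abs_mult mult.commute norm_power simp del: of_nat_Suc)
  qed
  have far: "(\<lambda>k. LINT u|lborel. f (x + u) * complex_of_real ((1 - I u) * g k u)) \<longlonglongrightarrow> 0"
  proof (rule Lim_null_comparison)
    show "(\<lambda>k. (LINT u|lborel. norm (f (x + u))) * (real (Suc k) ^ ?n * exp (- (pi * (real (Suc k))\<^sup>2)))) \<longlonglongrightarrow> 0"
    proof (rule tendsto_mult_right_zero)
      show "(\<lambda>k. real (Suc k) ^ ?n * exp (- (pi * (real (Suc k))\<^sup>2))) \<longlonglongrightarrow> 0"
        by real_asymp
    qed
    show "\<forall>\<^sub>F k in sequentially. norm (LINT u|lborel. f (x + u) * complex_of_real ((1 - I u) * g k u))
       \<le> (LINT u|lborel. norm (f (x + u))) * (real (Suc k) ^ ?n * exp (- (pi * (real (Suc k))\<^sup>2)))"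
    proof (intro always_eventually allI)
      fix k
      have b: "\<bar>(1 - I u) * g k u\<bar> \<le> real (Suc k) ^ ?n * exp (- (pi * (real (Suc k))\<^sup>2))" for u
      proof (cases "norm u \<le> 1")
        case True then show ?thesis by (auto simp: I_def)
      next
        case False
        then have "(norm u)\<^sup>2 \<ge> 1" by simp
        then have "pi * (real (Suc k))\<^sup>2 * (norm u)\<^sup>2 \<ge> pi * (real (Suc k))\<^sup>2 * 1"
          by (intro mult_left_mono) auto
        then show ?thesis using False by (auto simp: I_def g_def simp del: of_nat_Suc)
      qed
      have "norm (LINT u|lborel. f (x + u) * complex_of_real ((1 - I u) * g k u))
          \<le> (LINT u|lborel. norm (f (x + u) * complex_of_real ((1 - I u) * g k u)))"
        by (rule integral_norm_bound)
      also have "\<dots> \<le> (LINT u|lborel. norm (f (x + u)) * (real (Suc k) ^ ?n * exp (- (pi * (real (Suc k))\<^sup>2))))"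
      proof (rule integral_mono)
        show "integrable lborel (\<lambda>u. norm (f (x + u) * complex_of_real ((1 - I u) * g k u)))"
          using I01 by (intro integrable_norm int) (auto simp: abs_le_iff)
        show "norm (f (x + u) * complex_of_real ((1 - I u) * g k u))
           \<le> norm (f (x + u)) * (real (Suc k) ^ ?n * exp (- (pi * (real (Suc k))\<^sup>2)))" for u
          unfolding norm_mult norm_of_real by (intro mult_left_mono b) auto
      qed (use fs in auto)
      finally show "norm (LINT u|lborel. f (x + u) * complex_of_real ((1 - I u) * g k u))
       \<le> (LINT u|lborel. norm (f (x + u))) * (real (Suc k) ^ ?n * exp (- (pi * (real (Suc k))\<^sup>2)))" by simp
    qed
  qed
  have "compact (f ` cball x 1)"
    by (intro compact_continuous_image continuous_on_subset[OF c]) auto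
  then obtain M where M: "\<And>u. u \<in> cball x 1 \<Longrightarrow> norm (f u) \<le> M"
    using compact_imp_bounded by (force simp: bounded_iff)
  have near: "(\<lambda>k. LINT u|lborel. f (x + u) * complex_of_real (I u * g k u)) \<longlonglongrightarrow> f x"
  proof -
    \<comment> \<open>After the substitution u = v / (k + 1) the kernel is the fixed Gaussian
      \<open>gau pi v\<close> and \<open>f\<close> is evaluated ever closer to \<open>x\<close>,
      which suits dominated convergence.\<close>
    define F where "F = (\<lambda>k v. f (x + v /\<^sub>R real (Suc k)) * complex_of_real (I (v /\<^sub>R real (Suc k)) * gau pi v))"
    have sc: "(LINT u|lborel. f (x + u) * complex_of_real (I u * g k u)) = (LINT v|lborel. F k v)" for k
    proof -
      let ?r = "real (Suc k)"
      have r: "?r > 0" by simp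
      have "(LINT v|lborel. F k v) = (?r ^ ?n) *\<^sub>R (LINT v|lborel. F k (?r *\<^sub>R v))"
        by (rule integral_dilate[symmetric, OF _ r]) (unfold F_def, measurable)
      also have "\<dots> = (LINT v|lborel. (?r ^ ?n) *\<^sub>R F k (?r *\<^sub>R v))" by simp
      also have "\<dots> = (LINT u|lborel. f (x + u) * complex_of_real (I u * g k u))"
      proof (intro Bochner_Integration.integral_cong refl)
        fix v :: "real^'n"
        have "F k (?r *\<^sub>R v) = f (x + v) * complex_of_real (I v * gau (pi * ?r\<^sup>2) v)"
          using r by (simp add: F_def power_mult_distrib mult_ac del: of_nat_Suc)
        then show "(?r ^ ?n) *\<^sub>R F k (?r *\<^sub>R v) = f (x + v) * complex_of_real (I v * g k v)"
          by (simp add: g_def scaleR_conv_of_real mult_ac del: of_nat_Suc)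
      qed
      finally show ?thesis ..
    qed
    have "(\<lambda>k. LINT v|lborel. F k v) \<longlonglongrightarrow> (LINT v|(lborel::(real^'n) measure). f x * cgau pi v)"
    proof (rule integral_dominated_convergence)
      show "integrable lborel (\<lambda>v::real^'n. M * gau pi v)" by (intro integrable_mult_right integrable_gau) auto
      show "AE v in lborel. norm (F k v) \<le> M * gau pi v" for k
      proof (intro AE_I2)
        fix v :: "real^'n"
        show "norm (F k v) \<le> M * gau pi v"
        proof (cases "v /\<^sub>R real (Suc k) \<in> cball 0 1")
          case True
          then have "norm (f (x + v /\<^sub>R real (Suc k))) \<le> M" by (intro M) (auto simp: dist_norm norm_minus_commute simp del: of_nat_Suc)
          moreover have "norm (F k v) = norm (f (x + v /\<^sub>R real (Suc k))) * gau pi v"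
            using True by (simp add: F_def I_def norm_mult del: of_nat_Suc)
          ultimately show ?thesis by (simp add: mult_right_mono)
        next
          case False
          have "0 \<le> M" using order_trans[OF norm_ge_zero M[of x]] by simp
          then show ?thesis using False by (simp add: F_def I_def del: of_nat_Suc)
        qed
      qed
      show "AE v in lborel. (\<lambda>k. F k v) \<longlonglongrightarrow> f x * cgau pi v"
      proof (intro AE_I2)
        fix v :: "real^'n"
        have 1: "(\<lambda>k. v /\<^sub>R real (Suc k)) \<longlonglongrightarrow> 0"
          using tendsto_scaleR[OF LIMSEQ_inverse_real_of_nat tendsto_const[of v]] by simp
        have "isCont f x" using c by (simp add: continuous_on_eq_continuous_at)
        then have 2: "(\<lambda>k. f (x + v /\<^sub>R real (Suc k))) \<longlonglongrightarrow> f x"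
          by (intro isCont_tendsto_compose[of x f]) (use tendsto_add[OF tendsto_const[of x] 1] in auto)
        have "eventually (\<lambda>k. v /\<^sub>R real (Suc k) \<in> ball 0 1) sequentially"
          using 1 by (intro topological_tendstoD) auto
        then have "eventually (\<lambda>k. I (v /\<^sub>R real (Suc k)) = 1) sequentially"
          by (rule eventually_mono) (auto simp: I_def indicator_def simp del: of_nat_Suc)
        then have 3: "(\<lambda>k. I (v /\<^sub>R real (Suc k))) \<longlonglongrightarrow> 1"
          by (rule tendsto_eventually)
        show "(\<lambda>k. F k v) \<longlonglongrightarrow> f x * cgau pi v"
          unfolding F_def using 2 3 by (auto intro!: tendsto_eq_intros simp del: of_nat_Suc)
      qed
    qed (unfold F_def, measurable)
    moreover have "(LINT v|(lborel::(real^'n) measure). f x * cgau pi v) = f x"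
      using fourier_gau[of 1 "0::real^'n"] by (simp add: fourier_def)
    ultimately show ?thesis unfolding sc by (simp only:)
  qed
  have "(LINT u|lborel. f (x + u) * complex_of_real (g k u))
      = (LINT u|lborel. f (x + u) * complex_of_real (I u * g k u)) + (LINT u|lborel. f (x + u) * complex_of_real ((1 - I u) * g k u))" for k
  proof -
    have i1: "integrable lborel (\<lambda>u. f (x + u) * complex_of_real (I u * g k u))"
      using I01 by (intro int) (auto simp: abs_le_iff)
    have i2: "integrable lborel (\<lambda>u. f (x + u) * complex_of_real ((1 - I u) * g k u))"
      using I01 by (intro int) (auto simp: abs_le_iff)
    show ?thesis
      unfolding Bochner_Integration.integral_add[OF i1 i2, symmetric]
      by (intro Bochner_Integration.integral_cong refl) (simp add: algebra_simps)
  qed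
  then show ?thesis using tendsto_add[OF near far] by (simp add: g_def del: of_nat_Suc of_real_mult)
qed

text \<open>A Gaussian factor in \<xi> permits Fubini. Its transform is the approximate identity of
  \<open>integral_gau_scaled_tendsto\<close>, while the factor itself tends to 1 and disappears by
  dominated convergence.\<close>

theorem fourier_inversion:
  fixes f :: "real ^ 'n::finite \<Rightarrow> complex"
  assumes c: "continuous_on UNIV f" and f: "integrable lborel f" and fh: "integrable lborel (fourier f)"
  shows "(LINT \<xi>|lborel. fourier f \<xi> * cis (2 * pi * (x \<bullet> \<xi>))) = f x"
proof -
  let ?n = "CARD('n)"
  have [measurable]: "f \<in> borel_measurable borel" using c by (rule borel_measurable_continuous_onI)
  define g where "g = (\<lambda>k u. real (Suc k) ^ ?n * gau (pi * (real (Suc k))\<^sup>2) (u::real^'n))"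
  \<comment> \<open>Chosen so that the transform of \<open>cgau (pi * c k)\<close> is exactly the
    approximate identity \<open>g k\<close>.\<close>
  define c where "c = (\<lambda>k. 1 / (real (Suc k))\<^sup>2)"
  have cp: "c k > 0" for k by (simp add: c_def)
  have eq: "(LINT \<xi>|lborel. fourier f \<xi> * cis (2 * pi * (x \<bullet> \<xi>)) * cgau (pi * c k) \<xi>)
     = (LINT u|lborel. f (x + u) * complex_of_real (g k u))" for k
  proof -
    have "(LINT \<xi>|lborel. fourier f \<xi> * cis (2 * pi * (x \<bullet> \<xi>)) * cgau (pi * c k) \<xi>)
       = (LINT \<xi>|lborel. LINT y|lborel. cgau (pi * c k) \<xi> * f y * cis (- 2 * pi * (\<xi> \<bullet> (y - x))))"
      unfolding fourier_def
    proof (intro Bochner_Integration.integral_cong refl)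
      fix \<xi> :: "real^'n"
      have "(LINT x|lborel. f x * cis (- 2 * pi * (x \<bullet> \<xi>))) * cis (2 * pi * (x \<bullet> \<xi>)) * cgau (pi * c k) \<xi>
        = (LINT y|lborel. (f y * cis (- 2 * pi * (y \<bullet> \<xi>))) * (cis (2 * pi * (x \<bullet> \<xi>)) * cgau (pi * c k) \<xi>))"
        by (subst integral_mult_left_zero) (simp add: mult.assoc)
      also have "\<dots> = (LINT y|lborel. cgau (pi * c k) \<xi> * f y * cis (- 2 * pi * (\<xi> \<bullet> (y - x))))"
      proof (intro Bochner_Integration.integral_cong refl)
        fix y
        have "cis (- 2 * pi * (\<xi> \<bullet> (y - x))) = cis (- 2 * pi * (y \<bullet> \<xi>)) * cis (2 * pi * (x \<bullet> \<xi>))"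
          by (simp add: cis_mult inner_diff_right inner_commute algebra_simps)
        then show "(f y * cis (- 2 * pi * (y \<bullet> \<xi>))) * (cis (2 * pi * (x \<bullet> \<xi>)) * cgau (pi * c k) \<xi>)
           = cgau (pi * c k) \<xi> * f y * cis (- 2 * pi * (\<xi> \<bullet> (y - x)))"
          by (simp add: mult_ac)
      qed
      finally show "(LINT x|lborel. f x * cis (- 2 * pi * (x \<bullet> \<xi>))) * cis (2 * pi * (x \<bullet> \<xi>)) * cgau (pi * c k) \<xi>
        = (LINT y|lborel. cgau (pi * c k) \<xi> * f y * cis (- 2 * pi * (\<xi> \<bullet> (y - x))))" .
    qed
    also have "\<dots> = (LINT y|lborel. LINT \<xi>|lborel. cgau (pi * c k) \<xi> * f y * cis (- 2 * pi * (\<xi> \<bullet> (y - x))))"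
      using cp[of k] by (intro Fubini_pair_prod f integrable_of_real integrable_gau) (auto, measurable)
    also have "\<dots> = (LINT y|lborel. f y * fourier (\<lambda>\<xi>. cgau (pi * c k) \<xi>) (y - x))"
      unfolding fourier_def by (simp add: mult.commute[of _ "f _"] mult.assoc)
    also have "\<dots> = (LINT y|lborel. f y * complex_of_real (g k (y - x)))"
    proof -
      have "(c k) powr (- real ?n / 2) = real (Suc k) ^ ?n"
      proof -
        have "c k = real (Suc k) powr (- 2)" by (simp add: c_def powr_minus_divide powr_numeral del: of_nat_Suc)
        then show ?thesis by (simp add: powr_powr powr_realpow del: of_nat_Suc)
      qed
      moreover have "pi / c k = pi * (real (Suc k))\<^sup>2" by (simp add: c_def)
      ultimately show ?thesis unfolding fourier_gau[OF cp] g_def by simp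
    qed
    also have "\<dots> = (LINT u|lborel. f (x + u) * complex_of_real (g k (x + u - x)))"
      by (rule integral_shift[symmetric]) (unfold g_def, measurable)
    finally show ?thesis by simp
  qed
  have "(\<lambda>k. LINT \<xi>|lborel. fourier f \<xi> * cis (2 * pi * (x \<bullet> \<xi>)) * cgau (pi * c k) \<xi>)
     \<longlonglongrightarrow> (LINT \<xi>|lborel. fourier f \<xi> * cis (2 * pi * (x \<bullet> \<xi>)))"
  proof (rule integral_dominated_convergence)
    show "integrable lborel (\<lambda>\<xi>. norm (fourier f \<xi>))" using fh by auto
    show "AE \<xi> in lborel. norm (fourier f \<xi> * cis (2 * pi * (x \<bullet> \<xi>)) * cgau (pi * c k) \<xi>) \<le> norm (fourier f \<xi>)" for k
      using cp[of k] by (auto simp: norm_mult intro!: mult_left_le)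
    show "AE \<xi> in lborel. (\<lambda>k. fourier f \<xi> * cis (2 * pi * (x \<bullet> \<xi>)) * cgau (pi * c k) \<xi>)
       \<longlonglongrightarrow> fourier f \<xi> * cis (2 * pi * (x \<bullet> \<xi>))"
    proof (intro AE_I2)
      fix \<xi> :: "real^'n"
      have "c \<longlonglongrightarrow> 0" unfolding c_def by real_asymp
      then have "(\<lambda>k. gau (pi * c k) \<xi>) \<longlonglongrightarrow> 1" by (auto intro!: tendsto_eq_intros)
      then show "(\<lambda>k. fourier f \<xi> * cis (2 * pi * (x \<bullet> \<xi>)) * cgau (pi * c k) \<xi>)
       \<longlonglongrightarrow> fourier f \<xi> * cis (2 * pi * (x \<bullet> \<xi>))"
        using tendsto_mult[OF tendsto_const tendsto_of_real] by fastforce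
    qed
  qed measurable
  moreover have "(\<lambda>k. LINT u|lborel. f (x + u) * complex_of_real (g k u)) \<longlonglongrightarrow> f x"
    unfolding g_def by (rule integral_gau_scaled_tendsto[OF assms(1) f])
  ultimately show ?thesis unfolding eq by (rule LIMSEQ_unique)
qed

text \<open>The factor \<open>u\<close> is written as the inverse transform of
  \<open>fourier u\<close>; Fubini then leaves the transform of \<open>v\<close> at the shifted
  frequency.\<close>

lemma fourier_mult:
  fixes u v :: "real ^ 'n::finite \<Rightarrow> complex"
  assumes c: "continuous_on UNIV u" and u: "integrable lborel u" and uh: "integrable lborel (fourier u)"
    and v: "integrable lborel v"
  shows "fourier (\<lambda>y. u y * v y) x = (LINT y|lborel. fourier u y * fourier v (x - y))"
proof -
  have "fourier (\<lambda>y. u y * v y) x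
     = (LINT z|lborel. LINT y|lborel. v z * fourier u y * cis (- 2 * pi * (z \<bullet> (x - y))))"
    unfolding fourier_def[of "\<lambda>y. u y * v y"]
  proof (intro Bochner_Integration.integral_cong refl)
    fix z :: "real^'n"
    have "u z * v z * cis (- 2 * pi * (z \<bullet> x))
      = (LINT y|lborel. fourier u y * cis (2 * pi * (z \<bullet> y))) * (v z * cis (- 2 * pi * (z \<bullet> x)))"
      unfolding fourier_inversion[OF c u uh] by (simp add: mult.assoc)
    also have "\<dots> = (LINT y|lborel. fourier u y * cis (2 * pi * (z \<bullet> y)) * (v z * cis (- 2 * pi * (z \<bullet> x))))"
      by (subst integral_mult_left_zero) simp
    also have "\<dots> = (LINT y|lborel. v z * fourier u y * cis (- 2 * pi * (z \<bullet> (x - y))))"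
    proof (intro Bochner_Integration.integral_cong refl)
      fix y :: "real^'n"
      have "cis (- 2 * pi * (z \<bullet> (x - y))) = cis (2 * pi * (z \<bullet> y)) * cis (- 2 * pi * (z \<bullet> x))"
        by (simp add: cis_mult inner_diff_right algebra_simps)
      then show "fourier u y * cis (2 * pi * (z \<bullet> y)) * (v z * cis (- 2 * pi * (z \<bullet> x)))
        = v z * fourier u y * cis (- 2 * pi * (z \<bullet> (x - y)))"
        by (simp add: mult_ac)
    qed
    finally show "u z * v z * cis (- 2 * pi * (z \<bullet> x))
      = (LINT y|lborel. v z * fourier u y * cis (- 2 * pi * (z \<bullet> (x - y))))" .
  qed
  also have "\<dots> = (LINT y|lborel. LINT z|lborel. v z * fourier u y * cis (- 2 * pi * (z \<bullet> (x - y))))"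
    by (intro Fubini_pair_prod v uh) (auto, measurable)
  also have "\<dots> = (LINT y|lborel. fourier u y * fourier v (x - y))"
    unfolding fourier_def[of v] by (simp add: mult.commute[of _ "fourier u _"] mult.assoc)
  finally show ?thesis .
qed

text \<open>Holds for every \<open>f\<close>, because a non-integrable one has integral 0.\<close>

lemma ennreal_norm_integral_le:
  fixes f :: "'a \<Rightarrow> 'b::{banach, second_countable_topology}"
  shows "ennreal (norm (integral\<^sup>L M f)) \<le> (\<integral>\<^sup>+x. ennreal (norm (f x)) \<partial>M)"
  by (cases "integrable M f") (auto simp: integral_norm_bound_ennreal not_integrable_integral_eq)

lemma fourier_mult_bound:
  fixes u v :: "real ^ 'n::finite \<Rightarrow> complex"
  assumes "continuous_on UNIV u" and "integrable lborel u" and "integrable lborel (fourier u)"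
    and "integrable lborel v"
    and ub: "\<And>y. norm (fourier u y) \<le> k y" and vb: "\<And>y. norm (fourier v y) \<le> B y"
  shows "ennreal (norm (fourier (\<lambda>y. u y * v y) x)) \<le> (\<integral>y. ennreal (k y * B (x - y)))"
proof -
  have "ennreal (norm (fourier (\<lambda>y. u y * v y) x)) \<le> (\<integral>y. ennreal (norm (fourier u y * fourier v (x - y))))"
    unfolding fourier_mult[OF assms(1-4)] by (rule ennreal_norm_integral_le)
  also have "\<dots> \<le> (\<integral>y. ennreal (k y * B (x - y)))"
    using ub vb order_trans[OF norm_ge_zero ub]
    by (intro nn_integral_mono ennreal_leI) (auto simp: norm_mult intro!: mult_mono)
  finally show ?thesis .
qed

text \<open>No limits at infinity are taken. Integrating \<open>G'\<close> over a unit segment in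
  direction j gives G(\<eta> + e) - G(\<eta>), whose integral over \<eta> vanishes by translation
  invariance; by Fubini the integral of these segment integrals is that of
  \<open>G'\<close>.\<close>

lemma integral_pd_eq_0:
  fixes G :: "real ^ 'n::finite \<Rightarrow> complex"
  assumes d: "\<And>\<eta>. ((\<lambda>t. G (\<eta> + t *\<^sub>R axis j 1)) has_vector_derivative G' \<eta>) (at 0)"
    and c: "continuous_on UNIV G'" and G: "integrable lborel G" and G': "integrable lborel G'"
  shows "(LINT \<eta>|lborel. G' \<eta>) = 0"
proof -
  let ?e = "axis j (1::real) :: real^'n"
  have [measurable]: "G' \<in> borel_measurable borel" using c by (rule borel_measurable_continuous_onI)
  have d': "((\<lambda>t. G (\<eta> + t *\<^sub>R ?e)) has_vector_derivative G' (\<eta> + r *\<^sub>R ?e)) (at r)" for \<eta> r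
  proof -
    have 1: "((\<lambda>t::real. t - r) has_vector_derivative 1) (at r)"
      by (auto intro!: derivative_eq_intros)
    have 2: "((\<lambda>t. G ((\<eta> + r *\<^sub>R ?e) + t *\<^sub>R ?e)) has_vector_derivative G' (\<eta> + r *\<^sub>R ?e)) (at (r - r))"
      using d[of "\<eta> + r *\<^sub>R ?e"] by simp
    show ?thesis using vector_diff_chain_at[OF 1 2] by (simp add: o_def algebra_simps)
  qed
  have ftc: "(LINT r|lborel. indicator {0..1} r *\<^sub>R G' (\<eta> + r *\<^sub>R ?e)) = G (?e + \<eta>) - G \<eta>" for \<eta>
  proof -
    have "(LINT r|lborel. indicator {0..1} r *\<^sub>R G' (\<eta> + r *\<^sub>R ?e)) = G (\<eta> + 1 *\<^sub>R ?e) - G (\<eta> + 0 *\<^sub>R ?e)"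
    proof (rule integral_FTC_atLeastAtMost)
      show "((\<lambda>t. G (\<eta> + t *\<^sub>R ?e)) has_vector_derivative G' (\<eta> + r *\<^sub>R ?e)) (at r within {0..1})" for r
        using d' by (rule has_vector_derivative_at_within)
      show "continuous_on {0..1} (\<lambda>r. G' (\<eta> + r *\<^sub>R ?e))"
        by (rule continuous_on_compose2[OF c]) (auto intro!: continuous_intros)
    qed simp
    then show ?thesis by (simp add: add.commute)
  qed
  let ?f = "\<lambda>(r::real, \<eta>::real^'n). indicator {0..1} r *\<^sub>R G' (\<eta> + r *\<^sub>R ?e)"
  have sh: "integrable lborel (\<lambda>\<eta>. G' (\<eta> + r *\<^sub>R ?e))" for r
    using integrable_shift[OF G', of "r *\<^sub>R ?e"] by (simp add: add.commute)
  have shi: "(LINT \<eta>|lborel. h (G' (\<eta> + r *\<^sub>R ?e))) = (LINT \<eta>|lborel. h (G' \<eta>))"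
    if [measurable]: "h \<in> borel_measurable borel" for r and h :: "complex \<Rightarrow> 'c::{banach, second_countable_topology}"
    using integral_shift[of "\<lambda>\<eta>. h (G' \<eta>)" "r *\<^sub>R ?e"] by (simp add: add.commute)
  have int: "integrable (lborel \<Otimes>\<^sub>M lborel) ?f"
  proof (rule lborel_pair.Fubini_integrable)
    show "?f \<in> borel_measurable (lborel \<Otimes>\<^sub>M lborel)" by measurable
    have "(\<lambda>r. LINT \<eta>|lborel. norm (?f (r, \<eta>))) = (\<lambda>r. indicator {0..1} r *\<^sub>R (LINT \<eta>|lborel. norm (G' \<eta>)))"
      using shi[of norm] by (auto simp: fun_eq_iff split: split_indicator)
    then show "integrable lborel (\<lambda>r. LINT \<eta>|lborel. norm (?f (r, \<eta>)))"
      by simp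
    show "AE r in lborel. integrable lborel (\<lambda>\<eta>. ?f (r, \<eta>))"
      using sh by auto
  qed
  have "(LINT \<eta>|lborel. LINT r|lborel. ?f (r, \<eta>)) = (LINT r|lborel. LINT \<eta>|lborel. ?f (r, \<eta>))"
    using lborel_pair.Fubini_integral[OF int] by simp
  also have "\<dots> = (LINT r|lborel. indicator {0..1::real} r *\<^sub>R (LINT \<eta>|lborel. G' \<eta>))"
    using shi[of "\<lambda>x. x"] by simp
  also have "\<dots> = (LINT \<eta>|lborel. G' \<eta>)" by simp
  finally have "(LINT \<eta>|lborel. G' \<eta>) = (LINT \<eta>|lborel. G (?e + \<eta>) - G \<eta>)"
    by (simp add: ftc)
  also have "\<dots> = 0"
    using integrable_shift[OF G, of ?e] G integral_shift[of G ?e]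
    by (simp add: borel_measurable_integrable[OF G, simplified])
  finally show ?thesis .
qed

text \<open>\<open>integral_pd_eq_0\<close> for the product of \<open>F\<close> with a character.
  Every integration by parts below is an instance of this.\<close>

lemma fourier_pd:
  fixes F :: "real ^ 'n::finite \<Rightarrow> complex"
  assumes d: "\<And>\<eta>. ((\<lambda>t. F (\<eta> + t *\<^sub>R axis j 1)) has_vector_derivative F' \<eta>) (at 0)"
    and c: "continuous_on UNIV F'" and cF: "continuous_on UNIV F"
    and F: "integrable lborel F" and F': "integrable lborel F'"
  shows "fourier F' x = 2 * pi * \<i> * (x $ j) * fourier F x"
proof -
  let ?e = "axis j (1::real) :: real^'n"
  define a where "a = - 2 * pi * \<i> * complex_of_real (x $ j)"
  have [measurable]: "F \<in> borel_measurable borel" "F' \<in> borel_measurable borel"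
    using c cF by (auto intro: borel_measurable_continuous_onI)
  define E where "E = (\<lambda>\<eta>. cis (- 2 * pi * (\<eta> \<bullet> x)))"
  have E: "((\<lambda>t. E (\<eta> + t *\<^sub>R ?e)) has_vector_derivative a * E \<eta>) (at 0)" for \<eta>
  proof -
    have "((\<lambda>t. cis (- 2 * pi * (\<eta> \<bullet> x) + - 2 * pi * (x $ j) * t)) has_vector_derivative a * E \<eta>) (at 0)"
    proof -
      have "((\<lambda>z. exp (- 2 * pi * \<i> * complex_of_real (\<eta> \<bullet> x) + a * z)) has_field_derivative a * E \<eta>) (at (complex_of_real 0))"
        by (auto intro!: derivative_eq_intros simp: E_def cis_conv_exp mult_ac)
      from has_vector_derivative_real_field[OF this]
      show ?thesis unfolding cis_conv_exp a_def by (simp add: algebra_simps)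
    qed
    then show ?thesis unfolding E_def by (simp add: inner_add_left inner_axis' algebra_simps)
  qed
  have i1: "integrable lborel (\<lambda>\<eta>. F \<eta> * E \<eta>)" "integrable lborel (\<lambda>\<eta>. F' \<eta> * E \<eta>)"
    using F F' unfolding E_def by (auto intro!: integrable_mult_cis)
  have i2: "integrable lborel (\<lambda>\<eta>. F \<eta> * (a * E \<eta>))"
    using integrable_mult_right[OF i1(1), of a] by (simp add: mult_ac)
  have "(LINT \<eta>|lborel. F \<eta> * (a * E \<eta>) + F' \<eta> * E \<eta>) = 0"
  proof (rule integral_pd_eq_0)
    show "((\<lambda>t. F (\<eta> + t *\<^sub>R ?e) * E (\<eta> + t *\<^sub>R ?e)) has_vector_derivative F \<eta> * (a * E \<eta>) + F' \<eta> * E \<eta>) (at 0)" for \<eta>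
      using has_vector_derivative_mult[OF d E, of \<eta> \<eta>] by simp
    show "continuous_on UNIV (\<lambda>\<eta>. F \<eta> * (a * E \<eta>) + F' \<eta> * E \<eta>)"
      unfolding E_def by (intro continuous_intros c cF)
  qed (use i1 i2 in auto)
  then have "(LINT \<eta>|lborel. F' \<eta> * E \<eta>) = - (LINT \<eta>|lborel. F \<eta> * (a * E \<eta>))"
    using i1 i2 by (simp add: add_eq_0_iff)
  also have "(LINT \<eta>|lborel. F \<eta> * (a * E \<eta>)) = a * (LINT \<eta>|lborel. F \<eta> * E \<eta>)"
    by (subst integral_mult_right_zero[symmetric]) (simp add: mult_ac)
  finally show ?thesis by (simp add: fourier_def E_def a_def)
qed

section \<open>Narrowing and widening of Gaussian windows\<close>

lemma gau_mult_gau: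
  "gau (2 * pi) \<tau> * gau (2 * pi) (z - \<tau>) = gau pi z * gau (4 * pi) (\<tau> - z /\<^sub>R 2)"
proof -
  have "2 * pi * (norm \<tau>)\<^sup>2 + 2 * pi * (norm (z - \<tau>))\<^sup>2 = pi * (norm z)\<^sup>2 + 4 * pi * (norm (\<tau> - z /\<^sub>R 2))\<^sup>2"
    by (simp add: power2_norm_eq_inner inner_diff_left inner_diff_right inner_commute algebra_simps)
  then show ?thesis unfolding exp_add[symmetric] by (simp add: algebra_simps)
qed

lemma integral_gau_conv:
  fixes z :: "real ^ 'n::finite"
  shows "integrable lborel (\<lambda>\<tau>. gau (2 * pi) \<tau> * gau (2 * pi) (z - \<tau>))"
    and "(LINT \<tau>|lborel. gau (2 * pi) \<tau> * gau (2 * pi) (z - \<tau>)) = gau pi z / 2 ^ CARD('n)"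
proof -
  have i: "integrable lborel (\<lambda>\<tau>::real^'n. gau (4 * pi) (- (z /\<^sub>R 2) + \<tau>))"
    by (intro integrable_shift integrable_gau) simp
  then have i': "integrable lborel (\<lambda>\<tau>::real^'n. gau (4 * pi) (\<tau> - z /\<^sub>R 2))" by simp
  show "integrable lborel (\<lambda>\<tau>. gau (2 * pi) \<tau> * gau (2 * pi) (z - \<tau>))"
    unfolding gau_mult_gau using i' by (rule integrable_mult_right)
  have "(LINT \<tau>|lborel. gau (4 * pi) (\<tau> - z /\<^sub>R 2)) = (LINT \<tau>|(lborel::(real^'n) measure). gau (4 * pi) \<tau>)"
    using integral_shift[of "gau (4 * pi)" "- (z /\<^sub>R 2)"] by simp
  also have "\<dots> = 1 / 2 ^ CARD('n)"
  proof -
    have "complex_of_real (LINT \<tau>|(lborel::(real^'n) measure). gau (4 * pi) \<tau>) = complex_of_real (4 powr (- real CARD('n) / 2))"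
      using fourier_gau[of 4 "0::real^'n"] by (simp add: fourier_def mult.commute)
    then have "(LINT \<tau>|(lborel::(real^'n) measure). gau (4 * pi) \<tau>) = 4 powr (- real CARD('n) / 2)"
      by (simp only: of_real_eq_iff)
    also have "(4::real) powr (- real CARD('n) / 2) = (2 powr 2) powr (- real CARD('n) / 2)" by simp
    also have "\<dots> = 1 / 2 ^ CARD('n)"
      unfolding powr_powr by (simp add: powr_minus_divide powr_realpow)
    finally show ?thesis .
  qed
  finally have "(LINT \<tau>|lborel. gau (4 * pi) (\<tau> - z /\<^sub>R 2)) = 1 / 2 ^ CARD('n)" .
  then show "(LINT \<tau>|lborel. gau (2 * pi) \<tau> * gau (2 * pi) (z - \<tau>)) = gau pi z / 2 ^ CARD('n)"
    unfolding gau_mult_gau by simp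
qed

text \<open>A Gaussian window is a Gaussian average of translates of the narrower window
  $e^{-2\pi|x|^2}$; this compensates the narrowing of windows in products.\<close>

lemma fourier_widen:
  fixes F :: "real ^ 'n::finite \<Rightarrow> complex"
  assumes [measurable]: "F \<in> borel_measurable borel"
    and F: "integrable lborel (\<lambda>z. F z * cgau pi z)"
  shows "fourier (\<lambda>z. F z * cgau pi z) x
    = 2 ^ CARD('n) * (LINT \<tau>|lborel. cgau (2 * pi) \<tau> * cis (- 2 * pi * (\<tau> \<bullet> x))
         * fourier (\<lambda>z. F (\<tau> + z) * cgau (2 * pi) z) x)"
proof -
  let ?n = "CARD('n)"
  \<comment> \<open>Integrated over \<tau> first, this rebuilds the wide window
    \<open>gau pi z\<close> up to the factor 2^n; integrated over z first, after the shift z ->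
    \<tau> + z, it gives the narrow-window transforms of the translates.\<close>
  define f where "f = (\<lambda>(z, \<tau>). F z * cis (- 2 * pi * (z \<bullet> x)) * complex_of_real (gau (2 * pi) \<tau> * gau (2 * pi) (z - \<tau>)))"
  have int: "integrable (lborel \<Otimes>\<^sub>M lborel) f"
  proof (rule lborel_pair.Fubini_integrable)
    show "f \<in> borel_measurable (lborel \<Otimes>\<^sub>M lborel)" unfolding f_def by measurable
    have "(LINT \<tau>|lborel. norm (f (z, \<tau>))) = norm (F z * cgau pi z) / 2 ^ ?n" for z
    proof -
      have "(LINT \<tau>|lborel. norm (f (z, \<tau>))) = (LINT \<tau>|lborel. norm (F z) * (gau (2 * pi) \<tau> * gau (2 * pi) (z - \<tau>)))"
        unfolding f_def by (simp add: norm_mult del: of_real_mult)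
      then show ?thesis using integral_gau_conv(2)[of z] by (simp add: norm_mult)
    qed
    then show "integrable lborel (\<lambda>z. LINT \<tau>|lborel. norm (f (z, \<tau>)))"
      using integrable_norm[OF F] by simp
    show "AE z in lborel. integrable lborel (\<lambda>\<tau>. f (z, \<tau>))"
      unfolding f_def using integral_gau_conv(1)
      by (intro AE_I2) (simp del: of_real_mult, intro integrable_mult_right integrable_of_real)
  qed
  have "(LINT \<tau>|lborel. cgau (2 * pi) \<tau> * cis (- 2 * pi * (\<tau> \<bullet> x))
         * fourier (\<lambda>z. F (\<tau> + z) * cgau (2 * pi) z) x)
     = (LINT \<tau>|lborel. LINT z|lborel. f (z, \<tau>))"
  proof (intro Bochner_Integration.integral_cong refl)
    fix \<tau> :: "real^'n"
    have "(LINT z|lborel. f (z, \<tau>)) = (LINT z|lborel. f (\<tau> + z, \<tau>))"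
      by (rule integral_shift[symmetric]) (unfold f_def prod.case, measurable)
    also have "\<dots> = (LINT z|lborel. cgau (2 * pi) \<tau> * cis (- 2 * pi * (\<tau> \<bullet> x))
       * (F (\<tau> + z) * cgau (2 * pi) z * cis (- 2 * pi * (z \<bullet> x))))"
    proof (intro Bochner_Integration.integral_cong refl)
      fix z
      have "cis (- 2 * pi * ((\<tau> + z) \<bullet> x)) = cis (- 2 * pi * (\<tau> \<bullet> x)) * cis (- 2 * pi * (z \<bullet> x))"
        by (simp add: cis_mult inner_add_left algebra_simps)
      then show "f (\<tau> + z, \<tau>) = cgau (2 * pi) \<tau> * cis (- 2 * pi * (\<tau> \<bullet> x))
       * (F (\<tau> + z) * cgau (2 * pi) z * cis (- 2 * pi * (z \<bullet> x)))"
        by (simp add: f_def mult_ac)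
    qed
    finally show "cgau (2 * pi) \<tau> * cis (- 2 * pi * (\<tau> \<bullet> x))
         * fourier (\<lambda>z. F (\<tau> + z) * cgau (2 * pi) z) x = (LINT z|lborel. f (z, \<tau>))"
      unfolding fourier_def by simp
  qed
  also have "\<dots> = (LINT z|lborel. LINT \<tau>|lborel. f (z, \<tau>))"
    by (subst lborel_pair.Fubini_integral) (use int in \<open>auto simp: split_beta'\<close>)
  also have "\<dots> = (LINT z|lborel. F z * cgau pi z * cis (- 2 * pi * (z \<bullet> x)) / 2 ^ ?n)"
  proof (intro Bochner_Integration.integral_cong refl)
    fix z
    have "(LINT \<tau>|lborel. f (z, \<tau>)) = F z * cis (- 2 * pi * (z \<bullet> x)) * complex_of_real (gau pi z / 2 ^ ?n)"
      unfolding f_def prod.case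
      by (subst integral_mult_right_zero, subst integral_complex_of_real, subst integral_gau_conv(2)) simp
    then show "(LINT \<tau>|lborel. f (z, \<tau>)) = F z * cgau pi z * cis (- 2 * pi * (z \<bullet> x)) / 2 ^ ?n"
      by simp
  qed
  finally show ?thesis unfolding fourier_def[of "\<lambda>z. F z * cgau pi z"] by simp
qed

lemma fourier_widen_bound:
  fixes F :: "real ^ 'n::finite \<Rightarrow> complex"
  assumes "F \<in> borel_measurable borel"
    and "integrable lborel (\<lambda>z. F z * cgau pi z)"
    and B: "\<And>\<tau>. norm (fourier (\<lambda>z. F (\<tau> + z) * cgau (2 * pi) z) x) \<le> B \<tau>"
  shows "ennreal (norm (fourier (\<lambda>z. F z * cgau pi z) x))
    \<le> 2 ^ CARD('n) * (\<integral>\<tau>. ennreal (gau (2 * pi) \<tau> * B \<tau>))"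
proof -
  let ?I = "(LINT \<tau>|lborel. cgau (2 * pi) \<tau> * cis (- 2 * pi * (\<tau> \<bullet> x))
         * fourier (\<lambda>z. F (\<tau> + z) * cgau (2 * pi) z) x)"
  have "ennreal (norm (fourier (\<lambda>z. F z * cgau pi z) x)) = 2 ^ CARD('n) * ennreal (norm ?I)"
    unfolding fourier_widen[OF assms(1,2)] norm_mult
    by (simp add: norm_power ennreal_mult ennreal_power[symmetric])
  also have "ennreal (norm ?I) \<le> (\<integral>\<tau>. ennreal (gau (2 * pi) \<tau> * B \<tau>))"
    by (rule order_trans[OF ennreal_norm_integral_le])
       (intro nn_integral_mono ennreal_leI, auto simp: norm_mult intro!: mult_left_mono B)
  finally show ?thesis by (simp add: mult_left_mono)
qed

text \<open>A = 2 * C is the fixed point of A -> C + A / 2. Repeating \<open>step\<close> from the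
  trivial bound \<open>B0\<close> therefore keeps the coefficient of \<kappa> and halves the
  remainder each time.\<close>

lemma absorption:
  fixes K \<kappa> :: "'a \<Rightarrow> real"
  assumes "\<And>z. K z \<le> B0" and "0 \<le> C" and "0 \<le> B0" and "\<And>z. 0 \<le> \<kappa> z"
    and step: "\<And>A R z. 0 \<le> A \<Longrightarrow> 0 \<le> R \<Longrightarrow> (\<And>z. K z \<le> A * \<kappa> z + R) \<Longrightarrow> K z \<le> (C + A / 2) * \<kappa> z + R / 2"
  shows "K z \<le> 2 * C * \<kappa> z"
proof -
  have *: "\<forall>z. K z \<le> 2 * C * \<kappa> z + B0 / 2 ^ m" for m
  proof (induction m)
    case 0
    show ?case using assms(1,2,4) by (simp add: add_increasing)
  next
    case (Suc m)
    have "K z \<le> (C + (2 * C) / 2) * \<kappa> z + (B0 / 2 ^ m) / 2" for z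
      by (rule step) (use Suc assms in auto)
    then show ?case by (simp add: mult.commute)
  qed
  have "(\<lambda>m. 2 * C * \<kappa> z + B0 * (1 / 2) ^ m) \<longlonglongrightarrow> 2 * C * \<kappa> z + B0 * 0"
    by (intro tendsto_intros LIMSEQ_power_zero) auto
  then show ?thesis
    using * by (intro LIMSEQ_le_const[of _ _ "K z"]) (auto simp: power_divide)
qed

text \<open>Since x = y + (x - y), one of <y> and <x - y> is at least <x> / 4; the other factor is
  kept.\<close>

lemma jbr_mult_le:
  assumes "0 \<le> t"
  shows "jbr y powr (- t) * jbr (x - y) powr (- t)
    \<le> 4 powr t * jbr x powr (- t) * (jbr y powr (- t) + jbr (x - y) powr (- t))"
proof -
  have *: "jbr x powr (- t) * 4 powr t \<ge> jbr u powr (- t)" if "jbr x \<le> 4 * jbr u" for u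
  proof -
    have "jbr x powr t \<le> (4 * jbr u) powr t" using that assms by (intro powr_mono2) auto
    then show ?thesis by (simp add: powr_mult powr_minus field_simps)
  qed
  have "jbr x \<le> 1 + norm x" by (rule jbr_le_norm)
  also have "\<dots> \<le> 1 + (norm y + norm (x - y))" using norm_triangle_ineq[of y "x - y"] by simp
  also have "\<dots> \<le> 2 * jbr y + 2 * jbr (x - y)"
    using norm_le_jbr[of y] norm_le_jbr[of "x - y"] jbr_ge_1[of y] jbr_ge_1[of "x - y"] by linarith
  finally have "jbr x \<le> 4 * jbr y \<or> jbr x \<le> 4 * jbr (x - y)" by linarith
  then show ?thesis
  proof
    assume "jbr x \<le> 4 * jbr y"
    then have "jbr y powr (- t) * jbr (x - y) powr (- t) \<le> (jbr x powr (- t) * 4 powr t) * jbr (x - y) powr (- t)"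
      by (intro mult_right_mono *) auto
    also have "\<dots> \<le> (jbr x powr (- t) * 4 powr t) * (jbr y powr (- t) + jbr (x - y) powr (- t))"
      by (intro mult_left_mono) auto
    finally show ?thesis by (simp add: mult_ac)
  next
    assume "jbr x \<le> 4 * jbr (x - y)"
    then have "jbr y powr (- t) * jbr (x - y) powr (- t) \<le> jbr y powr (- t) * (jbr x powr (- t) * 4 powr t)"
      by (intro mult_left_mono *) auto
    also have "\<dots> \<le> (jbr y powr (- t) + jbr (x - y) powr (- t)) * (jbr x powr (- t) * 4 powr t)"
      by (intro mult_right_mono) auto
    finally show ?thesis by (simp add: mult_ac)
  qed
qed

lemma nn_integral_jbr_powr_eq:
  assumes "real CARD('n) < t"
  shows "(\<integral>(x::real^'n::finite). ennreal (jbr x powr (- t))) = ennreal (LINT x|(lborel::(real^'n) measure). jbr x powr (- t))"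
  by (intro nn_integral_eq_integral integrable_jbr_powr assms) auto

text \<open>The basic stability under averaging: \<open>jbr_mult_le\<close> takes <x>^(-t) out of
  the integral, and what is left is integrable because t > n.\<close>

lemma conv_jbr:
  assumes t: "real CARD('n) < t"
  shows "\<exists>C>0. \<forall>x::real^'n::finite.
    (\<integral>y. ennreal (jbr y powr (- t) * jbr (x - y) powr (- t))) \<le> ennreal (C * jbr x powr (- t))"
proof -
  define I where "I = (LINT x|(lborel::(real^'n) measure). jbr x powr (- t))"
  have I0: "0 \<le> I" unfolding I_def by simp
  have t0: "0 \<le> t" using t by linarith
  \<comment> \<open>The summand 1, here and in later constants, only secures positivity.\<close>
  have "(\<integral>y. ennreal (jbr y powr (- t) * jbr (x - y) powr (- t))) \<le> ennreal ((4 powr t * (I + I) + 1) * jbr x powr (- t))" for x :: "real^'n"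
  proof -
    have "(\<integral>y. ennreal (jbr y powr (- t) * jbr (x - y) powr (- t)))
      \<le> (\<integral>y. ennreal (4 powr t * jbr x powr (- t)) * (ennreal (jbr y powr (- t)) + ennreal (jbr (x - y) powr (- t))))"
      using jbr_mult_le[OF t0] by (intro nn_integral_mono) (simp add: ennreal_mult[symmetric] ennreal_plus[symmetric] ennreal_leI del: ennreal_plus)
    also have "\<dots> = ennreal (4 powr t * jbr x powr (- t)) * ((\<integral>(y::real^'n). ennreal (jbr y powr (- t))) + (\<integral>y. ennreal (jbr (x - y) powr (- t))))"
      by (simp add: nn_integral_cmult nn_integral_add)
    also have "(\<integral>y. ennreal (jbr (x - y) powr (- t))) = (\<integral>(y::real^'n). ennreal (jbr y powr (- t)))"
      using nn_integral_reflect[of "\<lambda>y. ennreal (jbr y powr (- t))" x] by simp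
    also have "ennreal (4 powr t * jbr x powr (- t)) * ((\<integral>(y::real^'n). ennreal (jbr y powr (- t))) + (\<integral>(y::real^'n). ennreal (jbr y powr (- t))))
        = ennreal (4 powr t * jbr x powr (- t) * (I + I))"
      unfolding nn_integral_jbr_powr_eq[OF t] I_def[symmetric] using I0
      by (simp add: ennreal_mult ennreal_plus[symmetric] del: ennreal_plus)
    also have "\<dots> \<le> ennreal ((4 powr t * (I + I) + 1) * jbr x powr (- t))"
      by (intro ennreal_leI) (simp add: algebra_simps)
    finally show ?thesis .
  qed
  moreover have "4 powr t * (I + I) + 1 > 0" using I0 by (simp add: add_nonneg_pos)
  ultimately show ?thesis by blast
qed

section \<open>Windowed transforms of the derivatives of the phase\<close>

text \<open>A point where \<open>P\<close> fails would bring a whole ball of such points, of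
  positive measure. It turns essential suprema of continuous functions into bounds at every
  point.\<close>

lemma AE_lborel_closed:
  fixes x :: "'a::euclidean_space"
  assumes "closed {x. P x}" and "AE x in lborel. P x"
  shows "P x"
proof (rule ccontr)
  assume "\<not> P x"
  then have "x \<in> - {x. P x}" by simp
  then obtain e where e: "e > 0" "ball x e \<subseteq> - {x. P x}"
    using assms(1) open_contains_ball[of "- {x. P x}"] by (auto simp: closed_def)
  obtain N where N: "{x \<in> space lborel. \<not> P x} \<subseteq> N" "emeasure lborel N = 0" "N \<in> sets lborel"
    using AE_E[OF assms(2)] by blast
  have "emeasure lborel (ball x e) \<le> emeasure lborel N"
    using e(2) N by (intro emeasure_mono) auto
  then show False using N(2) e(1) unit_ball_vol_pos[of "real DIM('a)"] by (simp add: emeasure_ball)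
qed

lemma continuous_on_fourier:
  fixes u :: "real ^ 'n::finite \<Rightarrow> complex"
  assumes u: "integrable lborel u"
  shows "continuous_on UNIV (fourier u)"
proof (rule continuous_on_sequentiallyI)
  fix z :: "nat \<Rightarrow> real^'n" and a assume z: "z \<longlonglongrightarrow> a"
  have [measurable]: "u \<in> borel_measurable borel"
    using u by (auto dest: borel_measurable_integrable)
  show "(\<lambda>n. fourier u (z n)) \<longlonglongrightarrow> fourier u a"
    unfolding fourier_def
  proof (rule integral_dominated_convergence)
    show "integrable lborel (\<lambda>x. norm (u x))" using u by auto
    show "AE x in lborel. (\<lambda>n. u x * cis (- 2 * pi * (x \<bullet> z n))) \<longlonglongrightarrow> u x * cis (- 2 * pi * (x \<bullet> a))"
      using z by (intro AE_I2 tendsto_intros isCont_tendsto_compose[of _ cis])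
        (auto intro: continuous_intros simp: cis_conv_exp)
  qed (auto simp: norm_mult)
qed

lemma integrable_bounded_gau:
  fixes g :: "real ^ 'n::finite \<Rightarrow> complex"
  assumes [measurable]: "g \<in> borel_measurable borel" and "\<And>x. norm (g x) \<le> B * jbr x powr b" and "c > 0"
  shows "integrable lborel (\<lambda>z. g z * cgau c z)"
proof (rule Bochner_Integration.integrable_bound)
  show "integrable lborel (\<lambda>z::real^'n. B * (jbr z powr b * gau c z))"
    by (intro integrable_mult_right integrable_jbr_gau assms)
  have "norm (g x * cgau c x) \<le> (B * jbr x powr b) * gau c x" for x
    unfolding norm_mult using assms(2) by (auto intro!: mult_right_mono)
  then have "norm (g x * cgau c x) \<le> norm (B * (jbr x powr b * gau c x))" for x
    unfolding real_norm_def mult.assoc by (rule order_trans[OF _ abs_ge_self])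
  then show "AE x in lborel. norm (g x * cgau c x) \<le> norm (B * (jbr x powr b * gau c x))"
    by (rule AE_I2)
qed measurable

lemma continuous_window_transform:
  fixes g :: "real ^ 'n::finite \<Rightarrow> complex"
  assumes c: "continuous_on UNIV g" and b: "\<And>x. norm (g x) \<le> B"
  shows "continuous_on UNIV (\<lambda>w. fourier (\<lambda>\<zeta>. g (w + \<zeta>) * cgau pi \<zeta>) x)"
proof (rule continuous_on_sequentiallyI)
  fix z :: "nat \<Rightarrow> real^'n" and a assume z: "z \<longlonglongrightarrow> a"
  have [measurable]: "g \<in> borel_measurable borel" using c by (rule borel_measurable_continuous_onI)
  show "(\<lambda>n. fourier (\<lambda>\<zeta>. g (z n + \<zeta>) * cgau pi \<zeta>) x) \<longlonglongrightarrow> fourier (\<lambda>\<zeta>. g (a + \<zeta>) * cgau pi \<zeta>) x"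
    unfolding fourier_def
  proof (rule integral_dominated_convergence)
    show "integrable lborel (\<lambda>\<zeta>::real^'n. B * gau pi \<zeta>)" by (intro integrable_mult_right integrable_gau) simp
    have "(\<lambda>n. g (z n + \<zeta>)) \<longlonglongrightarrow> g (a + \<zeta>)" for \<zeta>
      using c by (intro isCont_tendsto_compose[of _ g] tendsto_intros z) (simp add: continuous_on_eq_continuous_at)
    then show "AE \<zeta> in lborel. (\<lambda>n. g (z n + \<zeta>) * cgau pi \<zeta> * cis (- 2 * pi * (\<zeta> \<bullet> x)))
      \<longlonglongrightarrow> g (a + \<zeta>) * cgau pi \<zeta> * cis (- 2 * pi * (\<zeta> \<bullet> x))"
      by (intro AE_I2 tendsto_intros)
    show "AE \<zeta> in lborel. norm (g (z n + \<zeta>) * cgau pi \<zeta> * cis (- 2 * pi * (\<zeta> \<bullet> x))) \<le> B * gau pi \<zeta>" for n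
      using b by (auto simp: norm_mult intro!: mult_right_mono)
  qed measurable
qed

text \<open>Recentring the window at 0 only produces a unimodular factor.\<close>

lemma norm_stft_eq:
  fixes g :: "real ^ 'n::finite \<Rightarrow> complex"
  assumes [measurable]: "g \<in> borel_measurable borel"
  shows "norm (stft g x \<xi>) = norm (fourier (\<lambda>z. g (x + z) * cgau pi z) \<xi>)"
proof -
  have [measurable]: "(\<lambda>y. cnj (window (y - x))) \<in> borel_measurable borel"
    unfolding window_def by (intro borel_measurable_continuous_onI continuous_intros)
  have "stft g x \<xi> = (LINT z|lborel. g (x + z) * cnj (window (x + z - x)) * cis (- 2 * pi * ((x + z) \<bullet> \<xi>)))"
    unfolding stft_def by (rule integral_shift[symmetric]) measurable
  also have "\<dots> = (LINT z|lborel. cis (- 2 * pi * (x \<bullet> \<xi>)) * (g (x + z) * cgau pi z * cis (- 2 * pi * (z \<bullet> \<xi>))))"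
  proof (intro Bochner_Integration.integral_cong refl)
    fix z
    have "cis (- 2 * pi * ((x + z) \<bullet> \<xi>)) = cis (- 2 * pi * (x \<bullet> \<xi>)) * cis (- 2 * pi * (z \<bullet> \<xi>))"
      by (simp add: cis_mult inner_add_left algebra_simps)
    then show "g (x + z) * cnj (window (x + z - x)) * cis (- 2 * pi * ((x + z) \<bullet> \<xi>))
      = cis (- 2 * pi * (x \<bullet> \<xi>)) * (g (x + z) * cgau pi z * cis (- 2 * pi * (z \<bullet> \<xi>)))"
      by (simp add: window_def mult_ac)
  qed
  finally show ?thesis by (simp add: fourier_def norm_mult)
qed

text \<open>Two essential suprema become bounds at every point. Continuity in \<xi> handles the
  inner one. The outer one needs continuity in the window centre, hence boundedness of
  \<open>g\<close>; this comes from Fourier inversion of \<open>g\<close> times a window, whose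
  transform is integrable because t > n.\<close>

lemma in_Winf_bound:
  fixes g :: "real ^ 'n::finite \<Rightarrow> complex"
  assumes W: "in_Winf t g" and c: "continuous_on UNIV g" and t: "real CARD('n) < t"
  shows "\<exists>C>0. (\<forall>\<eta>. norm (g \<eta>) \<le> C) \<and>
     (\<forall>w x. norm (fourier (\<lambda>z. g (w + z) * cgau pi z) x) \<le> C * jbr x powr (- t))"
proof -
  have [measurable]: "g \<in> borel_measurable borel" using c by (rule borel_measurable_continuous_onI)
  define M where "M = enn2real (Wnorm \<infinity> \<infinity> t g)"
  have M: "ennreal M = Wnorm \<infinity> \<infinity> t g" "0 \<le> M"
    using W unfolding M_def in_Winf_def by auto
  have ui: "integrable lborel (\<lambda>y. g y * cnj (window (y - x)))" for x using W by (simp add: in_Winf_def)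
  have uc: "continuous_on UNIV (\<lambda>y. g y * cnj (window (y - x)))" for x
    unfolding window_def by (intro continuous_intros c)
  have fs: "stft g x = fourier (\<lambda>y. g y * cnj (window (y - x)))" for x
    by (simp add: fun_eq_iff stft_def fourier_def)
  have 1: "AE x in lborel. \<forall>\<xi>. norm (stft g x \<xi>) \<le> M * jbr \<xi> powr (- t)"
  proof -
    have "AE x in lborel. Lnorm lborel \<infinity> (\<lambda>\<xi>. ennreal (norm (stft g x \<xi>) * jbr \<xi> powr t)) \<le> Wnorm \<infinity> \<infinity> t g"
      unfolding Wnorm_def by (subst (2) Lnorm_def) (simp add: esssup_AE)
    then show ?thesis
    proof eventually_elim
      fix x assume x: "Lnorm lborel \<infinity> (\<lambda>\<xi>. ennreal (norm (stft g x \<xi>) * jbr \<xi> powr t)) \<le> Wnorm \<infinity> \<infinity> t g"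
      have "AE \<xi> in lborel. ennreal (norm (stft g x \<xi>) * jbr \<xi> powr t) \<le> Lnorm lborel \<infinity> (\<lambda>\<xi>. ennreal (norm (stft g x \<xi>) * jbr \<xi> powr t))"
        by (simp add: Lnorm_def esssup_AE)
      then have "AE \<xi> in lborel. norm (stft g x \<xi>) * jbr \<xi> powr t \<le> M"
      proof eventually_elim
        fix \<xi> assume "ennreal (norm (stft g x \<xi>) * jbr \<xi> powr t) \<le> Lnorm lborel \<infinity> (\<lambda>\<xi>. ennreal (norm (stft g x \<xi>) * jbr \<xi> powr t))"
        with x have "ennreal (norm (stft g x \<xi>) * jbr \<xi> powr t) \<le> ennreal M" unfolding M by (rule order_trans[rotated])
        then show "norm (stft g x \<xi>) * jbr \<xi> powr t \<le> M" using M(2) by simp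
      qed
      moreover have "closed {\<xi>. norm (stft g x \<xi>) * jbr \<xi> powr t \<le> M}"
      proof (rule closed_Collect_le)
        show "continuous_on UNIV (\<lambda>\<xi>. norm (stft g x \<xi>) * jbr \<xi> powr t)"
          unfolding fs by (intro continuous_intros continuous_on_fourier ui) auto
      qed auto
      ultimately have "norm (stft g x \<xi>) * jbr \<xi> powr t \<le> M" for \<xi> by (rule AE_lborel_closed[rotated])
      then show "\<forall>\<xi>. norm (stft g x \<xi>) \<le> M * jbr \<xi> powr (- t)"
        by (simp add: powr_minus field_simps)
    qed
  qed
  define I where "I = (LINT x|(lborel::(real^'n) measure). jbr x powr (- t))"
  have I0: "0 \<le> I" unfolding I_def by simp
  have bd: "norm (g y) \<le> M * I" for y
  proof -
    have "AE x in lborel. norm (g y) * gau pi (y - x) \<le> M * I"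
      using 1
    proof eventually_elim
      fix x assume x: "\<forall>\<xi>. norm (stft g x \<xi>) \<le> M * jbr \<xi> powr (- t)"
      have i1: "integrable lborel (\<lambda>\<xi>::real^'n. M * jbr \<xi> powr (- t))"
        by (intro integrable_mult_right integrable_jbr_powr t)
      have i2: "integrable lborel (stft g x)"
        by (rule Bochner_Integration.integrable_bound[OF i1])
           (use x M(2) ui in \<open>auto simp: fs intro!: borel_measurable_continuous_onI continuous_on_fourier\<close>)
      \<comment> \<open>Inversion recovers the windowed function at \<open>y\<close> with a bound
        independent of the window centre \<open>x\<close>.\<close>
      have "g y * cnj (window (y - x)) = (LINT \<xi>|lborel. stft g x \<xi> * cis (2 * pi * (y \<bullet> \<xi>)))"
        using fourier_inversion[OF uc ui i2[unfolded fs]] unfolding fs by simp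
      then have "norm (g y * cnj (window (y - x))) \<le> (LINT \<xi>|lborel. norm (stft g x \<xi> * cis (2 * pi * (y \<bullet> \<xi>))))"
        by simp
      also have "\<dots> \<le> (LINT \<xi>|(lborel::(real^'n) measure). M * jbr \<xi> powr (- t))"
        using x i1 i2 by (intro integral_mono) (auto simp: norm_mult)
      also have "\<dots> = M * I" by (simp add: I_def)
      finally show "norm (g y) * gau pi (y - x) \<le> M * I"
        by (simp add: norm_mult window_def)
    qed
    moreover have "closed {x. norm (g y) * gau pi (y - x) \<le> M * I}"
      by (intro closed_Collect_le continuous_intros)
    \<comment> \<open>The centre is moved to \<open>y\<close> itself, where the window equals
      1.\<close>
    ultimately have "norm (g y) * gau pi (y - y) \<le> M * I" by (rule AE_lborel_closed[rotated])
    then show ?thesis by simp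
  qed
  have 2: "norm (fourier (\<lambda>z. g (w + z) * cgau pi z) x) \<le> M * jbr x powr (- t)" for w x
  proof -
    have "AE w in lborel. norm (fourier (\<lambda>z. g (w + z) * cgau pi z) x) \<le> M * jbr x powr (- t)"
      using 1 by eventually_elim (auto simp: norm_stft_eq)
    moreover have "closed {w. norm (fourier (\<lambda>z. g (w + z) * cgau pi z) x) \<le> M * jbr x powr (- t)}"
      by (intro closed_Collect_le continuous_intros continuous_window_transform[OF c bd])
    ultimately show ?thesis by (rule AE_lborel_closed[rotated])
  qed
  show ?thesis
  proof (intro exI[of _ "M + M * I + 1"] conjI allI)
    show "0 < M + M * I + 1" using M(2) I0 by (simp add: add_nonneg_pos)
    show "norm (g \<eta>) \<le> M + M * I + 1" for \<eta> using bd[of \<eta>] M(2) by simp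
    show "norm (fourier (\<lambda>z. g (w + z) * cgau pi z) x) \<le> (M + M * I + 1) * jbr x powr (- t)" for w x
      using M(2) I0 by (intro order_trans[OF 2] mult_right_mono) auto
  qed
qed

section \<open>Derivatives of the phase and of weighted Gaussians\<close>

lemma C2_derivatives:
  fixes \<mu> :: "real ^ 'n::finite \<Rightarrow> real"
  assumes "C2 \<mu>"
  shows "((\<lambda>t. \<mu> (x + t *\<^sub>R axis j 1)) has_real_derivative pd j \<mu> x) (at 0)"
    and "((\<lambda>t. pd j \<mu> (x + t *\<^sub>R axis j' 1)) has_real_derivative pd j' (pd j \<mu>) x) (at 0)"
    and "continuous_on UNIV \<mu>" and "continuous_on UNIV (pd j \<mu>)" and "continuous_on UNIV (pd j' (pd j \<mu>))"
proof -
  have *: "((\<lambda>t. f (x + t *\<^sub>R axis k 1)) has_real_derivative pd k f x) (at 0)"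
    if "f differentiable_on UNIV" for f :: "real^'n \<Rightarrow> real" and k
  proof -
    have "f differentiable (at x)" using that by (simp add: differentiable_on_def)
    then obtain D where D: "(f has_derivative D) (at x)" unfolding differentiable_def by blast
    have l: "((\<lambda>t. x + t *\<^sub>R axis k 1) has_vector_derivative axis k 1) (at 0)"
      by (auto intro!: derivative_eq_intros)
    have "(f \<circ> (\<lambda>t. x + t *\<^sub>R axis k 1) has_vector_derivative D (axis k 1)) (at 0)"
      by (rule vector_derivative_diff_chain_within[of _ _ _ UNIV f D, OF l])
         (use D in \<open>auto intro: has_derivative_at_withinI\<close>)
    then have "((\<lambda>t. f (x + t *\<^sub>R axis k 1)) has_vector_derivative D (axis k 1)) (at 0)" by (simp add: o_def)
    then show ?thesis
      unfolding pd_def using vector_derivative_at has_real_derivative_iff_has_vector_derivative by metis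
  qed
  show "((\<lambda>t. \<mu> (x + t *\<^sub>R axis j 1)) has_real_derivative pd j \<mu> x) (at 0)"
    "((\<lambda>t. pd j \<mu> (x + t *\<^sub>R axis j' 1)) has_real_derivative pd j' (pd j \<mu>) x) (at 0)"
    using assms by (auto simp: C2_def intro!: *)
  show "continuous_on UNIV \<mu>" "continuous_on UNIV (pd j \<mu>)" "continuous_on UNIV (pd j' (pd j \<mu>))"
    using assms by (auto simp: C2_def intro: differentiable_imp_continuous_on)
qed

text \<open>Mean value inequality; the dimension factor comes from estimating the differential by
  the sum of its coordinate values.\<close>

lemma C2_lipschitz:
  fixes \<mu> :: "real ^ 'n::finite \<Rightarrow> real"
  assumes "C2 \<mu>" and H: "\<And>i j x. \<bar>pd i (pd j \<mu>) x\<bar> \<le> C"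
  shows "\<bar>pd j \<mu> x - pd j \<mu> y\<bar> \<le> real CARD('n) * C * norm (x - y)"
proof -
  let ?f = "pd j \<mu>"
  have "\<forall>x. \<exists>D. (?f has_derivative D) (at x)"
    using assms(1) by (auto simp: C2_def differentiable_on_def differentiable_def)
  then obtain D where D: "\<And>x. (?f has_derivative D x) (at x)" by metis
  have De: "D x (axis i 1) = pd i ?f x" for x i
  proof -
    have l: "((\<lambda>t. x + t *\<^sub>R axis i 1) has_vector_derivative axis i 1) (at 0)"
      by (auto intro!: derivative_eq_intros)
    have "(?f \<circ> (\<lambda>t. x + t *\<^sub>R axis i 1) has_vector_derivative D x (axis i 1)) (at 0)"
      by (rule vector_derivative_diff_chain_within[of _ _ _ UNIV ?f "D x", OF l])
         (use D in \<open>auto intro: has_derivative_at_withinI\<close>)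
    then show ?thesis unfolding pd_def[of i] by (simp add: o_def vector_derivative_at)
  qed
  have on: "onorm (D x) \<le> real CARD('n) * C" for x
  proof (rule onorm_le)
    fix v :: "real^'n"
    have lin: "linear (D x)" using D has_derivative_linear by blast
    have "v = (\<Sum>i\<in>UNIV. v $ i *\<^sub>R axis i 1)"
      using basis_expansion[of v] by (simp add: scalar_mult_eq_scaleR)
    then have "D x v = D x (\<Sum>i\<in>UNIV. v $ i *\<^sub>R axis i 1)" by simp
    also have "\<dots> = (\<Sum>i\<in>UNIV. v $ i * pd i ?f x)"
      by (simp add: linear_sum[OF lin] linear_scale[OF lin] De)
    finally have "norm (D x v) \<le> (\<Sum>i\<in>UNIV. \<bar>v $ i * pd i ?f x\<bar>)" by (simp add: sum_abs)
    also have "\<dots> \<le> (\<Sum>i\<in>(UNIV::'n set). norm v * C)"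
      unfolding abs_mult by (intro sum_mono mult_mono component_le_norm_cart H) auto
    finally show "norm (D x v) \<le> real CARD('n) * C * norm v" by (simp add: mult_ac)
  qed
  have "norm (?f x - ?f y) \<le> real CARD('n) * C * norm (x - y)"
    by (rule differentiable_bound[of UNIV ?f D]) (use D on in auto)
  then show ?thesis by simp
qed

lemma norm_sq_add_axis:
  fixes v :: "real^'n::finite"
  shows "(norm (v + t *\<^sub>R axis j 1))\<^sup>2 = (norm v)\<^sup>2 + 2 * t * v $ j + t\<^sup>2"
proof -
  have 1: "(t *\<^sub>R axis j 1) \<bullet> v = t * v $ j" by (simp add: inner_axis')
  have 2: "v \<bullet> (t *\<^sub>R axis j 1) = t * v $ j" by (simp add: inner_axis)
  have 3: "(t *\<^sub>R axis j (1::real) :: real^'n) \<bullet> (t *\<^sub>R axis j 1) = t\<^sup>2"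
    by (simp add: inner_axis_axis power2_eq_square)
  show ?thesis
    unfolding power2_norm_eq_inner inner_add_left inner_add_right 1 2 3 by linarith
qed

lemma gau_has_pd:
  "((\<lambda>t. gau c (x + t *\<^sub>R axis j 1)) has_real_derivative - 2 * c * x $ j * gau c x) (at 0)"
proof -
  have "((\<lambda>t. exp (- (c * ((norm x)\<^sup>2 + 2 * t * x $ j + t\<^sup>2)))) has_real_derivative
      exp (- (c * ((norm x)\<^sup>2 + 2 * 0 * x $ j + 0\<^sup>2))) * (- (c * (2 * x $ j)))) (at 0)"
    by (rule derivative_eq_intros refl | simp)+
  then show ?thesis unfolding norm_sq_add_axis by (simp add: mult_ac)
qed

lemma jbr_powr_has_pd:
  "((\<lambda>t. jbr (x + t *\<^sub>R axis j 1) powr \<sigma>) has_real_derivative \<sigma> * x $ j * jbr x powr (\<sigma> - 2)) (at 0)"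
proof -
  have e: "jbr y powr \<sigma> = (1 + (norm y)\<^sup>2) powr (\<sigma> / 2)" for y :: "real^'n" and \<sigma>
    by (simp add: jbr_def powr_half_sqrt[symmetric] powr_powr)
  have p: "1 + ((norm x)\<^sup>2 + 2 * 0 * x $ j + 0\<^sup>2) > 0" by (simp add: add_pos_nonneg)
  have "((\<lambda>t. (1 + ((norm x)\<^sup>2 + 2 * t * x $ j + t\<^sup>2)) powr (\<sigma> / 2)) has_real_derivative
      (\<sigma> / 2) * (1 + (norm x)\<^sup>2) powr (\<sigma> / 2 - 1) * (2 * x $ j)) (at 0)"
    using p by (auto intro!: derivative_eq_intros)
  moreover have "(\<sigma> - 2) / 2 = \<sigma> / 2 - 1" by simp
  ultimately show ?thesis unfolding e norm_sq_add_axis by (simp add: mult_ac diff_divide_distrib)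
qed

lemma fourier_gau_1: "fourier (\<lambda>z::real^'n::finite. cgau pi z) y = cgau pi y"
proof -
  have "1 powr (- real CARD('n) / 2) * gau (pi / 1) y = gau pi y" by simp
  then show ?thesis using fourier_gau[of 1 y] unfolding mult_1_right by simp
qed

text \<open>The function is a multiple of the j-th derivative of the window, so
  \<open>fourier_pd\<close> evaluates its transform.\<close>

lemma fourier_coord_gau:
  fixes y :: "real^'n::finite"
  shows "fourier (\<lambda>z. complex_of_real (z $ j * gau pi z)) y = - \<i> * complex_of_real (y $ j * gau pi y)"
proof -
  have i: "integrable lborel (\<lambda>z::real^'n. cgau pi z)" by (intro integrable_of_real integrable_gau) simp
  have i2: "integrable lborel (\<lambda>z::real^'n. complex_of_real (z $ j) * cgau pi z)"
    by (rule integrable_bounded_gau[where B = 1 and b = 1])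
       (auto intro: order_trans[OF component_le_norm_cart norm_le_jbr])
  have "fourier (\<lambda>z. complex_of_real (- 2 * pi * z $ j * gau pi z)) y = 2 * pi * \<i> * (y $ j) * fourier (\<lambda>z. cgau pi z) y"
  proof (rule fourier_pd)
    show "((\<lambda>t. cgau pi (x + t *\<^sub>R axis j 1)) has_vector_derivative complex_of_real (- 2 * pi * x $ j * gau pi x)) (at 0)" for x :: "real^'n"
      by (intro has_vector_derivative_of_real gau_has_pd)
    show "integrable lborel (\<lambda>z::real^'n. complex_of_real (- 2 * pi * z $ j * gau pi z))"
      using integrable_mult_right[OF i2, of "- 2 * pi"] by (simp add: mult_ac)
  qed (intro continuous_intros i)+
  moreover have "fourier (\<lambda>z. complex_of_real (- 2 * pi * z $ j * gau pi z)) y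
      = - 2 * pi * fourier (\<lambda>z. complex_of_real (z $ j * gau pi z)) y"
    unfolding fourier_def by (subst integral_mult_right_zero[symmetric]) (simp add: mult_ac)
  ultimately have "- 2 * pi * fourier (\<lambda>z. complex_of_real (z $ j * gau pi z)) y = 2 * pi * \<i> * (y $ j) * cgau pi y"
    unfolding fourier_gau_1 by (simp only:)
  also have "\<dots> = - 2 * pi * (- \<i> * complex_of_real (y $ j * gau pi y))" by simp
  finally show ?thesis by (subst (asm) mult_cancel_left) simp
qed

lemma fourier_add:
  assumes "integrable lborel f" and "integrable lborel g"
  shows "fourier (\<lambda>x. f x + g x) y = fourier f y + fourier g y"
  unfolding fourier_def distrib_right
  by (rule Bochner_Integration.integral_add) (auto intro!: integrable_mult_cis assms)

lemma fourier_cmult: "fourier (\<lambda>x. c * f x) y = c * fourier f y"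
  unfolding fourier_def mult.assoc by (rule integral_mult_right_zero)

text \<open>Narrow-window bounds may grow polynomially in the translation \<tau>: the Gaussian
  average absorbs the growth into a constant.\<close>

lemma fourier_widen_bound_jbr:
  fixes F :: "real ^ 'n::finite \<Rightarrow> complex"
  assumes F: "F \<in> borel_measurable borel"
    and i: "integrable lborel (\<lambda>z. F z * cgau pi z)"
    and B: "\<And>\<tau>. norm (fourier (\<lambda>z. F (\<tau> + z) * cgau (2 * pi) z) x) \<le> M * jbr \<tau> powr b"
  shows "norm (fourier (\<lambda>z. F z * cgau pi z) x)
    \<le> 2 ^ CARD('n) * (LINT \<tau>|(lborel::(real^'n) measure). jbr \<tau> powr b * gau (2 * pi) \<tau>) * M"
proof -
  define J where "J = (LINT \<tau>|(lborel::(real^'n) measure). jbr \<tau> powr b * gau (2 * pi) \<tau>)"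
  have J0: "0 \<le> J" unfolding J_def by simp
  have M0: "0 \<le> M"
    using order_trans[OF norm_ge_zero B[of 0]] by (simp add: zero_le_mult_iff)
  have i2: "integrable lborel (\<lambda>\<tau>::real^'n. M * (jbr \<tau> powr b * gau (2 * pi) \<tau>))"
    by (intro integrable_mult_right integrable_jbr_gau) simp
  have "ennreal (norm (fourier (\<lambda>z. F z * cgau pi z) x))
    \<le> 2 ^ CARD('n) * (\<integral>(\<tau>::real^'n). ennreal (gau (2 * pi) \<tau> * (M * jbr \<tau> powr b)))"
    by (rule fourier_widen_bound[OF F i B])
  also have "(\<integral>(\<tau>::real^'n). ennreal (gau (2 * pi) \<tau> * (M * jbr \<tau> powr b)))
     = (\<integral>\<tau>. ennreal (M * (jbr (\<tau>::real^'n) powr b * gau (2 * pi) \<tau>)))"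
    by (simp only: mult_ac)
  also have "\<dots> = ennreal (M * J)"
    unfolding J_def by (subst nn_integral_eq_integral[OF i2]) (use M0 in auto)
  also have "2 ^ CARD('n) * ennreal (M * J) = ennreal (2 ^ CARD('n) * J * M)"
    using J0 M0 by (simp add: ennreal_mult ennreal_power[symmetric] mult_ac)
  finally show ?thesis
    using J0 M0 by (simp add: J_def)
qed

text \<open>\<open>E\<close> bounds the average of \<open>B\<close> at the single point
  \<open>x\<close>, so that kernel estimates valid only in a restricted region of \<open>x\<close>
  can be inserted.\<close>

lemma fourier_mult_bound_jbr:
  fixes u v :: "real ^ 'n::finite \<Rightarrow> complex"
  assumes "continuous_on UNIV u" and "integrable lborel u" and "integrable lborel v"
    and t: "real CARD('n) < t"
    and ub: "\<And>y. norm (fourier u y) \<le> c * jbr y powr (- t)" and vb: "\<And>y. norm (fourier v y) \<le> B y"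
    and E: "(\<integral>y. ennreal (jbr y powr (- t) * B (x - y))) \<le> ennreal E" "0 \<le> E"
    and [measurable]: "B \<in> borel_measurable borel"
  shows "norm (fourier (\<lambda>y. u y * v y) x) \<le> c * E"
proof -
  have c0: "0 \<le> c"
    using order_trans[OF norm_ge_zero ub[of 0]] by (simp add: zero_le_mult_iff)
  have i: "integrable lborel (\<lambda>y::real^'n. c * jbr y powr (- t))"
    by (intro integrable_mult_right integrable_jbr_powr t)
  have uh: "integrable lborel (fourier u)"
    by (rule Bochner_Integration.integrable_bound[OF i])
       (use ub c0 assms(2) in \<open>auto intro!: borel_measurable_continuous_onI continuous_on_fourier\<close>)
  have "ennreal (norm (fourier (\<lambda>y. u y * v y) x)) \<le> (\<integral>y. ennreal ((c * jbr y powr (- t)) * B (x - y)))"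
    by (rule fourier_mult_bound[OF assms(1,2) uh assms(3) ub vb])
  also have "\<dots> = (\<integral>y. ennreal c * ennreal (jbr y powr (- t) * B (x - y)))"
    using c0 by (simp add: ennreal_mult' mult.assoc)
  also have "\<dots> = ennreal c * (\<integral>y. ennreal (jbr y powr (- t) * B (x - y)))"
    by (rule nn_integral_cmult) measurable
  also have "\<dots> \<le> ennreal c * ennreal E" by (intro mult_left_mono E) simp
  also have "\<dots> = ennreal (c * E)" using c0 by (simp add: ennreal_mult')
  finally show ?thesis using c0 E(2) by simp
qed

text \<open>Averaging maps a bound A \<kappa> + R to one of the same form, which is what
  \<open>absorption\<close> iterates. \<open>E\<close> stands for the value of \<kappa> at
  \<open>x\<close>; the remainder picks up the total mass of the weight.\<close>

lemma conv_affine: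
  fixes \<kappa> :: "real ^ 'n::finite \<Rightarrow> real"
  assumes t: "real CARD('n) < t" and [measurable]: "\<kappa> \<in> borel_measurable borel" and k0: "\<And>y. 0 \<le> \<kappa> y"
    and C0: "(\<integral>y. ennreal (jbr y powr (- t) * \<kappa> (x - y))) \<le> ennreal (C0 * E)" "0 \<le> C0" "0 \<le> E"
    and A: "0 \<le> A" "0 \<le> R"
  shows "(\<integral>y. ennreal (jbr y powr (- t) * (A * \<kappa> (x - y) + R)))
     \<le> ennreal ((C0 + (LINT y|(lborel::(real^'n) measure). jbr y powr (- t))) * (A * E + R))"
proof -
  define I where "I = (LINT y|(lborel::(real^'n) measure). jbr y powr (- t))"
  have I0: "0 \<le> I" unfolding I_def by simp
  have "(\<integral>y. ennreal (jbr y powr (- t) * (A * \<kappa> (x - y) + R)))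
     = (\<integral>y. ennreal A * ennreal (jbr y powr (- t) * \<kappa> (x - y)) + ennreal R * ennreal (jbr y powr (- t)))"
    using A k0 by (intro nn_integral_cong) (simp add: ennreal_mult[symmetric] ennreal_plus[symmetric] algebra_simps del: ennreal_plus)
  also have "\<dots> = ennreal A * (\<integral>y. ennreal (jbr y powr (- t) * \<kappa> (x - y))) + ennreal R * (\<integral>(y::real^'n). ennreal (jbr y powr (- t)))"
    by (simp add: nn_integral_add nn_integral_cmult)
  also have "\<dots> \<le> ennreal A * ennreal (C0 * E) + ennreal R * ennreal I"
    unfolding nn_integral_jbr_powr_eq[OF t] I_def by (intro add_mono mult_left_mono C0) auto
  also have "\<dots> = ennreal (A * (C0 * E) + R * I)"
    using A C0 I0 by (simp add: ennreal_mult ennreal_plus)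
  also have "\<dots> \<le> ennreal ((C0 + I) * (A * E + R))"
  proof (rule ennreal_leI)
    have "0 \<le> I * (A * E) + C0 * R" using A C0 I0 by simp
    then show "A * (C0 * E) + R * I \<le> (C0 + I) * (A * E + R)" by (simp add: algebra_simps)
  qed
  finally show ?thesis unfolding I_def .
qed

text \<open>Decay in y is reduced to decay in the separate coordinates through the largest of them,
  \<open>M\<close>.\<close>

lemma jbr_power_le_components:
  fixes y :: "real ^ 'n::finite"
  shows "jbr y ^ L \<le> (1 + real CARD('n)) ^ L * (1 + (\<Sum>j\<in>UNIV. \<bar>y $ j\<bar> ^ L))"
proof -
  define M where "M = Max (range (\<lambda>j. \<bar>y $ j\<bar>))"
  have M: "\<bar>y $ j\<bar> \<le> M" for j unfolding M_def by simp
  have "M \<in> range (\<lambda>j. \<bar>y $ j\<bar>)" unfolding M_def by (rule Max_in) auto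
  then obtain k where k: "M = \<bar>y $ k\<bar>" by auto
  have M0: "0 \<le> M" unfolding k by simp
  have "jbr y \<le> 1 + norm y" by (rule jbr_le_norm)
  also have "\<dots> \<le> 1 + (\<Sum>j\<in>(UNIV::'n set). M)"
  proof -
    have "(\<Sum>j\<in>UNIV. \<bar>y $ j\<bar>) \<le> (\<Sum>j\<in>(UNIV::'n set). M)" by (rule sum_mono) (rule M)
    then show ?thesis using norm_le_l1_cart[of y] by linarith
  qed
  also have "\<dots> \<le> (1 + real CARD('n)) * max 1 M"
  proof -
    have "real CARD('n) * M \<le> real CARD('n) * max 1 M" by (intro mult_left_mono) auto
    then show ?thesis unfolding distrib_right sum_constant using max.cobounded1[of 1 M] by linarith
  qed
  finally have "jbr y ^ L \<le> ((1 + real CARD('n)) * max 1 M) ^ L" by (intro power_mono) auto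
  also have "\<dots> = (1 + real CARD('n)) ^ L * max 1 M ^ L" by (rule power_mult_distrib)
  also have "\<dots> \<le> (1 + real CARD('n)) ^ L * (1 + (\<Sum>j\<in>UNIV. \<bar>y $ j\<bar> ^ L))"
  proof (rule mult_left_mono)
    have "M ^ L \<le> (\<Sum>j\<in>UNIV. \<bar>y $ j\<bar> ^ L)"
      unfolding k by (rule member_le_sum) auto
    moreover have "max 1 M ^ L \<le> 1 + M ^ L" using M0 by (cases "1 \<le> M") (auto simp: max_def)
    ultimately show "max 1 M ^ L \<le> 1 + (\<Sum>j\<in>UNIV. \<bar>y $ j\<bar> ^ L)" by linarith
  qed simp
  finally show ?thesis .
qed

text \<open>Up to linear combinations, the functions with a + \<sigma> <= s are closed under the
  j-th derivative, and each has L^1 norm O(<w>^s). Every integration by parts thus gains |y_j| and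
  stays in the class, which drives the induction on \<open>L\<close>. The exponents \<open>a\<close>
  and \<open>b\<close> are there for this closure.\<close>

lemma fourier_jbr_class:
  fixes j :: "'n::finite"
  assumes s: "0 \<le> s"
  shows "real a + \<sigma> \<le> s \<Longrightarrow> \<exists>C\<ge>0. \<forall>(w::real^'n) y. \<bar>y $ j\<bar> ^ L *
    norm (fourier (\<lambda>z. complex_of_real ((w + z) $ j ^ a * jbr (w + z) powr \<sigma> * z $ j ^ b * gau pi z)) y)
    \<le> C * jbr w powr s"
proof (induction L arbitrary: a \<sigma> b)
  define f where "f = (\<lambda>w a \<sigma> b (z::real^'n). (w + z) $ j ^ a * jbr (w + z) powr \<sigma> * z $ j ^ b * gau pi z)"
  have fcont: "continuous_on UNIV (f w a \<sigma> b)" for w a \<sigma> b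
    unfolding f_def by (intro continuous_intros) auto
  have fb: "\<bar>f w a \<sigma> b z\<bar> \<le> 2 powr s * jbr w powr s * (jbr z powr (s + real b) * gau pi z)"
    if "real a + \<sigma> \<le> s" for w a \<sigma> b z
  proof -
    have p: "\<bar>v $ j\<bar> ^ k \<le> jbr v powr real k" for v :: "real^'n" and k
      using order_trans[OF component_le_norm_cart norm_le_jbr, of v j]
      by (auto simp: powr_realpow intro!: power_mono)
    have "\<bar>(w + z) $ j\<bar> ^ a * jbr (w + z) powr \<sigma> \<le> jbr (w + z) powr real a * jbr (w + z) powr \<sigma>"
      by (intro mult_right_mono p) auto
    also have "\<dots> = jbr (w + z) powr (real a + \<sigma>)" by (simp add: powr_add)
    also have "\<dots> \<le> jbr (w + z) powr s" using that jbr_ge_1 by (intro powr_mono) auto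
    also have "\<dots> \<le> 2 powr s * jbr w powr s * jbr z powr s" by (rule jbr_powr_add_pos[OF s])
    finally have 1: "\<bar>(w + z) $ j\<bar> ^ a * jbr (w + z) powr \<sigma> \<le> 2 powr s * jbr w powr s * jbr z powr s" .
    have "\<bar>f w a \<sigma> b z\<bar> = (\<bar>(w + z) $ j\<bar> ^ a * jbr (w + z) powr \<sigma>) * \<bar>z $ j\<bar> ^ b * gau pi z"
      unfolding f_def by (simp add: abs_mult power_abs)
    also have "\<dots> \<le> (2 powr s * jbr w powr s * jbr z powr s) * jbr z powr real b * gau pi z"
      by (intro mult_right_mono mult_mono 1 p) auto
    also have "\<dots> = 2 powr s * jbr w powr s * (jbr z powr (s + real b) * gau pi z)"
      by (simp add: powr_add)
    finally show ?thesis .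
  qed
  have bi: "integrable lborel (\<lambda>z::real^'n. c * (jbr z powr b * gau pi z))" for c b :: real
    by (intro integrable_mult_right integrable_jbr_gau) simp
  have fi: "integrable lborel (\<lambda>z. complex_of_real (f w a \<sigma> b z))" if "real a + \<sigma> \<le> s" for w a \<sigma> b
    by (rule Bochner_Integration.integrable_bound[OF bi[of "2 powr s * jbr w powr s" "s + real b"]])
       (use fb[OF that] in \<open>auto intro!: borel_measurable_continuous_onI fcont borel_measurable_of_real
           intro: order_trans[OF _ abs_ge_self]\<close>)
  have fold: "(\<lambda>z. complex_of_real ((w + z) $ j ^ a * jbr (w + z) powr \<sigma> * z $ j ^ b * gau pi z))
     = (\<lambda>z. complex_of_real (f w a \<sigma> b z))" for w a \<sigma> b
    by (simp add: f_def)
  {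
    case 0
    define J where "J = (LINT z|(lborel::(real^'n) measure). jbr z powr (s + real b) * gau pi z)"
    have "norm (fourier (\<lambda>z. complex_of_real (f w a \<sigma> b z)) y) \<le> (2 powr s * J) * jbr w powr s" for w y
    proof -
      have "norm (fourier (\<lambda>z. complex_of_real (f w a \<sigma> b z)) y) \<le> (LINT z|lborel. norm (complex_of_real (f w a \<sigma> b z)))"
        by (rule norm_fourier_le[OF fi[OF 0]])
      also have "\<dots> \<le> (LINT z|(lborel::(real^'n) measure). 2 powr s * jbr w powr s * (jbr z powr (s + real b) * gau pi z))"
        by (rule integral_mono[OF integrable_norm[OF fi[OF 0]] bi]) (use fb[OF 0] in simp)
      also have "\<dots> = (2 powr s * J) * jbr w powr s" by (simp add: J_def)
      finally show ?thesis .
    qed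
    moreover have "0 \<le> 2 powr s * J" by (simp add: J_def)
    ultimately show ?case unfolding fold by auto
  next
    case (Suc L)
    note as = Suc.prems
    \<comment> \<open>Truncated subtraction does no harm: for a = 0 the corresponding term of the
      derivative carries the factor \<open>real a\<close> = 0, and likewise for
      \<open>b - 1\<close>.\<close>
    have as1: "real (a - 1) + \<sigma> \<le> s" using as by (cases a) auto
    obtain C1 where C1: "C1 \<ge> 0" "\<And>w y. \<bar>y $ j\<bar> ^ L * norm (fourier (\<lambda>z. complex_of_real (f w (a - 1) \<sigma> b z)) y) \<le> C1 * jbr w powr s"
      using Suc.IH[OF as1, of b] unfolding fold by auto
    obtain C2 where C2: "C2 \<ge> 0" "\<And>w y. \<bar>y $ j\<bar> ^ L * norm (fourier (\<lambda>z. complex_of_real (f w (a + 1) (\<sigma> - 2) b z)) y) \<le> C2 * jbr w powr s"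
      using Suc.IH[of "a + 1" "\<sigma> - 2" b] as unfolding fold by auto
    obtain C3 where C3: "C3 \<ge> 0" "\<And>w y. \<bar>y $ j\<bar> ^ L * norm (fourier (\<lambda>z. complex_of_real (f w a \<sigma> (b - 1) z)) y) \<le> C3 * jbr w powr s"
      using Suc.IH[of a \<sigma> "b - 1"] as unfolding fold by auto
    obtain C4 where C4: "C4 \<ge> 0" "\<And>w y. \<bar>y $ j\<bar> ^ L * norm (fourier (\<lambda>z. complex_of_real (f w a \<sigma> (b + 1) z)) y) \<le> C4 * jbr w powr s"
      using Suc.IH[of a \<sigma> "b + 1"] as unfolding fold by auto
    define D where "D = (\<lambda>w z. real a * f w (a - 1) \<sigma> b z + (\<sigma> * f w (a + 1) (\<sigma> - 2) b z
        + (real b * f w a \<sigma> (b - 1) z + (- 2 * pi) * f w a \<sigma> (b + 1) z)))"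
    have i1: "integrable lborel (\<lambda>z. complex_of_real (f w (a - 1) \<sigma> b z))" for w by (rule fi[OF as1])
    have i2: "integrable lborel (\<lambda>z. complex_of_real (f w (a + 1) (\<sigma> - 2) b z))" for w using as by (intro fi) auto
    have i3: "integrable lborel (\<lambda>z. complex_of_real (f w a \<sigma> b' z))" for w b' using as by (intro fi) auto
    have der: "((\<lambda>r. f w a \<sigma> b (z + r *\<^sub>R axis j 1)) has_real_derivative D w z) (at 0)" for w z
    proof -
      have d1: "((\<lambda>r. (w + (z + r *\<^sub>R axis j 1)) $ j ^ a) has_real_derivative real a * (w + z) $ j ^ (a - 1)) (at 0)"
        by (auto intro!: derivative_eq_intros)
      have d2: "((\<lambda>r. jbr (w + (z + r *\<^sub>R axis j 1)) powr \<sigma>) has_real_derivative \<sigma> * (w + z) $ j * jbr (w + z) powr (\<sigma> - 2)) (at 0)"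
        using jbr_powr_has_pd[of "w + z" j \<sigma>] by (simp add: add.assoc)
      have d3: "((\<lambda>r. (z + r *\<^sub>R axis j 1) $ j ^ b) has_real_derivative real b * z $ j ^ (b - 1)) (at 0)"
        by (auto intro!: derivative_eq_intros)
      have d4: "((\<lambda>r. gau pi (z + r *\<^sub>R axis j 1)) has_real_derivative - 2 * pi * z $ j * gau pi z) (at 0)"
        by (rule gau_has_pd)
      show ?thesis
        unfolding f_def
        by (rule DERIV_cong[OF DERIV_mult[OF DERIV_mult[OF DERIV_mult[OF d1 d2] d3] d4]])
           (simp add: D_def f_def algebra_simps)
    qed
    have key: "fourier (\<lambda>z. complex_of_real (D w z)) y = 2 * pi * \<i> * (y $ j) * fourier (\<lambda>z. complex_of_real (f w a \<sigma> b z)) y" for w y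
    proof (rule fourier_pd)
      show "((\<lambda>r. complex_of_real (f w a \<sigma> b (z + r *\<^sub>R axis j 1))) has_vector_derivative complex_of_real (D w z)) (at 0)" for z
        by (intro has_vector_derivative_of_real der)
      show "continuous_on UNIV (\<lambda>z. complex_of_real (D w z))"
        unfolding D_def by (intro continuous_intros fcont)
      show "continuous_on UNIV (\<lambda>z. complex_of_real (f w a \<sigma> b z))"
        by (intro continuous_intros fcont)
      show "integrable lborel (\<lambda>z. complex_of_real (D w z))"
        unfolding D_def of_real_add of_real_mult by (intro Bochner_Integration.integrable_add integrable_mult_right i1 i2 i3)
    qed (rule i3)
    let ?F1 = "\<lambda>w z. complex_of_real (f w (a - 1) \<sigma> b z)"
    let ?F2 = "\<lambda>w z. complex_of_real (f w (a + 1) (\<sigma> - 2) b z)"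
    let ?F3 = "\<lambda>w z. complex_of_real (f w a \<sigma> (b - 1) z)"
    let ?F4 = "\<lambda>w z. complex_of_real (f w a \<sigma> (b + 1) z)"
    have lin: "fourier (\<lambda>z. complex_of_real (D w z)) y
      = complex_of_real (real a) * fourier (?F1 w) y
      + (complex_of_real \<sigma> * fourier (?F2 w) y
      + (complex_of_real (real b) * fourier (?F3 w) y
      + complex_of_real (- 2 * pi) * fourier (?F4 w) y))" for w y
    proof -
      note I1 = integrable_mult_right[OF i1[of w], of "complex_of_real (real a)"]
      note I2 = integrable_mult_right[OF i2[of w], of "complex_of_real \<sigma>"]
      note I3 = integrable_mult_right[OF i3[of w "b - 1"], of "complex_of_real (real b)"]
      note I4 = integrable_mult_right[OF i3[of w "b + 1"], of "complex_of_real (- 2 * pi)"]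
      note I34 = Bochner_Integration.integrable_add[OF I3 I4]
      note I234 = Bochner_Integration.integrable_add[OF I2 I34]
      have "(\<lambda>z. complex_of_real (D w z)) = (\<lambda>z. complex_of_real (real a) * ?F1 w z
        + (complex_of_real \<sigma> * ?F2 w z + (complex_of_real (real b) * ?F3 w z + complex_of_real (- 2 * pi) * ?F4 w z)))"
        unfolding D_def of_real_add of_real_mult ..
      then show ?thesis
        unfolding fourier_cmult[symmetric] fourier_add[OF I3 I4, symmetric] fourier_add[OF I2 I34, symmetric]
          fourier_add[OF I1 I234, symmetric] by (rule arg_cong)
    qed
    define C where "C = (real a * C1 + \<bar>\<sigma>\<bar> * C2 + real b * C3 + 2 * pi * C4)"
    have "\<bar>y $ j\<bar> ^ Suc L * norm (fourier (\<lambda>z. complex_of_real (f w a \<sigma> b z)) y) \<le> C * jbr w powr s" for w y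
    proof -
      have "\<bar>y $ j\<bar> * norm (fourier (\<lambda>z. complex_of_real (f w a \<sigma> b z)) y)
        \<le> 2 * pi * \<bar>y $ j\<bar> * norm (fourier (\<lambda>z. complex_of_real (f w a \<sigma> b z)) y)"
        using pi_gt3 by (intro mult_right_mono) (auto simp: mult_le_cancel_right1)
      also have "\<dots> = norm (fourier (\<lambda>z. complex_of_real (D w z)) y)"
        unfolding key by (simp add: norm_mult)
      also have "\<dots> \<le> real a * norm (fourier (\<lambda>z. complex_of_real (f w (a - 1) \<sigma> b z)) y)
        + (\<bar>\<sigma>\<bar> * norm (fourier (\<lambda>z. complex_of_real (f w (a + 1) (\<sigma> - 2) b z)) y)
        + (real b * norm (fourier (\<lambda>z. complex_of_real (f w a \<sigma> (b - 1) z)) y)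
        + 2 * pi * norm (fourier (\<lambda>z. complex_of_real (f w a \<sigma> (b + 1) z)) y)))" (is "_ \<le> ?r")
        unfolding lin
        by (intro order_trans[OF norm_triangle_ineq] add_mono) (simp_all add: norm_mult)
      finally have "\<bar>y $ j\<bar> ^ L * (\<bar>y $ j\<bar> * norm (fourier (\<lambda>z. complex_of_real (f w a \<sigma> b z)) y)) \<le> \<bar>y $ j\<bar> ^ L * ?r"
        by (intro mult_left_mono) auto
      also have "\<dots> = real a * (\<bar>y $ j\<bar> ^ L * norm (fourier (\<lambda>z. complex_of_real (f w (a - 1) \<sigma> b z)) y))
        + (\<bar>\<sigma>\<bar> * (\<bar>y $ j\<bar> ^ L * norm (fourier (\<lambda>z. complex_of_real (f w (a + 1) (\<sigma> - 2) b z)) y))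
        + (real b * (\<bar>y $ j\<bar> ^ L * norm (fourier (\<lambda>z. complex_of_real (f w a \<sigma> (b - 1) z)) y))
        + 2 * pi * (\<bar>y $ j\<bar> ^ L * norm (fourier (\<lambda>z. complex_of_real (f w a \<sigma> (b + 1) z)) y))))"
        by (simp add: distrib_left mult_ac)
      also have "\<dots> \<le> real a * (C1 * jbr w powr s) + (\<bar>\<sigma>\<bar> * (C2 * jbr w powr s) + (real b * (C3 * jbr w powr s) + 2 * pi * (C4 * jbr w powr s)))"
        by (intro add_mono mult_left_mono C1 C2 C3 C4) auto
      finally show ?thesis by (simp add: C_def algebra_simps)
    qed
    moreover have "0 \<le> C" unfolding C_def using C1(1) C2(1) C3(1) C4(1) by simp
    ultimately show ?case unfolding fold by blast
  }
qed

text \<open>Seen through a window at \<open>w\<close>, the weight <.>^s acts like the constant <w>^s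
  times a Schwartz function: enough integrations by parts in each coordinate reach any order
  \<open>t\<close>.\<close>

lemma fourier_jbr_powr_gau:
  assumes s: "0 \<le> s" 
  shows "\<exists>C>0. \<forall>(w::real^'n::finite) y.
    norm (fourier (\<lambda>z. complex_of_real (jbr (w + z) powr s * gau pi z)) y) \<le> C * jbr w powr s * jbr y powr (- t)"
proof -
  obtain L :: nat where L: "t \<le> real L" using real_arch_simple by blast
  let ?F = "\<lambda>w y. norm (fourier (\<lambda>z::real^'n. complex_of_real (jbr (w + z) powr s * gau pi z)) y)"
  \<comment> \<open>With L = 0 the coordinate enters to the power 0, so any index serves and
    \<open>undefined\<close> is passed.\<close>
  obtain C0 where C0: "C0 \<ge> 0" "\<And>w y. ?F w y \<le> C0 * jbr w powr s"
    using fourier_jbr_class[OF s, of 0 s undefined 0 0] by auto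
  have "\<forall>j. \<exists>C\<ge>0. \<forall>w y. \<bar>y $ j\<bar> ^ L * ?F w y \<le> C * jbr w powr s"
  proof
    fix j
    show "\<exists>C\<ge>0. \<forall>w y. \<bar>y $ j\<bar> ^ L * ?F w y \<le> C * jbr w powr s"
      using fourier_jbr_class[OF s, of 0 s j L 0] by simp
  qed
  from choice[OF this] obtain C where "\<forall>j. C j \<ge> 0 \<and> (\<forall>w y. \<bar>y $ j\<bar> ^ L * ?F w y \<le> C j * jbr w powr s)"
    by blast
  then have C: "\<And>j. C j \<ge> 0" "\<And>j w y. \<bar>y $ j\<bar> ^ L * ?F w y \<le> C j * jbr w powr s" by blast+
  define D where "D = (1 + real CARD('n)) ^ L * (C0 + (\<Sum>j\<in>UNIV. C j)) + 1"
  have D0: "D > 0" unfolding D_def using C0(1) C(1) by (auto intro!: add_nonneg_pos mult_nonneg_nonneg add_nonneg_nonneg sum_nonneg)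
  have "?F w y \<le> D * jbr w powr s * jbr y powr (- t)" for w y
  proof -
    have "jbr y powr t \<le> jbr y powr real L" using L jbr_ge_1[of y] by (rule powr_mono)
    then have "jbr y powr t * ?F w y \<le> jbr y ^ L * ?F w y"
      by (intro mult_right_mono) (simp_all add: powr_realpow)
    also have "\<dots> \<le> ((1 + real CARD('n)) ^ L * (1 + (\<Sum>j\<in>UNIV. \<bar>y $ j\<bar> ^ L))) * ?F w y"
      by (intro mult_right_mono jbr_power_le_components) auto
    also have "\<dots> = (1 + real CARD('n)) ^ L * (?F w y + (\<Sum>j\<in>UNIV. \<bar>y $ j\<bar> ^ L * ?F w y))"
      unfolding sum_distrib_right[symmetric] by (simp add: distrib_right mult.assoc)
    also have "\<dots> \<le> (1 + real CARD('n)) ^ L * (C0 * jbr w powr s + (\<Sum>j\<in>UNIV. C j * jbr w powr s))"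
      by (intro mult_left_mono add_mono sum_mono C0 C) auto
    also have "\<dots> = (D - 1) * jbr w powr s"
      unfolding D_def sum_distrib_right[symmetric] by (simp add: distrib_right)
    also have "\<dots> \<le> D * jbr w powr s" by (intro mult_right_mono) auto
    finally show ?thesis by (simp add: powr_minus field_simps)
  qed
  then show ?thesis using D0 by blast
qed

lemma coord_gau_le_jbr_powr:
  "\<exists>C>0. \<forall>(y::real^'n::finite) i. \<bar>y $ i\<bar> * gau pi y \<le> C * jbr y powr (- t)"
proof -
  obtain C where C: "C > 0" "\<And>y::real^'n. gau pi y \<le> C * jbr y powr (- (t + 1))"
    using gau_le_jbr_powr[of pi "t + 1"] by auto
  have "\<bar>y $ i\<bar> * gau pi y \<le> C * jbr y powr (- t)" for y :: "real^'n" and i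
  proof -
    have "\<bar>y $ i\<bar> * gau pi y \<le> jbr y * (C * jbr y powr (- (t + 1)))"
      using order_trans[OF component_le_norm_cart norm_le_jbr] by (intro mult_mono C) auto
    also have "\<dots> = C * (jbr y powr 1 * jbr y powr (- (t + 1)))" by simp
    also have "\<dots> = C * jbr y powr (- t)" unfolding powr_add[symmetric] by simp
    finally show ?thesis .
  qed
  then show ?thesis using C(1) by blast
qed

lemma norm_le_of_components:
  fixes x :: "real^'n::finite"
  assumes "\<And>i. \<bar>x $ i\<bar> * K \<le> c" and "0 \<le> K"
  shows "norm x * K \<le> real CARD('n) * c"
proof -
  have "norm x * K \<le> (\<Sum>i\<in>UNIV. \<bar>x $ i\<bar>) * K"
    by (intro mult_right_mono norm_le_l1_cart assms)
  also have "\<dots> \<le> (\<Sum>i\<in>(UNIV::'n set). c)" unfolding sum_distrib_right by (intro sum_mono assms)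
  finally show ?thesis by simp
qed

text \<open>The transform of $(g(\omega+\zeta)-g(\omega))\phi(\zeta)$ inherits the decay of the windowed
  transforms of $\nabla g$, uniformly in $\omega$: integration by parts gains a factor
  $|x|^{-1}$, which beats the constants for large $x$.\<close>

lemma first_order_transform:
  fixes g :: "real ^ 'n::finite \<Rightarrow> real" and h :: "'n \<Rightarrow> real ^ 'n \<Rightarrow> real"
  assumes t: "real CARD('n) < t"
    and der: "\<And>i x. ((\<lambda>r. g (x + r *\<^sub>R axis i 1)) has_real_derivative h i x) (at 0)"
    and gc: "continuous_on UNIV g" and hc: "\<And>i. continuous_on UNIV (h i)"
    and lip: "\<And>x y. \<bar>g x - g y\<bar> \<le> Lp * norm (x - y)" and Lp: "0 \<le> Lp"
    and hb: "\<And>i x. \<bar>h i x\<bar> \<le> Ch"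
    and ht: "\<And>i w x. norm (fourier (\<lambda>z. complex_of_real (h i (w + z)) * cgau pi z) x) \<le> Ch * jbr x powr (- t)"
  shows "\<exists>C>0. \<forall>w x. norm (fourier (\<lambda>z. complex_of_real (g (w + z) - g w) * cgau pi z) x) \<le> C * jbr x powr (- t)"
proof -
  define \<kappa> where "\<kappa> = (\<lambda>x::real^'n. jbr x powr (- t))"
  have \<kappa>m [measurable]: "\<kappa> \<in> borel_measurable borel" unfolding \<kappa>_def by measurable
  have \<kappa>0: "0 \<le> \<kappa> x" for x by (simp add: \<kappa>_def)
  define G where "G = (\<lambda>w z. complex_of_real (g (w + z) - g w))"
  define H where "H = (\<lambda>i w z. complex_of_real (h i (w + z)))"
  have Gc: "continuous_on UNIV (G w)" for w
    unfolding G_def by (intro continuous_intros continuous_on_compose2[OF gc]) auto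
  have Hc: "continuous_on UNIV (H i w)" for i w
    unfolding H_def by (intro continuous_intros continuous_on_compose2[OF hc]) auto
  have Gm [measurable]: "G w \<in> borel_measurable borel" for w using Gc by (rule borel_measurable_continuous_onI)
  have Hm [measurable]: "H i w \<in> borel_measurable borel" for i w using Hc by (rule borel_measurable_continuous_onI)
  have Gb: "norm (G w z) \<le> Lp * jbr z powr 1" for w z
  proof -
    have "norm (G w z) \<le> Lp * norm z" using lip[of "w + z" w] unfolding G_def norm_of_real by simp
    also have "\<dots> \<le> Lp * jbr z powr 1" using norm_le_jbr[of z] Lp by (intro mult_left_mono) auto
    finally show ?thesis .
  qed
  have Hb: "norm (H i w z) \<le> Ch * jbr z powr 0" for i w z using hb unfolding H_def by simp
  have Gi: "integrable lborel (\<lambda>z. G w z * cgau c z)" if "c > 0" for w c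
    by (rule integrable_bounded_gau[OF Gm Gb that])
  have Hi: "integrable lborel (\<lambda>z. H i w z * cgau c z)" if "c > 0" for i w c
    by (rule integrable_bounded_gau[OF Hm Hb that])
  \<comment> \<open>\<open>K\<close> belongs to the narrow window and \<open>W\<close> to the window
    itself. Integration by parts estimates \<open>K\<close> by averages of \<open>W\<close>, and
    \<open>wide\<close> leads from \<open>K\<close> back to \<open>W\<close>.\<close>
  define K where "K = (\<lambda>w x. norm (fourier (\<lambda>z. G w z * cgau (2 * pi) z) x))"
  define W where "W = (\<lambda>w x. norm (fourier (\<lambda>z. G w z * cgau pi z) x))"
  have K0: "0 \<le> K w x" for w x by (simp add: K_def)
  define J where "J = (LINT z|(lborel::(real^'n) measure). jbr z powr 1 * gau (2 * pi) z)"
  have J0: "0 \<le> J" unfolding J_def by (intro Bochner_Integration.integral_nonneg) auto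
  define B0 where "B0 = Lp * J"
  have B00: "0 \<le> B0" unfolding B0_def using Lp J0 by simp
  have KB: "K w x \<le> B0" for w x
  proof -
    have i: "integrable lborel (\<lambda>z::real^'n. Lp * (jbr z powr 1 * gau (2 * pi) z))"
      by (intro integrable_mult_right integrable_jbr_gau) simp
    have gi: "integrable lborel (\<lambda>z. G w z * cgau (2 * pi) z)" by (rule Gi) simp
    have "K w x \<le> (LINT z|lborel. norm (G w z * cgau (2 * pi) z))"
      unfolding K_def by (rule norm_fourier_le[OF gi])
    also have "\<dots> \<le> (LINT z|(lborel::(real^'n) measure). Lp * (jbr z powr 1 * gau (2 * pi) z))"
    proof (rule integral_mono[OF integrable_norm[OF gi] i])
      fix z :: "real^'n"
      show "norm (G w z * cgau (2 * pi) z) \<le> Lp * (jbr z powr 1 * gau (2 * pi) z)"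
        unfolding norm_mult mult.assoc[symmetric] using Lp by (intro mult_mono Gb) auto
    qed
    also have "\<dots> = B0" unfolding B0_def J_def by (rule integral_mult_right_zero)
    finally show ?thesis .
  qed
  obtain c1 where c1: "c1 > 0" "\<And>y::real^'n. gau pi y \<le> c1 * \<kappa> y"
    unfolding \<kappa>_def using gau_le_jbr_powr[of pi t] by auto
  obtain c2 where c2: "c2 > 0" "\<And>y::real^'n. norm (fourier (\<lambda>z. cgau (2 * pi) z) y) \<le> c2 * \<kappa> y"
  proof -
    obtain c where c: "c > 0" "\<And>y::real^'n. gau (pi / 2) y \<le> c * \<kappa> y"
      unfolding \<kappa>_def using gau_le_jbr_powr[of "pi / 2" t] by auto
    have "norm (fourier (\<lambda>z. cgau (2 * pi) z) y) \<le> c * \<kappa> y" for y :: "real^'n"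
    proof -
      have "norm (fourier (\<lambda>z. cgau (2 * pi) z) y) = 2 powr (- real CARD('n) / 2) * gau (pi / 2) y"
        using fourier_gau[of 2 y] unfolding mult.commute[of pi 2] by (simp add: norm_mult)
      also have "\<dots> \<le> 1 * gau (pi / 2) y"
      proof (rule mult_right_mono)
        have "2 powr (- real CARD('n) / 2) \<le> (2::real) powr 0" by (intro powr_mono) auto
        then show "2 powr (- real CARD('n) / 2) \<le> (1::real)" by simp
      qed simp
      finally show ?thesis using c(2)[of y] by simp
    qed
    then show ?thesis using that c(1) by blast
  qed
  obtain c3 where c3: "c3 > 0" "\<And>(y::real^'n) i. \<bar>y $ i\<bar> * gau pi y \<le> c3 * \<kappa> y"
    unfolding \<kappa>_def using coord_gau_le_jbr_powr[of t] by auto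
  obtain C0 where C0: "C0 > 0" "\<And>x. (\<integral>y. ennreal (jbr y powr (- t) * \<kappa> (x - y))) \<le> ennreal (C0 * \<kappa> x)"
    unfolding \<kappa>_def using conv_jbr[OF t] by auto
  define C0' where "C0' = C0 + (LINT y|(lborel::(real^'n) measure). jbr y powr (- t))"
  have C0'0: "0 \<le> C0'" unfolding C0'_def using C0(1) by (auto intro!: add_nonneg_nonneg)
  have conv: "(\<integral>y. ennreal (jbr y powr (- t) * (A * \<kappa> (x - y) + R))) \<le> ennreal (C0' * (A * \<kappa> x + R))"
    if "0 \<le> A" "0 \<le> R" for A R x
    unfolding C0'_def by (rule conv_affine[OF t \<kappa>m \<kappa>0 C0(2)]) (use that C0(1) \<kappa>0 in auto)
  define Cw where "Cw = 2 ^ CARD('n) * J * (1 + Lp * c2)"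
  have Cw0: "0 \<le> Cw" unfolding Cw_def using J0 Lp c2(1) by simp
  have wide: "W w x \<le> Cw * ((A + 1) * \<kappa> x + R)"
    if A: "0 \<le> A" "0 \<le> R" and KA: "\<And>w x. K w x \<le> A * \<kappa> x + R" for A R w x
  proof -
    have nn: "0 \<le> (A + 1) * \<kappa> x + R" using A \<kappa>0 by simp
    have "norm (fourier (\<lambda>z. G w (\<tau> + z) * cgau (2 * pi) z) x)
        \<le> ((1 + Lp * c2) * ((A + 1) * \<kappa> x + R)) * jbr \<tau> powr 1" for \<tau>
    proof -
      \<comment> \<open>Recentring at w + \<tau> leaves the constant g(w + \<tau>) - g(w), at most
        \<open>Lp\<close> |\<tau>|, times a Gaussian; this accounts for A + 1 in place of A.\<close>
      let ?d = "complex_of_real (g (w + \<tau>) - g w)"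
      have e: "(\<lambda>z. G w (\<tau> + z) * cgau (2 * pi) z)
         = (\<lambda>z. G (w + \<tau>) z * cgau (2 * pi) z + ?d * cgau (2 * pi) z)"
        unfolding G_def distrib_right[symmetric] of_real_add[symmetric] by (simp add: add.assoc)
      have i: "integrable lborel (\<lambda>z::real^'n. ?d * cgau (2 * pi) z)"
        by (intro integrable_mult_right integrable_of_real integrable_gau) simp
      have gi: "integrable lborel (\<lambda>z. G (w + \<tau>) z * cgau (2 * pi) z)" by (rule Gi) simp
      have "norm (fourier (\<lambda>z. G w (\<tau> + z) * cgau (2 * pi) z) x)
          \<le> K (w + \<tau>) x + norm ?d * norm (fourier (\<lambda>z::real^'n. cgau (2 * pi) z) x)"
        unfolding e fourier_add[OF gi i] fourier_cmult K_def norm_mult[symmetric] by (rule norm_triangle_ineq)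
      also have "\<dots> \<le> (A * \<kappa> x + R) + (Lp * jbr \<tau> powr 1) * (c2 * \<kappa> x)"
        using Gb[of w \<tau>] by (intro add_mono KA mult_mono c2(2)) (auto simp: G_def Lp)
      also have "\<dots> \<le> ((A + 1) * \<kappa> x + R) * jbr \<tau> powr 1 + (Lp * jbr \<tau> powr 1) * (c2 * ((A + 1) * \<kappa> x + R))"
      proof (intro add_mono mult_left_mono)
        have "A * \<kappa> x + R \<le> ((A + 1) * \<kappa> x + R) * 1" using \<kappa>0[of x] by (simp add: algebra_simps)
        also have "\<dots> \<le> ((A + 1) * \<kappa> x + R) * jbr \<tau> powr 1" using jbr_ge_1[of \<tau>] nn by (intro mult_left_mono) auto
        finally show "A * \<kappa> x + R \<le> ((A + 1) * \<kappa> x + R) * jbr \<tau> powr 1" .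
        show "\<kappa> x \<le> (A + 1) * \<kappa> x + R" using A \<kappa>0[of x] by (simp add: distrib_right)
      qed (use c2(1) Lp in auto)
      finally show ?thesis by (simp add: algebra_simps)
    qed
    from fourier_widen_bound_jbr[OF Gm Gi[OF pi_gt_zero] this]
    show ?thesis unfolding W_def Cw_def J_def by (simp add: mult.assoc)
  qed
  define C5 where "C5 = c1 * C0' * Ch + 4 * pi * (c3 * C0' * Cw)"
  have Ch0: "0 \<le> Ch" using order_trans[OF abs_ge_zero hb] by blast
  have C50: "0 \<le> C5" unfolding C5_def using c1(1) c3(1) C0'0 Ch0 Cw0 by simp
  have rec: "\<bar>x $ i\<bar> * K w x \<le> C5 * ((A + 1) * \<kappa> x + R)"
    if A: "0 \<le> A" "0 \<le> R" and KA: "\<And>w x. K w x \<le> A * \<kappa> x + R" for A R w x i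
  proof -
    \<comment> \<open>The narrow Gaussian is \<open>P * P\<close>. One copy stays with the function
      being transformed; the other, alone or as \<open>Q\<close> with the factor z_i from
      differentiating the Gaussian, supplies a rapidly decaying transform.\<close>
    define P where "P = (\<lambda>z::real^'n. cgau pi z)"
    define Q where "Q = (\<lambda>z::real^'n. complex_of_real (z $ i * gau pi z))"
    have PP: "cgau (2 * pi) z = P z * P z" for z
      unfolding P_def of_real_mult[symmetric] exp_add[symmetric] by simp
    have QP: "complex_of_real (- 2 * (2 * pi) * z $ i * gau (2 * pi) z) = (- 4 * pi) * (Q z * P z)" for z
    proof -
      have "gau (2 * pi) z = gau pi z * gau pi z" unfolding exp_add[symmetric] by simp
      then show ?thesis unfolding Q_def P_def by simp
    qed
    have Pc: "continuous_on UNIV P" unfolding P_def by (intro continuous_intros)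
    have Qc: "continuous_on UNIV Q" unfolding Q_def by (intro continuous_intros)
    have Pi: "integrable lborel P" unfolding P_def by (intro integrable_of_real integrable_gau) simp
    have Qi: "integrable lborel Q" unfolding Q_def of_real_mult
      by (rule integrable_bounded_gau[where B = 1 and b = 1])
         (auto intro: order_trans[OF component_le_norm_cart norm_le_jbr])
    have HPi: "integrable lborel (\<lambda>z. H i w z * P z)" unfolding P_def by (rule Hi) simp
    have GPi: "integrable lborel (\<lambda>z. G w z * P z)" unfolding P_def by (rule Gi) simp
    have F1i: "integrable lborel (\<lambda>z. P z * (H i w z * P z))"
      using Hi[of "2 * pi" i w] unfolding PP by (simp add: mult_ac)
    have F2i: "integrable lborel (\<lambda>z. Q z * (G w z * P z))"
    proof -
      have "integrable lborel (\<lambda>z. (complex_of_real (z $ i) * G w z) * cgau (2 * pi) z)"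
      proof (rule integrable_bounded_gau)
        show "norm (complex_of_real (z $ i) * G w z) \<le> Lp * jbr z powr 2" for z
        proof -
          have "norm (complex_of_real (z $ i) * G w z) \<le> jbr z * (Lp * jbr z powr 1)"
            unfolding norm_mult norm_of_real using order_trans[OF component_le_norm_cart norm_le_jbr] Gb
            by (intro mult_mono) auto
          then show ?thesis by (simp add: power2_eq_square mult_ac)
        qed
      qed (auto intro!: borel_measurable_times Gm borel_measurable_of_real)
      then show ?thesis unfolding PP Q_def P_def by (simp add: mult_ac)
    qed
    define F' where "F' = (\<lambda>z. P z * (H i w z * P z) + (- 4 * pi) * (Q z * (G w z * P z)))"
    have key: "fourier F' x = 2 * pi * \<i> * (x $ i) * fourier (\<lambda>z. G w z * cgau (2 * pi) z) x"
    proof (rule fourier_pd)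
      show "((\<lambda>r. G w (z + r *\<^sub>R axis i 1) * cgau (2 * pi) (z + r *\<^sub>R axis i 1)) has_vector_derivative F' z) (at 0)" for z
      proof -
        have d1: "((\<lambda>r. G w (z + r *\<^sub>R axis i 1)) has_vector_derivative H i w z) (at 0)"
          unfolding G_def H_def
          by (rule has_vector_derivative_of_real)
             (use DERIV_diff[OF der[of "w + z" i] DERIV_const[of "g w"]] in \<open>simp add: add.assoc\<close>)
        have d2: "((\<lambda>r. cgau (2 * pi) (z + r *\<^sub>R axis i 1)) has_vector_derivative (- 4 * pi) * (Q z * P z)) (at 0)"
          unfolding QP[symmetric] by (rule has_vector_derivative_of_real[OF gau_has_pd])
        have "F' z = G w (z + 0 *\<^sub>R axis i 1) * ((- 4 * pi) * (Q z * P z)) + H i w z * cgau (2 * pi) (z + 0 *\<^sub>R axis i 1)"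
          unfolding PP F'_def by (simp add: mult_ac)
        then show ?thesis using has_vector_derivative_mult[OF d1 d2] by simp
      qed
      show "continuous_on UNIV F'" unfolding F'_def by (intro continuous_intros Pc Qc Gc Hc)
      show "continuous_on UNIV (\<lambda>z. G w z * cgau (2 * pi) z)" by (intro continuous_intros Gc)
      show "integrable lborel (\<lambda>z. G w z * cgau (2 * pi) z)" by (rule Gi) simp
      show "integrable lborel F'" unfolding F'_def
        by (rule Bochner_Integration.integrable_add[OF F1i integrable_mult_right[OF F2i]])
    qed
    have b1: "norm (fourier (\<lambda>z. P z * (H i w z * P z)) x) \<le> c1 * (C0' * (Ch * \<kappa> x + 0))"
    proof (rule fourier_mult_bound_jbr[OF Pc Pi HPi t])
      show "norm (fourier P y) \<le> c1 * jbr y powr (- t)" for y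
        unfolding P_def fourier_gau_1 using c1(2)[of y] by (simp add: \<kappa>_def)
      show "norm (fourier (\<lambda>z. H i w z * P z) y) \<le> Ch * \<kappa> y + 0" for y
        using ht[of i w y] unfolding H_def P_def \<kappa>_def by simp
      show "(\<integral>y. ennreal (jbr y powr (- t) * (Ch * \<kappa> (x - y) + 0))) \<le> ennreal (C0' * (Ch * \<kappa> x + 0))"
        by (rule conv[OF Ch0 order_refl])
    qed (use C0'0 Ch0 \<kappa>0 in auto)
    have b2: "norm (fourier (\<lambda>z. Q z * (G w z * P z)) x) \<le> c3 * (C0' * ((Cw * (A + 1)) * \<kappa> x + Cw * R))"
    proof (rule fourier_mult_bound_jbr[OF Qc Qi GPi t])
      show "norm (fourier Q y) \<le> c3 * jbr y powr (- t)" for y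
        unfolding Q_def fourier_coord_gau using c3(2)[of y i] by (simp add: \<kappa>_def norm_mult abs_mult)
      show "norm (fourier (\<lambda>z. G w z * P z) y) \<le> (Cw * (A + 1)) * \<kappa> y + Cw * R" for y
        using wide[OF A KA, of w y] unfolding W_def P_def by (simp add: algebra_simps)
      show "(\<integral>y. ennreal (jbr y powr (- t) * ((Cw * (A + 1)) * \<kappa> (x - y) + Cw * R))) \<le> ennreal (C0' * ((Cw * (A + 1)) * \<kappa> x + Cw * R))"
        by (rule conv) (use A Cw0 in auto)
    qed (use C0'0 Cw0 A \<kappa>0 in auto)
    have "2 * pi * (\<bar>x $ i\<bar> * K w x) = norm (fourier F' x)"
      unfolding key K_def by (simp add: norm_mult)
    also have "\<dots> \<le> norm (fourier (\<lambda>z. P z * (H i w z * P z)) x) + 4 * pi * norm (fourier (\<lambda>z. Q z * (G w z * P z)) x)"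
      unfolding F'_def fourier_add[OF F1i integrable_mult_right[OF F2i]] fourier_cmult
      by (rule order_trans[OF norm_triangle_ineq]) (simp add: norm_mult)
    also have "\<dots> \<le> c1 * (C0' * (Ch * \<kappa> x + 0)) + 4 * pi * (c3 * (C0' * ((Cw * (A + 1)) * \<kappa> x + Cw * R)))"
      by (intro add_mono mult_left_mono b1 b2) auto
    also have "\<dots> = (c1 * C0' * Ch) * \<kappa> x + 4 * pi * (c3 * C0' * Cw) * ((A + 1) * \<kappa> x + R)"
      by (simp add: algebra_simps)
    also have "\<dots> \<le> (c1 * C0' * Ch) * ((A + 1) * \<kappa> x + R) + 4 * pi * (c3 * C0' * Cw) * ((A + 1) * \<kappa> x + R)"
      using A \<kappa>0[of x] c1(1) C0'0 Ch0 by (intro add_right_mono mult_left_mono) (auto simp: distrib_right)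
    also have "\<dots> = C5 * ((A + 1) * \<kappa> x + R)" by (simp add: C5_def distrib_right)
    finally have "2 * pi * (\<bar>x $ i\<bar> * K w x) \<le> C5 * ((A + 1) * \<kappa> x + R)" .
    moreover have "1 * (\<bar>x $ i\<bar> * K w x) \<le> 2 * pi * (\<bar>x $ i\<bar> * K w x)"
      using pi_gt3 K0 by (intro mult_right_mono) auto
    ultimately show ?thesis by linarith
  qed
  define C6 where "C6 = real CARD('n) * C5"
  have C60: "0 \<le> C6" using C50 by (simp add: C6_def)
  \<comment> \<open>Beyond radius 2 C6 + 1 the gain 1 / |x| turns C6 ((A + 1) \<kappa> + R) into at
    most half of the bracket, whence the summand 1 / 2. Inside, <x> <= 2 C6 + 2 lets \<kappa> absorb
    the trivial bound \<open>B0\<close>.\<close>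
  define C where "C = 1 / 2 + B0 * (2 * C6 + 2) powr t"
  have C0: "0 \<le> C" unfolding C_def using B00 by simp
  have step: "K w x \<le> (C + A / 2) * \<kappa> x + R / 2"
    if A: "0 \<le> A" "0 \<le> R" and KA: "\<And>w x. K w x \<le> A * \<kappa> x + R" for A R w x
  proof (cases "norm x \<le> 2 * C6 + 1")
    case True
    have "jbr x \<le> 2 * C6 + 2" using True jbr_le_norm[of x] by linarith
    then have "jbr x powr t \<le> (2 * C6 + 2) powr t" using t by (intro powr_mono2) auto
    then have "1 \<le> (2 * C6 + 2) powr t * \<kappa> x" unfolding \<kappa>_def by (simp add: powr_minus field_simps)
    then have "B0 * 1 \<le> B0 * ((2 * C6 + 2) powr t * \<kappa> x)" by (intro mult_left_mono B00)
    also have "\<dots> \<le> C * \<kappa> x" using \<kappa>0[of x] by (simp add: C_def distrib_right mult.assoc)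
    finally have "K w x \<le> C * \<kappa> x" using KB[of w x] by simp
    also have "\<dots> \<le> (C + A / 2) * \<kappa> x + R / 2" using A \<kappa>0[of x] by (simp add: distrib_right)
    finally show ?thesis .
  next
    case False
    define Z where "Z = (A + 1) * \<kappa> x + R"
    have Z0: "0 \<le> Z" unfolding Z_def using A \<kappa>0 by simp
    have "norm x * K w x \<le> C6 * Z"
      using norm_le_of_components[of x "K w x" "C5 * Z"] rec[OF A KA] K0 by (simp add: C6_def Z_def mult.assoc)
    also have "\<dots> \<le> (norm x / 2) * Z" using False Z0 by (intro mult_right_mono) auto
    finally have "norm x * K w x \<le> norm x * (Z / 2)" by simp
    moreover have "0 < norm x" using False C60 by linarith
    ultimately have "K w x \<le> Z / 2" by simp
    also have "\<dots> \<le> (C + A / 2) * \<kappa> x + R / 2"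
    proof -
      have "(1 / 2) * \<kappa> x \<le> C * \<kappa> x" unfolding C_def using B00 by (intro mult_right_mono \<kappa>0) simp
      then show ?thesis by (simp add: Z_def algebra_simps)
    qed
    finally show ?thesis .
  qed
  have fin: "K w x \<le> 2 * C * \<kappa> x + 0" for w x
  proof -
    \<comment> \<open>Absorption runs over pairs (w, x), since each step uses the bound at all
      frequencies \<open>w\<close> simultaneously.\<close>
    have "K (fst z) (snd z) \<le> 2 * C * \<kappa> (snd z)" for z :: "(real^'n) \<times> (real^'n)"
    proof (rule absorption[of "\<lambda>z. K (fst z) (snd z)" B0 C "\<lambda>z. \<kappa> (snd z)"])
      fix A R :: real and z :: "(real^'n) \<times> (real^'n)"
      assume A: "0 \<le> A" "0 \<le> R" and "\<And>z. K (fst z) (snd z) \<le> A * \<kappa> (snd z) + R"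
      then have "K w x \<le> A * \<kappa> x + R" for w x using prod.sel by metis
      from step[OF A this] show "K (fst z) (snd z) \<le> (C + A / 2) * \<kappa> (snd z) + R / 2" .
    qed (use KB C0 B00 \<kappa>0 in auto)
    from this[of "(w, x)"] show ?thesis by simp
  qed
  have "W w x \<le> (Cw * (2 * C + 1) + 1) * jbr x powr (- t)" for w x
  proof -
    have "W w x \<le> Cw * ((2 * C + 1) * \<kappa> x + 0)" by (rule wide[OF _ _ fin]) (use C0 in auto)
    also have "\<dots> \<le> (Cw * (2 * C + 1) + 1) * \<kappa> x" using \<kappa>0[of x] by (simp add: algebra_simps)
    finally show ?thesis by (simp add: \<kappa>_def)
  qed
  moreover have "0 < Cw * (2 * C + 1) + 1" using Cw0 C0 by (simp add: add_nonneg_pos)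
  ultimately show ?thesis unfolding W_def G_def by blast
qed

text \<open>Removes the weight from the hypothesis on the gradient: g = <.>^s b, the narrow window
  splits between the two factors, the weight contributes <w>^s by
  \<open>fourier_jbr_powr_gau\<close>, and widening costs only a power of <\<tau>>.\<close>

lemma gradient_transform:
  fixes g :: "real ^ 'n::finite \<Rightarrow> real"
  assumes t: "real CARD('n) < t" and s: "0 \<le> s" and gc: "continuous_on UNIV g"
    and gb: "\<And>x. \<bar>jbr x powr (- s) * g x\<bar> \<le> Cb"
    and gt: "\<And>w x. norm (fourier (\<lambda>z. complex_of_real (jbr (w + z) powr (- s) * g (w + z)) * cgau pi z) x) \<le> Cb * jbr x powr (- t)"
  shows "\<exists>C>0. \<forall>w x. norm (fourier (\<lambda>z. complex_of_real (g (w + z)) * cgau pi z) x) \<le> C * jbr w powr s * jbr x powr (- t)"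
proof -
  define b where "b = (\<lambda>x. jbr x powr (- s) * g x)"
  have gbeq: "g x = jbr x powr s * b x" for x by (simp add: b_def powr_minus)
  have bc: "continuous_on UNIV b" unfolding b_def by (intro continuous_intros gc) auto
  have Cb0: "0 \<le> Cb" using order_trans[OF abs_ge_zero gb] by blast
  obtain c where c: "c > 0" "\<And>(w::real^'n) y. norm (fourier (\<lambda>z. complex_of_real (jbr (w + z) powr s * gau pi z)) y) \<le> c * jbr w powr s * jbr y powr (- t)"
    using fourier_jbr_powr_gau[OF s, of t] by auto
  obtain C0 where C0: "C0 > 0" "\<And>x::real^'n. (\<integral>y. ennreal (jbr y powr (- t) * jbr (x - y) powr (- t))) \<le> ennreal (C0 * jbr x powr (- t))"
    using conv_jbr[OF t] by auto
  define C0' where "C0' = C0 + (LINT y|(lborel::(real^'n) measure). jbr y powr (- t))"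
  have C0'0: "0 \<le> C0'" unfolding C0'_def using C0(1) by (auto intro!: add_nonneg_nonneg)
  define U where "U = (\<lambda>w z. complex_of_real (jbr (w + z) powr s * gau pi (z::real^'n)))"
  define V where "V = (\<lambda>w z. complex_of_real (b (w + z)) * cgau pi (z::real^'n))"
  have Uc: "continuous_on UNIV (U w)" for w unfolding U_def by (intro continuous_intros) auto
  have Ui: "integrable lborel (U w)" for w
  proof -
    have "integrable lborel (\<lambda>z. complex_of_real (jbr (w + z) powr s) * cgau pi z)"
    proof (rule integrable_bounded_gau)
      show "norm (complex_of_real (jbr (w + z) powr s)) \<le> (2 powr s * jbr w powr s) * jbr z powr s" for z
        using jbr_powr_add_pos[OF s, of w z] by simp
    qed auto
    then show ?thesis by (simp add: U_def)
  qed
  have Vi: "integrable lborel (V w)" for w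
    unfolding V_def
  proof (rule integrable_bounded_gau)
    show "norm (complex_of_real (b (w + z))) \<le> Cb * jbr z powr 0" for z using gb[of "w + z"] unfolding b_def norm_of_real by simp
    show "(\<lambda>z. complex_of_real (b (w + z))) \<in> borel_measurable borel"
      by (intro borel_measurable_continuous_onI continuous_intros continuous_on_compose2[OF bc]) auto
  qed simp
  have narrow: "norm (fourier (\<lambda>z. complex_of_real (g (w + z)) * cgau (2 * pi) z) x)
      \<le> (c * jbr w powr s) * (C0' * (Cb * jbr x powr (- t) + 0))" for w x
  proof -
    have e: "complex_of_real (g (w + z)) * cgau (2 * pi) z = U w z * V w z" for z
    proof -
      have "gau (2 * pi) z = gau pi z * gau pi z" unfolding exp_add[symmetric] by simp
      then show ?thesis unfolding U_def V_def gbeq by simp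
    qed
    show ?thesis unfolding e
    proof (rule fourier_mult_bound_jbr[OF Uc Ui Vi t])
      show "norm (fourier (U w) y) \<le> (c * jbr w powr s) * jbr y powr (- t)" for y unfolding U_def by (rule c(2))
      show "norm (fourier (V w) y) \<le> Cb * jbr y powr (- t) + 0" for y using gt[of w y] unfolding V_def b_def by simp
      show "(\<integral>y. ennreal (jbr y powr (- t) * (Cb * jbr (x - y) powr (- t) + 0))) \<le> ennreal (C0' * (Cb * jbr x powr (- t) + 0))"
        unfolding C0'_def by (rule conv_affine[OF t _ _ C0(2)]) (use C0(1) Cb0 in auto)
    qed (use C0'0 Cb0 in auto)
  qed
  define J where "J = (LINT z|(lborel::(real^'n) measure). jbr z powr s * gau (2 * pi) z)"
  have J0: "0 \<le> J" unfolding J_def by (intro Bochner_Integration.integral_nonneg) auto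
  define D where "D = 2 ^ CARD('n) * J * (c * 2 powr s * C0' * Cb) + 1"
  have "norm (fourier (\<lambda>z. complex_of_real (g (w + z)) * cgau pi z) x) \<le> D * jbr w powr s * jbr x powr (- t)" for w x
  proof -
    define F where "F = (\<lambda>z. complex_of_real (g (w + z)))"
    have Fm: "F \<in> borel_measurable borel" unfolding F_def
      by (intro borel_measurable_continuous_onI continuous_intros continuous_on_compose2[OF gc]) auto
    have Fi: "integrable lborel (\<lambda>z. F z * cgau pi z)"
    proof (rule integrable_bounded_gau[OF Fm])
      show "norm (F z) \<le> (2 powr s * jbr w powr s * Cb) * jbr z powr s" for z
      proof -
        have "norm (F z) = jbr (w + z) powr s * \<bar>b (w + z)\<bar>" unfolding F_def gbeq norm_of_real by (simp add: abs_mult)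
        also have "\<dots> \<le> (2 powr s * jbr w powr s * jbr z powr s) * Cb"
          using gb by (intro mult_mono jbr_powr_add_pos s) (auto simp: b_def)
        finally show ?thesis by (simp add: mult_ac)
      qed
    qed simp
    have "norm (fourier (\<lambda>z. F (\<tau> + z) * cgau (2 * pi) z) x) \<le> (c * 2 powr s * jbr w powr s * C0' * Cb * jbr x powr (- t)) * jbr \<tau> powr s" for \<tau>
    proof -
      have "norm (fourier (\<lambda>z. F (\<tau> + z) * cgau (2 * pi) z) x) \<le> (c * jbr (w + \<tau>) powr s) * (C0' * (Cb * jbr x powr (- t) + 0))"
        using narrow[of "w + \<tau>" x] unfolding F_def by (simp add: add.assoc)
      also have "\<dots> \<le> (c * (2 powr s * jbr w powr s * jbr \<tau> powr s)) * (C0' * (Cb * jbr x powr (- t) + 0))"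
        using c(1) C0'0 Cb0 by (intro mult_right_mono mult_left_mono jbr_powr_add_pos s) auto
      finally show ?thesis by (simp add: mult_ac)
    qed
    from fourier_widen_bound_jbr[OF Fm Fi this]
    have "norm (fourier (\<lambda>z. F z * cgau pi z) x) \<le> (D - 1) * (jbr w powr s * jbr x powr (- t))"
      unfolding J_def[symmetric] D_def by (simp add: mult_ac)
    also have "\<dots> \<le> D * (jbr w powr s * jbr x powr (- t))" by (intro mult_right_mono) auto
    finally show ?thesis unfolding F_def by (simp add: mult_ac)
  qed
  moreover have "0 < D" unfolding D_def using J0 c(1) C0'0 Cb0 by (simp add: add_nonneg_pos)
  ultimately show ?thesis by blast
qed

section \<open>The windowed transform of a unimodular function\<close>

text \<open>The stationary point in x of the windowed transform: near \<open>w\<close> the phase is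
  linear with gradient grad \<mu>(w), and for the character e^{-2 pi i x.z} the matching position is
  the gradient over 2 pi.\<close>

definition phase_velocity :: "(real ^ 'n::finite \<Rightarrow> real) \<Rightarrow> real ^ 'n \<Rightarrow> real ^ 'n" where
  "phase_velocity \<mu> w = (\<chi> j. pd j \<mu> w / (2 * pi))"

text \<open>Order \<open>t\<close> about the stationary point, raised to order \<open>t'\<close>
  once |x| exceeds <w>^s, the scale that bounds the stationary point. The second factor is
  comparable to 1 for |x| up to a multiple of <w>^s, so it may be inserted or dropped there.\<close>

definition phase_kernel :: "(real ^ 'n::finite \<Rightarrow> real) \<Rightarrow> real \<Rightarrow> real \<Rightarrow> real \<Rightarrow> real ^ 'n \<Rightarrow> real ^ 'n \<Rightarrow> real" where
  "phase_kernel \<mu> s t t' w x =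
     jbr (x - phase_velocity \<mu> w) powr (- t) * (1 + norm x / jbr w powr s) powr (- (t' - t))"

lemma phase_kernel_nonneg [simp]: "0 \<le> phase_kernel \<mu> s t t' w x"
  by (simp add: phase_kernel_def)

lemma phase_kernel_measurable [measurable]: "phase_kernel \<mu> s t t' w \<in> borel_measurable borel"
  unfolding phase_kernel_def[abs_def] by measurable

lemma jbr_powr_ge_1: "0 \<le> s \<Longrightarrow> 1 \<le> jbr w powr s"
  using jbr_ge_1 by (intro ge_one_powr_ge_zero) auto

lemma phase_kernel_le: "t \<le> t' \<Longrightarrow> phase_kernel \<mu> s t t' w x \<le> jbr (x - phase_velocity \<mu> w) powr (- t)"
proof -
  assume t: "t \<le> t'"
  have "(1 + norm x / jbr w powr s) powr (- (t' - t)) \<le> 1 powr (- (t' - t))"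
    using t by (intro powr_mono2') auto
  then show ?thesis unfolding phase_kernel_def by (intro mult_left_le) auto
qed

lemma powr_minus_le_of_le:
  fixes q c r \<beta> :: real
  assumes "q \<le> c * r" and "0 < q" and "0 < r" and "0 \<le> \<beta>"
  shows "r powr (- \<beta>) \<le> c powr \<beta> * q powr (- \<beta>)"
proof -
  have c: "0 < c"
  proof (rule ccontr)
    assume "\<not> 0 < c" then have "c * r \<le> 0" using assms(3) by (auto simp: mult_le_0_iff)
    then show False using assms(1,2) by linarith
  qed
  have "q powr \<beta> \<le> (c * r) powr \<beta>" using assms by (intro powr_mono2) auto
  then show ?thesis using c assms(2,3) by (simp add: powr_mult powr_minus field_simps)
qed

text \<open>In this region 1 + |x| / <w>^s is at most 1 + c, so the second factor is bounded
  below.\<close>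

lemma phase_kernel_near:
  assumes "t \<le> t'" and "norm x \<le> c * jbr w powr s" and "0 \<le> c"
  shows "jbr (x - phase_velocity \<mu> w) powr (- t) \<le> (1 + c) powr (t' - t) * phase_kernel \<mu> s t t' w x"
proof -
  let ?q = "1 + norm x / jbr w powr s"
  have q: "?q \<le> 1 + c" "?q > 0" using assms(2) by (auto simp: divide_le_eq add_pos_nonneg)
  have "1 powr (- (t' - t)) \<le> (1 + c) powr (t' - t) * ?q powr (- (t' - t))"
    by (rule powr_minus_le_of_le) (use q assms(1) in auto)
  then have "1 \<le> (1 + c) powr (t' - t) * ?q powr (- (t' - t))" by simp
  then have "jbr (x - phase_velocity \<mu> w) powr (- t) * 1 \<le> jbr (x - phase_velocity \<mu> w) powr (- t) * ((1 + c) powr (t' - t) * ?q powr (- (t' - t)))"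
    by (intro mult_left_mono) auto
  then show ?thesis by (simp add: phase_kernel_def mult_ac)
qed

text \<open>Moving the frequency by \<tau> moves the stationary point by at most \<open>La\<close>
  |\<tau>| and changes <w>^s by at most a constant times <\<tau>>^s; these produce the exponents t
  and s (t' - t).\<close>

lemma phase_kernel_shift_freq:
  fixes \<mu> :: "real ^ 'n::finite \<Rightarrow> real"
  assumes t: "0 \<le> t" "t \<le> t'" and s: "0 \<le> s"
    and lip: "\<And>x y. norm (phase_velocity \<mu> x - phase_velocity \<mu> y) \<le> La * norm (x - y)" and La: "0 \<le> La"
  shows "phase_kernel \<mu> s t t' (w + \<tau>) x
    \<le> (2 powr t * (1 + La) powr t * 2 powr (s * (t' - t))) * jbr \<tau> powr (t + s * (t' - t)) * phase_kernel \<mu> s t t' w x"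
proof -
  let ?a = "phase_velocity \<mu>" and ?\<beta> = "t' - t"
  have 1: "jbr (x - ?a (w + \<tau>)) powr (- t) \<le> 2 powr t * jbr (x - ?a w) powr (- t) * ((1 + La) powr t * jbr \<tau> powr t)"
  proof -
    have "jbr (?a w - ?a (w + \<tau>)) \<le> 1 + La * norm \<tau>"
      using jbr_le_norm[of "?a w - ?a (w + \<tau>)"] lip[of w "w + \<tau>"] by simp
    also have "\<dots> \<le> (1 + La) * jbr \<tau>"
      using jbr_ge_1[of \<tau>] mult_left_mono[OF norm_le_jbr[of \<tau>] La] by (simp add: distrib_right)
    finally have "jbr (?a w - ?a (w + \<tau>)) powr t \<le> ((1 + La) * jbr \<tau>) powr t" by (intro powr_mono2 t) auto
    then have "jbr (?a w - ?a (w + \<tau>)) powr t \<le> (1 + La) powr t * jbr \<tau> powr t" using La by (simp add: powr_mult)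
    then have "2 powr t * jbr (x - ?a w) powr (- t) * jbr (?a w - ?a (w + \<tau>)) powr t
        \<le> 2 powr t * jbr (x - ?a w) powr (- t) * ((1 + La) powr t * jbr \<tau> powr t)"
      by (intro mult_left_mono) auto
    moreover have "jbr (x - ?a (w + \<tau>)) powr (- t) \<le> 2 powr t * jbr (x - ?a w) powr (- t) * jbr (?a w - ?a (w + \<tau>)) powr t"
      using jbr_powr_add[OF t(1), of "x - ?a w" "?a w - ?a (w + \<tau>)"] by simp
    ultimately show ?thesis by linarith
  qed
  have 2: "(1 + norm x / jbr (w + \<tau>) powr s) powr (- ?\<beta>) \<le> (2 powr s * jbr \<tau> powr s) powr ?\<beta> * (1 + norm x / jbr w powr s) powr (- ?\<beta>)"
  proof (rule powr_minus_le_of_le)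
    let ?c = "2 powr s * jbr \<tau> powr s"
    have c: "1 \<le> ?c" using mult_mono[of 1 "2 powr s" 1 "jbr \<tau> powr s"] jbr_powr_ge_1[OF s, of \<tau>] s
      by (simp add: ge_one_powr_ge_zero)
    have "jbr (w + \<tau>) powr s \<le> ?c * jbr w powr s" using jbr_powr_add_pos[OF s, of w \<tau>] by (simp add: mult_ac)
    then have "1 / jbr w powr s \<le> ?c * (1 / jbr (w + \<tau>) powr s)" by (simp add: field_simps)
    then have "norm x * (1 / jbr w powr s) \<le> norm x * (?c * (1 / jbr (w + \<tau>) powr s))" by (intro mult_left_mono) auto
    then show "1 + norm x / jbr w powr s \<le> ?c * (1 + norm x / jbr (w + \<tau>) powr s)"
      using c by (simp add: distrib_left mult_ac)
  qed (use t in \<open>auto intro!: add_pos_nonneg\<close>)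
  have "phase_kernel \<mu> s t t' (w + \<tau>) x \<le> (2 powr t * jbr (x - ?a w) powr (- t) * ((1 + La) powr t * jbr \<tau> powr t))
      * ((2 powr s * jbr \<tau> powr s) powr ?\<beta> * (1 + norm x / jbr w powr s) powr (- ?\<beta>))"
    unfolding phase_kernel_def by (intro mult_mono 1 2) auto
  also have "\<dots> = (2 powr t * (1 + La) powr t * 2 powr (s * ?\<beta>)) * (jbr \<tau> powr t * jbr \<tau> powr (s * ?\<beta>)) * phase_kernel \<mu> s t t' w x"
    by (simp add: phase_kernel_def powr_mult powr_powr mult_ac)
  finally show ?thesis by (simp add: powr_add)
qed

text \<open>Of the order \<open>t'\<close> of the averaging weight, the part t' - t pays for
  replacing |x - y| by |x| in the second factor of the kernel; the remaining \<open>t\<close> is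
  handled by \<open>conv_jbr\<close>.\<close>

lemma phase_kernel_conv_far:
  fixes \<mu> :: "real ^ 'n::finite \<Rightarrow> real"
  assumes t: "real CARD('n) < t" "t \<le> t'" and s: "0 \<le> s"
  shows "\<exists>C>0. \<forall>w x. (\<integral>y. ennreal (jbr y powr (- t') * phase_kernel \<mu> s t t' w (x - y))) \<le> ennreal (C * phase_kernel \<mu> s t t' w x)"
proof -
  let ?\<beta> = "t' - t"
  obtain C0 where C0: "C0 > 0" "\<And>x::real^'n. (\<integral>y. ennreal (jbr y powr (- t) * jbr (x - y) powr (- t))) \<le> ennreal (C0 * jbr x powr (- t))"
    using conv_jbr[OF t(1)] by auto
  have "(\<integral>y. ennreal (jbr y powr (- t') * phase_kernel \<mu> s t t' w (x - y))) \<le> ennreal (2 powr ?\<beta> * C0 * phase_kernel \<mu> s t t' w x)" for w x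
  proof -
    define c where "c = 2 powr ?\<beta> * (1 + norm x / jbr w powr s) powr (- ?\<beta>)"
    let ?x = "x - phase_velocity \<mu> w"
    have c0: "0 \<le> c" by (simp add: c_def)
    have pt: "jbr y powr (- t') * phase_kernel \<mu> s t t' w (x - y) \<le> c * (jbr y powr (- t) * jbr (?x - y) powr (- t))" for y
    proof -
      let ?N = "jbr w powr s"
      have N: "1 \<le> ?N" by (rule jbr_powr_ge_1[OF s])
      have "(1 + norm (x - y) / ?N) powr (- ?\<beta>) \<le> (2 * jbr y) powr ?\<beta> * (1 + norm x / ?N) powr (- ?\<beta>)"
      proof (rule powr_minus_le_of_le)
        have "norm x \<le> norm (x - y) + norm y" using norm_triangle_ineq[of "x - y" y] by simp
        then have "norm x / ?N \<le> norm (x - y) / ?N + norm y / ?N"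
          unfolding add_divide_distrib[symmetric] using N by (intro divide_right_mono) auto
        moreover have "norm y / ?N \<le> norm y" using N by (simp add: divide_le_eq mult_le_cancel_left1)
        ultimately have "1 + norm x / ?N \<le> 1 + norm (x - y) / ?N + jbr y" using norm_le_jbr[of y] by linarith
        also have "\<dots> \<le> (1 + norm (x - y) / ?N) * (2 * jbr y)"
        proof -
          have "0 \<le> norm (x - y) / ?N" by simp
          then have "norm (x - y) / ?N * 1 \<le> norm (x - y) / ?N * (2 * jbr y)" using jbr_ge_1[of y] by (intro mult_left_mono) auto
          moreover have "1 + jbr y \<le> 2 * jbr y" using jbr_ge_1[of y] by simp
          ultimately show ?thesis by (simp add: distrib_right)
        qed
        finally show "1 + norm x / ?N \<le> 2 * jbr y * (1 + norm (x - y) / ?N)" by (simp add: mult.commute)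
      qed (use t in \<open>auto intro!: add_pos_nonneg\<close>)
      also have "\<dots> = jbr y powr ?\<beta> * c" by (simp add: c_def powr_mult mult_ac)
      finally have "phase_kernel \<mu> s t t' w (x - y) \<le> jbr (x - y - phase_velocity \<mu> w) powr (- t) * (jbr y powr ?\<beta> * c)"
        unfolding phase_kernel_def by (intro mult_left_mono) auto
      then have "jbr y powr (- t') * phase_kernel \<mu> s t t' w (x - y) \<le> jbr y powr (- t') * (jbr (x - y - phase_velocity \<mu> w) powr (- t) * (jbr y powr ?\<beta> * c))"
        by (intro mult_left_mono) auto
      also have "\<dots> = c * ((jbr y powr (- t') * jbr y powr ?\<beta>) * jbr (?x - y) powr (- t))"
        by (simp add: mult_ac algebra_simps)
      finally show ?thesis by (simp add: powr_add[symmetric])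
    qed
    have "(\<integral>y. ennreal (jbr y powr (- t') * phase_kernel \<mu> s t t' w (x - y)))
      \<le> (\<integral>y. ennreal c * ennreal (jbr y powr (- t) * jbr (?x - y) powr (- t)))"
      using pt c0 by (intro nn_integral_mono) (simp add: ennreal_mult[symmetric] ennreal_leI)
    also have "\<dots> = ennreal c * (\<integral>y. ennreal (jbr y powr (- t) * jbr (?x - y) powr (- t)))"
      by (rule nn_integral_cmult) measurable
    also have "\<dots> \<le> ennreal c * ennreal (C0 * jbr ?x powr (- t))" by (intro mult_left_mono C0(2)) simp
    also have "\<dots> = ennreal (2 powr ?\<beta> * C0 * phase_kernel \<mu> s t t' w x)"
      using c0 C0(1) by (simp add: ennreal_mult[symmetric] c_def phase_kernel_def mult_ac)
    finally show ?thesis .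
  qed
  moreover have "0 < 2 powr ?\<beta> * C0" using C0(1) by simp
  ultimately show ?thesis by blast
qed

text \<open>A weight of order \<open>t\<close> has no spare decay for the second factor, which is
  therefore bounded by 1 under the integral and restored afterwards by
  \<open>phase_kernel_near\<close>; hence the restriction on |x|.\<close>

lemma phase_kernel_conv_near:
  fixes \<mu> :: "real ^ 'n::finite \<Rightarrow> real"
  assumes t: "real CARD('n) < t" "t \<le> t'" and c: "0 \<le> c"
  shows "\<exists>C>0. \<forall>w x. norm x \<le> c * jbr w powr s \<longrightarrow>
    (\<integral>y. ennreal (jbr y powr (- t) * phase_kernel \<mu> s t t' w (x - y))) \<le> ennreal (C * phase_kernel \<mu> s t t' w x)"
proof -
  obtain C0 where C0: "C0 > 0" "\<And>x::real^'n. (\<integral>y. ennreal (jbr y powr (- t) * jbr (x - y) powr (- t))) \<le> ennreal (C0 * jbr x powr (- t))"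
    using conv_jbr[OF t(1)] by auto
  have "(\<integral>y. ennreal (jbr y powr (- t) * phase_kernel \<mu> s t t' w (x - y))) \<le> ennreal ((C0 * (1 + c) powr (t' - t)) * phase_kernel \<mu> s t t' w x)"
    if x: "norm x \<le> c * jbr w powr s" for w x
  proof -
    let ?x = "x - phase_velocity \<mu> w"
    have "(\<integral>y. ennreal (jbr y powr (- t) * phase_kernel \<mu> s t t' w (x - y)))
      \<le> (\<integral>y. ennreal (jbr y powr (- t) * jbr (?x - y) powr (- t)))"
    proof (intro nn_integral_mono ennreal_leI mult_left_mono)
      show "phase_kernel \<mu> s t t' w (x - y) \<le> jbr (?x - y) powr (- t)" for y
        using phase_kernel_le[OF t(2), of \<mu> s w "x - y"] by (simp add: algebra_simps)
    qed simp
    also have "\<dots> \<le> ennreal (C0 * jbr ?x powr (- t))" by (rule C0)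
    also have "\<dots> \<le> ennreal (C0 * ((1 + c) powr (t' - t) * phase_kernel \<mu> s t t' w x))"
      using C0(1) by (intro ennreal_leI mult_left_mono phase_kernel_near t x c) auto
    finally show ?thesis by (simp add: mult.assoc)
  qed
  moreover have "0 < C0 * (1 + c) powr (t' - t)" using C0(1) c by simp
  ultimately show ?thesis by blast
qed

lemma has_vector_derivative_cis:
  assumes "(g has_real_derivative d) (at x)"
  shows "((\<lambda>r. cis (g r)) has_vector_derivative \<i> * complex_of_real d * cis (g x)) (at x)"
proof -
  have 1: "((\<lambda>r. \<i> * complex_of_real (g r)) has_vector_derivative \<i> * complex_of_real d) (at x)"
    by (intro has_vector_derivative_mult_right has_vector_derivative_of_real assms)
  have 2: "(exp has_field_derivative exp (\<i> * complex_of_real (g x))) (at (\<i> * complex_of_real (g x)))"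
    by (rule DERIV_exp)
  show ?thesis
    using field_vector_diff_chain_at[OF 1 2] by (simp add: o_def cis_conv_exp)
qed

text \<open>Integration by parts in both forms: without the linear part of the phase
  (for $x$ near the stationary point) and with it (far away).\<close>

lemma phase_transform_step:
  fixes \<mu> :: "real ^ 'n::finite \<Rightarrow> real"
  assumes C2: "C2 \<mu>" and t: "real CARD('n) < t"
    and gb: "\<And>z. \<bar>pd j \<mu> (w + z)\<bar> \<le> B * jbr z powr b"
    and gt: "\<And>y. norm (fourier (\<lambda>z. complex_of_real (pd j \<mu> (w + z) - c) * cgau pi z) y) \<le> cu * jbr y powr (- t)"
    and c3: "\<And>y::real^'n. \<bar>y $ j\<bar> * gau pi y \<le> c3 * jbr y powr (- t)"
    and W: "\<And>y. norm (fourier (\<lambda>z. cis (\<mu> (w + z)) * cgau pi z) y) \<le> Bw y"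
    and E: "(\<integral>y. ennreal (jbr y powr (- t) * Bw (x - y))) \<le> ennreal E" "0 \<le> E"
    and Bwm: "Bw \<in> borel_measurable borel"
  shows "\<bar>x $ j - c / (2 * pi)\<bar> * norm (fourier (\<lambda>z. cis (\<mu> (w + z)) * cgau (2 * pi) z) x)
    \<le> (cu + 4 * pi * c3) * E"
proof -
  define M where "M = (\<lambda>z. cis (\<mu> (w + z)))"
  define P where "P = (\<lambda>z::real^'n. cgau pi z)"
  define Q where "Q = (\<lambda>z::real^'n. complex_of_real (z $ j * gau pi z))"
  define D where "D = (\<lambda>z. complex_of_real (pd j \<mu> (w + z)))"
  note dif = C2_derivatives[OF C2]
  have Mc: "continuous_on UNIV M" unfolding M_def
    by (intro continuous_on_compose2[OF continuous_on_cis] continuous_on_compose2[OF dif(3)] continuous_intros) auto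
  have Dc: "continuous_on UNIV D" unfolding D_def
    by (intro continuous_intros continuous_on_compose2[OF dif(4)]) auto
  have Pc: "continuous_on UNIV P" unfolding P_def by (intro continuous_intros)
  have Qc: "continuous_on UNIV Q" unfolding Q_def by (intro continuous_intros)
  note m = borel_measurable_continuous_onI
  have PP: "cgau (2 * pi) z = P z * P z" for z
    unfolding P_def of_real_mult[symmetric] exp_add[symmetric] by simp
  have QP: "complex_of_real (- 2 * (2 * pi) * z $ j * gau (2 * pi) z) = (- 4 * pi) * (Q z * P z)" for z
  proof -
    have "gau (2 * pi) z = gau pi z * gau pi z" unfolding exp_add[symmetric] by simp
    then show ?thesis unfolding Q_def P_def by simp
  qed
  have Pi: "integrable lborel P" unfolding P_def by (intro integrable_of_real integrable_gau) simp
  have Qi: "integrable lborel Q" unfolding Q_def of_real_mult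
    by (rule integrable_bounded_gau[where B = 1 and b = 1])
       (auto intro: order_trans[OF component_le_norm_cart norm_le_jbr])
  have MPi: "integrable lborel (\<lambda>z. M z * P z)" unfolding P_def
    by (rule integrable_bounded_gau[where B = 1 and b = 0]) (auto simp: M_def intro: m[OF Mc, unfolded M_def])
  have MPPi: "integrable lborel (\<lambda>z. M z * cgau (2 * pi) z)"
    by (rule integrable_bounded_gau[where B = 1 and b = 0]) (auto simp: M_def intro: m[OF Mc, unfolded M_def])
  have DPi: "integrable lborel (\<lambda>z. D z * P z)" unfolding P_def
    by (rule integrable_bounded_gau[where B = B and b = b]) (use gb m[OF Dc] in \<open>auto simp: D_def\<close>)
  \<comment> \<open>The derivative of the windowed e^{i \<mu>}, less i c times the function itself,
    equals \<open>U\<close> times one windowed copy of e^{i \<mu>}. The term with \<open>c\<close>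
    joins the left-hand side and turns x_j into x_j - c / (2 pi).\<close>
  define U where "U = (\<lambda>z. \<i> * ((D z - complex_of_real c) * P z) + (- 4 * pi) * Q z)"
  have U1i: "integrable lborel (\<lambda>z. (D z - complex_of_real c) * P z)"
    unfolding left_diff_distrib by (intro Bochner_Integration.integrable_diff DPi integrable_mult_right Pi)
  have Ui: "integrable lborel U" unfolding U_def
    by (intro Bochner_Integration.integrable_add integrable_mult_right U1i Qi)
  have Uc: "continuous_on UNIV U" unfolding U_def by (intro continuous_intros Dc Pc Qc)
  have UMPi: "integrable lborel (\<lambda>z. U z * (M z * P z))"
  proof (rule Bochner_Integration.integrable_bound[OF Ui])
    show "(\<lambda>z. U z * (M z * P z)) \<in> borel_measurable lborel"
      using m[OF Uc] m[OF Mc] m[OF Pc] by simp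
    show "AE z in lborel. norm (U z * (M z * P z)) \<le> norm (U z)"
      by (auto simp: norm_mult M_def P_def intro!: mult_left_le)
  qed
  have icM: "integrable lborel (\<lambda>z. (\<i> * complex_of_real c) * (M z * cgau (2 * pi) z))"
    by (intro integrable_mult_right MPPi)
  define F' where "F' = (\<lambda>z. U z * (M z * P z) + (\<i> * complex_of_real c) * (M z * cgau (2 * pi) z))"
  let ?K = "fourier (\<lambda>z. M z * cgau (2 * pi) z) x"
  have key: "fourier F' x = 2 * pi * \<i> * (x $ j) * ?K"
  proof (rule fourier_pd)
    show "((\<lambda>r. M (z + r *\<^sub>R axis j 1) * cgau (2 * pi) (z + r *\<^sub>R axis j 1)) has_vector_derivative F' z) (at 0)" for z
    proof -
      have d0: "((\<lambda>r. \<mu> (w + (z + r *\<^sub>R axis j 1))) has_real_derivative pd j \<mu> (w + z)) (at 0)"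
        using dif(1)[of "w + z" j] by (simp add: add.assoc)
      have d1: "((\<lambda>r. M (z + r *\<^sub>R axis j 1)) has_vector_derivative \<i> * D z * M z) (at 0)"
        using has_vector_derivative_cis[OF d0] unfolding M_def D_def by simp
      have d2: "((\<lambda>r. cgau (2 * pi) (z + r *\<^sub>R axis j 1)) has_vector_derivative (- 4 * pi) * (Q z * P z)) (at 0)"
        unfolding QP[symmetric] by (rule has_vector_derivative_of_real[OF gau_has_pd])
      have "F' z = M (z + 0 *\<^sub>R axis j 1) * ((- 4 * pi) * (Q z * P z)) + \<i> * D z * M z * cgau (2 * pi) (z + 0 *\<^sub>R axis j 1)"
        unfolding PP F'_def U_def by (simp add: algebra_simps)
      then show ?thesis using has_vector_derivative_mult[OF d1 d2] by simp
    qed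
    show "continuous_on UNIV F'" unfolding F'_def by (intro continuous_intros Uc Mc Pc)
    show "continuous_on UNIV (\<lambda>z. M z * cgau (2 * pi) z)" by (intro continuous_intros Mc)
    show "integrable lborel F'" unfolding F'_def by (rule Bochner_Integration.integrable_add[OF UMPi icM])
  qed (rule MPPi)
  have split: "fourier F' x = fourier (\<lambda>z. U z * (M z * P z)) x + \<i> * complex_of_real c * ?K"
    unfolding F'_def fourier_add[OF UMPi icM] fourier_cmult ..
  have "norm (fourier (\<lambda>z. U z * (M z * P z)) x) \<le> (cu + 4 * pi * c3) * E"
  proof (rule fourier_mult_bound_jbr[OF Uc Ui MPi t _ _ E Bwm])
    show "norm (fourier (\<lambda>z. M z * P z) y) \<le> Bw y" for y using W[of y] by (simp add: M_def P_def)
    show "norm (fourier U y) \<le> (cu + 4 * pi * c3) * jbr y powr (- t)" for y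
    proof -
      have "norm (fourier U y) \<le> norm (fourier (\<lambda>z. (D z - complex_of_real c) * P z) y) + 4 * pi * norm (fourier Q y)"
        unfolding U_def fourier_add[OF integrable_mult_right[OF U1i] integrable_mult_right[OF Qi]] fourier_cmult
        by (rule order_trans[OF norm_triangle_ineq]) (simp add: norm_mult)
      also have "\<dots> \<le> cu * jbr y powr (- t) + 4 * pi * (c3 * jbr y powr (- t))"
      proof (intro add_mono mult_left_mono)
        show "norm (fourier (\<lambda>z. (D z - complex_of_real c) * P z) y) \<le> cu * jbr y powr (- t)"
          using gt[of y] by (simp add: D_def P_def)
        show "norm (fourier Q y) \<le> c3 * jbr y powr (- t)"
          unfolding Q_def fourier_coord_gau using c3[of y] by (simp add: norm_mult abs_mult)
      qed auto
      finally show ?thesis by (simp add: distrib_right)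
    qed
  qed
  moreover have "fourier (\<lambda>z. U z * (M z * P z)) x = 2 * pi * \<i> * complex_of_real (x $ j - c / (2 * pi)) * ?K"
  proof -
    have "2 * pi * (x $ j - c / (2 * pi)) = 2 * pi * x $ j - c" by (simp add: right_diff_distrib)
    then have "complex_of_real (2 * pi) * complex_of_real (x $ j - c / (2 * pi)) = complex_of_real (2 * pi * x $ j) - complex_of_real c"
      unfolding of_real_mult[symmetric] of_real_diff[symmetric] by (rule arg_cong)
    then have "2 * pi * \<i> * complex_of_real (x $ j - c / (2 * pi)) = 2 * pi * \<i> * (x $ j) - \<i> * complex_of_real c"
      by (simp add: algebra_simps)
    then show ?thesis using key split by (simp only: left_diff_distrib) (simp only: eq_diff_eq)
  qed
  then have "norm (fourier (\<lambda>z. U z * (M z * P z)) x) = norm (2 * pi * \<i> * complex_of_real (x $ j - c / (2 * pi)) * ?K)"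
    by (rule arg_cong)
  then have "norm (fourier (\<lambda>z. U z * (M z * P z)) x) = 2 * pi * (\<bar>x $ j - c / (2 * pi)\<bar> * norm ?K)"
    unfolding norm_mult[of _ ?K] norm_mult[of "_ * \<i>"] norm_of_real by (simp add: norm_mult)
  moreover have "1 * (\<bar>x $ j - c / (2 * pi)\<bar> * norm ?K) \<le> 2 * pi * (\<bar>x $ j - c / (2 * pi)\<bar> * norm ?K)"
    using pi_gt3 by (intro mult_right_mono) auto
  ultimately show ?thesis unfolding M_def by linarith
qed

lemma phase_velocity_lipschitz:
  fixes \<mu> :: "real ^ 'n::finite \<Rightarrow> real"
  assumes "C2 \<mu>" and hb: "\<And>i j x. \<bar>pd i (pd j \<mu>) x\<bar> \<le> Ch"
  shows "norm (phase_velocity \<mu> x - phase_velocity \<mu> y) \<le> real CARD('n) * (real CARD('n) * Ch) * norm (x - y)"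
proof -
  let ?a = "phase_velocity \<mu>"
  have "\<bar>(?a x - ?a y) $ j\<bar> * 1 \<le> real CARD('n) * Ch * norm (x - y)" for j
  proof -
    have "(?a x - ?a y) $ j = (pd j \<mu> x - pd j \<mu> y) / (2 * pi)" by (simp add: phase_velocity_def diff_divide_distrib)
    then have "\<bar>(?a x - ?a y) $ j\<bar> = \<bar>pd j \<mu> x - pd j \<mu> y\<bar> / (2 * pi)" by simp
    also have "\<dots> \<le> \<bar>pd j \<mu> x - pd j \<mu> y\<bar> / 1" using pi_gt3 by (intro divide_left_mono) auto
    finally show ?thesis using C2_lipschitz[OF assms(1) hb, of j x y] by simp
  qed
  from norm_le_of_components[OF this] show ?thesis by (simp add: mult.assoc)
qed

text \<open>Absorption with a frequency-dependent kernel. Beyond |x| = C1 <w>^s the whole gradient,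
  of size <w>^s, is used with weights of order \<open>t'\<close>. Within it the gradient minus its
  value at \<open>w\<close> is used with weights of order \<open>t\<close>, and the gain is measured
  from the stationary point.\<close>

theorem phase_transform:
  fixes \<mu> :: "real ^ 'n::finite \<Rightarrow> real"
  assumes C2: "C2 \<mu>" and t: "real CARD('n) < t" "t \<le> t'" and s: "0 \<le> s"
    and hb: "\<And>i j x. \<bar>pd i (pd j \<mu>) x\<bar> \<le> Ch"
    and ht: "\<And>i j w x. norm (fourier (\<lambda>z. complex_of_real (pd i (pd j \<mu>) (w + z)) * cgau pi z) x) \<le> Ch * jbr x powr (- t)"
    and gb: "\<And>j x. \<bar>pd j \<mu> x\<bar> \<le> Cg * jbr x powr s"
    and gt: "\<And>j w x. norm (fourier (\<lambda>z. complex_of_real (pd j \<mu> (w + z)) * cgau pi z) x) \<le> Cg * jbr w powr s * jbr x powr (- t')"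
  shows "\<exists>C>0. \<forall>w x. norm (fourier (\<lambda>z. cis (\<mu> (w + z)) * cgau pi z) x) \<le> C * phase_kernel \<mu> s t t' w x"
proof -
  define \<kappa> where "\<kappa> = phase_kernel \<mu> s t t'"
  let ?a = "phase_velocity \<mu>"
  have \<kappa>0: "0 \<le> \<kappa> w x" for w x by (simp add: \<kappa>_def)
  have \<kappa>m [measurable]: "\<kappa> w \<in> borel_measurable borel" for w by (simp add: \<kappa>_def)
  have Ch0: "0 \<le> Ch" using order_trans[OF abs_ge_zero hb] by blast
  have Cg0: "0 \<le> Cg" using order_trans[OF abs_ge_zero gb[of undefined 0]] by (simp add: zero_le_mult_iff jbr_def)
  note dif = C2_derivatives[OF C2]
  note lip = C2_lipschitz[OF C2 hb]
  define La where "La = real CARD('n) * (real CARD('n) * Ch)"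
  have La0: "0 \<le> La" using Ch0 by (simp add: La_def)
  have a_lip: "norm (?a x - ?a y) \<le> La * norm (x - y)" for x y
    unfolding La_def by (rule phase_velocity_lipschitz[OF C2 hb])
  \<comment> \<open>Only after subtraction of its value at \<open>w\<close> does the gradient have
    windowed transforms bounded independently of \<open>w\<close>; this is the use made of the
    second derivatives.\<close>
  obtain CD where CD: "\<And>j w x. norm (fourier (\<lambda>z. complex_of_real (pd j \<mu> (w + z) - pd j \<mu> w) * cgau pi z) x) \<le> CD * jbr x powr (- t)"
    "0 \<le> CD"
  proof -
    have "\<forall>j. \<exists>C>0. \<forall>w x. norm (fourier (\<lambda>z. complex_of_real (pd j \<mu> (w + z) - pd j \<mu> w) * cgau pi z) x) \<le> C * jbr x powr (- t)"
    proof
      fix j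
      show "\<exists>C>0. \<forall>w x. norm (fourier (\<lambda>z. complex_of_real (pd j \<mu> (w + z) - pd j \<mu> w) * cgau pi z) x) \<le> C * jbr x powr (- t)"
        by (rule first_order_transform[OF t(1) dif(2) dif(4) dif(5) lip _ hb ht]) (use Ch0 in simp)
    qed
    from choice[OF this] obtain C where C: "\<And>j. 0 < C j"
      "\<And>j w x. norm (fourier (\<lambda>z. complex_of_real (pd j \<mu> (w + z) - pd j \<mu> w) * cgau pi z) x) \<le> C j * jbr x powr (- t)"
      by blast
    have le: "C j \<le> (\<Sum>j\<in>UNIV. C j)" for j using C(1) by (intro member_le_sum) (auto intro: less_imp_le)
    show ?thesis
    proof (rule that)
      show "norm (fourier (\<lambda>z. complex_of_real (pd j \<mu> (w + z) - pd j \<mu> w) * cgau pi z) x) \<le> (\<Sum>j\<in>UNIV. C j) * jbr x powr (- t)" for j w x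
        by (rule order_trans[OF C(2) mult_right_mono[OF le]]) simp
      show "0 \<le> (\<Sum>j\<in>UNIV. C j)" using C(1) by (intro sum_nonneg) (auto intro: less_imp_le)
    qed
  qed
  obtain c3 where c3: "c3 > 0" "\<And>(y::real^'n) i. \<bar>y $ i\<bar> * gau pi y \<le> c3 * jbr y powr (- t)"
    using coord_gau_le_jbr_powr[of t] by auto
  obtain c3' where c3': "c3' > 0" "\<And>(y::real^'n) i. \<bar>y $ i\<bar> * gau pi y \<le> c3' * jbr y powr (- t')"
    using coord_gau_le_jbr_powr[of t'] by auto
  define K where "K = (\<lambda>w x. norm (fourier (\<lambda>z. cis (\<mu> (w + z)) * cgau (2 * pi) z) x))"
  define W where "W = (\<lambda>w x. norm (fourier (\<lambda>z. cis (\<mu> (w + z)) * cgau pi z) x))"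
  have K0: "0 \<le> K w x" for w x by (simp add: K_def)
  have Mm: "(\<lambda>z. cis (\<mu> (w + z))) \<in> borel_measurable borel" for w
    by (intro borel_measurable_continuous_onI continuous_on_compose2[OF continuous_on_cis] continuous_on_compose2[OF dif(3)] continuous_intros) auto
  have Mi: "integrable lborel (\<lambda>z. cis (\<mu> (w + z)) * cgau c z)" if "c > 0" for w c
    by (rule integrable_bounded_gau[OF Mm _ that, where B = 1 and b = 0]) simp
  define B0 where "B0 = (LINT z|(lborel::(real^'n) measure). gau (2 * pi) z)"
  have B00: "0 \<le> B0" unfolding B0_def by (intro Bochner_Integration.integral_nonneg) auto
  have KB: "K w x \<le> B0" for w x
  proof -
    have "K w x \<le> (LINT z|lborel. norm (cis (\<mu> (w + z)) * cgau (2 * pi) z))"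
      unfolding K_def by (rule norm_fourier_le[OF Mi]) simp
    then show ?thesis by (simp add: B0_def norm_mult)
  qed
  define Mx where "Mx = t + s * (t' - t)"
  define cm where "cm = 2 powr t * (1 + La) powr t * 2 powr (s * (t' - t))"
  have t0: "0 \<le> t" using t by linarith
  have \<kappa>shift: "\<kappa> (w + \<tau>) x \<le> cm * jbr \<tau> powr Mx * \<kappa> w x" for w \<tau> x
    unfolding \<kappa>_def Mx_def cm_def by (rule phase_kernel_shift_freq[OF t0 t(2) s a_lip La0])
  have cm0: "0 \<le> cm" by (simp add: cm_def)
  have Mx0: "0 \<le> Mx" unfolding Mx_def using t0 t(2) s by simp
  define J where "J = (LINT z|(lborel::(real^'n) measure). jbr z powr Mx * gau (2 * pi) z)"
  have J0: "0 \<le> J" unfolding J_def by (intro Bochner_Integration.integral_nonneg) auto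
  define Cw where "Cw = 2 ^ CARD('n) * J * (cm + 1)"
  have Cw0: "0 \<le> Cw" unfolding Cw_def using J0 cm0 by simp
  \<comment> \<open>Widening averages over the frequencies w + \<tau>; \<open>\<kappa>shift\<close>
    returns the kernel to \<open>w\<close> at the cost of <\<tau>>^Mx, which the Gaussian
    absorbs.\<close>
  have wide: "W w x \<le> (Cw * A) * \<kappa> w x + Cw * R"
    if A: "0 \<le> A" "0 \<le> R" and KA: "\<And>w x. K w x \<le> A * \<kappa> w x + R" for A R w x
  proof -
    have "norm (fourier (\<lambda>z. cis (\<mu> (w + (\<tau> + z))) * cgau (2 * pi) z) x) \<le> ((cm + 1) * (A * \<kappa> w x + R)) * jbr \<tau> powr Mx" for \<tau>
    proof -
      have "norm (fourier (\<lambda>z. cis (\<mu> (w + (\<tau> + z))) * cgau (2 * pi) z) x) = K (w + \<tau>) x"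
        by (simp add: K_def add.assoc)
      also have "\<dots> \<le> A * \<kappa> (w + \<tau>) x + R" by (rule KA)
      also have "\<dots> \<le> A * (cm * jbr \<tau> powr Mx * \<kappa> w x) + R * jbr \<tau> powr Mx"
        using A jbr_powr_ge_1[OF Mx0, of \<tau>] by (intro add_mono mult_left_mono \<kappa>shift) (auto simp: mult_le_cancel_left1)
      also have "\<dots> = (cm * (A * \<kappa> w x) + R) * jbr \<tau> powr Mx" by (simp add: algebra_simps)
      also have "\<dots> \<le> ((cm + 1) * (A * \<kappa> w x + R)) * jbr \<tau> powr Mx"
      proof (intro mult_right_mono)
        have "0 \<le> A * \<kappa> w x + cm * R" using A cm0 \<kappa>0 by simp
        then show "cm * (A * \<kappa> w x) + R \<le> (cm + 1) * (A * \<kappa> w x + R)" by (simp add: algebra_simps)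
      qed simp
      finally show ?thesis .
    qed
    from fourier_widen_bound_jbr[OF Mm Mi[OF pi_gt_zero] this]
    show ?thesis unfolding W_def Cw_def J_def by (simp add: algebra_simps)
  qed
  define I where "I = (\<lambda>t. LINT y|(lborel::(real^'n) measure). jbr y powr (- t))"
  have I0: "0 \<le> I t" for t by (simp add: I_def)
  have t': "real CARD('n) < t'" using t by linarith
  obtain Cf where Cf: "Cf > 0" "\<And>w x. (\<integral>y. ennreal (jbr y powr (- t') * \<kappa> w (x - y))) \<le> ennreal (Cf * \<kappa> w x)"
    using phase_kernel_conv_far[OF t s, of \<mu>] unfolding \<kappa>_def by auto
  define C2f where "C2f = real CARD('n) * (((Cg + 4 * pi * c3') * (Cf + I t')) * Cw)"
  have C2f0: "0 \<le> C2f" unfolding C2f_def using Cg0 c3'(1) Cf(1) I0[of t'] Cw0 by simp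
  have far: "norm x * K w x \<le> C2f * jbr w powr s * (A * \<kappa> w x + R)"
    if A: "0 \<le> A" "0 \<le> R" and KA: "\<And>w x. K w x \<le> A * \<kappa> w x + R" for A R w x
  proof -
    have N: "1 \<le> jbr w powr s" by (rule jbr_powr_ge_1[OF s])
    have "\<bar>x $ j\<bar> * K w x \<le> ((Cg + 4 * pi * c3') * (Cf + I t')) * Cw * jbr w powr s * (A * \<kappa> w x + R)" for j
    proof -
      have gb': "\<bar>pd j \<mu> (w + z)\<bar> \<le> (Cg * 2 powr s * jbr w powr s) * jbr z powr s" for z
        using order_trans[OF gb mult_left_mono[OF jbr_powr_add_pos[OF s] Cg0]] by (simp add: mult_ac)
      have gt': "norm (fourier (\<lambda>z. complex_of_real (pd j \<mu> (w + z) - 0) * cgau pi z) y) \<le> (Cg * jbr w powr s) * jbr y powr (- t')" for y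
        using gt[of j w y] by simp
      \<comment> \<open>Parameter c = 0: nothing is subtracted from the gradient.\<close>
      have "\<bar>x $ j - 0 / (2 * pi)\<bar> * K w x \<le> (Cg * jbr w powr s + 4 * pi * c3') * ((Cf + I t') * ((Cw * A) * \<kappa> w x + Cw * R))"
        unfolding K_def
      proof (rule phase_transform_step[OF C2 t' gb' gt' c3'(2)])
        show "norm (fourier (\<lambda>z. cis (\<mu> (w + z)) * cgau pi z) y) \<le> (Cw * A) * \<kappa> w y + Cw * R" for y
          using wide[OF A KA, of w y] by (simp add: W_def)
        show "(\<integral>y. ennreal (jbr y powr (- t') * ((Cw * A) * \<kappa> w (x - y) + Cw * R))) \<le> ennreal ((Cf + I t') * ((Cw * A) * \<kappa> w x + Cw * R))"
          unfolding I_def by (rule conv_affine[OF t' \<kappa>m \<kappa>0 Cf(2)]) (use Cf(1) A Cw0 \<kappa>0 in auto)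
        show "0 \<le> (Cf + I t') * ((Cw * A) * \<kappa> w x + Cw * R)" using Cf(1) I0[of t'] A Cw0 \<kappa>0 by simp
      qed measurable
      also have "\<dots> \<le> ((Cg + 4 * pi * c3') * jbr w powr s) * ((Cf + I t') * ((Cw * A) * \<kappa> w x + Cw * R))"
      proof (rule mult_right_mono)
        have "4 * pi * c3' * 1 \<le> 4 * pi * c3' * jbr w powr s" using N c3'(1) by (intro mult_left_mono) auto
        then show "Cg * jbr w powr s + 4 * pi * c3' \<le> (Cg + 4 * pi * c3') * jbr w powr s" by (simp add: distrib_right)
        show "0 \<le> (Cf + I t') * ((Cw * A) * \<kappa> w x + Cw * R)" using Cf(1) I0[of t'] A Cw0 \<kappa>0 by simp
      qed
      also have "\<dots> = ((Cg + 4 * pi * c3') * (Cf + I t')) * Cw * jbr w powr s * (A * \<kappa> w x + R)"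
        by (simp add: algebra_simps)
      finally show ?thesis by simp
    qed
    from norm_le_of_components[OF this K0] show ?thesis by (simp add: C2f_def mult.assoc)
  qed
  \<comment> \<open>Beyond |x| = 2 C2f <w>^s the far estimate gains the factor 1 / 2 that
    \<open>absorption\<close> asks for.\<close>
  define C1 where "C1 = 2 * C2f"
  have C10: "0 \<le> C1" using C2f0 by (simp add: C1_def)
  obtain Cn where Cn: "Cn > 0" "\<And>w x. norm x \<le> C1 * jbr w powr s \<Longrightarrow> (\<integral>y. ennreal (jbr y powr (- t) * \<kappa> w (x - y))) \<le> ennreal (Cn * \<kappa> w x)"
    using phase_kernel_conv_near[OF t C10, of s \<mu>] unfolding \<kappa>_def by auto
  define C3 where "C3 = real CARD('n) * (((CD + 4 * pi * c3) * (Cn + I t)) * Cw)"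
  have C30: "0 \<le> C3" unfolding C3_def using CD(2) c3(1) Cn(1) I0[of t] Cw0 by simp
  have near: "norm (x - ?a w) * K w x \<le> C3 * (A * \<kappa> w x + R)"
    if A: "0 \<le> A" "0 \<le> R" and KA: "\<And>w x. K w x \<le> A * \<kappa> w x + R" and x: "norm x \<le> C1 * jbr w powr s" for A R w x
  proof -
    have "\<bar>(x - ?a w) $ j\<bar> * K w x \<le> ((CD + 4 * pi * c3) * (Cn + I t)) * Cw * (A * \<kappa> w x + R)" for j
    proof -
      have gb': "\<bar>pd j \<mu> (w + z)\<bar> \<le> (Cg * 2 powr s * jbr w powr s) * jbr z powr s" for z
        using order_trans[OF gb mult_left_mono[OF jbr_powr_add_pos[OF s] Cg0]] by (simp add: mult_ac)
      have "\<bar>x $ j - pd j \<mu> w / (2 * pi)\<bar> * K w x \<le> (CD + 4 * pi * c3) * ((Cn + I t) * ((Cw * A) * \<kappa> w x + Cw * R))"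
        unfolding K_def
      proof (rule phase_transform_step[OF C2 t(1) gb' CD(1) c3(2)])
        show "norm (fourier (\<lambda>z. cis (\<mu> (w + z)) * cgau pi z) y) \<le> (Cw * A) * \<kappa> w y + Cw * R" for y
          using wide[OF A KA, of w y] by (simp add: W_def)
        show "(\<integral>y. ennreal (jbr y powr (- t) * ((Cw * A) * \<kappa> w (x - y) + Cw * R))) \<le> ennreal ((Cn + I t) * ((Cw * A) * \<kappa> w x + Cw * R))"
          unfolding I_def by (rule conv_affine[OF t(1) \<kappa>m \<kappa>0 Cn(2)[OF x]]) (use Cn(1) A Cw0 \<kappa>0 in auto)
        show "0 \<le> (Cn + I t) * ((Cw * A) * \<kappa> w x + Cw * R)" using Cn(1) I0[of t] A Cw0 \<kappa>0 by simp
      qed measurable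
      also have "\<dots> = ((CD + 4 * pi * c3) * (Cn + I t)) * Cw * (A * \<kappa> w x + R)"
        by (simp add: algebra_simps)
      finally show ?thesis by (simp add: phase_velocity_def)
    qed
    from norm_le_of_components[OF this K0] show ?thesis by (simp add: C3_def mult.assoc)
  qed
  \<comment> \<open>Where neither estimate gains 1 / 2, namely |x| <= C1 <w>^s within distance 2 C3
    + 1 of the stationary point, the kernel is bounded below and dominates the trivial bound
    \<open>B0\<close>.\<close>
  define C where "C = B0 * ((2 * C3 + 2) powr t * (1 + C1) powr (t' - t))"
  have C0: "0 \<le> C" unfolding C_def using B00 by simp
  have step: "K w x \<le> (C + A / 2) * \<kappa> w x + R / 2"
    if A: "0 \<le> A" "0 \<le> R" and KA: "\<And>w x. K w x \<le> A * \<kappa> w x + R" for A R w x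
  proof -
    define Z where "Z = A * \<kappa> w x + R"
    have Z0: "0 \<le> Z" unfolding Z_def using A \<kappa>0 by simp
    have half: ?thesis if "K w x \<le> Z / 2"
    proof -
      have "0 \<le> C * \<kappa> w x" using C0 \<kappa>0 by simp
      then show ?thesis using that by (simp add: Z_def algebra_simps)
    qed
    show ?thesis
    proof (cases "norm x \<le> C1 * jbr w powr s")
      case False
      have "0 \<le> C1 * jbr w powr s" using C10 by simp
      then have x0: "0 < norm x" using False by linarith
      have "norm x * K w x \<le> (C2f * jbr w powr s) * Z" using far[OF A KA, of x w] by (simp add: Z_def)
      also have "\<dots> \<le> (norm x / 2) * Z" using False Z0 by (intro mult_right_mono) (auto simp: C1_def)
      finally have "norm x * K w x \<le> norm x * (Z / 2)" by simp
      then show ?thesis using x0 by (intro half) simp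
    next
      case x: True
      show ?thesis
      proof (cases "norm (x - ?a w) \<le> 2 * C3 + 1")
        case False
        have x0: "0 < norm (x - ?a w)" using False C30 by linarith
        have "norm (x - ?a w) * K w x \<le> C3 * Z" using near[OF A KA x] by (simp add: Z_def)
        also have "\<dots> \<le> (norm (x - ?a w) / 2) * Z" using False Z0 by (intro mult_right_mono) auto
        finally have "norm (x - ?a w) * K w x \<le> norm (x - ?a w) * (Z / 2)" by simp
        then show ?thesis using x0 by (intro half) (simp only: mult_le_cancel_left_pos)
      next
        case True
        have "jbr (x - ?a w) \<le> 2 * C3 + 2" using True jbr_le_norm[of "x - ?a w"] by linarith
        then have "1 powr (- t) \<le> (2 * C3 + 2) powr t * jbr (x - ?a w) powr (- t)"
          by (intro powr_minus_le_of_le t0) auto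
        also have "\<dots> \<le> (2 * C3 + 2) powr t * ((1 + C1) powr (t' - t) * \<kappa> w x)"
          unfolding \<kappa>_def by (intro mult_left_mono phase_kernel_near t x C10) auto
        finally have "B0 * 1 \<le> B0 * ((2 * C3 + 2) powr t * ((1 + C1) powr (t' - t) * \<kappa> w x))"
          by (intro mult_left_mono B00) simp
        also have "\<dots> = C * \<kappa> w x" by (simp add: C_def mult_ac)
        also have "\<dots> \<le> (C + A / 2) * \<kappa> w x + R / 2" using A \<kappa>0[of w x] by (simp add: distrib_right)
        finally show ?thesis using KB[of w x] by simp
      qed
    qed
  qed
  have fin: "K w x \<le> 2 * C * \<kappa> w x + 0" for w x
  proof -
    have "K (fst z) (snd z) \<le> 2 * C * \<kappa> (fst z) (snd z)" for z :: "(real^'n) \<times> (real^'n)"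
    proof (rule absorption[of "\<lambda>z. K (fst z) (snd z)" B0 C "\<lambda>z. \<kappa> (fst z) (snd z)"])
      fix A R :: real and z :: "(real^'n) \<times> (real^'n)"
      assume A: "0 \<le> A" "0 \<le> R" and "\<And>z. K (fst z) (snd z) \<le> A * \<kappa> (fst z) (snd z) + R"
      then have "K w x \<le> A * \<kappa> w x + R" for w x using prod.sel by metis
      from step[OF A this] show "K (fst z) (snd z) \<le> (C + A / 2) * \<kappa> (fst z) (snd z) + R / 2" .
    qed (use KB C0 B00 \<kappa>0 in auto)
    from this[of "(w, x)"] show ?thesis by simp
  qed
  have "W w x \<le> (Cw * (2 * C) + 1) * \<kappa> w x" for w x
  proof -
    have "W w x \<le> (Cw * (2 * C)) * \<kappa> w x + Cw * 0" by (rule wide[OF _ _ fin]) (use C0 in auto)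
    also have "\<dots> \<le> (Cw * (2 * C) + 1) * \<kappa> w x" using \<kappa>0[of w x] by (simp add: distrib_right)
    finally show ?thesis .
  qed
  moreover have "0 < Cw * (2 * C) + 1" using Cw0 C0 by (simp add: add_nonneg_pos)
  ultimately show ?thesis unfolding W_def \<kappa>_def by blast
qed

section \<open>Reflection and the multiplication formula\<close>

lemma integral_reflect:
  fixes f :: "real ^ 'n::finite \<Rightarrow> 'b::{banach, second_countable_topology}"
  assumes [measurable]: "f \<in> borel_measurable borel"
  shows "(LINT x|lborel. f (- x)) = (LINT x|lborel. f x)"
proof -
  have "lborel = distr lborel borel (\<lambda>x::real^'n. - x)"
    using lborel_affine[of "- 1" "0::real^'n"] by (simp add: density_1)
  then have "(LINT x|lborel. f x) = (LINT x|distr lborel borel (\<lambda>x. - x). f x)" by simp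
  also have "\<dots> = (LINT x|lborel. f (- x))" by (rule integral_distr) measurable
  finally show ?thesis ..
qed

lemma parseval_fourier:
  fixes f g :: "real ^ 'n::finite \<Rightarrow> complex"
  assumes "integrable lborel f" and "integrable lborel g"
  shows "(LINT y|lborel. f y * fourier g y) = (LINT \<eta>|lborel. fourier f \<eta> * g \<eta>)"
proof -
  have "(LINT y|lborel. f y * fourier g y) = (LINT y|lborel. LINT \<eta>|lborel. f y * g \<eta> * cis (- 2 * pi * (y \<bullet> \<eta>)))"
    unfolding fourier_def by (simp add: mult.assoc inner_commute)
  also have "\<dots> = (LINT \<eta>|lborel. LINT y|lborel. f y * g \<eta> * cis (- 2 * pi * (y \<bullet> \<eta>)))"
    by (intro Fubini_pair_prod assms) (auto, measurable)
  also have "\<dots> = (LINT \<eta>|lborel. fourier f \<eta> * g \<eta>)"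
    unfolding fourier_def integral_mult_left_zero[symmetric] by (simp add: mult_ac)
  finally show ?thesis .
qed

section \<open>The short-time Fourier transform on the frequency side\<close>

text \<open>With h the transform of f this is |V_\<phi> f(x, w)|: up to a phase, the short-time
  transform of f at (x, w) is that of h at (w, -x) with the transformed window, and the Gaussian is
  its own transform.\<close>

definition freq_stft :: "(real ^ 'n::finite \<Rightarrow> complex) \<Rightarrow> real ^ 'n \<Rightarrow> real ^ 'n \<Rightarrow> real" where
  "freq_stft h x w = norm (fourier (\<lambda>z. h (w + z) * cgau pi z) (- x))"

lemma freq_stft_nonneg [simp]: "0 \<le> freq_stft h x w"
  by (simp add: freq_stft_def)

lemma freq_stft_eq:
  fixes h :: "real ^ 'n::finite \<Rightarrow> complex"
  assumes [measurable]: "h \<in> borel_measurable borel"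
  shows "freq_stft h x \<xi> = norm (LINT \<eta>|lborel. h \<eta> * (cgau pi (\<eta> - \<xi>) * cis (2 * pi * (x \<bullet> (\<eta> - \<xi>)))))"
proof -
  have "(LINT \<eta>|lborel. h \<eta> * (cgau pi (\<eta> - \<xi>) * cis (2 * pi * (x \<bullet> (\<eta> - \<xi>)))))
    = (LINT z|lborel. h (\<xi> + z) * (cgau pi (\<xi> + z - \<xi>) * cis (2 * pi * (x \<bullet> (\<xi> + z - \<xi>)))))"
    by (rule integral_shift[symmetric]) measurable
  also have "\<dots> = fourier (\<lambda>z. h (\<xi> + z) * cgau pi z) (- x)"
    unfolding fourier_def by (simp add: mult.assoc inner_commute)
  finally show ?thesis by (simp add: freq_stft_def)
qed

lemma integrable_gau_cis:
  "integrable lborel (\<lambda>\<eta>::real^'n::finite. cgau pi (\<eta> - \<xi>) * cis (2 * pi * (x \<bullet> (\<eta> - \<xi>))))"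
proof (rule integrable_mult_cis)
  have "integrable lborel (\<lambda>\<eta>::real^'n. gau pi (- \<xi> + \<eta>))" by (intro integrable_shift integrable_gau) simp
  then show "integrable lborel (\<lambda>\<eta>::real^'n. cgau pi (\<eta> - \<xi>))"
    by (intro integrable_of_real) simp
qed measurable

text \<open>Translation and modulation change places under the Fourier transform.\<close>

lemma fourier_gau_cis:
  fixes y :: "real^'n::finite"
  shows "fourier (\<lambda>\<eta>. cgau pi (\<eta> - \<xi>) * cis (2 * pi * (x \<bullet> (\<eta> - \<xi>)))) y
    = cgau pi (y - x) * cis (- 2 * pi * (y \<bullet> \<xi>))"
proof -
  have "fourier (\<lambda>\<eta>. cgau pi (\<eta> - \<xi>) * cis (2 * pi * (x \<bullet> (\<eta> - \<xi>)))) y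
    = (LINT z|lborel. cgau pi (\<xi> + z - \<xi>) * cis (2 * pi * (x \<bullet> (\<xi> + z - \<xi>))) * cis (- 2 * pi * ((\<xi> + z) \<bullet> y)))"
    unfolding fourier_def by (rule integral_shift[symmetric]) measurable
  also have "\<dots> = (LINT z|lborel. cis (- 2 * pi * (y \<bullet> \<xi>)) * (cgau pi z * cis (- 2 * pi * (z \<bullet> (y - x)))))"
  proof (intro Bochner_Integration.integral_cong refl)
    fix z
    have "cis (2 * pi * (x \<bullet> z)) * cis (- 2 * pi * ((\<xi> + z) \<bullet> y)) = cis (- 2 * pi * (y \<bullet> \<xi>)) * cis (- 2 * pi * (z \<bullet> (y - x)))"
      unfolding cis_mult by (rule arg_cong[of _ _ cis]) (simp add: inner_add_left inner_diff_right inner_commute algebra_simps)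
    then have "cgau pi z * (cis (2 * pi * (x \<bullet> z)) * cis (- 2 * pi * ((\<xi> + z) \<bullet> y)))
       = cgau pi z * (cis (- 2 * pi * (y \<bullet> \<xi>)) * cis (- 2 * pi * (z \<bullet> (y - x))))" by (rule arg_cong)
    then show "cgau pi (\<xi> + z - \<xi>) * cis (2 * pi * (x \<bullet> (\<xi> + z - \<xi>))) * cis (- 2 * pi * ((\<xi> + z) \<bullet> y))
      = cis (- 2 * pi * (y \<bullet> \<xi>)) * (cgau pi z * cis (- 2 * pi * (z \<bullet> (y - x))))"
      by (simp only: add_diff_cancel_left' mult_ac)
  qed
  also have "\<dots> = cis (- 2 * pi * (y \<bullet> \<xi>)) * fourier (\<lambda>z. cgau pi z) (y - x)"
    unfolding fourier_def by (rule integral_mult_right_zero)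
  finally show ?thesis unfolding fourier_gau_1 by (simp only: mult.commute)
qed

lemma window_eq: "cnj (window (y - x)) = cgau pi (y - x)"
  by (simp add: window_def)

text \<open>The shifted and modulated window is itself a transform by
  \<open>fourier_gau_cis\<close>, so the multiplication formula moves the Fourier transform onto
  \<open>f\<close>.\<close>

lemma norm_stft_freq:
  fixes f :: "real ^ 'n::finite \<Rightarrow> complex"
  assumes f: "integrable lborel f"
  shows "norm (stft f x \<xi>) = freq_stft (fourier f) x \<xi>"
proof -
  have [measurable]: "f \<in> borel_measurable borel"
    using f by (auto dest: borel_measurable_integrable)
  have "stft f x \<xi> = (LINT y|lborel. f y * fourier (\<lambda>\<eta>. cgau pi (\<eta> - \<xi>) * cis (2 * pi * (x \<bullet> (\<eta> - \<xi>)))) y)"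
    unfolding fourier_gau_cis stft_def window_eq by (simp only: mult.assoc)
  also have "\<dots> = (LINT \<eta>|lborel. fourier f \<eta> * (cgau pi (\<eta> - \<xi>) * cis (2 * pi * (x \<bullet> (\<eta> - \<xi>)))))"
    by (rule parseval_fourier[OF f integrable_gau_cis])
  finally show ?thesis by (simp only: freq_stft_eq[OF measurable_fourier[OF \<open>f \<in> borel_measurable borel\<close>]])
qed

text \<open>\<open>mult_op \<mu> f\<close> is the reflected transform of h = e^{i \<mu>} times
  \<open>fourier f\<close>. The multiplication formula shifts the transform from \<open>h\<close> to
  the window, so only \<open>h\<close> has to be integrable, not the image of
  \<open>f\<close>.\<close>

lemma norm_stft_mult_op:
  fixes f :: "real ^ 'n::finite \<Rightarrow> complex"
  assumes \<mu> [measurable]: "\<mu> \<in> borel_measurable borel" and fh: "integrable lborel (fourier f)"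
  shows "norm (stft (mult_op \<mu> f) x \<xi>) = freq_stft (\<lambda>\<eta>. cis (\<mu> \<eta>) * fourier f \<eta>) x \<xi>"
proof -
  define h where "h = (\<lambda>\<eta>. cis (\<mu> \<eta>) * fourier f \<eta>)"
  have hi: "integrable lborel h"
    unfolding h_def using integrable_mult_cis[OF fh \<mu>] by (simp add: mult.commute)
  then have [measurable]: "h \<in> borel_measurable borel" by (auto dest: borel_measurable_integrable)
  have T: "mult_op \<mu> f y = fourier h (- y)" for y
    unfolding mult_op_def fourier_def[of h] by (simp add: h_def inner_commute)
  define g where "g = (\<lambda>y. cgau pi (y - (- x)) * cis (2 * pi * (\<xi> \<bullet> (y - (- x)))))"
  define c where "c = cis (- 2 * pi * (\<xi> \<bullet> x))"
  have "stft (mult_op \<mu> f) x \<xi> = (LINT y|lborel. fourier h (- y) * cgau pi (y - x) * cis (- 2 * pi * (y \<bullet> \<xi>)))"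
    unfolding stft_def window_eq T ..
  also have "\<dots> = (LINT y|lborel. fourier h (- (- y)) * cgau pi (- y - x) * cis (- 2 * pi * (- y \<bullet> \<xi>)))"
    by (rule integral_reflect[symmetric]) measurable
  also have "\<dots> = (LINT y|lborel. c * (fourier h y * g y))"
  proof (intro Bochner_Integration.integral_cong refl)
    fix y
    have 1: "cis (- 2 * pi * (- y \<bullet> \<xi>)) = c * cis (2 * pi * (\<xi> \<bullet> (y - (- x))))"
      unfolding c_def cis_mult by (rule arg_cong[of _ _ cis]) (simp add: inner_add_right inner_commute algebra_simps)
    have "norm (- y - x) = norm (y + x)" using norm_minus_cancel[of "y + x"] by simp
    then have 2: "gau pi (- y - x) = gau pi (y - (- x))" by simp
    show "fourier h (- (- y)) * cgau pi (- y - x) * cis (- 2 * pi * (- y \<bullet> \<xi>)) = c * (fourier h y * g y)"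
      unfolding 1 2 g_def by (simp only: minus_minus mult_ac)
  qed
  also have "\<dots> = c * (LINT y|lborel. fourier h y * g y)" by (rule integral_mult_right_zero)
  also have "(LINT y|lborel. fourier h y * g y) = (LINT \<eta>|lborel. h \<eta> * fourier g \<eta>)"
    unfolding g_def by (rule parseval_fourier[OF hi integrable_gau_cis, symmetric])
  also have "\<dots> = (LINT \<eta>|lborel. h \<eta> * (cgau pi (\<eta> - \<xi>) * cis (2 * pi * (x \<bullet> \<eta>))))"
    unfolding g_def fourier_gau_cis by (simp add: inner_commute)
  also have "\<dots> = (LINT \<eta>|lborel. cis (2 * pi * (x \<bullet> \<xi>)) * (h \<eta> * (cgau pi (\<eta> - \<xi>) * cis (2 * pi * (x \<bullet> (\<eta> - \<xi>))))))"
  proof (intro Bochner_Integration.integral_cong refl)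
    fix \<eta>
    have 1: "cis (2 * pi * (x \<bullet> \<eta>)) = cis (2 * pi * (x \<bullet> \<xi>)) * cis (2 * pi * (x \<bullet> (\<eta> - \<xi>)))"
      unfolding cis_mult by (rule arg_cong[of _ _ cis]) (simp add: inner_diff_right algebra_simps)
    show "h \<eta> * (cgau pi (\<eta> - \<xi>) * cis (2 * pi * (x \<bullet> \<eta>))) = cis (2 * pi * (x \<bullet> \<xi>)) * (h \<eta> * (cgau pi (\<eta> - \<xi>) * cis (2 * pi * (x \<bullet> (\<eta> - \<xi>)))))"
      unfolding 1 by (simp only: mult_ac)
  qed
  also have "\<dots> = cis (2 * pi * (x \<bullet> \<xi>)) * (LINT \<eta>|lborel. h \<eta> * (cgau pi (\<eta> - \<xi>) * cis (2 * pi * (x \<bullet> (\<eta> - \<xi>)))))"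
    by (rule integral_mult_right_zero)
  finally have st: "stft (mult_op \<mu> f) x \<xi> = c * (cis (2 * pi * (x \<bullet> \<xi>)) * (LINT \<eta>|lborel. h \<eta> * (cgau pi (\<eta> - \<xi>) * cis (2 * pi * (x \<bullet> (\<eta> - \<xi>))))))" .
  show ?thesis
    unfolding h_def[symmetric] st freq_stft_eq[OF \<open>h \<in> borel_measurable borel\<close>]
    by (simp only: norm_mult c_def norm_cis mult_1_left)
qed

lemma integrable_shift_gau:
  fixes h :: "real ^ 'n::finite \<Rightarrow> complex"
  assumes "integrable lborel h" and "c > 0"
  shows "integrable lborel (\<lambda>z. h (w + z) * cgau c z)"
proof (rule Bochner_Integration.integrable_bound[OF integrable_shift[OF assms(1), of w]])
  have [measurable]: "h \<in> borel_measurable borel" using assms by (auto dest: borel_measurable_integrable)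
  show "(\<lambda>z. h (w + z) * cgau c z) \<in> borel_measurable lborel" by measurable
  show "AE z in lborel. norm (h (w + z) * cgau c z) \<le> norm (h (w + z))"
    using assms(2) by (auto simp: norm_mult intro!: mult_left_le)
qed

lemma freq_stft_measurable [measurable]:
  fixes h :: "real ^ 'n::finite \<Rightarrow> complex"
  assumes [measurable]: "h \<in> borel_measurable borel"
  shows "(\<lambda>(x, \<xi>). freq_stft h x \<xi>) \<in> borel_measurable (borel \<Otimes>\<^sub>M borel)"
  unfolding freq_stft_def fourier_def by measurable

lemma freq_stft_bounded:
  assumes "integrable lborel h"
  shows "freq_stft h x w \<le> (LINT \<eta>|lborel. norm (h \<eta>))"
proof -
  have [measurable]: "h \<in> borel_measurable borel" using assms by (auto dest: borel_measurable_integrable)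
  have "freq_stft h x w \<le> (LINT z|lborel. norm (h (w + z) * cgau pi z))"
    unfolding freq_stft_def by (rule norm_fourier_le[OF integrable_shift_gau[OF assms]]) simp
  also have "\<dots> \<le> (LINT z|lborel. norm (h (w + z)))"
  proof (rule integral_mono)
    show "integrable lborel (\<lambda>z. norm (h (w + z) * cgau pi z))"
      by (intro integrable_norm integrable_shift_gau assms) simp
    show "integrable lborel (\<lambda>z. norm (h (w + z)))" by (intro integrable_norm integrable_shift assms)
  qed (auto simp: norm_mult intro!: mult_left_le)
  also have "\<dots> = (LINT \<eta>|lborel. norm (h \<eta>))" by (rule integral_shift) measurable
  finally show ?thesis .
qed

text \<open>Widening introduces the average over frequency shifts \<tau> and leaves the narrow
  window, which splits into one window for \<open>M\<close> and one for \<open>h\<close>;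
  \<open>fourier_mult\<close> then turns the product into a convolution in position.\<close>

lemma freq_stft_mult_bound:
  fixes h M :: "real ^ 'n::finite \<Rightarrow> complex"
  assumes h: "integrable lborel h" and Mc: "continuous_on UNIV M" and M1: "\<And>x. norm (M x) \<le> 1"
    and Ki: "\<And>w. integrable lborel (fourier (\<lambda>z. M (w + z) * cgau pi z))"
    and Kb: "\<And>w y. norm (fourier (\<lambda>z. M (w + z) * cgau pi z) y) \<le> k w y"
    and km [measurable]: "\<And>w. k w \<in> borel_measurable borel"
  shows "ennreal (freq_stft (\<lambda>\<eta>. M \<eta> * h \<eta>) x \<xi>)
    \<le> 2 ^ CARD('n) * (\<integral>\<tau>. \<integral>y. ennreal (gau (2 * pi) \<tau> * (k (\<xi> + \<tau>) y * freq_stft h (x + y) (\<xi> + \<tau>))))"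
proof -
  have hm [measurable]: "h \<in> borel_measurable borel" using h by (auto dest: borel_measurable_integrable)
  have Mm [measurable]: "M \<in> borel_measurable borel" using Mc by (rule borel_measurable_continuous_onI)
  have Mhi: "integrable lborel (\<lambda>\<eta>. M \<eta> * h \<eta>)"
    by (rule Bochner_Integration.integrable_bound[OF h]) (auto simp: norm_mult M1 intro!: mult_left_le_one_le)
  have Mc': "continuous_on UNIV (\<lambda>z. M (w + z) * cgau pi z)" for w
    by (intro continuous_intros continuous_on_compose2[OF Mc]) auto
  have Mi: "integrable lborel (\<lambda>z. M (w + z) * cgau pi z)" for w
    by (rule integrable_bounded_gau[where B = 1 and b = 0]) (auto simp: M1)
  have "ennreal (freq_stft (\<lambda>\<eta>. M \<eta> * h \<eta>) x \<xi>)
    \<le> 2 ^ CARD('n) * (\<integral>\<tau>. ennreal (gau (2 * pi) \<tau> * norm (fourier (\<lambda>z. (M (\<xi> + (\<tau> + z)) * h (\<xi> + (\<tau> + z))) * cgau (2 * pi) z) (- x))))"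
    unfolding freq_stft_def
    by (rule fourier_widen_bound[OF _ integrable_shift_gau[OF Mhi]]) auto
  also have "\<dots> \<le> 2 ^ CARD('n) * (\<integral>\<tau>. \<integral>y. ennreal (gau (2 * pi) \<tau> * (k (\<xi> + \<tau>) y * freq_stft h (x + y) (\<xi> + \<tau>))))"
  proof (intro mult_left_mono nn_integral_mono)
    fix \<tau> :: "real^'n"
    define w where "w = \<xi> + \<tau>"
    have k0: "0 \<le> k w y" for y using order_trans[OF norm_ge_zero Kb] .
    have e: "(M (\<xi> + (\<tau> + z)) * h (\<xi> + (\<tau> + z))) * cgau (2 * pi) z
       = (M (w + z) * cgau pi z) * (h (w + z) * cgau pi z)" for z
    proof -
      have "gau (2 * pi) z = gau pi z * gau pi z" unfolding exp_add[symmetric] by simp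
      then show ?thesis unfolding w_def by (simp add: add.assoc mult_ac)
    qed
    have "ennreal (norm (fourier (\<lambda>z. (M (\<xi> + (\<tau> + z)) * h (\<xi> + (\<tau> + z))) * cgau (2 * pi) z) (- x)))
       = ennreal (norm (LINT y|lborel. fourier (\<lambda>z. M (w + z) * cgau pi z) y * fourier (\<lambda>z. h (w + z) * cgau pi z) (- x - y)))"
      unfolding e by (subst fourier_mult[OF Mc' Mi Ki integrable_shift_gau[OF h]]) auto
    also have "\<dots> \<le> (\<integral>y. ennreal (norm (fourier (\<lambda>z. M (w + z) * cgau pi z) y * fourier (\<lambda>z. h (w + z) * cgau pi z) (- x - y))))"
      by (rule ennreal_norm_integral_le)
    also have "\<dots> \<le> (\<integral>y. ennreal (k w y * freq_stft h (x + y) w))"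
    proof (intro nn_integral_mono ennreal_leI)
      fix y
      have "norm (fourier (\<lambda>z. h (w + z) * cgau pi z) (- x - y)) = freq_stft h (x + y) w"
        by (simp add: freq_stft_def)
      then show "norm (fourier (\<lambda>z. M (w + z) * cgau pi z) y * fourier (\<lambda>z. h (w + z) * cgau pi z) (- x - y)) \<le> k w y * freq_stft h (x + y) w"
        unfolding norm_mult using Kb by (intro mult_mono) (auto simp: k0)
    qed
    finally have "ennreal (gau (2 * pi) \<tau>) * ennreal (norm (fourier (\<lambda>z. (M (\<xi> + (\<tau> + z)) * h (\<xi> + (\<tau> + z))) * cgau (2 * pi) z) (- x)))
      \<le> ennreal (gau (2 * pi) \<tau>) * (\<integral>y. ennreal (k w y * freq_stft h (x + y) w))"
      by (intro mult_left_mono) auto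
    also have "\<dots> \<le> (\<integral>y. ennreal (gau (2 * pi) \<tau>) * ennreal (k w y * freq_stft h (x + y) w))"
      by (subst nn_integral_cmult) measurable
    finally show "ennreal (gau (2 * pi) \<tau> * norm (fourier (\<lambda>z. (M (\<xi> + (\<tau> + z)) * h (\<xi> + (\<tau> + z))) * cgau (2 * pi) z) (- x)))
      \<le> (\<integral>y. ennreal (gau (2 * pi) \<tau> * (k (\<xi> + \<tau>) y * freq_stft h (x + y) (\<xi> + \<tau>))))"
      unfolding w_def by (simp add: ennreal_mult')
  qed simp
  finally show ?thesis .
qed

text \<open>A Peetre maximal function on phase space. The exponential weight is compatible with the
  triangle inequality, giving slow variation with the constant exp(distance), and it is still beaten
  by Gaussians.\<close>

definition peetre_max :: "(real ^ 'n::finite \<Rightarrow> real ^ 'n \<Rightarrow> real) \<Rightarrow> real ^ 'n \<Rightarrow> real ^ 'n \<Rightarrow> real" where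
  "peetre_max F x \<xi> = (SUP z. F (fst z) (snd z) * exp (- (norm (x - fst z) + norm (\<xi> - snd z))))"

text \<open>The upper bound makes the real-valued supremum in \<open>peetre_max\<close> a genuine
  one.\<close>

locale bounded_nonneg =
  fixes F :: "real ^ 'n::finite \<Rightarrow> real ^ 'n \<Rightarrow> real" and B :: real
  assumes F0: "\<And>x \<xi>. 0 \<le> F x \<xi>" and FB: "\<And>x \<xi>. F x \<xi> \<le> B"
begin

lemma B0: "0 \<le> B" using order_trans[OF F0 FB] .

lemma term_le_B: "F y \<eta> * exp (- (norm (x - y) + norm (\<xi> - \<eta>))) \<le> B"
proof -
  have "F y \<eta> * exp (- (norm (x - y) + norm (\<xi> - \<eta>))) \<le> F y \<eta> * 1"
  proof (intro mult_left_mono F0)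
    have "0 \<le> norm (x - y) + norm (\<xi> - \<eta>)" by simp
    then show "exp (- (norm (x - y) + norm (\<xi> - \<eta>))) \<le> 1" by (simp only: exp_le_one_iff neg_le_0_iff_le)
  qed
  then show ?thesis using FB[of y \<eta>] by simp
qed

lemma bdd: "bdd_above (range (\<lambda>z. F (fst z) (snd z) * exp (- (norm (x - fst z) + norm (\<xi> - snd z)))))"
  by (rule bdd_aboveI[of _ B]) (clarify, rule term_le_B)

lemma peetre_upper: "F y \<eta> * exp (- (norm (x - y) + norm (\<xi> - \<eta>))) \<le> peetre_max F x \<xi>"
  unfolding peetre_max_def using cSUP_upper[OF UNIV_I bdd, of "(y, \<eta>)" x \<xi>] by simp

lemma peetre_least:
  assumes "\<And>y \<eta>. F y \<eta> * exp (- (norm (x - y) + norm (\<xi> - \<eta>))) \<le> c"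
  shows "peetre_max F x \<xi> \<le> c"
  unfolding peetre_max_def by (rule cSUP_least) (rule UNIV_not_empty, rule assms)

lemma peetre_nonneg: "0 \<le> peetre_max F x \<xi>"
  by (rule order_trans[OF _ peetre_upper[of x \<xi>]]) (simp add: F0)

lemma peetre_le_B: "peetre_max F x \<xi> \<le> B"
  by (rule peetre_least) (rule term_le_B)

lemma le_peetre: "F y \<eta> \<le> exp (norm (x - y) + norm (\<xi> - \<eta>)) * peetre_max F x \<xi>"
proof -
  define d where "d = norm (x - y) + norm (\<xi> - \<eta>)"
  have "exp d * (F y \<eta> * exp (- d)) \<le> exp d * peetre_max F x \<xi>"
    unfolding d_def by (intro mult_left_mono peetre_upper) simp
  moreover have "exp d * (F y \<eta> * exp (- d)) = F y \<eta>" by (simp add: exp_minus)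
  ultimately show ?thesis by (simp only: d_def)
qed

lemma peetre_slow: "peetre_max F x' \<xi>' \<le> exp (norm (x - x') + norm (\<xi> - \<xi>')) * peetre_max F x \<xi>"
proof (rule peetre_least)
  fix y \<eta>
  have "norm (x - y) \<le> norm (x - x') + norm (x' - y)" "norm (\<xi> - \<eta>) \<le> norm (\<xi> - \<xi>') + norm (\<xi>' - \<eta>)"
    using norm_triangle_ineq[of "x - x'" "x' - y"] norm_triangle_ineq[of "\<xi> - \<xi>'" "\<xi>' - \<eta>"] by auto
  then have "exp (- (norm (x' - y) + norm (\<xi>' - \<eta>))) \<le> exp (norm (x - x') + norm (\<xi> - \<xi>')) * exp (- (norm (x - y) + norm (\<xi> - \<eta>)))"
    unfolding exp_add[symmetric] by simp
  then have "F y \<eta> * exp (- (norm (x' - y) + norm (\<xi>' - \<eta>))) \<le> F y \<eta> * (exp (norm (x - x') + norm (\<xi> - \<xi>')) * exp (- (norm (x - y) + norm (\<xi> - \<eta>))))"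
    by (intro mult_left_mono F0)
  also have "\<dots> = exp (norm (x - x') + norm (\<xi> - \<xi>')) * (F y \<eta> * exp (- (norm (x - y) + norm (\<xi> - \<eta>))))" by simp
  also have "\<dots> \<le> exp (norm (x - x') + norm (\<xi> - \<xi>')) * peetre_max F x \<xi>" by (intro mult_left_mono peetre_upper) simp
  finally show "F y \<eta> * exp (- (norm (x' - y) + norm (\<xi>' - \<eta>))) \<le> exp (norm (x - x') + norm (\<xi> - \<xi>')) * peetre_max F x \<xi>" .
qed

text \<open>Slow variation together with boundedness gives continuity, which also settles the
  measurability of this supremum over uncountably many points.\<close>

lemma peetre_continuous: "continuous_on UNIV (\<lambda>z. peetre_max F (fst z) (snd z))"
proof (rule continuous_on_sequentiallyI)
  fix u :: "nat \<Rightarrow> (real^'n) \<times> (real^'n)" and a assume u: "u \<longlonglongrightarrow> a"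
  define d where "d = (\<lambda>n. norm (fst a - fst (u n)) + norm (snd a - snd (u n)))"
  have d: "d \<longlonglongrightarrow> 0"
  proof -
    have "d \<longlonglongrightarrow> norm (fst a - fst a) + norm (snd a - snd a)"
      unfolding d_def by (intro tendsto_intros u)
    then show ?thesis by simp
  qed
  have lim: "(\<lambda>n. (exp (d n) - 1) * B) \<longlonglongrightarrow> 0"
    using tendsto_mult[OF tendsto_diff[OF tendsto_exp[OF d] tendsto_const[of 1]] tendsto_const[of B]] by simp
  have "norm (peetre_max F (fst (u n)) (snd (u n)) - peetre_max F (fst a) (snd a)) \<le> (exp (d n) - 1) * B" for n
  proof -
    let ?u = "peetre_max F (fst (u n)) (snd (u n))" and ?a = "peetre_max F (fst a) (snd a)"
    have e: "0 \<le> exp (d n) - 1" by (simp add: d_def)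
    have 1: "?u \<le> exp (d n) * ?a" unfolding d_def by (rule peetre_slow)
    have 2: "?a \<le> exp (d n) * ?u" unfolding d_def using peetre_slow[of "fst a" "snd a" "fst (u n)" "snd (u n)"] by (simp add: norm_minus_commute)
    have "?u - ?a \<le> (exp (d n) - 1) * ?a" using 1 by (simp add: left_diff_distrib)
    also have "\<dots> \<le> (exp (d n) - 1) * B" by (intro mult_left_mono peetre_le_B e)
    finally have 3: "?u - ?a \<le> (exp (d n) - 1) * B" .
    have "?a - ?u \<le> (exp (d n) - 1) * ?u" using 2 by (simp add: left_diff_distrib)
    also have "\<dots> \<le> (exp (d n) - 1) * B" by (intro mult_left_mono peetre_le_B e)
    finally show ?thesis using 3 by (simp add: abs_le_iff)
  qed
  then have "(\<lambda>n. peetre_max F (fst (u n)) (snd (u n)) - peetre_max F (fst a) (snd a)) \<longlonglongrightarrow> 0"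
    by (intro Lim_null_comparison[OF _ lim]) auto
  then show "(\<lambda>n. peetre_max F (fst (u n)) (snd (u n))) \<longlonglongrightarrow> peetre_max F (fst a) (snd a)"
    by (simp add: LIM_zero_iff)
qed

lemma peetre_measurable [measurable]: "(\<lambda>(x, \<xi>). peetre_max F x \<xi>) \<in> borel_measurable (borel \<Otimes>\<^sub>M borel)"
  using borel_measurable_continuous_onI[OF peetre_continuous] by (simp add: borel_prod split_beta')

end

text \<open>The maximal function is dominated by an $r$-mean of the original one: one writes
  $F = F^r F^{1-r}$ in the reproducing formula and estimates the second factor by the
  maximal function itself.\<close>

lemma peetre_power_bound:
  fixes h :: "real ^ 'n::finite \<Rightarrow> complex" and r :: real
  assumes r: "0 < r" "r \<le> 1"
  shows "\<exists>C>0. \<forall>h::real^'n \<Rightarrow> complex. integrable lborel h \<longrightarrow> (\<forall>x \<xi>.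
    ennreal (peetre_max (freq_stft h) x \<xi> powr r) \<le> ennreal C * (\<integral>\<eta>. \<integral>y. ennreal (freq_stft h (x + y) (\<xi> + \<eta>) powr r * exp (- r * (norm y + norm \<eta>)))))"
proof -
  obtain c1 where c1: "c1 > 0" "\<And>\<tau>::real^'n. gau (2 * pi) \<tau> \<le> c1 * exp (- 1 * norm \<tau>)"
    using gau_le_exp[of "2 * pi" 1] by auto
  obtain c2 where c2: "c2 > 0" "\<And>\<tau>::real^'n. gau pi \<tau> \<le> c2 * exp (- 1 * norm \<tau>)"
    using gau_le_exp[of pi 1] by auto
  define C where "C = 2 ^ CARD('n) * (c1 * c2)"
  have C0: "C > 0" using c1(1) c2(1) by (simp add: C_def)
  have main: "ennreal (peetre_max (freq_stft h) x \<xi> powr r) \<le> ennreal C * (\<integral>\<eta>. \<integral>y. ennreal (freq_stft h (x + y) (\<xi> + \<eta>) powr r * exp (- r * (norm y + norm \<eta>))))"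
    if h: "integrable lborel h" for h :: "real^'n \<Rightarrow> complex" and x \<xi>
  proof -
    define F where "F = freq_stft h"
    have hm [measurable]: "h \<in> borel_measurable borel" using h by (auto dest: borel_measurable_integrable)
    have Fm: "(\<lambda>(x, \<xi>). F x \<xi>) \<in> borel_measurable (borel \<Otimes>\<^sub>M borel)" unfolding F_def by measurable
    note Fm [measurable]
    interpret bounded_nonneg F "LINT \<eta>|lborel. norm (h \<eta>)"
      by standard (auto simp: F_def freq_stft_def[of h] freq_stft_bounded[OF h, unfolded freq_stft_def])
    define E where "E = (\<lambda>y \<eta>. exp (- (norm (x - y) + norm (\<xi> - \<eta>))))"
    have E0: "0 < E y \<eta>" for y \<eta> by (simp add: E_def)
    define \<Phi> where "\<Phi> = (\<lambda>y \<eta>. ennreal ((F y \<eta> * E y \<eta>) powr r))"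
    have [measurable]: "(\<lambda>(y, \<eta>). \<Phi> y \<eta>) \<in> borel_measurable (borel \<Otimes>\<^sub>M borel)"
      unfolding \<Phi>_def E_def using Fm by measurable
    define P where "P = peetre_max F x \<xi>"
    have P0: "0 \<le> P" unfolding P_def by (rule peetre_nonneg)
    define J where "J = (\<integral>\<eta>. \<integral>y. \<Phi> (x + y) (\<xi> + \<eta>))"
    have shift: "(\<integral>\<eta>. \<integral>y. \<Phi> (a + y) (b + \<eta>)) = (\<integral>\<eta>. \<integral>y. \<Phi> y \<eta>)" for a b
    proof -
      have "(\<integral>\<eta>. \<integral>y. \<Phi> (a + y) (b + \<eta>)) = (\<integral>\<eta>. \<integral>y. \<Phi> y (b + \<eta>))"
        by (intro nn_integral_cong nn_integral_shift) measurable
      also have "\<dots> = (\<integral>\<eta>. \<integral>y. \<Phi> y \<eta>)"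
        by (rule nn_integral_shift[of "\<lambda>\<eta>. (\<integral>y. \<Phi> y \<eta>)"]) measurable
      finally show ?thesis .
    qed
    have one: "fourier (\<lambda>z. 1 * cgau pi z) = (\<lambda>y::real^'n. cgau pi y)"
      by (simp only: mult_1_left fourier_gau_1 fun_eq_iff) simp
    have gi: "integrable lborel (\<lambda>y::real^'n. cgau pi y)"
      by (intro integrable_of_real integrable_gau) simp
    \<comment> \<open>The reproducing formula is the product estimate for M = 1, whose windowed
      transform is the Gaussian itself.\<close>
    have rep: "ennreal (F w v) \<le> 2 ^ CARD('n) * (\<integral>\<tau>. \<integral>y. ennreal (gau (2 * pi) \<tau> * (gau pi y * F (w + y) (v + \<tau>))))" for w v
    proof -
      have "ennreal (freq_stft (\<lambda>\<eta>. 1 * h \<eta>) w v) \<le> 2 ^ CARD('n) * (\<integral>\<tau>. \<integral>y. ennreal (gau (2 * pi) \<tau> * (gau pi y * freq_stft h (w + y) (v + \<tau>))))"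
        by (rule freq_stft_mult_bound[OF h]) (simp_all only: one gi continuous_on_const norm_of_real norm_one abs_exp_cancel order_refl, measurable)
      then show ?thesis by (simp add: F_def)
    qed
    have key: "ennreal (F w v * E w v) \<le> ennreal (C * P powr (1 - r)) * J" for w v
    proof -
      have pt: "gau (2 * pi) \<tau> * (gau pi y * F (w + y) (v + \<tau>)) * E w v \<le> (c1 * c2 * P powr (1 - r)) * (F (w + y) (v + \<tau>) * E (w + y) (v + \<tau>)) powr r" for \<tau> y
      proof -
        let ?f = "F (w + y) (v + \<tau>)" and ?e = "E (w + y) (v + \<tau>)"
        have f0: "0 \<le> ?f" by (rule F0)
        have "norm (x - (w + y)) \<le> norm (x - w) + norm y" "norm (\<xi> - (v + \<tau>)) \<le> norm (\<xi> - v) + norm \<tau>"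
          using norm_triangle_ineq4[of "x - w" y] norm_triangle_ineq4[of "\<xi> - v" \<tau>] by (simp_all add: algebra_simps)
        then have "exp (- norm \<tau>) * exp (- norm y) * E w v \<le> ?e"
          unfolding E_def exp_add[symmetric] by simp
        then have ee: "exp (- norm \<tau>) * exp (- norm y) * E w v * ?f \<le> ?e * ?f" by (intro mult_right_mono f0)
        have "gau (2 * pi) \<tau> * gau pi y \<le> (c1 * exp (- norm \<tau>)) * (c2 * exp (- norm y))"
          using c1(2)[of \<tau>] c2(2)[of y] c1(1) by (intro mult_mono) auto
        then have "(gau (2 * pi) \<tau> * gau pi y) * (E w v * ?f) \<le> ((c1 * exp (- norm \<tau>)) * (c2 * exp (- norm y))) * (E w v * ?f)"
          using f0 E0[of w v] by (intro mult_right_mono) auto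
        also have "\<dots> = (c1 * c2) * (exp (- norm \<tau>) * exp (- norm y) * E w v * ?f)" by (simp only: mult_ac)
        also have "\<dots> \<le> (c1 * c2) * (?e * ?f)" using c1(1) c2(1) ee by (intro mult_left_mono) auto
        also have "\<dots> \<le> (c1 * c2) * (P powr (1 - r) * (?f * ?e) powr r)"
        proof (intro mult_left_mono)
          show "?e * ?f \<le> P powr (1 - r) * (?f * ?e) powr r"
          proof (cases "?f = 0")
            case False
            then have p: "0 < ?f * ?e" using f0 E0 by simp
            have le: "?f * ?e \<le> P" unfolding P_def E_def by (rule peetre_upper)
            have "?e * ?f = (?f * ?e) powr (1 - r) * (?f * ?e) powr r"
              unfolding powr_add[symmetric] using p by simp
            also have "\<dots> \<le> P powr (1 - r) * (?f * ?e) powr r"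
              using p le r by (intro mult_right_mono powr_mono2) auto
            finally show ?thesis .
          qed simp
        qed (use c1(1) c2(1) in auto)
        finally show ?thesis by (simp only: mult_ac)
      qed
      have "ennreal (F w v * E w v) = ennreal (E w v) * ennreal (F w v)"
        using F0 E0[of w v] by (simp add: ennreal_mult[symmetric] mult.commute)
      also have "\<dots> \<le> ennreal (E w v) * (2 ^ CARD('n) * (\<integral>\<tau>. \<integral>y. ennreal (gau (2 * pi) \<tau> * (gau pi y * F (w + y) (v + \<tau>)))))"
        by (intro mult_left_mono rep) simp
      also have "\<dots> = 2 ^ CARD('n) * (ennreal (E w v) * (\<integral>\<tau>. \<integral>y. ennreal (gau (2 * pi) \<tau> * (gau pi y * F (w + y) (v + \<tau>)))))"
        by (simp only: mult_ac)
      also have "\<dots> = 2 ^ CARD('n) * (\<integral>\<tau>. \<integral>y. ennreal (E w v) * ennreal (gau (2 * pi) \<tau> * (gau pi y * F (w + y) (v + \<tau>))))"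
        by (subst nn_integral_cmult[symmetric], measurable, subst nn_integral_cmult[symmetric], measurable)
      also have "\<dots> \<le> 2 ^ CARD('n) * (\<integral>\<tau>. \<integral>y. ennreal (c1 * c2 * P powr (1 - r)) * \<Phi> (w + y) (v + \<tau>))"
      proof (intro mult_left_mono nn_integral_mono)
        fix \<tau> y
        have "ennreal (E w v) * ennreal (gau (2 * pi) \<tau> * (gau pi y * F (w + y) (v + \<tau>))) = ennreal (gau (2 * pi) \<tau> * (gau pi y * F (w + y) (v + \<tau>)) * E w v)"
          using F0 E0[of w v] by (subst ennreal_mult[symmetric]) (auto simp: mult.commute intro: less_imp_le)
        also have "\<dots> \<le> ennreal ((c1 * c2 * P powr (1 - r)) * (F (w + y) (v + \<tau>) * E (w + y) (v + \<tau>)) powr r)"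
          by (rule ennreal_leI[OF pt])
        also have "\<dots> = ennreal (c1 * c2 * P powr (1 - r)) * \<Phi> (w + y) (v + \<tau>)"
          using c1(1) c2(1) by (simp add: \<Phi>_def ennreal_mult)
        finally show "ennreal (E w v) * ennreal (gau (2 * pi) \<tau> * (gau pi y * F (w + y) (v + \<tau>))) \<le> ennreal (c1 * c2 * P powr (1 - r)) * \<Phi> (w + y) (v + \<tau>)" .
      qed simp
      also have "\<dots> = 2 ^ CARD('n) * (ennreal (c1 * c2 * P powr (1 - r)) * J)"
      proof -
        have J: "J = (\<integral>\<tau>. \<integral>y. \<Phi> (w + y) (v + \<tau>))"
          unfolding J_def shift[of x \<xi>] shift[of w v] ..
        have "(\<integral>\<tau>. \<integral>y. ennreal (c1 * c2 * P powr (1 - r)) * \<Phi> (w + y) (v + \<tau>))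
          = (\<integral>\<tau>. ennreal (c1 * c2 * P powr (1 - r)) * (\<integral>y. \<Phi> (w + y) (v + \<tau>)))"
          by (intro nn_integral_cong nn_integral_cmult) measurable
        also have "\<dots> = ennreal (c1 * c2 * P powr (1 - r)) * J"
          unfolding J by (rule nn_integral_cmult) measurable
        finally show ?thesis by (rule arg_cong)
      qed
      also have "\<dots> = ennreal (C * P powr (1 - r)) * J"
        using c1(1) c2(1) by (simp add: C_def ennreal_mult ennreal_power[symmetric] mult_ac)
      finally show ?thesis .
    qed
    have "ennreal (P powr r) \<le> ennreal C * J"
    \<comment> \<open>An infinite mean \<open>J\<close> leaves nothing to show. Otherwise
      \<open>P\<close>, finite because the function is bounded, is divided out of P <= C P^(1 - r)
      J.\<close>
    proof (cases "J = \<infinity> \<or> P = 0")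
      case True then show ?thesis using C0 by (auto simp: ennreal_mult_top)
    next
      case False
      then have Pp: "0 < P" and Jf: "J \<noteq> \<infinity>" using P0 by auto
      then obtain j where j: "J = ennreal j" "0 \<le> j" by (cases J) auto
      have "F w v * E w v \<le> C * P powr (1 - r) * j" for w v
      proof -
        have "ennreal (F w v * E w v) \<le> ennreal (C * P powr (1 - r) * j)"
          using key[of w v] C0 j by (simp add: ennreal_mult)
        then show ?thesis using C0 j(2) by (simp add: ennreal_le_iff)
      qed
      then have "P \<le> C * P powr (1 - r) * j" unfolding P_def E_def by (intro peetre_least)
      then have "P powr (r - 1) * P \<le> P powr (r - 1) * (C * P powr (1 - r) * j)" by (intro mult_left_mono) auto
      also have "P powr (r - 1) * P = P powr r" using Pp by (simp add: powr_mult_base mult.commute)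
      also have "P powr (r - 1) * (C * P powr (1 - r) * j) = (P powr (r - 1) * P powr (1 - r)) * (C * j)" by (simp only: mult_ac)
      also have "P powr (r - 1) * P powr (1 - r) = 1" unfolding powr_add[symmetric] using Pp by simp
      finally show ?thesis using j C0 by (simp add: ennreal_mult[symmetric] ennreal_leI)
    qed
    also have "J = (\<integral>\<eta>. \<integral>y. ennreal (F (x + y) (\<xi> + \<eta>) powr r * exp (- r * (norm y + norm \<eta>))))"
      unfolding J_def \<Phi>_def E_def using F0 by (simp add: powr_mult exp_powr_real algebra_simps)
    finally show ?thesis by (simp add: P_def F_def)
  qed
  show ?thesis using C0 main by blast
qed

section \<open>Mixed quasi-norms\<close>

lemma epow_top [simp]: "epow top r = top"
  by (simp add: epow_def)

lemma epow_ennreal [simp]: "0 \<le> x \<Longrightarrow> epow (ennreal x) r = ennreal (x powr r)"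
  by (simp add: epow_def)

lemma epow_0 [simp]: "epow 0 r = 0"
  by (simp add: epow_def)

lemma epow_1 [simp]: "epow a 1 = a"
  by (cases a) (auto simp: epow_def)

lemma epow_mono: "0 \<le> r \<Longrightarrow> a \<le> b \<Longrightarrow> epow a r \<le> epow b r"
  by (cases a; cases b) (auto simp: ennreal_leI powr_mono2 top_unique)

lemma epow_eq_0_iff [simp]: "epow a r = 0 \<longleftrightarrow> a = 0"
  by (cases a) (auto simp: ennreal_eq_0_iff)

lemma epow_eq_top_iff [simp]: "epow a r = top \<longleftrightarrow> a = top"
  by (cases a) auto

text \<open>Valid for all real exponents, since \<open>powr\<close> fixes 0 and \<open>epow\<close>
  fixes top.\<close>

lemma epow_epow: "epow (epow a r) u = epow a (r * u)"
  by (cases a) (auto simp: powr_powr)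

lemma epow_inverse: "r \<noteq> 0 \<Longrightarrow> epow (epow a r) (1 / r) = a"
  by (simp add: epow_epow)

lemma epow_inverse': "r \<noteq> 0 \<Longrightarrow> epow (epow a (1 / r)) r = a"
  by (simp add: epow_epow)

lemma epow_mult: "epow (a * b) r = epow a r * epow b r"
proof (cases "a = top \<or> b = top")
  case True
  then show ?thesis by (cases "a = 0"; cases "b = 0") (auto simp: ennreal_mult_top ennreal_top_mult)
next
  case False
  then obtain x y where "a = ennreal x" "0 \<le> x" "b = ennreal y" "0 \<le> y"
    by (cases a; cases b) auto
  then show ?thesis by (simp add: ennreal_mult[symmetric] powr_mult)
qed

lemma epow_add: "0 \<le> r \<Longrightarrow> 0 \<le> u \<Longrightarrow> epow a (r + u) = epow a r * epow a u"
  by (cases a) (auto simp: powr_add ennreal_mult)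

lemma epow_le_iff: "0 < r \<Longrightarrow> epow a r \<le> epow b r \<longleftrightarrow> a \<le> b"
  using epow_mono[of r a b] epow_mono[of "1 / r" "epow a r" "epow b r"] by (auto simp: epow_inverse)

lemma epow_le_swap: "0 < r \<Longrightarrow> epow a r \<le> b \<Longrightarrow> a \<le> epow b (1 / r)"
  using epow_mono[of "1 / r" "epow a r" b] by (simp add: epow_inverse)

lemma epow_swap_le: "0 < r \<Longrightarrow> a \<le> epow b r \<Longrightarrow> epow a (1 / r) \<le> b"
  using epow_mono[of "1 / r" a "epow b r"] by (simp add: epow_inverse)

lemma measurable_epow [measurable (raw)]:
  assumes [measurable]: "f \<in> borel_measurable M"
  shows "(\<lambda>x. epow (f x) r) \<in> borel_measurable M"
  unfolding epow_def by measurable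

section \<open>Lebesgue quasi-norms, Hoelder's and Minkowski's inequalities\<close>

lemma Lnorm_PInf: "Lnorm M \<infinity> g = esssup M g"
  by (simp add: Lnorm_def)

lemma Lnorm_ereal: "Lnorm M (ereal p) g = epow (\<integral>\<^sup>+x. epow (g x) p \<partial>M) (1 / p)"
  by (simp add: Lnorm_def)

lemma ereal_pos_cases [consumes 1, case_names PInf real]:
  assumes "0 < (p::ereal)"
  obtains "p = \<infinity>" | p' where "p = ereal p'" "0 < p'"
  using assms by (cases p) auto

text \<open>The essential supremum exceeds a level exactly where the section does so on a set of
  positive measure, and that measure depends measurably on the point by Tonelli.\<close>

lemma measurable_esssup:
  fixes f :: "'a \<Rightarrow> 'b \<Rightarrow> ennreal"
  assumes N: "sigma_finite_measure N"
    and f [measurable]: "(\<lambda>(x, y). f x y) \<in> borel_measurable (X \<Otimes>\<^sub>M N)"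
  shows "(\<lambda>x. esssup N (f x)) \<in> borel_measurable X"
proof (rule borel_measurableI_greater)
  fix c :: ennreal
  interpret sigma_finite_measure N by fact
  have sec: "f x \<in> borel_measurable N" if "x \<in> space X" for x
    using measurable_Pair2[OF f that] by simp
  have "c < esssup N (f x) \<longleftrightarrow> 0 < (\<integral>\<^sup>+y. indicator {z. c < z} (f x y) \<partial>N)" if x: "x \<in> space X" for x
  proof -
    note [measurable] = sec[OF x]
    have e: "(\<integral>\<^sup>+y. indicator {z. c < z} (f x y) \<partial>N) = emeasure N {y \<in> space N. c < f x y}"
    proof -
      have "(\<integral>\<^sup>+y. indicator {z. c < z} (f x y) \<partial>N) = (\<integral>\<^sup>+y. indicator {y \<in> space N. c < f x y} y \<partial>N)"
        by (intro nn_integral_cong) (auto simp: indicator_def)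
      then show ?thesis by simp
    qed
    show ?thesis
    proof
      assume "c < esssup N (f x)"
      then show "0 < (\<integral>\<^sup>+y. indicator {z. c < z} (f x y) \<partial>N)"
        unfolding e by (rule esssup_pos_measure[OF sec[OF x]])
    next
      assume pos: "0 < (\<integral>\<^sup>+y. indicator {z. c < z} (f x y) \<partial>N)"
      show "c < esssup N (f x)"
      proof (rule ccontr)
        assume "\<not> c < esssup N (f x)"
        then have "AE y in N. f x y \<le> c" using esssup_AE[of "f x" N] by (auto elim: eventually_mono)
        then have "emeasure N {y \<in> space N. \<not> f x y \<le> c} = 0" by (subst (asm) AE_iff_measurable[OF _ refl]) auto
        then show False using pos unfolding e by (simp add: not_le)
      qed
    qed
  qed
  then have "{x \<in> space X. c < esssup N (f x)} = {x \<in> space X. 0 < (\<integral>\<^sup>+y. indicator {z. c < z} (f x y) \<partial>N)}"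
    by auto
  also have "\<dots> \<in> sets X"
  proof -
    have "(\<lambda>(x, y). indicator {z. c < z} (f x y) :: ennreal) \<in> borel_measurable (X \<Otimes>\<^sub>M N)" by measurable
    then have "(\<lambda>x. \<integral>\<^sup>+y. indicator {z. c < z} (f x y) \<partial>N) \<in> borel_measurable X"
      by (rule borel_measurable_nn_integral)
    then show ?thesis by measurable
  qed
  finally show "{x \<in> space X. c < esssup N (f x)} \<in> sets X" .
qed

lemma measurable_Lnorm:
  fixes f :: "'a \<Rightarrow> 'b \<Rightarrow> ennreal"
  assumes N: "sigma_finite_measure N" and p: "0 < p"
    and f [measurable]: "(\<lambda>(x, y). f x y) \<in> borel_measurable (X \<Otimes>\<^sub>M N)"
  shows "(\<lambda>x. Lnorm N p (f x)) \<in> borel_measurable X"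
  using p
proof (cases p rule: ereal_pos_cases)
  case PInf
  then show ?thesis using measurable_esssup[OF N f] by (simp add: Lnorm_PInf)
next
  case (real p')
  interpret sigma_finite_measure N by fact
  have "(\<lambda>(x, y). epow (f x y) p') \<in> borel_measurable (X \<Otimes>\<^sub>M N)" by measurable
  then have "(\<lambda>x. \<integral>\<^sup>+y. epow (f x y) p' \<partial>N) \<in> borel_measurable X" by (rule borel_measurable_nn_integral)
  then show ?thesis unfolding real Lnorm_ereal by measurable
qed

lemma Lnorm_AE_mono:
  assumes p: "0 < p" and [measurable]: "f \<in> borel_measurable M" and le: "AE x in M. f x \<le> g x"
  shows "Lnorm M p f \<le> Lnorm M p g"
  using p
proof (cases p rule: ereal_pos_cases)
  case PInf
  then show ?thesis using le by (simp add: Lnorm_PInf esssup_AE_mono)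
next
  case (real p')
  then show ?thesis unfolding real Lnorm_ereal using le
    by (intro epow_mono nn_integral_mono_AE) (auto elim: eventually_mono intro!: epow_mono)
qed

lemma Lnorm_mono:
  "0 < p \<Longrightarrow> f \<in> borel_measurable M \<Longrightarrow> (\<And>x. f x \<le> g x) \<Longrightarrow> Lnorm M p f \<le> Lnorm M p g"
  by (rule Lnorm_AE_mono) auto

lemma Lnorm_cmult_le:
  assumes p: "0 < p" and [measurable]: "f \<in> borel_measurable M"
  shows "Lnorm M p (\<lambda>x. c * f x) \<le> c * Lnorm M p f"
  using p
proof (cases p rule: ereal_pos_cases)
  case PInf
  have "AE x in M. c * f x \<le> c * esssup M f"
    using esssup_AE[of f M] by eventually_elim (rule mult_left_mono, auto)
  then show ?thesis unfolding PInf Lnorm_PInf by (intro esssup_I) auto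
next
  case (real p')
  have "(\<integral>\<^sup>+x. epow (c * f x) p' \<partial>M) = epow c p' * (\<integral>\<^sup>+x. epow (f x) p' \<partial>M)"
    unfolding epow_mult by (rule nn_integral_cmult) measurable
  then have "epow (\<integral>\<^sup>+x. epow (c * f x) p' \<partial>M) (1 / p') = epow (epow c p' * (\<integral>\<^sup>+x. epow (f x) p' \<partial>M)) (1 / p')"
    by (rule arg_cong)
  also have "\<dots> = c * epow (\<integral>\<^sup>+x. epow (f x) p' \<partial>M) (1 / p')"
    unfolding epow_mult using real by (simp add: epow_inverse)
  finally show ?thesis unfolding real Lnorm_ereal by simp
qed

lemma ereal_divide_PInf: "0 < r \<Longrightarrow> \<infinity> / ereal r = \<infinity>"
  by (simp add: divide_ereal_def)

text \<open>Reduces small exponents to exponents at least 1: for r not above p, the r-th power is a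
  norm with exponent p / r, where Minkowski's inequality holds.\<close>

lemma Lnorm_power:
  assumes p: "0 < p" and r: "0 < r" and f [measurable]: "f \<in> borel_measurable M"
  shows "epow (Lnorm M p f) r = Lnorm M (p / ereal r) (\<lambda>x. epow (f x) r)"
  using p
proof (cases p rule: ereal_pos_cases)
  case PInf
  have "esssup M (\<lambda>x. epow (f x) r) \<le> epow (esssup M f) r"
    using esssup_AE[of f M] r by (intro esssup_I) (auto elim!: eventually_mono intro: epow_mono)
  moreover have "esssup M f \<le> epow (esssup M (\<lambda>x. epow (f x) r)) (1 / r)"
    using esssup_AE[of "\<lambda>x. epow (f x) r" M] r by (intro esssup_I f) (auto elim!: eventually_mono intro: epow_le_swap)
  then have "epow (esssup M f) r \<le> epow (epow (esssup M (\<lambda>x. epow (f x) r)) (1 / r)) r" using r by (intro epow_mono) auto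
  then have "epow (esssup M f) r \<le> esssup M (\<lambda>x. epow (f x) r)" using r by (simp add: epow_inverse')
  ultimately show ?thesis unfolding PInf using r by (simp add: ereal_divide_PInf Lnorm_PInf)
next
  case (real p')
  have "ereal p' / ereal r = ereal (p' / r)" using r by simp
  then show ?thesis unfolding real using r real(2) by (simp add: Lnorm_ereal epow_epow)
qed

lemma Lnorm_shift:
  fixes f :: "real^'n::finite \<Rightarrow> ennreal"
  assumes p: "0 < p" and [measurable]: "f \<in> borel_measurable borel"
  shows "Lnorm lborel p (\<lambda>x. f (c + x)) = Lnorm lborel p f"
  using p
proof (cases p rule: ereal_pos_cases)
  case PInf
  have le: "Lnorm lborel \<infinity> (\<lambda>x. g (c + x)) \<le> Lnorm lborel \<infinity> g" if [measurable]: "g \<in> borel_measurable borel" for g :: "real^'n \<Rightarrow> ennreal" and c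
  proof -
    have "AE x in lborel. g x \<le> esssup lborel g" by (rule esssup_AE)
    then have "AE x in distr lborel borel ((+) c). g x \<le> esssup lborel g" unfolding lborel_distr_plus .
    then have "AE x in lborel. g (c + x) \<le> esssup lborel g" by (subst (asm) AE_distr_iff) auto
    then show ?thesis unfolding Lnorm_PInf by (intro esssup_I) auto
  qed
  show ?thesis unfolding PInf
  proof (rule antisym[OF le])
    have "Lnorm lborel \<infinity> (\<lambda>x. (\<lambda>x. f (c + x)) (- c + x)) \<le> Lnorm lborel \<infinity> (\<lambda>x. f (c + x))" by (rule le) measurable
    then show "Lnorm lborel \<infinity> f \<le> Lnorm lborel \<infinity> (\<lambda>x. f (c + x))" by simp
  qed measurable
next
  case (real p')
  then show ?thesis unfolding real Lnorm_ereal
    by (subst nn_integral_shift[of "\<lambda>x. epow (f x) p'" c]) auto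
qed

lemma nn_integral_Holder:
  fixes f g :: "'a \<Rightarrow> ennreal"
  assumes [measurable]: "f \<in> borel_measurable M" "g \<in> borel_measurable M"
    and pq: "1 < p" "1 < q" "1 / p + 1 / q = 1"
  shows "(\<integral>\<^sup>+x. f x * g x \<partial>M) \<le> epow (\<integral>\<^sup>+x. epow (f x) p \<partial>M) (1 / p) * epow (\<integral>\<^sup>+x. epow (g x) q \<partial>M) (1 / q)"
proof -
  let ?A = "\<integral>\<^sup>+x. epow (f x) p \<partial>M" and ?B = "\<integral>\<^sup>+x. epow (g x) q \<partial>M"
  consider "?A = 0" | "?B = 0" | "?A \<noteq> 0" "?B \<noteq> 0" "?A = top \<or> ?B = top" | "?A \<noteq> 0" "?B \<noteq> 0" "?A \<noteq> top" "?B \<noteq> top" by blast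
  then show ?thesis
  proof cases
    case 1
    then have "AE x in M. epow (f x) p = 0" by (subst (asm) nn_integral_0_iff_AE) auto
    then have "AE x in M. f x * g x = 0" by eventually_elim simp
    then have "(\<integral>\<^sup>+x. f x * g x \<partial>M) = 0" by (subst nn_integral_0_iff_AE) auto
    then show ?thesis by simp
  next
    case 2
    then have "AE x in M. epow (g x) q = 0" by (subst (asm) nn_integral_0_iff_AE) auto
    then have "AE x in M. f x * g x = 0" by eventually_elim simp
    then have "(\<integral>\<^sup>+x. f x * g x \<partial>M) = 0" by (subst nn_integral_0_iff_AE) auto
    then show ?thesis by simp
  next
    case 3
    then have "epow ?A (1 / p) * epow ?B (1 / q) = top"
      by (auto simp: ennreal_mult_top ennreal_top_mult)
    then show ?thesis by simp
  next
    case 4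
    define a where "a = enn2real (epow ?A (1 / p))"
    define b where "b = enn2real (epow ?B (1 / q))"
    have a: "epow ?A (1 / p) = ennreal a" "0 < a"
      unfolding a_def using 4 by (auto simp: enn2real_positive_iff less_top[symmetric] zero_less_iff_neq_zero)
    have b: "epow ?B (1 / q) = ennreal b" "0 < b"
      unfolding b_def using 4 by (auto simp: enn2real_positive_iff less_top[symmetric] zero_less_iff_neq_zero)
    have A: "?A = ennreal (a powr p)" using arg_cong[OF a(1), of "\<lambda>x. epow x p"] a(2) pq by (simp add: epow_inverse')
    have B: "?B = ennreal (b powr q)" using arg_cong[OF b(1), of "\<lambda>x. epow x q"] b(2) pq by (simp add: epow_inverse')
    \<comment> \<open>Coefficients of Young's inequality for u / a and v / b, multiplied by a b;
      after integration the two terms add up to a b.\<close>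
    define c1 where "c1 = a * b / p * a powr (- p)"
    define c2 where "c2 = a * b / q * b powr (- q)"
    have c: "0 < c1" "0 < c2" using a(2) b(2) pq by (auto simp: c1_def c2_def)
    have pt: "f x * g x \<le> ennreal c1 * epow (f x) p + ennreal c2 * epow (g x) q" for x
    proof (cases "f x = top \<or> g x = top")
      case True then show ?thesis using c by (auto simp: ennreal_mult_top)
    next
      case False
      then obtain u v where uv: "f x = ennreal u" "0 \<le> u" "g x = ennreal v" "0 \<le> v"
        by (cases "f x"; cases "g x") auto
      have "(u / a) * (v / b) \<le> (u / a) powr p / p + (v / b) powr q / q"
        using uv a(2) b(2) pq by (intro Youngs_inequality) auto
      then have "(a * b) * ((u / a) * (v / b)) \<le> (a * b) * ((u / a) powr p / p + (v / b) powr q / q)"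
        using a(2) b(2) by (intro mult_left_mono) auto
      then have "u * v \<le> c1 * u powr p + c2 * v powr q"
        using a(2) b(2) uv by (simp add: c1_def c2_def powr_divide powr_minus field_simps)
      then show ?thesis using uv c by (simp add: ennreal_mult[symmetric] ennreal_plus[symmetric] ennreal_leI del: ennreal_plus)
    qed
    have "(\<integral>\<^sup>+x. f x * g x \<partial>M) \<le> (\<integral>\<^sup>+x. ennreal c1 * epow (f x) p + ennreal c2 * epow (g x) q \<partial>M)"
      by (intro nn_integral_mono pt)
    also have "\<dots> = ennreal c1 * ?A + ennreal c2 * ?B"
      by (subst nn_integral_add) (auto simp: nn_integral_cmult)
    also have "\<dots> = ennreal (c1 * a powr p + c2 * b powr q)"
      unfolding A B using c by (simp add: ennreal_mult ennreal_plus)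
    also have "c1 * a powr p + c2 * b powr q = a * b * (1 / p + 1 / q)"
      using a(2) b(2) by (simp add: c1_def c2_def powr_minus field_simps)
    also have "\<dots> = a * b" unfolding pq by simp
    finally show ?thesis unfolding a(1) b(1) using a(2) b(2) by (simp add: ennreal_mult)
  qed
qed

text \<open>The left-hand side is truncated so that it is finite and can be divided out after
  Hoelder's inequality.\<close>

lemma Minkowski_integral_real:
  fixes f :: "'a::euclidean_space \<Rightarrow> 'b \<Rightarrow> ennreal"
  assumes N: "sigma_finite_measure N" and p: "1 \<le> p"
    and f [measurable]: "(\<lambda>(x, y). f x y) \<in> borel_measurable (borel \<Otimes>\<^sub>M N)"
  shows "Lnorm lborel (ereal p) (\<lambda>x. \<integral>\<^sup>+y. f x y \<partial>N) \<le> (\<integral>\<^sup>+y. Lnorm lborel (ereal p) (\<lambda>x. f x y) \<partial>N)"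
proof (cases "p = 1")
  interpret N: sigma_finite_measure N by fact
  interpret pair_sigma_finite lborel N ..
  have f' [measurable]: "(\<lambda>(x, y). f x y) \<in> borel_measurable (lborel \<Otimes>\<^sub>M N)"
    using f by (simp cong: measurable_cong_sets sets_pair_measure_cong)
  case True
  have "(\<integral>x. \<integral>\<^sup>+y. f x y \<partial>N) = (\<integral>\<^sup>+y. (\<integral>x. f x y) \<partial>N)"
    by (rule Fubini'[symmetric]) measurable
  then show ?thesis unfolding True Lnorm_ereal by simp
next
  interpret N: sigma_finite_measure N by fact
  interpret pair_sigma_finite lborel N ..
  have f' [measurable]: "(\<lambda>(x, y). f x y) \<in> borel_measurable (lborel \<Otimes>\<^sub>M N)"
    using f by (simp cong: measurable_cong_sets sets_pair_measure_cong)
  case False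
  then have p1: "1 < p" using p by simp
  define q where "q = p / (p - 1)"
  have q: "1 < q" "1 / p + 1 / q = 1" "(p - 1) * q = p" using p1 by (auto simp: q_def field_simps)
  define F where "F = (\<lambda>x. \<integral>\<^sup>+y. f x y \<partial>N)"
  have [measurable]: "F \<in> borel_measurable borel" unfolding F_def by measurable
  define A where "A = (\<integral>\<^sup>+y. Lnorm lborel (ereal p) (\<lambda>x. f x y) \<partial>N)"
  \<comment> \<open>Cut off in height and in space, so that the p-th power is integrable; the
    truncations increase to \<open>F\<close>.\<close>
  define T where "T = (\<lambda>k x. min (F x) (of_nat k) * indicator (ball 0 (real k)) x)"
  have [measurable]: "T k \<in> borel_measurable borel" for k
    unfolding T_def by (intro borel_measurable_times_ennreal borel_measurable_min borel_measurable_const borel_measurable_indicator) auto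
  have TF: "T k x \<le> F x" for k x by (auto simp: T_def indicator_def)
  have T_le: "(\<integral>x. epow (T k x) p) \<le> epow A p" for k
  proof -
    let ?X = "\<integral>x. epow (T k x) p"
    have "?X \<le> (\<integral>x. ennreal (real k powr p) * indicator (ball (0::'a) (real k)) x)"
    proof (intro nn_integral_mono)
      fix x :: 'a
      have "epow (T k x) p \<le> epow (of_nat k * indicator (ball 0 (real k)) x) p"
        using p1 by (intro epow_mono) (auto simp: T_def indicator_def)
      then show "epow (T k x) p \<le> ennreal (real k powr p) * indicator (ball 0 (real k)) x"
        by (auto simp: indicator_def ennreal_of_nat_eq_real_of_nat)
    qed
    also have "\<dots> < \<infinity>"
      using emeasure_bounded_finite[OF bounded_ball, of "0::'a" "real k"]
      by (subst nn_integral_cmult_indicator) (auto simp: ennreal_mult_less_top)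
    finally have Xf: "?X < \<infinity>" .
    show ?thesis
    proof (cases "?X = 0")
      case False
      have "?X \<le> (\<integral>x. \<integral>\<^sup>+y. f x y * epow (T k x) (p - 1) \<partial>N)"
      proof (intro nn_integral_mono)
        fix x
        have "epow (T k x) p = epow (T k x) 1 * epow (T k x) (p - 1)"
          using p1 by (subst epow_add[symmetric]) auto
        also have "\<dots> \<le> F x * epow (T k x) (p - 1)" using TF[of k x] by (intro mult_right_mono) auto
        also have "\<dots> = (\<integral>\<^sup>+y. f x y * epow (T k x) (p - 1) \<partial>N)"
          unfolding F_def by (rule nn_integral_multc[symmetric]) measurable
        finally show "epow (T k x) p \<le> (\<integral>\<^sup>+y. f x y * epow (T k x) (p - 1) \<partial>N)" .
      qed
      also have "\<dots> = (\<integral>\<^sup>+y. (\<integral>x. f x y * epow (T k x) (p - 1)) \<partial>N)"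
        by (rule Fubini'[symmetric]) measurable
      also have "\<dots> \<le> (\<integral>\<^sup>+y. Lnorm lborel (ereal p) (\<lambda>x. f x y) * epow ?X (1 / q) \<partial>N)"
      proof (intro nn_integral_mono)
        fix y assume y: "y \<in> space N"
        have [measurable]: "(\<lambda>x. f x y) \<in> borel_measurable borel" using measurable_Pair1[OF f y] by simp
        have "(\<integral>x. f x y * epow (T k x) (p - 1)) \<le> epow (\<integral>x. epow (f x y) p) (1 / p) * epow (\<integral>x. epow (epow (T k x) (p - 1)) q) (1 / q)"
          by (rule nn_integral_Holder) (use p1 q in auto)
        then show "(\<integral>x. f x y * epow (T k x) (p - 1)) \<le> Lnorm lborel (ereal p) (\<lambda>x. f x y) * epow ?X (1 / q)"
          unfolding Lnorm_ereal epow_epow q .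
      qed
      also have "\<dots> = A * epow ?X (1 / q)"
        unfolding A_def
      proof (rule nn_integral_multc)
        have "(\<lambda>(y, x). f x y) \<in> borel_measurable (N \<Otimes>\<^sub>M lborel)" using measurable_compose[OF measurable_pair_swap' f'] by (simp add: split_beta')
        then show "(\<lambda>y. Lnorm lborel (ereal p) (\<lambda>x. f x y)) \<in> borel_measurable N"
          using p1 by (intro measurable_Lnorm sigma_finite_lborel) auto
      qed
      finally have le: "?X \<le> A * epow ?X (1 / q)" .
      \<comment> \<open>\<open>X\<close> is positive and finite, so X <= A X^(1/q) may be divided by
        X^(1/q).\<close>
      obtain X where X: "?X = ennreal X" "0 < X" using False Xf by (cases "?X") (auto simp: zero_less_iff_neq_zero)
      have "epow ?X (1 / p) \<le> A"
      proof -
        have "?X * epow ?X (1 / p - 1) = epow ?X (1 / p)" using X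
          by (simp add: ennreal_mult[symmetric] powr_mult_base)
        moreover have "epow ?X (1 / q) * epow ?X (1 / p - 1) = 1"
        proof -
          have "1 / q + (1 / p - 1) = 0" using q(2) by simp
          then show ?thesis using X by (simp add: ennreal_mult[symmetric] powr_add[symmetric])
        qed
        moreover have "?X * epow ?X (1 / p - 1) \<le> A * epow ?X (1 / q) * epow ?X (1 / p - 1)" using le by (rule mult_right_mono) simp
        ultimately show ?thesis by (simp add: mult.assoc)
      qed
      then have "epow (epow ?X (1 / p)) p \<le> epow A p" using p1 by (intro epow_mono) auto
      then show ?thesis using p1 by (simp add: epow_inverse')
    qed simp
  qed
  \<comment> \<open>The truncations eventually reach every finite level up to \<open>F x\<close>, so
    Fatou's lemma removes them.\<close>
  have "(\<integral>x. epow (F x) p) \<le> (\<integral>x. liminf (\<lambda>k. epow (T k x) p))"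
  proof (intro nn_integral_mono)
    fix x
    show "epow (F x) p \<le> liminf (\<lambda>k. epow (T k x) p)"
    proof (cases "F x = top")
      case True
      have "\<forall>c. eventually (\<lambda>k. c \<le> T k x) sequentially \<or> c = top"
      proof
        fix c :: ennreal
        obtain k1 k2 :: nat where k: "c \<noteq> top \<Longrightarrow> c \<le> of_nat k1" "norm x < real k2"
          using reals_Archimedean2[of "norm x"] ennreal_Ex_less_of_nat[of c] by (metis less_top order_less_imp_le)
        have "c \<le> T k x" if "c \<noteq> top" "k \<ge> max k1 k2" for k
        proof -
          have "of_nat k1 \<le> (of_nat k :: ennreal)" using that by simp
          moreover have "norm x < real k" using that k(2) by (auto intro: order_less_le_trans)
          ultimately show ?thesis using k(1)[OF that(1)] by (auto simp: T_def True intro: order_trans)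
        qed
        then show "eventually (\<lambda>k. c \<le> T k x) sequentially \<or> c = top"
          unfolding eventually_sequentially by blast
      qed
      then have ev: "c < top \<Longrightarrow> eventually (\<lambda>k. c \<le> T k x) sequentially" for c by auto
      show ?thesis
      proof (rule ccontr)
        assume "\<not> ?thesis"
        then have l: "liminf (\<lambda>k. epow (T k x) p) < top" by (simp add: True not_le)
        obtain d where d: "liminf (\<lambda>k. epow (T k x) p) < d" "d < top" using dense[OF l] by blast
        have "epow d (1 / p) < top" using d(2) by (simp add: less_top[symmetric])
        from ev[OF this] have "eventually (\<lambda>k. d \<le> epow (T k x) p) sequentially"
        proof eventually_elim
          fix k assume "epow d (1 / p) \<le> T k x"
          then have "epow (epow d (1 / p)) p \<le> epow (T k x) p" using p1 by (intro epow_mono) auto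
          then show "d \<le> epow (T k x) p" using p1 by (simp add: epow_inverse')
        qed
        then have "d \<le> liminf (\<lambda>k. epow (T k x) p)" by (rule Liminf_bounded)
        then show False using d(1) by simp
      qed
    next
      case False
      obtain k1 k2 :: nat where k: "F x \<le> of_nat k1" "norm x < real k2"
        using reals_Archimedean2[of "norm x"] ennreal_Ex_less_of_nat[of "F x"] False by (metis less_top order_less_imp_le)
      have "epow (F x) p \<le> epow (T k x) p" if "k \<ge> max k1 k2" for k
      proof -
        have "of_nat k1 \<le> (of_nat k :: ennreal)" using that by simp
        moreover have "norm x < real k" using that k(2) by (auto intro: order_less_le_trans)
        ultimately show ?thesis using k(1) p1 by (intro epow_mono) (auto simp: T_def intro: order_trans)
      qed
      then show ?thesis by (intro Liminf_bounded) (use eventually_sequentially in blast)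
    qed
  qed
  also have "\<dots> \<le> liminf (\<lambda>k. (\<integral>x. epow (T k x) p))" by (rule nn_integral_liminf) measurable
  also have "\<dots> \<le> epow A p"
  proof -
    have "liminf (\<lambda>k. (\<integral>x. epow (T k x) p)) \<le> limsup (\<lambda>k. (\<integral>x. epow (T k x) p))" by (rule Liminf_le_Limsup) simp
    also have "\<dots> \<le> epow A p" by (rule Limsup_bounded) (use T_le in auto)
    finally show ?thesis .
  qed
  finally show ?thesis
    unfolding Lnorm_ereal F_def[symmetric] A_def[symmetric, unfolded Lnorm_ereal] using p1 by (intro epow_swap_le) auto
qed

lemma Minkowski_integral:
  fixes f :: "'a::euclidean_space \<Rightarrow> 'b \<Rightarrow> ennreal"
  assumes N: "sigma_finite_measure N" and p: "1 \<le> p"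
    and f [measurable]: "(\<lambda>(x, y). f x y) \<in> borel_measurable (borel \<Otimes>\<^sub>M N)"
  shows "Lnorm lborel p (\<lambda>x. \<integral>\<^sup>+y. f x y \<partial>N) \<le> (\<integral>\<^sup>+y. Lnorm lborel p (\<lambda>x. f x y) \<partial>N)"
proof (cases p)
  case (real p')
  then show ?thesis using Minkowski_integral_real[OF N _ f, of p'] p by simp
next
  case PInf
  interpret N: sigma_finite_measure N by fact
  interpret pair_sigma_finite lborel N ..
  have f' [measurable]: "(\<lambda>(x, y). f x y) \<in> borel_measurable (lborel \<Otimes>\<^sub>M N)"
    using f by (simp cong: measurable_cong_sets sets_pair_measure_cong)
  have fs: "(\<lambda>(y, x). f x y) \<in> borel_measurable (N \<Otimes>\<^sub>M lborel)" using measurable_compose[OF measurable_pair_swap' f'] by (simp add: split_beta')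
  have [measurable]: "(\<lambda>y. esssup lborel (\<lambda>x. f x y)) \<in> borel_measurable N"
    by (rule measurable_esssup[OF sigma_finite_lborel fs])
  \<comment> \<open>For p = \<infinity> the null set depends on \<open>y\<close>; exchanging the two
    quantifiers gives one null set in \<open>x\<close>, off which the bound holds for almost every
    \<open>y\<close>.\<close>
  have "AE y in N. AE x in lborel. f x y \<le> esssup lborel (\<lambda>x. f x y)" by (intro AE_I2 esssup_AE)
  then have "AE x in lborel. AE y in N. f x y \<le> esssup lborel (\<lambda>x. f x y)"
    by (subst AE_commute) measurable
  then have "AE x in lborel. (\<integral>\<^sup>+y. f x y \<partial>N) \<le> (\<integral>\<^sup>+y. esssup lborel (\<lambda>x. f x y) \<partial>N)"
    by eventually_elim (rule nn_integral_mono_AE)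
  then show ?thesis unfolding PInf Lnorm_PInf by (intro esssup_I) measurable
qed (use p in auto)

text \<open>The norm underlying \<open>Wnorm\<close>, for arbitrary functions on phase space, so
  that maximal functions, averages and single frequency shells can be measured with it.\<close>

definition mixed_norm :: "ereal \<Rightarrow> ereal \<Rightarrow> (real ^ 'n::finite \<Rightarrow> real ^ 'n \<Rightarrow> ennreal) \<Rightarrow> ennreal" where
  "mixed_norm p q \<Phi> = Lnorm lborel p (\<lambda>x. Lnorm lborel q (\<Phi> x))"

abbreviation jointly_measurable :: "(real ^ 'n::finite \<Rightarrow> real ^ 'n \<Rightarrow> ennreal) \<Rightarrow> bool" where
  "jointly_measurable \<Phi> \<equiv> (\<lambda>(x, \<xi>). \<Phi> x \<xi>) \<in> borel_measurable (borel \<Otimes>\<^sub>M borel)"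

section \<open>Mixed norms: measurability, powers, translations and convolutions\<close>

lemma jointly_measurable_lborel:
  fixes f :: "'a::euclidean_space \<Rightarrow> 'b::euclidean_space \<Rightarrow> ennreal"
  shows "(\<lambda>(x, \<xi>). f x \<xi>) \<in> borel_measurable (borel \<Otimes>\<^sub>M borel) \<Longrightarrow> (\<lambda>(x, \<xi>). f x \<xi>) \<in> borel_measurable (borel \<Otimes>\<^sub>M lborel)"
  by (simp cong: measurable_cong_sets sets_pair_measure_cong)

lemma measurable_section:
  assumes "jointly_measurable \<Phi>"
  shows "\<Phi> x \<in> borel_measurable borel"
  using measurable_Pair2[OF assms, of x] by simp

lemma measurable_inner_norm:
  assumes "0 < q" and "jointly_measurable \<Phi>"
  shows "(\<lambda>x. Lnorm lborel q (\<Phi> x)) \<in> borel_measurable borel"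
  by (rule measurable_Lnorm[OF sigma_finite_lborel assms(1) jointly_measurable_lborel[OF assms(2)]])

lemma ereal_ge_1_pos: "1 \<le> p \<Longrightarrow> 0 < (p::ereal)"
  using less_le_trans[of 0 1 p] by simp

lemma mixed_norm_mono:
  assumes "0 < p" "0 < q" "jointly_measurable \<Phi>" and "\<And>x \<xi>. \<Phi> x \<xi> \<le> \<Psi> x \<xi>"
  shows "mixed_norm p q \<Phi> \<le> mixed_norm p q \<Psi>"
  unfolding mixed_norm_def
  using measurable_section[OF assms(3)] measurable_inner_norm[OF assms(2,3)] assms(4)
  by (intro Lnorm_mono assms(1,2)) auto

lemma mixed_norm_cmult_le:
  assumes "0 < p" "0 < q" "jointly_measurable \<Phi>"
  shows "mixed_norm p q (\<lambda>x \<xi>. c * \<Phi> x \<xi>) \<le> c * mixed_norm p q \<Phi>"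
proof -
  note [measurable] = assms(3) measurable_section[OF assms(3)]
  have jm: "jointly_measurable (\<lambda>x \<xi>. c * \<Phi> x \<xi>)" by measurable
  have "mixed_norm p q (\<lambda>x \<xi>. c * \<Phi> x \<xi>) \<le> Lnorm lborel p (\<lambda>x. c * Lnorm lborel q (\<Phi> x))"
    unfolding mixed_norm_def
    using measurable_inner_norm[OF assms(2) jm]
    by (intro Lnorm_mono assms Lnorm_cmult_le) auto
  also have "\<dots> \<le> c * mixed_norm p q \<Phi>"
    unfolding mixed_norm_def
    using measurable_inner_norm[OF assms(2,3)] by (intro Lnorm_cmult_le assms) auto
  finally show ?thesis .
qed

lemma mixed_norm_power:
  assumes "0 < p" "0 < q" "0 < r" "jointly_measurable \<Phi>"
  shows "epow (mixed_norm p q \<Phi>) r = mixed_norm (p / ereal r) (q / ereal r) (\<lambda>x \<xi>. epow (\<Phi> x \<xi>) r)"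
proof -
  note [measurable] = measurable_section[OF assms(4)]
  have "epow (mixed_norm p q \<Phi>) r = Lnorm lborel (p / ereal r) (\<lambda>x. epow (Lnorm lborel q (\<Phi> x)) r)"
    unfolding mixed_norm_def
    by (rule Lnorm_power) (use assms measurable_inner_norm[OF assms(2,4)] in auto)
  also have "\<dots> = mixed_norm (p / ereal r) (q / ereal r) (\<lambda>x \<xi>. epow (\<Phi> x \<xi>) r)"
    unfolding mixed_norm_def by (subst Lnorm_power) (use assms in auto)
  finally show ?thesis .
qed

lemma mixed_norm_shift:
  assumes "0 < p" "0 < q" "jointly_measurable \<Phi>"
  shows "mixed_norm p q (\<lambda>x \<xi>. \<Phi> (a + x) (b + \<xi>)) = mixed_norm p q \<Phi>"
proof -
  have "mixed_norm p q (\<lambda>x \<xi>. \<Phi> (a + x) (b + \<xi>)) = Lnorm lborel p (\<lambda>x. Lnorm lborel q (\<Phi> (a + x)))"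
    unfolding mixed_norm_def
    by (subst Lnorm_shift) (auto intro: assms measurable_section[OF assms(3)])
  also have "\<dots> = mixed_norm p q \<Phi>"
    unfolding mixed_norm_def
    by (rule Lnorm_shift[OF assms(1) measurable_inner_norm[OF assms(2,3)]])
  finally show ?thesis .
qed

text \<open>Minkowski's inequality for the inner norm, then for the outer one. \<open>N\<close> will
  be Lebesgue measure for convolutions and counting measure for the sum over frequency
  shells.\<close>

lemma mixed_norm_Minkowski:
  fixes f :: "real^'n::finite \<Rightarrow> real^'n \<Rightarrow> 'b \<Rightarrow> ennreal"
  assumes N: "sigma_finite_measure N" and p: "1 \<le> p" "1 \<le> q"
    and f: "(\<lambda>(x, \<xi>, z). f x \<xi> z) \<in> borel_measurable (borel \<Otimes>\<^sub>M (borel \<Otimes>\<^sub>M N))"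
  shows "mixed_norm p q (\<lambda>x \<xi>. \<integral>\<^sup>+z. f x \<xi> z \<partial>N) \<le> (\<integral>\<^sup>+z. mixed_norm p q (\<lambda>x \<xi>. f x \<xi> z) \<partial>N)"
proof -
  interpret N: sigma_finite_measure N by fact
  have p0: "0 < p" "0 < q" using ereal_ge_1_pos p by auto
  have fx: "(\<lambda>(\<xi>, z). f x \<xi> z) \<in> borel_measurable (borel \<Otimes>\<^sub>M N)" for x
    using measurable_Pair2[OF f, of x] by simp
  have fp: "(\<lambda>((x, \<xi>), z). f x \<xi> z) \<in> borel_measurable ((borel \<Otimes>\<^sub>M borel) \<Otimes>\<^sub>M N)"
  proof -
    have "(\<lambda>w. (fst (fst w), snd (fst w), snd w)) \<in> ((borel \<Otimes>\<^sub>M borel) \<Otimes>\<^sub>M N) \<rightarrow>\<^sub>M (borel \<Otimes>\<^sub>M (borel \<Otimes>\<^sub>M N))" by measurable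
    from measurable_compose[OF this f] show ?thesis by (simp add: split_beta')
  qed
  have fl: "(\<lambda>((x, z), \<xi>). f x \<xi> z) \<in> borel_measurable ((borel \<Otimes>\<^sub>M N) \<Otimes>\<^sub>M lborel)"
  proof -
    have "(\<lambda>w. (fst (fst w), snd w, snd (fst w))) \<in> ((borel \<Otimes>\<^sub>M N) \<Otimes>\<^sub>M lborel) \<rightarrow>\<^sub>M (borel \<Otimes>\<^sub>M (borel \<Otimes>\<^sub>M N))" by measurable
    from measurable_compose[OF this f] show ?thesis by (simp add: split_beta')
  qed
  have jm: "jointly_measurable (\<lambda>x \<xi>. \<integral>\<^sup>+z. f x \<xi> z \<partial>N)"
    using N.borel_measurable_nn_integral_fst[OF fp] by (simp add: split_beta')
  have g: "(\<lambda>(x, z). Lnorm lborel q (\<lambda>\<xi>. f x \<xi> z)) \<in> borel_measurable (borel \<Otimes>\<^sub>M N)"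
  proof -
    have "(\<lambda>w. Lnorm lborel q (\<lambda>\<xi>. f (fst w) \<xi> (snd w))) \<in> borel_measurable (borel \<Otimes>\<^sub>M N)"
      by (rule measurable_Lnorm[OF sigma_finite_lborel p0(2)]) (use fl in \<open>simp add: split_beta'\<close>)
    then show ?thesis by (simp add: split_beta')
  qed
  have "mixed_norm p q (\<lambda>x \<xi>. \<integral>\<^sup>+z. f x \<xi> z \<partial>N) \<le> Lnorm lborel p (\<lambda>x. \<integral>\<^sup>+z. Lnorm lborel q (\<lambda>\<xi>. f x \<xi> z) \<partial>N)"
    unfolding mixed_norm_def
    using measurable_inner_norm[OF p0(2) jm]
    by (intro Lnorm_mono p0 Minkowski_integral[OF N p(2) fx]) auto
  also have "\<dots> \<le> (\<integral>\<^sup>+z. mixed_norm p q (\<lambda>x \<xi>. f x \<xi> z) \<partial>N)"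
    unfolding mixed_norm_def by (rule Minkowski_integral[OF N p(1) g])
  finally show ?thesis .
qed

text \<open>The maps \<open>A\<close> and \<open>B\<close> translate position and frequency
  separately, so averages over either variable are instances.\<close>

lemma mixed_norm_convolution:
  fixes \<Psi> :: "real^'n::finite \<Rightarrow> real^'n \<Rightarrow> ennreal" and k :: "real^'n \<Rightarrow> ennreal"
  assumes p: "1 \<le> p" "1 \<le> q" and \<Psi>: "jointly_measurable \<Psi>"
    and k [measurable]: "k \<in> borel_measurable borel"
    and AB [measurable]: "A \<in> borel \<rightarrow>\<^sub>M borel" "B \<in> borel \<rightarrow>\<^sub>M borel"
  shows "mixed_norm p q (\<lambda>x \<xi>. (\<integral>z. k z * \<Psi> (A z + x) (B z + \<xi>))) \<le> (\<integral>z. k z) * mixed_norm p q \<Psi>"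
proof -
  have p0: "0 < p" "0 < q" using ereal_ge_1_pos p by auto
  have s: "(\<lambda>(x, \<xi>, z). \<Psi> (A z + x) (B z + \<xi>)) \<in> borel_measurable (borel \<Otimes>\<^sub>M (borel \<Otimes>\<^sub>M lborel))"
  proof -
    have "(\<lambda>w. (A (snd (snd w)) + fst w, B (snd (snd w)) + fst (snd w))) \<in> (borel \<Otimes>\<^sub>M (borel \<Otimes>\<^sub>M lborel)) \<rightarrow>\<^sub>M (borel \<Otimes>\<^sub>M borel)" by measurable
    from measurable_compose[OF this \<Psi>] show ?thesis by (simp add: split_beta')
  qed
  have s2: "jointly_measurable (\<lambda>x \<xi>. \<Psi> (a + x) (b + \<xi>))" for a b
  proof -
    have "(\<lambda>w. (a + fst w, b + snd w)) \<in> (borel \<Otimes>\<^sub>M borel) \<rightarrow>\<^sub>M (borel \<Otimes>\<^sub>M borel)" by measurable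
    from measurable_compose[OF this \<Psi>] show ?thesis by (simp add: split_beta')
  qed
  have "mixed_norm p q (\<lambda>x \<xi>. (\<integral>z. k z * \<Psi> (A z + x) (B z + \<xi>)))
    \<le> (\<integral>z. mixed_norm p q (\<lambda>x \<xi>. k z * \<Psi> (A z + x) (B z + \<xi>)))"
  proof (rule mixed_norm_Minkowski[OF sigma_finite_lborel p])
    have "(\<lambda>w. k (snd (snd w))) \<in> borel_measurable (borel \<Otimes>\<^sub>M (borel \<Otimes>\<^sub>M lborel))" by measurable
    from borel_measurable_times_ennreal[OF this s[unfolded split_beta']]
    show "(\<lambda>(x, \<xi>, z). k z * \<Psi> (A z + x) (B z + \<xi>)) \<in> borel_measurable (borel \<Otimes>\<^sub>M (borel \<Otimes>\<^sub>M lborel))"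
      by (simp add: split_beta')
  qed
  also have "\<dots> \<le> (\<integral>z. k z * mixed_norm p q \<Psi>)"
    using mixed_norm_cmult_le[OF p0 s2] unfolding mixed_norm_shift[OF p0 \<Psi>] by (intro nn_integral_mono)
  also have "\<dots> = (\<integral>z. k z) * mixed_norm p q \<Psi>" by (rule nn_integral_multc) measurable
  finally show ?thesis .
qed

text \<open>The largest r <= 1 for which p / r and q / r are at least 1; the r-th power of the mixed
  quasi-norm is subadditive.\<close>

definition quasi_exponent :: "ereal \<Rightarrow> ereal \<Rightarrow> real" where
  "quasi_exponent p q = min (dotexp p) (dotexp q)"

lemma dotexp_pos: "0 < p \<Longrightarrow> 0 < dotexp p" and dotexp_le_1: "0 < p \<Longrightarrow> dotexp p \<le> 1"
  by (cases p; simp add: dotexp_def min_def one_ereal_def)+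

lemma dotexp_ereal: "0 < p \<Longrightarrow> dotexp (ereal p) = min 1 p"
  by (simp add: dotexp_def min_def one_ereal_def)

lemma dotexp_PInf [simp]: "dotexp \<infinity> = 1"
  by (simp add: dotexp_def min_def one_ereal_def)

lemma divide_dotexp_ge_1:
  assumes "0 < p" and "0 < r" and "r \<le> dotexp p"
  shows "1 \<le> p / ereal r"
  using assms(1)
proof (cases p rule: ereal_pos_cases)
  case PInf then show ?thesis using assms(2) by (simp add: ereal_divide_PInf)
next
  case (real p')
  then show ?thesis using assms by (simp add: dotexp_ereal one_ereal_def)
qed

text \<open>After taking r-th powers, r = \<open>quasi_exponent p q\<close>,
  \<open>peetre_power_bound\<close> reads as a convolution inequality for exponents at least 1, to
  which Minkowski's inequality applies.\<close>

lemma mixed_norm_peetre: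
  fixes \<delta> :: real
  assumes p: "0 < p" "0 < q" and \<delta>: "0 \<le> \<delta>"
  shows "\<exists>C>0. \<forall>h::real^'n::finite \<Rightarrow> complex. integrable lborel h \<longrightarrow>
    mixed_norm p q (\<lambda>x \<xi>. ennreal (peetre_max (freq_stft h) x \<xi> * jbr \<xi> powr \<delta>))
      \<le> ennreal C * mixed_norm p q (\<lambda>x \<xi>. ennreal (freq_stft h x \<xi> * jbr \<xi> powr \<delta>))"
proof -
  define r where "r = quasi_exponent p q"
  have r: "0 < r" "r \<le> 1" "r \<le> dotexp p" "r \<le> dotexp q"
    using dotexp_pos[OF p(1)] dotexp_pos[OF p(2)] dotexp_le_1[OF p(1)] by (auto simp: r_def quasi_exponent_def)
  have P: "1 \<le> p / ereal r" "1 \<le> q / ereal r" using divide_dotexp_ge_1 p r by auto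
  have P0: "0 < p / ereal r" "0 < q / ereal r" using ereal_ge_1_pos P by auto
  obtain c where c: "c > 0" "\<And>h::real^'n \<Rightarrow> complex. \<And>x \<xi>. integrable lborel h \<Longrightarrow>
    ennreal (peetre_max (freq_stft h) x \<xi> powr r) \<le> ennreal c * (\<integral>\<eta>. \<integral>y. ennreal (freq_stft h (x + y) (\<xi> + \<eta>) powr r * exp (- r * (norm y + norm \<eta>))))"
    using peetre_power_bound[OF r(1,2)] by blast
  \<comment> \<open>\<open>k1\<close> averages in position and \<open>k2\<close> in frequency;
    \<open>k2\<close> also carries the cost <\<eta>>^(\<delta> r) of moving the weight
    <\<xi>>^\<delta> to the shifted frequency.\<close>
  define k1 where "k1 = (\<lambda>y::real^'n. ennreal (exp (- r * norm y)))"
  define k2 where "k2 = (\<lambda>\<eta>::real^'n. ennreal (2 powr (\<delta> * r) * (jbr \<eta> powr (\<delta> * r) * exp (- r * norm \<eta>))))"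
  have [measurable]: "k1 \<in> borel_measurable borel" "k2 \<in> borel_measurable borel" unfolding k1_def k2_def by measurable
  obtain d where d: "d > 0" "\<And>x::real^'n. exp (- r * norm x) \<le> d * jbr x powr (- (\<delta> * r + real CARD('n) + 1))"
    using exp_le_jbr_powr[OF r(1)] by blast
  have k1f: "(\<integral>y. k1 y) < \<infinity>"
    unfolding k1_def using integrable_exp_norm[OF r(1), where 'n='n] by (simp add: nn_integral_eq_integral)
  have k2f: "(\<integral>y. k2 y) < \<infinity>"
  proof -
    have i: "integrable lborel (\<lambda>\<eta>::real^'n. (2 powr (\<delta> * r) * d) * jbr \<eta> powr (- (real CARD('n) + 1)))"
      by (intro integrable_mult_right integrable_jbr_powr) simp
    have "(\<integral>y. k2 y) \<le> (\<integral>(\<eta>::real^'n). ennreal ((2 powr (\<delta> * r) * d) * jbr \<eta> powr (- (real CARD('n) + 1))))"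
      unfolding k2_def
    proof (intro nn_integral_mono ennreal_leI)
      fix \<eta> :: "real^'n"
      have "2 powr (\<delta> * r) * (jbr \<eta> powr (\<delta> * r) * exp (- r * norm \<eta>)) \<le> 2 powr (\<delta> * r) * (jbr \<eta> powr (\<delta> * r) * (d * jbr \<eta> powr (- (\<delta> * r + real CARD('n) + 1))))"
        by (intro mult_left_mono d(2)) auto
      also have "\<dots> = (2 powr (\<delta> * r) * d) * (jbr \<eta> powr (\<delta> * r) * jbr \<eta> powr (- (\<delta> * r + real CARD('n) + 1)))" by (simp only: mult_ac)
      also have "\<dots> = (2 powr (\<delta> * r) * d) * jbr \<eta> powr (- (real CARD('n) + 1))"
        unfolding powr_add[symmetric] by simp
      finally show "2 powr (\<delta> * r) * (jbr \<eta> powr (\<delta> * r) * exp (- r * norm \<eta>)) \<le> (2 powr (\<delta> * r) * d) * jbr \<eta> powr (- (real CARD('n) + 1))" .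
    qed
    also have "\<dots> < \<infinity>" using d(1) by (subst nn_integral_eq_integral[OF i]) auto
    finally show ?thesis .
  qed
  define K where "K = ennreal c * ((\<integral>y. k2 y) * (\<integral>y. k1 y))"
  have Kf: "K < \<infinity>" unfolding K_def using k1f k2f by (auto simp: ennreal_mult_less_top less_top)
  define D where "D = enn2real (epow K (1 / r)) + 1"
  have D: "epow K (1 / r) \<le> ennreal D"
  proof -
    have "epow K (1 / r) < top" using Kf by (simp add: less_top[symmetric])
    then have "epow K (1 / r) = ennreal (enn2real (epow K (1 / r)))" by simp
    also have "\<dots> \<le> ennreal D" unfolding D_def by (intro ennreal_leI) simp
    finally show ?thesis .
  qed
  have "mixed_norm p q (\<lambda>x \<xi>. ennreal (peetre_max (freq_stft h) x \<xi> * jbr \<xi> powr \<delta>))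
      \<le> ennreal D * mixed_norm p q (\<lambda>x \<xi>. ennreal (freq_stft h x \<xi> * jbr \<xi> powr \<delta>))"
    if h: "integrable lborel h" for h :: "real^'n \<Rightarrow> complex"
  proof -
    have hm [measurable]: "h \<in> borel_measurable borel" using h by (auto dest: borel_measurable_integrable)
    define F where "F = freq_stft h"
    define G where "G = peetre_max F"
    have Fm [measurable]: "(\<lambda>(x, \<xi>). F x \<xi>) \<in> borel_measurable (borel \<Otimes>\<^sub>M borel)" unfolding F_def by measurable
    interpret bounded_nonneg F "LINT \<eta>|lborel. norm (h \<eta>)"
      by standard (auto simp: F_def freq_stft_bounded[OF h])
    have Gm [measurable]: "(\<lambda>(x, \<xi>). G x \<xi>) \<in> borel_measurable (borel \<Otimes>\<^sub>M borel)" unfolding G_def by measurable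
    define \<Psi> where "\<Psi> = (\<lambda>x \<xi>. epow (ennreal (F x \<xi> * jbr \<xi> powr \<delta>)) r)"
    have \<Psi>m [measurable]: "jointly_measurable \<Psi>" unfolding \<Psi>_def by measurable
    have jF: "jointly_measurable (\<lambda>x \<xi>. ennreal (F x \<xi> * jbr \<xi> powr \<delta>))" by measurable
    have jG: "jointly_measurable (\<lambda>x \<xi>. ennreal (G x \<xi> * jbr \<xi> powr \<delta>))" by measurable
    define \<Psi>1 where "\<Psi>1 = (\<lambda>x \<xi>. (\<integral>y. k1 y * \<Psi> (y + x) (0 + \<xi>)))"
    have \<Psi>1m [measurable]: "jointly_measurable \<Psi>1" unfolding \<Psi>1_def by measurable
    have pt: "epow (ennreal (G x \<xi> * jbr \<xi> powr \<delta>)) r \<le> ennreal c * (\<integral>\<eta>. k2 \<eta> * \<Psi>1 (0 + x) (\<eta> + \<xi>))" for x \<xi>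
    proof -
      have "epow (ennreal (G x \<xi> * jbr \<xi> powr \<delta>)) r = ennreal (jbr \<xi> powr (\<delta> * r)) * ennreal (G x \<xi> powr r)"
      proof -
        have nn: "0 \<le> G x \<xi> * jbr \<xi> powr \<delta>" using peetre_nonneg[of x \<xi>] by (simp add: G_def)
        show ?thesis unfolding epow_ennreal[OF nn]
          using peetre_nonneg[of x \<xi>] by (simp add: G_def powr_mult powr_powr ennreal_mult mult.commute)
      qed
      also have "\<dots> \<le> ennreal (jbr \<xi> powr (\<delta> * r)) * (ennreal c * (\<integral>\<eta>. \<integral>y. ennreal (F (x + y) (\<xi> + \<eta>) powr r * exp (- r * (norm y + norm \<eta>)))))"
        unfolding G_def F_def by (intro mult_left_mono c(2) h) simp
      also have "\<dots> = ennreal c * (\<integral>\<eta>. \<integral>y. ennreal (jbr \<xi> powr (\<delta> * r)) * ennreal (F (x + y) (\<xi> + \<eta>) powr r * exp (- r * (norm y + norm \<eta>))))"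
      proof -
        have "(\<integral>\<eta>. \<integral>y. ennreal (jbr \<xi> powr (\<delta> * r)) * ennreal (F (x + y) (\<xi> + \<eta>) powr r * exp (- r * (norm y + norm \<eta>))))
          = (\<integral>\<eta>. ennreal (jbr \<xi> powr (\<delta> * r)) * (\<integral>y. ennreal (F (x + y) (\<xi> + \<eta>) powr r * exp (- r * (norm y + norm \<eta>)))))"
          by (intro nn_integral_cong nn_integral_cmult) measurable
        also have "\<dots> = ennreal (jbr \<xi> powr (\<delta> * r)) * (\<integral>\<eta>. \<integral>y. ennreal (F (x + y) (\<xi> + \<eta>) powr r * exp (- r * (norm y + norm \<eta>))))"
          by (rule nn_integral_cmult) measurable
        finally show ?thesis by (simp only: mult_ac)
      qed
      also have "\<dots> \<le> ennreal c * (\<integral>\<eta>. \<integral>y. k2 \<eta> * (k1 y * \<Psi> (y + x) (0 + (\<eta> + \<xi>))))"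
      proof (intro mult_left_mono nn_integral_mono)
        fix \<eta> y :: "real^'n"
        let ?f = "F (x + y) (\<xi> + \<eta>)"
        have "jbr \<xi> powr (\<delta> * r) = jbr ((\<xi> + \<eta>) + (- \<eta>)) powr (\<delta> * r)" by simp
        also have "\<dots> \<le> 2 powr (\<delta> * r) * jbr (\<xi> + \<eta>) powr (\<delta> * r) * jbr (- \<eta>) powr (\<delta> * r)"
          using \<delta> r by (intro jbr_powr_add_pos) auto
        finally have w: "jbr \<xi> powr (\<delta> * r) \<le> 2 powr (\<delta> * r) * jbr (\<xi> + \<eta>) powr (\<delta> * r) * jbr \<eta> powr (\<delta> * r)" by simp
        have ex: "exp (- r * (norm y + norm \<eta>)) = exp (- r * norm y) * exp (- r * norm \<eta>)"
          unfolding exp_add[symmetric] by (simp add: algebra_simps)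
        have "jbr \<xi> powr (\<delta> * r) * (?f powr r * exp (- r * (norm y + norm \<eta>)))
          \<le> (2 powr (\<delta> * r) * jbr (\<xi> + \<eta>) powr (\<delta> * r) * jbr \<eta> powr (\<delta> * r)) * (?f powr r * exp (- r * (norm y + norm \<eta>)))"
          by (intro mult_right_mono w) auto
        also have "\<dots> = (2 powr (\<delta> * r) * (jbr \<eta> powr (\<delta> * r) * exp (- r * norm \<eta>))) * (exp (- r * norm y) * (?f * jbr (\<xi> + \<eta>) powr \<delta>) powr r)"
          unfolding ex using F0 by (simp add: powr_mult powr_powr mult_ac)
        finally have "ennreal (jbr \<xi> powr (\<delta> * r) * (?f powr r * exp (- r * (norm y + norm \<eta>))))
           \<le> ennreal ((2 powr (\<delta> * r) * (jbr \<eta> powr (\<delta> * r) * exp (- r * norm \<eta>))) * (exp (- r * norm y) * (?f * jbr (\<xi> + \<eta>) powr \<delta>) powr r))"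
          by (rule ennreal_leI)
        also have "\<dots> = k2 \<eta> * (k1 y * \<Psi> (y + x) (0 + (\<eta> + \<xi>)))"
          using F0 by (simp add: k1_def k2_def \<Psi>_def ennreal_mult[symmetric] add.commute)
        finally show "ennreal (jbr \<xi> powr (\<delta> * r)) * ennreal (?f powr r * exp (- r * (norm y + norm \<eta>))) \<le> k2 \<eta> * (k1 y * \<Psi> (y + x) (0 + (\<eta> + \<xi>)))"
          by (simp add: ennreal_mult)
      qed simp
      also have "(\<integral>\<eta>. \<integral>y. k2 \<eta> * (k1 y * \<Psi> (y + x) (0 + (\<eta> + \<xi>)))) = (\<integral>\<eta>. k2 \<eta> * \<Psi>1 (0 + x) (\<eta> + \<xi>))"
      proof (intro nn_integral_cong)
        fix \<eta> :: "real^'n"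
        have m: "(\<lambda>y. k1 y * \<Psi> (y + x) (0 + (\<eta> + \<xi>))) \<in> borel_measurable lborel" by measurable
        show "(\<integral>y. k2 \<eta> * (k1 y * \<Psi> (y + x) (0 + (\<eta> + \<xi>)))) = k2 \<eta> * \<Psi>1 (0 + x) (\<eta> + \<xi>)"
          unfolding \<Psi>1_def nn_integral_cmult[OF m] by simp
      qed
      finally show ?thesis .
    qed
    have "epow (mixed_norm p q (\<lambda>x \<xi>. ennreal (G x \<xi> * jbr \<xi> powr \<delta>))) r
        = mixed_norm (p / ereal r) (q / ereal r) (\<lambda>x \<xi>. epow (ennreal (G x \<xi> * jbr \<xi> powr \<delta>)) r)"
      by (rule mixed_norm_power[OF p r(1) jG])
    also have "\<dots> \<le> mixed_norm (p / ereal r) (q / ereal r) (\<lambda>x \<xi>. ennreal c * (\<integral>\<eta>. k2 \<eta> * \<Psi>1 (0 + x) (\<eta> + \<xi>)))"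
      by (rule mixed_norm_mono[OF P0 _ pt]) measurable
    also have "\<dots> \<le> ennreal c * mixed_norm (p / ereal r) (q / ereal r) (\<lambda>x \<xi>. (\<integral>\<eta>. k2 \<eta> * \<Psi>1 (0 + x) (\<eta> + \<xi>)))"
      by (rule mixed_norm_cmult_le[OF P0]) measurable
    also have "\<dots> \<le> ennreal c * ((\<integral>y. k2 y) * mixed_norm (p / ereal r) (q / ereal r) \<Psi>1)"
      by (intro mult_left_mono mixed_norm_convolution[OF P \<Psi>1m]) measurable
    also have "\<dots> \<le> ennreal c * ((\<integral>y. k2 y) * ((\<integral>y. k1 y) * mixed_norm (p / ereal r) (q / ereal r) \<Psi>))"
      unfolding \<Psi>1_def by (intro mult_left_mono mixed_norm_convolution[OF P \<Psi>m]) measurable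
    also have "\<dots> = K * mixed_norm (p / ereal r) (q / ereal r) \<Psi>" by (simp add: K_def mult_ac)
    also have "\<dots> = K * epow (mixed_norm p q (\<lambda>x \<xi>. ennreal (F x \<xi> * jbr \<xi> powr \<delta>))) r"
      unfolding \<Psi>_def by (subst mixed_norm_power[OF p r(1) jF]) simp
    finally have "mixed_norm p q (\<lambda>x \<xi>. ennreal (G x \<xi> * jbr \<xi> powr \<delta>)) \<le> epow (K * epow (mixed_norm p q (\<lambda>x \<xi>. ennreal (F x \<xi> * jbr \<xi> powr \<delta>))) r) (1 / r)"
      by (rule epow_le_swap[OF r(1)])
    also have "\<dots> = epow K (1 / r) * mixed_norm p q (\<lambda>x \<xi>. ennreal (F x \<xi> * jbr \<xi> powr \<delta>))"
      unfolding epow_mult using r(1) by (simp add: epow_inverse)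
    also have "\<dots> \<le> ennreal D * mixed_norm p q (\<lambda>x \<xi>. ennreal (F x \<xi> * jbr \<xi> powr \<delta>))" by (intro mult_right_mono D) simp
    finally show ?thesis by (simp add: F_def G_def)
  qed
  moreover have "0 < D" unfolding D_def by (simp add: add_nonneg_pos)
  ultimately show ?thesis by blast
qed

text \<open>Removes the frequency average left by \<open>freq_stft_mult_bound\<close>: from \<xi> +
  \<tau> to \<xi> the kernel changes by a power of <\<tau>> and the maximal function by exp
  |\<tau>|, and the Gaussian in \<tau> absorbs both.\<close>

lemma freq_stft_phase_bound:
  fixes \<mu> :: "real ^ 'n::finite \<Rightarrow> real"
  assumes \<mu>: "continuous_on UNIV \<mu>" and t: "real CARD('n) < t" "t \<le> t'" and s: "0 \<le> s"
    and lip: "\<And>x y. norm (phase_velocity \<mu> x - phase_velocity \<mu> y) \<le> La * norm (x - y)" and La: "0 \<le> La"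
    and Ck: "0 < Ck" and K: "\<And>w y. norm (fourier (\<lambda>z. cis (\<mu> (w + z)) * cgau pi z) y) \<le> Ck * phase_kernel \<mu> s t t' w y"
  shows "\<exists>C>0. \<forall>h::real^'n \<Rightarrow> complex. integrable lborel h \<longrightarrow> (\<forall>x \<xi>.
    ennreal (freq_stft (\<lambda>\<eta>. cis (\<mu> \<eta>) * h \<eta>) x \<xi>)
      \<le> ennreal C * (\<integral>y. ennreal (phase_kernel \<mu> s t t' \<xi> y * peetre_max (freq_stft h) (x + y) \<xi>)))"
proof -
  define \<kappa> where "\<kappa> = phase_kernel \<mu> s t t'"
  have \<kappa>0: "0 \<le> \<kappa> w y" for w y by (simp add: \<kappa>_def)
  have [measurable]: "\<kappa> w \<in> borel_measurable borel" for w by (simp add: \<kappa>_def)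
  have t0: "0 \<le> t" using t by linarith
  define Mx where "Mx = t + s * (t' - t)"
  define cm where "cm = 2 powr t * (1 + La) powr t * 2 powr (s * (t' - t))"
  have \<kappa>shift: "\<kappa> (w + \<tau>) x \<le> cm * jbr \<tau> powr Mx * \<kappa> w x" for w \<tau> x
    unfolding \<kappa>_def Mx_def cm_def by (rule phase_kernel_shift_freq[OF t0 t(2) s lip La])
  have cm0: "0 \<le> cm" by (simp add: cm_def)
  obtain c2 where c2: "c2 > 0" "\<And>\<tau>::real^'n. gau pi \<tau> \<le> c2 * exp (- 1 * norm \<tau>)"
    using gau_le_exp[of pi 1] by auto
  have Mc: "continuous_on UNIV (\<lambda>\<eta>. cis (\<mu> \<eta>))"
    by (intro continuous_on_compose2[OF continuous_on_cis] \<mu>) auto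
  \<comment> \<open>The convolution theorem asks for an integrable transform of the windowed e^{i
    \<mu>}; the kernel bound of order t > n supplies it.\<close>
  have Ki: "integrable lborel (fourier (\<lambda>z. cis (\<mu> (w + z)) * cgau pi z))" for w
  proof (rule Bochner_Integration.integrable_bound)
    have "integrable lborel (\<lambda>y::real^'n. jbr (- phase_velocity \<mu> w + y) powr (- t))"
      by (rule integrable_shift[OF integrable_jbr_powr[OF t(1)]])
    then show "integrable lborel (\<lambda>y::real^'n. Ck * jbr (y - phase_velocity \<mu> w) powr (- t))"
      by (intro integrable_mult_right) simp
    have "integrable lborel (\<lambda>z. cis (\<mu> (w + z)) * cgau pi z)"
      by (rule integrable_bounded_gau[where B = 1 and b = 0])
         (auto intro!: borel_measurable_continuous_onI continuous_on_compose2[OF continuous_on_cis] continuous_on_compose2[OF \<mu>] continuous_intros)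
    then show "fourier (\<lambda>z. cis (\<mu> (w + z)) * cgau pi z) \<in> borel_measurable lborel"
      by (auto intro: borel_measurable_continuous_onI continuous_on_fourier)
    show "AE y in lborel. norm (fourier (\<lambda>z. cis (\<mu> (w + z)) * cgau pi z) y) \<le> norm (Ck * jbr (y - phase_velocity \<mu> w) powr (- t))"
    proof (intro AE_I2)
      fix y
      have "norm (fourier (\<lambda>z. cis (\<mu> (w + z)) * cgau pi z) y) \<le> Ck * jbr (y - phase_velocity \<mu> w) powr (- t)"
        by (rule order_trans[OF K mult_left_mono[OF phase_kernel_le[OF t(2)]]]) (use Ck in simp)
      then show "norm (fourier (\<lambda>z. cis (\<mu> (w + z)) * cgau pi z) y) \<le> norm (Ck * jbr (y - phase_velocity \<mu> w) powr (- t))"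
        using Ck by simp
    qed
  qed
  define J where "J = (LINT z|(lborel::(real^'n) measure). jbr z powr Mx * gau pi z)"
  have J0: "0 \<le> J" unfolding J_def by (intro Bochner_Integration.integral_nonneg) auto
  have Ji: "(\<integral>\<tau>. ennreal (jbr (\<tau>::real^'n) powr Mx * gau pi \<tau>)) = ennreal J"
    unfolding J_def by (intro nn_integral_eq_integral integrable_jbr_gau) auto
  define D where "D = Ck * cm * c2"
  have D0: "0 \<le> D" unfolding D_def using Ck cm0 c2(1) by simp
  define C where "C = 2 ^ CARD('n) * (D * J) + 1"
  have main: "ennreal (freq_stft (\<lambda>\<eta>. cis (\<mu> \<eta>) * h \<eta>) x \<xi>) \<le> ennreal C * (\<integral>y. ennreal (\<kappa> \<xi> y * peetre_max (freq_stft h) (x + y) \<xi>))"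
    if h: "integrable lborel h" for h :: "real^'n \<Rightarrow> complex" and x \<xi>
  proof -
    have hm [measurable]: "h \<in> borel_measurable borel" using h by (auto dest: borel_measurable_integrable)
    define F where "F = freq_stft h"
    interpret bounded_nonneg F "LINT \<eta>|lborel. norm (h \<eta>)"
      by standard (auto simp: F_def freq_stft_bounded[OF h])
    define G where "G = peetre_max F"
    have Gm: "(\<lambda>(x, \<xi>). G x \<xi>) \<in> borel_measurable (borel \<Otimes>\<^sub>M borel)" unfolding G_def by measurable
    have Gx [measurable]: "(\<lambda>y. G (x + y) \<xi>) \<in> borel_measurable borel"
    proof -
      have "(\<lambda>y. (x + y, \<xi>)) \<in> borel \<rightarrow>\<^sub>M (borel \<Otimes>\<^sub>M borel)" by measurable
      from measurable_compose[OF this Gm] show ?thesis by simp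
    qed
    have G0: "0 \<le> G x \<xi>" for x \<xi> unfolding G_def by (rule peetre_nonneg)
    let ?I = "\<integral>y. ennreal (\<kappa> \<xi> y * G (x + y) \<xi>)"
    have "ennreal (freq_stft (\<lambda>\<eta>. cis (\<mu> \<eta>) * h \<eta>) x \<xi>)
      \<le> 2 ^ CARD('n) * (\<integral>(\<tau>::real^'n). \<integral>y. ennreal (gau (2 * pi) \<tau> * ((Ck * \<kappa> (\<xi> + \<tau>) y) * freq_stft h (x + y) (\<xi> + \<tau>))))"
      by (rule freq_stft_mult_bound[OF h Mc _ Ki]) (auto simp: K[folded \<kappa>_def])
    also have "\<dots> \<le> 2 ^ CARD('n) * (\<integral>(\<tau>::real^'n). \<integral>y. ennreal (D * (jbr \<tau> powr Mx * gau pi \<tau>)) * ennreal (\<kappa> \<xi> y * G (x + y) \<xi>))"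
    proof (intro mult_left_mono nn_integral_mono)
      fix \<tau> y :: "real^'n"
      \<comment> \<open>\<open>gau (2 * pi)\<close> is split in two: one copy of
        \<open>gau pi\<close> cancels exp |\<tau>|, the other remains to be integrated against
        <\<tau>>^Mx.\<close>
      have g: "gau (2 * pi) \<tau> \<le> c2 * exp (- norm \<tau>) * gau pi \<tau>"
      proof -
        have "gau (2 * pi) \<tau> = gau pi \<tau> * gau pi \<tau>" unfolding exp_add[symmetric] by simp
        also have "\<dots> \<le> (c2 * exp (- 1 * norm \<tau>)) * gau pi \<tau>" by (intro mult_right_mono c2(2)) simp
        finally show ?thesis by simp
      qed
      have f: "F (x + y) (\<xi> + \<tau>) \<le> exp (norm \<tau>) * G (x + y) \<xi>"
        using le_peetre[of "x + y" "\<xi> + \<tau>" "x + y" \<xi>] by (simp add: G_def)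
      have A: "(Ck * \<kappa> (\<xi> + \<tau>) y) * F (x + y) (\<xi> + \<tau>) \<le> (Ck * (cm * jbr \<tau> powr Mx * \<kappa> \<xi> y)) * (exp (norm \<tau>) * G (x + y) \<xi>)"
        using Ck cm0 \<kappa>0 F0 by (intro mult_mono mult_left_mono \<kappa>shift f) auto
      have "gau (2 * pi) \<tau> * ((Ck * \<kappa> (\<xi> + \<tau>) y) * F (x + y) (\<xi> + \<tau>))
        \<le> (c2 * exp (- norm \<tau>) * gau pi \<tau>) * ((Ck * (cm * jbr \<tau> powr Mx * \<kappa> \<xi> y)) * (exp (norm \<tau>) * G (x + y) \<xi>))"
        by (rule mult_mono[OF g A]) (use Ck \<kappa>0 F0 c2(1) in auto)
      also have "\<dots> = (exp (- norm \<tau>) * exp (norm \<tau>)) * ((D * (jbr \<tau> powr Mx * gau pi \<tau>)) * (\<kappa> \<xi> y * G (x + y) \<xi>))"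
        by (simp only: D_def mult_ac)
      also have "\<dots> = (D * (jbr \<tau> powr Mx * gau pi \<tau>)) * (\<kappa> \<xi> y * G (x + y) \<xi>)" by (simp add: exp_add[symmetric])
      finally show "ennreal (gau (2 * pi) \<tau> * ((Ck * \<kappa> (\<xi> + \<tau>) y) * freq_stft h (x + y) (\<xi> + \<tau>))) \<le> ennreal (D * (jbr \<tau> powr Mx * gau pi \<tau>)) * ennreal (\<kappa> \<xi> y * G (x + y) \<xi>)"
        unfolding F_def using D0 \<kappa>0 G0 by (subst ennreal_mult[symmetric]) (auto intro: ennreal_leI)
    qed simp
    also have "(\<integral>(\<tau>::real^'n). \<integral>y. ennreal (D * (jbr \<tau> powr Mx * gau pi \<tau>)) * ennreal (\<kappa> \<xi> y * G (x + y) \<xi>))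
       = (\<integral>\<tau>. ennreal D * ennreal (jbr (\<tau>::real^'n) powr Mx * gau pi \<tau>) * ?I)"
      using D0 by (intro nn_integral_cong, subst nn_integral_cmult) (auto simp: ennreal_mult)
    also have "\<dots> = ennreal D * ennreal J * ?I"
      by (simp add: nn_integral_multc nn_integral_cmult Ji)
    also have "2 ^ CARD('n) * (ennreal D * ennreal J * ?I) = ennreal (2 ^ CARD('n) * (D * J)) * ?I"
      using D0 J0 by (simp add: ennreal_mult ennreal_power[symmetric] mult_ac)
    also have "\<dots> \<le> ennreal C * ?I" unfolding C_def by (intro mult_right_mono ennreal_leI) auto
    finally show ?thesis by (simp add: G_def F_def)
  qed
  have "0 < C" unfolding C_def using D0 J0 by (simp add: add_nonneg_pos)
  then show ?thesis using main unfolding \<kappa>_def by blast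
qed

lemma epow_one [simp]: "epow 1 r = 1"
  by (simp add: epow_def)

section \<open>Averages of slowly varying functions\<close>

text \<open>Comparability on balls of radius 1. It is what survives of the smoothness of the window
  in the remaining estimates, and it lets integrals behave like sums over unit cells.\<close>

definition slowly_varying :: "real \<Rightarrow> (real ^ 'n::finite \<Rightarrow> ennreal) \<Rightarrow> bool" where
  "slowly_varying B h \<longleftrightarrow> (\<forall>z z'. norm (z - z') < 1 \<longrightarrow> h z' \<le> ennreal B * h z)"

lemma slowly_varyingD: "slowly_varying B h \<Longrightarrow> norm (z - z') < 1 \<Longrightarrow> h z' \<le> ennreal B * h z"
  by (auto simp: slowly_varying_def)

lemma slowly_varying_epow:
  fixes h :: "real ^ 'n::finite \<Rightarrow> ennreal"
  assumes "slowly_varying B h" and "0 \<le> B" and "0 \<le> r"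
  shows "slowly_varying (B powr r) (\<lambda>x. epow (h x) r)"
  unfolding slowly_varying_def
proof (intro allI impI)
  fix z z' :: "real^'n" assume "norm (z - z') < 1"
  then have "epow (h z') r \<le> epow (ennreal B * h z) r"
    by (intro epow_mono slowly_varyingD[OF assms(1)] assms(3))
  then show "epow (h z') r \<le> ennreal (B powr r) * epow (h z) r"
    unfolding epow_mult using assms(2) by simp
qed

lemma slowly_varying_mult:
  fixes h k :: "real ^ 'n::finite \<Rightarrow> ennreal"
  assumes "slowly_varying B h" and "slowly_varying B' k" and "0 \<le> B" and "0 \<le> B'"
  shows "slowly_varying (B * B') (\<lambda>x. h x * k x)"
  unfolding slowly_varying_def
proof (intro allI impI)
  fix z z' :: "real^'n" assume "norm (z - z') < 1"
  then have "h z' * k z' \<le> (ennreal B * h z) * (ennreal B' * k z)"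
    by (intro mult_mono slowly_varyingD[OF assms(1)] slowly_varyingD[OF assms(2)]) auto
  then show "h z' * k z' \<le> ennreal (B * B') * (h z * k z)"
    using assms(3,4) by (simp add: ennreal_mult mult_ac)
qed

lemma slowly_varying_shift:
  "slowly_varying B h \<Longrightarrow> slowly_varying B (\<lambda>y. h (x + y))"
  unfolding slowly_varying_def by (metis add_diff_cancel_left)

lemma slowly_varying_jbr:
  assumes "0 \<le> t"
  shows "slowly_varying (4 powr t) (\<lambda>y::real^'n::finite. ennreal (jbr (y - a) powr (- t)))"
  unfolding slowly_varying_def
proof (intro allI impI)
  fix z z' :: "real^'n" assume z: "norm (z - z') < 1"
  have "jbr (z' - a) powr (- t) = jbr ((z - a) + (z' - z)) powr (- t)" by simp
  also have "\<dots> \<le> 2 powr t * jbr (z - a) powr (- t) * jbr (z' - z) powr t" by (rule jbr_powr_add[OF assms])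
  also have "\<dots> \<le> 2 powr t * jbr (z - a) powr (- t) * 2 powr t"
  proof (intro mult_left_mono powr_mono2 assms)
    show "jbr (z' - z) \<le> 2" using jbr_le_norm[of "z' - z"] z by (simp add: norm_minus_commute)
  qed auto
  also have "\<dots> = 4 powr t * jbr (z - a) powr (- t)"
    using powr_mult[of 2 2 t] by simp
  finally show "ennreal (jbr (z' - a) powr (- t)) \<le> ennreal (4 powr t) * ennreal (jbr (z - a) powr (- t))"
    by (simp add: ennreal_mult[symmetric] ennreal_leI)
qed

text \<open>The value at \<open>z\<close> is compared with the mean over the unit ball around
  \<open>z\<close>.\<close>

lemma slowly_varying_pointwise:
  fixes h :: "real ^ 'n::finite \<Rightarrow> ennreal"
  assumes h [measurable]: "h \<in> borel_measurable borel" and sv: "slowly_varying B h" and B: "0 \<le> B"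
    and S': "ball z 1 \<subseteq> S'" "S' \<in> sets borel" and r: "0 \<le> r"
  shows "epow (h z) r \<le> ennreal (B powr r / unit_ball_vol (real CARD('n))) * (\<integral>y. epow (h y) r * indicator S' y)"
proof -
  define v where "v = unit_ball_vol (real CARD('n))"
  have v: "0 < v" unfolding v_def by (rule unit_ball_vol_pos) simp
  have e: "emeasure lborel (ball z 1) = ennreal v" unfolding v_def by (subst emeasure_ball) auto
  have sv': "slowly_varying (B powr r) (\<lambda>x. epow (h x) r)" by (rule slowly_varying_epow[OF sv B r])
  note S'(2) [measurable]
  have "ennreal v * epow (h z) r = (\<integral>y. epow (h z) r * indicator (ball z 1) y)"
    by (subst nn_integral_cmult_indicator) (auto simp: e mult.commute)
  also have "\<dots> \<le> (\<integral>y. ennreal (B powr r) * (epow (h y) r * indicator S' y))"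
  proof (intro nn_integral_mono)
    fix y
    show "epow (h z) r * indicator (ball z 1) y \<le> ennreal (B powr r) * (epow (h y) r * indicator S' y)"
    proof (cases "y \<in> ball z 1")
      case True
      then have "norm (y - z) < 1" "y \<in> S'" using S' by (auto simp: dist_norm norm_minus_commute)
      then show ?thesis using slowly_varyingD[OF sv', of y z] True by simp
    qed simp
  qed
  also have "\<dots> = ennreal (B powr r) * (\<integral>y. epow (h y) r * indicator S' y)"
    by (rule nn_integral_cmult) measurable
  finally have "ennreal (1 / v) * (ennreal v * epow (h z) r) \<le> ennreal (1 / v) * (ennreal (B powr r) * (\<integral>y. epow (h y) r * indicator S' y))"
    by (rule mult_left_mono) simp
  moreover have "ennreal (1 / v) * (ennreal v * epow (h z) r) = epow (h z) r"
    using v by (simp add: mult.assoc[symmetric] ennreal_mult[symmetric])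
  moreover have "ennreal (1 / v) * (ennreal (B powr r) * X) = ennreal (B powr r / v) * X" for X
    using v by (simp add: mult.assoc[symmetric] ennreal_mult[symmetric])
  ultimately show ?thesis by (simp add: v_def)
qed

text \<open>The inclusion of l^r in l^1, r <= 1, in continuous form: h = h^r h^(1 - r), and the
  second factor is bounded through \<open>slowly_varying_pointwise\<close> by the integral of h^r.
  That bound consumes the unit collar around \<open>S\<close>.\<close>

lemma slowly_varying_embedding:
  fixes h :: "real ^ 'n::finite \<Rightarrow> ennreal"
  assumes h [measurable]: "h \<in> borel_measurable borel" and sv: "slowly_varying B h" and B: "0 \<le> B"
    and S': "\<And>z. z \<in> S \<Longrightarrow> ball z 1 \<subseteq> S'" and S: "S \<in> sets borel" "S' \<in> sets borel" and r: "0 < r" "r \<le> 1"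
  shows "epow (\<integral>y. h y * indicator S y) r
    \<le> epow (ennreal (B powr r / unit_ball_vol (real CARD('n)))) (1 - r) * (\<integral>y. epow (h y) r * indicator S' y)"
proof -
  define c where "c = ennreal (B powr r / unit_ball_vol (real CARD('n)))"
  define J where "J = (\<integral>y. epow (h y) r * indicator S' y)"
  note S [measurable]
  have SS': "S \<subseteq> S'" using S' by force
  have "(\<integral>y. h y * indicator S y) \<le> (\<integral>y. epow (c * J) ((1 - r) / r) * (epow (h y) r * indicator S' y))"
  proof (intro nn_integral_mono)
    fix y
    show "h y * indicator S y \<le> epow (c * J) ((1 - r) / r) * (epow (h y) r * indicator S' y)"
    proof (cases "y \<in> S")
      case True
      have "h y = epow (h y) r * epow (h y) (1 - r)" using r epow_add[of r "1 - r" "h y"] by simp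
      also have "epow (h y) (1 - r) = epow (epow (h y) r) ((1 - r) / r)" using r by (simp add: epow_epow)
      also have "\<dots> \<le> epow (c * J) ((1 - r) / r)"
        unfolding c_def J_def using r by (intro epow_mono slowly_varying_pointwise[OF h sv B S'[OF True] S(2)]) auto
      finally have "h y \<le> epow (h y) r * epow (c * J) ((1 - r) / r)" by (simp add: mult_left_mono)
      then show ?thesis using True SS' by (auto simp: mult.commute)
    qed simp
  qed
  also have "\<dots> = epow (c * J) ((1 - r) / r) * J"
    unfolding J_def by (rule nn_integral_cmult) measurable
  finally have "epow (\<integral>y. h y * indicator S y) r \<le> epow (epow (c * J) ((1 - r) / r) * J) r"
    using r by (intro epow_mono) auto
  also have "\<dots> = epow c (1 - r) * (epow J (1 - r) * epow J r)"
    using r by (simp add: epow_mult epow_epow mult_ac)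
  also have "epow J (1 - r) * epow J r = J" using r epow_add[of "1 - r" r J] by simp
  finally show ?thesis by (simp add: c_def J_def)
qed

text \<open>For p >= 1 this is Hoelder's inequality with the kernel as a finite measure. For p < 1
  the embedding puts the power p on the kernel too and lowers its order to t p. Both cases give the
  order t min(1, p), which must exceed n.\<close>

lemma kernel_power_bound:
  fixes t p :: real
  assumes p: "0 < p" and t: "real CARD('n) < t * min 1 p" and B: "0 \<le> B"
  shows "\<exists>C>0. \<forall>(h::real^'n::finite \<Rightarrow> ennreal) a S S'.
    h \<in> borel_measurable borel \<longrightarrow> slowly_varying B h \<longrightarrow> S \<in> sets borel \<longrightarrow> S' \<in> sets borel \<longrightarrow> (\<forall>z\<in>S. ball z 1 \<subseteq> S') \<longrightarrow>
    epow (\<integral>y. ennreal (jbr (y - a) powr (- t)) * h y * indicator S y) p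
      \<le> ennreal C * (\<integral>y. ennreal (jbr (y - a) powr (- (t * min 1 p))) * epow (h y) p * indicator S' y)"
proof (cases "p < 1")
  case True
  have t0: "0 \<le> t" using t p True by (simp add: min_def zero_le_mult_iff)
       (metis less_le_not_le linorder_not_le mult_nonpos_nonneg of_nat_0_le_iff order_less_imp_le order_trans)
  define B' where "B' = 4 powr t * B"
  have B'0: "0 \<le> B'" using B by (simp add: B'_def)
  define C where "C = (B' powr p / unit_ball_vol (real CARD('n))) powr (1 - p) + 1"
  have "epow (\<integral>y. ennreal (jbr (y - a) powr (- t)) * h y * indicator S y) p
      \<le> ennreal C * (\<integral>y. ennreal (jbr (y - a) powr (- (t * min 1 p))) * epow (h y) p * indicator S' y)"
    if h [measurable]: "h \<in> borel_measurable borel" and sv: "slowly_varying B h" and S: "S \<in> sets borel" "S' \<in> sets borel"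
      and SS': "\<forall>z\<in>S. ball z 1 \<subseteq> S'" for h :: "real^'n \<Rightarrow> ennreal" and a S S'
  proof -
    have "epow (\<integral>y. ennreal (jbr (y - a) powr (- t)) * h y * indicator S y) p
      \<le> epow (ennreal (B' powr p / unit_ball_vol (real CARD('n)))) (1 - p) * (\<integral>y. epow (ennreal (jbr (y - a) powr (- t)) * h y) p * indicator S' y)"
      using SS' B'0 p True S unfolding B'_def
      by (intro slowly_varying_embedding slowly_varying_mult slowly_varying_jbr t0 sv B) auto
    also have "epow (ennreal (B' powr p / unit_ball_vol (real CARD('n)))) (1 - p) \<le> ennreal C"
      using B'0 by (subst epow_ennreal) (auto simp: C_def intro!: ennreal_leI divide_nonneg_nonneg)
    also have "(\<lambda>y. epow (ennreal (jbr (y - a) powr (- t)) * h y) p * indicator S' y) = (\<lambda>y. ennreal (jbr (y - a) powr (- (t * min 1 p))) * epow (h y) p * indicator S' y)"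
      using True by (simp add: epow_mult powr_powr)
    finally show ?thesis by (simp add: mult_right_mono)
  qed
  moreover have "0 < C" by (simp add: C_def add_nonneg_pos)
  ultimately show ?thesis by blast
next
  case False
  then have mp: "min 1 p = 1" by simp
  then have t': "real CARD('n) < t" using t by simp
  define I where "I = (LINT x|(lborel::(real^'n) measure). jbr x powr (- t))"
  have I0: "0 \<le> I" by (simp add: I_def)
  have Ia: "(\<integral>y. ennreal (jbr (y - a) powr (- t))) = ennreal I" for a :: "real^'n"
    using nn_integral_shift[of "\<lambda>y. ennreal (jbr y powr (- t))" "- a"] nn_integral_jbr_powr_eq[OF t'] by (simp add: I_def)
  define C where "C = I powr (p - 1) + 1"
  have "epow (\<integral>y. ennreal (jbr (y - a) powr (- t)) * h y * indicator S y) p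
      \<le> ennreal C * (\<integral>y. ennreal (jbr (y - a) powr (- (t * min 1 p))) * epow (h y) p * indicator S' y)"
    if h [measurable]: "h \<in> borel_measurable borel" and sv: "slowly_varying B h" and S: "S \<in> sets borel" "S' \<in> sets borel"
      and SS': "\<forall>z\<in>S. ball z 1 \<subseteq> S'" for h :: "real^'n \<Rightarrow> ennreal" and a S S'
  proof -
    note S [measurable]
    have SS: "S \<subseteq> S'" using SS' by force
    define k where "k = (\<lambda>y. ennreal (jbr (y - a) powr (- t)))"
    have km [measurable]: "k \<in> borel_measurable borel" unfolding k_def by measurable
    have mon: "(\<integral>y. k y * epow (h y) p * indicator S y) \<le> (\<integral>y. k y * epow (h y) p * indicator S' y)"
      using SS by (intro nn_integral_mono) (auto simp: indicator_def)
    have "epow (\<integral>y. k y * h y * indicator S y) p \<le> ennreal C * (\<integral>y. k y * epow (h y) p * indicator S' y)"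
    proof (cases "p = 1")
      case True
      have "(1::ennreal) \<le> ennreal C" by (simp add: C_def)
      then show ?thesis using mon mult_right_mono[of 1 "ennreal C" "\<integral>y. k y * h y * indicator S' y"] unfolding True by simp
    next
      case False
      then have p1: "1 < p" using \<open>\<not> p < 1\<close> by simp
      define q where "q = p / (p - 1)"
      have q: "1 < q" "1 / q + 1 / p = 1" "p / q = p - 1" using p1 by (auto simp: q_def field_simps)
      have "(\<integral>y. k y * h y * indicator S y) = (\<integral>y. epow (k y) (1 / q) * (epow (k y) (1 / p) * h y * indicator S y))"
      proof (intro nn_integral_cong)
        fix y
        have "k y = epow (k y) (1 / q) * epow (k y) (1 / p)" using p1 q epow_add[of "1 / q" "1 / p" "k y"] by simp
        then show "k y * h y * indicator S y = epow (k y) (1 / q) * (epow (k y) (1 / p) * h y * indicator S y)" by (metis mult.assoc)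
      qed
      also have "\<dots> \<le> epow (\<integral>y. epow (epow (k y) (1 / q)) q) (1 / q) * epow (\<integral>y. epow (epow (k y) (1 / p) * h y * indicator S y) p) (1 / p)"
        by (rule nn_integral_Holder) (use p1 q in auto)
      also have "(\<lambda>y. epow (epow (k y) (1 / q)) q) = k" using q by (simp add: epow_inverse')
      also have "(\<lambda>y. epow (epow (k y) (1 / p) * h y * indicator S y) p) = (\<lambda>y. k y * epow (h y) p * indicator S y)"
      proof
        fix y
        show "epow (epow (k y) (1 / p) * h y * indicator S y) p = k y * epow (h y) p * indicator S y"
          using p1 by (cases "y \<in> S") (simp_all add: epow_mult epow_inverse')
      qed
      finally have "epow (\<integral>y. k y * h y * indicator S y) p
        \<le> epow (epow (integral\<^sup>N lborel k) (1 / q) * epow (\<integral>y. k y * epow (h y) p * indicator S y) (1 / p)) p"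
        using p1 by (intro epow_mono) auto
      also have "\<dots> = epow (integral\<^sup>N lborel k) (p - 1) * (\<integral>y. k y * epow (h y) p * indicator S y)"
        unfolding epow_mult using p1 q by (simp add: epow_epow)
      also have "integral\<^sup>N lborel k = ennreal I" unfolding k_def by (rule Ia)
      also have "epow (ennreal I) (p - 1) \<le> ennreal C" using I0 by (simp add: C_def ennreal_leI)
      finally show ?thesis using mon by (meson mult_left_mono mult_right_mono order_trans zero_le)
    qed
    then show ?thesis unfolding k_def mp by simp
  qed
  moreover have "0 < C" by (simp add: C_def add_nonneg_pos)
  ultimately show ?thesis by blast
qed

text \<open>Integrating the local inequality over all centres \<open>z\<close> turns each side into
  the full integral times a ball volume; 4^n is the ratio of the volumes.\<close>

lemma ball_average:
  fixes f g :: "real ^ 'n::finite \<Rightarrow> ennreal"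
  assumes [measurable]: "f \<in> borel_measurable borel" "g \<in> borel_measurable borel" and R: "0 < R"
    and le: "\<And>z. (\<integral>x. f x * indicator (ball z R) x) \<le> D * (\<integral>x. g x * indicator (ball z (4 * R)) x)"
  shows "(\<integral>x. f x) \<le> 4 ^ CARD('n) * D * (\<integral>x. g x)"
proof -
  let ?v = "unit_ball_vol (real CARD('n))"
  have v: "0 < ?v" by (rule unit_ball_vol_pos) simp
  have avg: "(\<integral>z. \<integral>x. f x * indicator (ball z r) x) = ennreal (?v * r ^ CARD('n)) * (\<integral>x. f x)"
    if [measurable]: "f \<in> borel_measurable borel" and r: "0 < r" for f :: "real^'n \<Rightarrow> ennreal" and r
  proof -
    have i: "indicator (ball z r) x = (indicator {u. u < r} (norm (x - z)) :: ennreal)" for x z :: "real^'n"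
      by (simp add: indicator_def dist_norm norm_minus_commute)
    have "(\<integral>z. \<integral>x. f x * indicator (ball z r) x) = (\<integral>x. \<integral>z. f x * indicator {u. u < r} (norm (x - z)))"
      unfolding i by (rule lborel_pair.Fubini') measurable
    also have "\<dots> = (\<integral>x. f x * ennreal (?v * r ^ CARD('n)))"
    proof (intro nn_integral_cong)
      fix x
      have "(\<integral>z. f x * indicator {u. u < r} (norm (x - z))) = (\<integral>z. f x * indicator (ball x r) z)"
        by (intro nn_integral_cong) (simp add: indicator_def dist_norm)
      also have "\<dots> = f x * ennreal (?v * r ^ CARD('n))"
        using r by (subst nn_integral_cmult_indicator) (auto simp: emeasure_ball)
      finally show "(\<integral>z. f x * indicator {u. u < r} (norm (x - z))) = f x * ennreal (?v * r ^ CARD('n))" .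
    qed
    also have "\<dots> = ennreal (?v * r ^ CARD('n)) * (\<integral>x. f x)"
      by (subst nn_integral_multc) (auto simp: mult.commute)
    finally show ?thesis .
  qed
  define w where "w = ?v * R ^ CARD('n)"
  have w: "0 < w" using v R by (simp add: w_def)
  have gm: "(\<lambda>z. (\<integral>x. g x * indicator (ball z (4 * R)) x)) \<in> borel_measurable borel"
  proof -
    have i: "indicator (ball z (4 * R)) x = (indicator {u. u < 4 * R} (norm (x - z)) :: ennreal)" for x z :: "real^'n"
      by (simp add: indicator_def dist_norm norm_minus_commute)
    show ?thesis unfolding i by measurable
  qed
  have "ennreal w * (\<integral>x. f x) \<le> (\<integral>z. D * (\<integral>x. g x * indicator (ball z (4 * R)) x))"
    unfolding w_def by (subst avg[OF _ R, symmetric]) (auto intro!: nn_integral_mono le)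
  also have "\<dots> = D * (ennreal (?v * (4 * R) ^ CARD('n)) * (\<integral>x. g x))"
    using gm R by (subst nn_integral_cmult) (auto simp: avg)
  also have "\<dots> = ennreal w * (4 ^ CARD('n) * D * (\<integral>x. g x))"
    using v R by (simp add: w_def power_mult_distrib ennreal_mult ennreal_power[symmetric] mult_ac)
  finally have "ennreal (1 / w) * (ennreal w * (\<integral>x. f x)) \<le> ennreal (1 / w) * (ennreal w * (4 ^ CARD('n) * D * (\<integral>x. g x)))"
    by (rule mult_left_mono) simp
  moreover have "ennreal (1 / w) * (ennreal w * X) = X" for X
    using w by (simp add: mult.assoc[symmetric] ennreal_mult[symmetric])
  ultimately show ?thesis by simp
qed

text \<open>The part of the kernel average with displacement at most \<open>R\<close>;
  \<open>a\<close> is the centre of the kernel, later the stationary point.\<close>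

definition local_smear :: "real ^ 'n::finite \<Rightarrow> real \<Rightarrow> real \<Rightarrow> (real ^ 'n \<Rightarrow> ennreal) \<Rightarrow> real ^ 'n \<Rightarrow> ennreal" where
  "local_smear a t R h x = (\<integral>y. ennreal (jbr (y - a) powr (- t)) * h (x + y) * indicator {u. u \<le> R} (norm y))"

lemma local_smear_jm:
  fixes \<Gamma> :: "real ^ 'n::finite \<Rightarrow> real ^ 'n \<Rightarrow> ennreal"
  assumes \<Gamma>: "jointly_measurable \<Gamma>" and a [measurable]: "a \<in> borel \<rightarrow>\<^sub>M borel"
  shows "jointly_measurable (\<lambda>x \<xi>. local_smear (a \<xi>) t R (\<lambda>x. \<Gamma> x \<xi>) x)"
proof -
  have 1: "(\<lambda>w::((real^'n) \<times> (real^'n)) \<times> (real^'n). \<Gamma> (fst (fst w) + snd w) (snd (fst w))) \<in> borel_measurable ((borel \<Otimes>\<^sub>M borel) \<Otimes>\<^sub>M lborel)"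
  proof -
    have "(\<lambda>w::((real^'n) \<times> (real^'n)) \<times> (real^'n). (fst (fst w) + snd w, snd (fst w))) \<in> ((borel \<Otimes>\<^sub>M borel) \<Otimes>\<^sub>M lborel) \<rightarrow>\<^sub>M (borel \<Otimes>\<^sub>M borel)" by measurable
    from measurable_compose[OF this \<Gamma>] show ?thesis by simp
  qed
  have 2: "(\<lambda>w::((real^'n) \<times> (real^'n)) \<times> (real^'n). ennreal (jbr (snd w - a (snd (fst w))) powr (- t))) \<in> borel_measurable ((borel \<Otimes>\<^sub>M borel) \<Otimes>\<^sub>M lborel)"
    by measurable
  have 3: "(\<lambda>w::((real^'n) \<times> (real^'n)) \<times> (real^'n). indicator {u. u \<le> R} (norm (snd w)) :: ennreal) \<in> borel_measurable ((borel \<Otimes>\<^sub>M borel) \<Otimes>\<^sub>M lborel)"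
    by measurable
  have "(\<lambda>w. (\<integral>y. ennreal (jbr (y - a (snd w)) powr (- t)) * \<Gamma> (fst w + y) (snd w) * indicator {u. u \<le> R} (norm y))) \<in> borel_measurable (borel \<Otimes>\<^sub>M borel)"
    using borel_measurable_times_ennreal[OF borel_measurable_times_ennreal[OF 2 1] 3]
    by (intro sigma_finite_measure.borel_measurable_nn_integral[OF sigma_finite_lborel]) (simp add: split_beta')
  then show ?thesis by (simp add: local_smear_def split_beta')
qed

lemma kernel_integral:
  fixes a :: "real^'n::finite"
  assumes "real CARD('n) < t"
  shows "(\<integral>y. ennreal (jbr (y - a) powr (- t))) = ennreal (LINT x|(lborel::(real^'n) measure). jbr x powr (- t))"
  using nn_integral_shift[of "\<lambda>y. ennreal (jbr y powr (- t))" "- a"] nn_integral_jbr_powr_eq[OF assms] by simp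

text \<open>Balls are rewritten as conditions on a norm, a form in which joint measurability in
  centre and point is found automatically.\<close>

lemma indicator_cball_norm: "indicator (cball 0 R) y = indicator {u. u \<le> R} (norm y)"
  by (simp add: indicator_def)

lemma indicator_ball_dist: "indicator (ball z R) y = indicator {u. u < R} (norm (y - z))"
  by (simp add: indicator_def dist_norm norm_minus_commute)

lemma indicator_ball_norm: "indicator (ball 0 R) y = indicator {u. u < R} (norm y)"
  by (simp add: indicator_def)

lemma ball_subset_2:
  fixes z :: "real^'n::finite"
  assumes "1 \<le> R" and "z \<in> cball 0 R"
  shows "ball z 1 \<subseteq> ball 0 (2 * R)"
proof
  fix y assume "y \<in> ball z 1"
  then have "norm (z - y) < 1" by (simp add: dist_norm)
  moreover have "norm y \<le> norm z + norm (z - y)" using norm_triangle_ineq[of z "y - z"] by (simp add: norm_minus_commute)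
  ultimately show "y \<in> ball 0 (2 * R)" using assms by simp
qed

text \<open>Displacements up to \<open>R\<close>, or 2 R with the unit collar of
  \<open>kernel_power_bound\<close>, carry the ball of radius \<open>R\<close> into that of radius 3
  R. Fubini and translation invariance then leave the mass of the kernel of order t min(1,
  p).\<close>

lemma local_smear_local_norm:
  fixes p t B :: real
  assumes p: "0 < p" and t: "real CARD('n) < t * min 1 p" and B: "0 \<le> B"
  shows "\<exists>C>0. \<forall>(h::real^'n::finite \<Rightarrow> ennreal) a R z. h \<in> borel_measurable borel \<longrightarrow> slowly_varying B h \<longrightarrow> 1 \<le> R \<longrightarrow>
    (\<integral>x. epow (local_smear a t R h x) p * indicator (ball z R) x)
      \<le> ennreal C * (\<integral>x. epow (h x) p * indicator (ball z (3 * R)) x)"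
proof -
  obtain C1 where C1: "C1 > 0" "\<And>(h::real^'n \<Rightarrow> ennreal) a S S'. h \<in> borel_measurable borel \<Longrightarrow> slowly_varying B h \<Longrightarrow> S \<in> sets borel \<Longrightarrow> S' \<in> sets borel \<Longrightarrow> (\<forall>z\<in>S. ball z 1 \<subseteq> S') \<Longrightarrow>
    epow (\<integral>y. ennreal (jbr (y - a) powr (- t)) * h y * indicator S y) p
      \<le> ennreal C1 * (\<integral>y. ennreal (jbr (y - a) powr (- (t * min 1 p))) * epow (h y) p * indicator S' y)"
    using kernel_power_bound[OF p t B] by blast
  define u where "u = t * min 1 p"
  define I where "I = (LINT x|(lborel::(real^'n) measure). jbr x powr (- u))"
  have I0: "0 \<le> I" by (simp add: I_def)
  have main: "(\<integral>x. epow (local_smear a t R h x) p * indicator (ball z R) x)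
      \<le> ennreal (C1 * I + 1) * (\<integral>x. epow (h x) p * indicator (ball z (3 * R)) x)"
    if h [measurable]: "h \<in> borel_measurable borel" and sv: "slowly_varying B h" and R: "1 \<le> R" for h :: "real^'n \<Rightarrow> ennreal" and a z R
  proof -
    define k where "k = (\<lambda>y. ennreal (jbr (y - a) powr (- u)))"
    have [measurable]: "k \<in> borel_measurable borel" unfolding k_def by measurable
    have ib: "indicator (ball z r) x = (indicator {v. v < r} (norm (x - z)) :: ennreal)" for x r
      by (simp add: indicator_def dist_norm norm_minus_commute)
    have pw: "epow (local_smear a t R h x) p \<le> ennreal C1 * (\<integral>y. k y * epow (h (x + y)) p * indicator {v. v < 2 * R} (norm y))" for x
    proof -
      have "epow (\<integral>y. ennreal (jbr (y - a) powr (- t)) * h (x + y) * indicator (cball 0 R) y) p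
        \<le> ennreal C1 * (\<integral>y. ennreal (jbr (y - a) powr (- (t * min 1 p))) * epow (h (x + y)) p * indicator (ball 0 (2 * R)) y)"
        by (intro C1(2) slowly_varying_shift sv ballI ball_subset_2[OF R]) auto
      then show ?thesis unfolding local_smear_def k_def u_def indicator_cball_norm indicator_ball_norm .
    qed
    have "(\<integral>x. epow (local_smear a t R h x) p * indicator (ball z R) x)
      \<le> (\<integral>x. \<integral>y. ennreal C1 * (k y * (epow (h (x + y)) p * indicator {v. v < 3 * R} (norm (x + y - z)))))"
    proof (intro nn_integral_mono)
      fix x
      have "epow (local_smear a t R h x) p * indicator (ball z R) x
         \<le> (ennreal C1 * (\<integral>y. k y * epow (h (x + y)) p * indicator {v. v < 2 * R} (norm y))) * indicator {v. v < R} (norm (x - z))"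
        unfolding ib by (intro mult_right_mono pw) simp
      also have "\<dots> = (\<integral>y. ennreal C1 * (k y * epow (h (x + y)) p * indicator {v. v < 2 * R} (norm y)) * indicator {v. v < R} (norm (x - z)))"
        by (subst nn_integral_multc, measurable, subst nn_integral_cmult, measurable)
      also have "\<dots> \<le> (\<integral>y. ennreal C1 * (k y * (epow (h (x + y)) p * indicator {v. v < 3 * R} (norm (x + y - z)))))"
      proof (intro nn_integral_mono)
        fix y
        have "indicator {v. v < 2 * R} (norm y) * indicator {v. v < R} (norm (x - z)) \<le> (indicator {v. v < 3 * R} (norm (x + y - z)) :: ennreal)"
          using norm_triangle_ineq[of "x - z" y] by (auto simp: indicator_def algebra_simps)
        then have "(ennreal C1 * (k y * epow (h (x + y)) p)) * (indicator {v. v < 2 * R} (norm y) * indicator {v. v < R} (norm (x - z)))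
          \<le> (ennreal C1 * (k y * epow (h (x + y)) p)) * indicator {v. v < 3 * R} (norm (x + y - z))"
          by (intro mult_left_mono) auto
        then show "ennreal C1 * (k y * epow (h (x + y)) p * indicator {v. v < 2 * R} (norm y)) * indicator {v. v < R} (norm (x - z))
          \<le> ennreal C1 * (k y * (epow (h (x + y)) p * indicator {v. v < 3 * R} (norm (x + y - z))))"
          by (simp only: mult.assoc)
      qed
      finally show "epow (local_smear a t R h x) p * indicator (ball z R) x \<le> (\<integral>y. ennreal C1 * (k y * (epow (h (x + y)) p * indicator {v. v < 3 * R} (norm (x + y - z)))))" .
    qed
    also have "\<dots> = (\<integral>y. \<integral>x. ennreal C1 * (k y * (epow (h (x + y)) p * indicator {v. v < 3 * R} (norm (x + y - z)))))"
      by (rule lborel_pair.Fubini'[symmetric]) measurable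
    also have "\<dots> = (\<integral>y. ennreal C1 * (k y * (\<integral>x. epow (h x) p * indicator {v. v < 3 * R} (norm (x - z)))))"
    proof (intro nn_integral_cong)
      fix y
      have "(\<integral>x. ennreal C1 * (k y * (epow (h (x + y)) p * indicator {v. v < 3 * R} (norm (x + y - z)))))
        = ennreal C1 * (k y * (\<integral>x. epow (h (x + y)) p * indicator {v. v < 3 * R} (norm (x + y - z))))"
        by (subst nn_integral_cmult, measurable, subst nn_integral_cmult, measurable)
      also have "(\<integral>x. epow (h (x + y)) p * indicator {v. v < 3 * R} (norm (x + y - z))) = (\<integral>x. epow (h x) p * indicator {v. v < 3 * R} (norm (x - z)))"
        using nn_integral_shift[of "\<lambda>x. epow (h x) p * indicator {v. v < 3 * R} (norm (x - z))" y] by (simp add: add.commute)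
      finally show "(\<integral>x. ennreal C1 * (k y * (epow (h (x + y)) p * indicator {v. v < 3 * R} (norm (x + y - z)))))
        = ennreal C1 * (k y * (\<integral>x. epow (h x) p * indicator {v. v < 3 * R} (norm (x - z))))" .
    qed
    also have "\<dots> = ennreal C1 * (integral\<^sup>N lborel k * (\<integral>x. epow (h x) p * indicator {v. v < 3 * R} (norm (x - z))))"
      by (subst nn_integral_cmult, measurable, subst nn_integral_multc, measurable)
    also have "integral\<^sup>N lborel k = ennreal I" unfolding k_def I_def by (rule kernel_integral) (use t in \<open>simp add: u_def\<close>)
    also have "ennreal C1 * (ennreal I * X) \<le> ennreal (C1 * I + 1) * X" for X
    proof -
      have "ennreal C1 * (ennreal I * X) = ennreal (C1 * I) * X" using C1(1) I0 by (simp add: ennreal_mult mult.assoc)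
      then show ?thesis by (simp add: mult_right_mono ennreal_leI)
    qed
    finally show ?thesis unfolding ib .
  qed
  have "0 < C1 * I + 1" using C1(1) I0 by (simp add: add_nonneg_pos)
  then show ?thesis using main by blast
qed

text \<open>For |y| <= R slow variation bounds h(x + y) by the L^p norm of h over the ball of radius
  2 R around x, and the kernel contributes only its total mass. It serves the cases in which one
  exponent is infinite.\<close>

lemma local_smear_pointwise:
  fixes p t B :: real
  assumes p: "0 < p" and t: "real CARD('n) < t" and B: "0 \<le> B"
  shows "\<exists>C>0. \<forall>(h::real^'n::finite \<Rightarrow> ennreal) a R x. h \<in> borel_measurable borel \<longrightarrow> slowly_varying B h \<longrightarrow> 1 \<le> R \<longrightarrow>
    epow (local_smear a t R h x) p \<le> ennreal C * (\<integral>y. epow (h (x + y)) p * indicator {v. v < 2 * R} (norm y))"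
proof -
  define c where "c = B powr p / unit_ball_vol (real CARD('n))"
  have c0: "0 \<le> c" unfolding c_def by (intro divide_nonneg_nonneg) auto
  define I where "I = (LINT x|(lborel::(real^'n) measure). jbr x powr (- t))"
  have I0: "0 \<le> I" by (simp add: I_def)
  have main: "epow (local_smear a t R h x) p \<le> ennreal (I powr p * c + 1) * (\<integral>y. epow (h (x + y)) p * indicator {v. v < 2 * R} (norm y))" (is "_ \<le> _ * ?M")
    if h [measurable]: "h \<in> borel_measurable borel" and sv: "slowly_varying B h" and R: "1 \<le> R" for h :: "real^'n \<Rightarrow> ennreal" and a x R
  proof -
    have hb: "h (x + y) \<le> epow (ennreal c * ?M) (1 / p)" if y: "norm y \<le> R" for y
    proof -
      have "epow (h (x + y)) p \<le> ennreal c * (\<integral>y. epow (h (x + y)) p * indicator (ball 0 (2 * R)) y)"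
        unfolding c_def using ball_subset_2[OF R, of y] y p
        by (intro slowly_varying_pointwise[OF _ slowly_varying_shift[OF sv] B]) auto
      then show ?thesis unfolding indicator_ball_norm by (rule epow_le_swap[OF p])
    qed
    have "local_smear a t R h x \<le> (\<integral>y. ennreal (jbr (y - a) powr (- t)) * epow (ennreal c * ?M) (1 / p))"
      unfolding local_smear_def
    proof (intro nn_integral_mono)
      fix y
      show "ennreal (jbr (y - a) powr (- t)) * h (x + y) * indicator {u. u \<le> R} (norm y) \<le> ennreal (jbr (y - a) powr (- t)) * epow (ennreal c * ?M) (1 / p)"
        using hb[of y] by (cases "norm y \<le> R") (auto intro: mult_left_mono)
    qed
    also have "\<dots> = ennreal I * epow (ennreal c * ?M) (1 / p)"
      by (subst nn_integral_multc) (auto simp: kernel_integral[OF t] I_def)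
    finally have "epow (local_smear a t R h x) p \<le> epow (ennreal I * epow (ennreal c * ?M) (1 / p)) p" using p by (intro epow_mono) auto
    also have "\<dots> = ennreal (I powr p) * (ennreal c * ?M)"
      unfolding epow_mult[of "ennreal I"] using p I0 by (simp add: epow_inverse')
    also have "\<dots> = ennreal (I powr p * c) * ?M" using c0 by (simp add: ennreal_mult mult.assoc)
    also have "\<dots> \<le> ennreal (I powr p * c + 1) * ?M" by (intro mult_right_mono ennreal_leI) auto
    finally show ?thesis .
  qed
  have "0 < I powr p * c + 1" using c0 by (simp add: add_nonneg_pos)
  then show ?thesis using main by blast
qed

text \<open>Hoelder's inequality against the constant 1 on \<open>S\<close>; on balls of radius
  comparable to R this is the source of the powers of R.\<close>

lemma nn_integral_Holder_set:
  fixes f :: "real^'n::finite \<Rightarrow> ennreal"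
  assumes [measurable]: "f \<in> borel_measurable borel" "S \<in> sets borel" and r: "0 < r" "r < 1"
  shows "(\<integral>x. epow (f x) r * indicator S x) \<le> epow (\<integral>x. f x * indicator S x) r * epow (emeasure lborel S) (1 - r)"
proof -
  have "(\<integral>x. epow (f x) r * indicator S x) = (\<integral>x. (epow (f x) r * indicator S x) * indicator S x)"
    by (intro nn_integral_cong) (simp add: indicator_def)
  also have "\<dots> \<le> epow (\<integral>x. epow (epow (f x) r * indicator S x) (1 / r)) (1 / (1 / r)) * epow (\<integral>x. epow (indicator S x) (1 / (1 - r))) (1 / (1 / (1 - r)))"
    using r by (intro nn_integral_Holder) auto
  also have "(\<lambda>x. epow (epow (f x) r * indicator S x) (1 / r)) = (\<lambda>x. f x * indicator S x)"
  proof
    fix x show "epow (epow (f x) r * indicator S x) (1 / r) = f x * indicator S x"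
      using r by (cases "x \<in> S") (simp_all add: epow_inverse)
  qed
  also have "(\<lambda>x. epow (indicator S x) (1 / (1 - r))) = indicator S"
    by (simp add: fun_eq_iff indicator_def)
  finally show ?thesis by simp
qed

lemma emeasure_ball_powr:
  fixes z :: "real^'n::finite"
  assumes "0 \<le> R"
  shows "epow (emeasure lborel (ball z R)) \<rho> = ennreal (unit_ball_vol (real CARD('n)) powr \<rho> * (R ^ CARD('n)) powr \<rho>)"
  using assms by (simp add: emeasure_ball powr_mult)

lemma real_power_powr: "1 \<le> R \<Longrightarrow> ((R::real) ^ n) powr \<rho> = R powr (real n * \<rho>)"
  by (simp add: powr_realpow[symmetric] powr_powr)

text \<open>The estimate is made first in L^q for both variables, where Fubini applies. Passing to
  L^p in x on balls of radius \<open>R\<close> costs R^(n (1 - \<rho>)), \<rho> = p / q, on the left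
  by Hoelder's inequality, and no power of R on the right, because the inner norm is slowly varying.
  The p-th root gives the exponent n (1/p - 1/q).\<close>

lemma shell_p_less_q:
  fixes p q t B :: real
  assumes pq: "0 < p" "p < q" and t: "real CARD('n) < t * min 1 q" and B: "0 \<le> B"
  shows "\<exists>C>0. \<forall>(\<Gamma>::real^'n::finite \<Rightarrow> real^'n \<Rightarrow> ennreal) a R.
    jointly_measurable \<Gamma> \<longrightarrow> (\<forall>\<xi>. slowly_varying B (\<lambda>x. \<Gamma> x \<xi>)) \<longrightarrow> a \<in> borel \<rightarrow>\<^sub>M borel \<longrightarrow> 1 \<le> R \<longrightarrow>
    mixed_norm (ereal p) (ereal q) (\<lambda>x \<xi>. local_smear (a \<xi>) t R (\<lambda>x. \<Gamma> x \<xi>) x)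
      \<le> ennreal (C * R powr (real CARD('n) * (1 / p - 1 / q))) * mixed_norm (ereal p) (ereal q) \<Gamma>"
proof -
  have q: "0 < q" using pq by simp
  define \<rho> where "\<rho> = p / q"
  have \<rho>: "0 < \<rho>" "\<rho> < 1" using pq by (auto simp: \<rho>_def)
  obtain C1 where C1: "C1 > 0" "\<And>(h::real^'n \<Rightarrow> ennreal) a R z. h \<in> borel_measurable borel \<Longrightarrow> slowly_varying B h \<Longrightarrow> 1 \<le> R \<Longrightarrow>
    (\<integral>x. epow (local_smear a t R h x) q * indicator (ball z R) x)
      \<le> ennreal C1 * (\<integral>x. epow (h x) q * indicator (ball z (3 * R)) x)"
    using local_smear_local_norm[OF q t B] by blast
  define v where "v = unit_ball_vol (real CARD('n))"
  define c2 where "c2 = ((B powr q) powr \<rho> / v) powr (1 - \<rho>)"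
  have v: "0 < v" unfolding v_def by (rule unit_ball_vol_pos) simp
  define C where "C = (4 ^ CARD('n) * (v powr (1 - \<rho>) * C1 powr \<rho> * c2) + 1) powr (1 / p)"
  have c20: "0 \<le> c2" by (simp add: c2_def)
  have main: "mixed_norm (ereal p) (ereal q) (\<lambda>x \<xi>. local_smear (a \<xi>) t R (\<lambda>x. \<Gamma> x \<xi>) x)
      \<le> ennreal (C * R powr (real CARD('n) * (1 / p - 1 / q))) * mixed_norm (ereal p) (ereal q) \<Gamma>"
    if \<Gamma> [measurable]: "jointly_measurable \<Gamma>" and sv: "\<And>\<xi>. slowly_varying B (\<lambda>x. \<Gamma> x \<xi>)" and a: "a \<in> borel \<rightarrow>\<^sub>M borel" and R: "1 \<le> R" for \<Gamma> :: "real^'n \<Rightarrow> real^'n \<Rightarrow> ennreal" and a R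
  proof -
    define H where "H = (\<lambda>x \<xi>. local_smear (a \<xi>) t R (\<lambda>x. \<Gamma> x \<xi>) x)"
    have Hm [measurable]: "jointly_measurable H" unfolding H_def by (rule local_smear_jm[OF \<Gamma> a])
    have \<Gamma>x [measurable]: "(\<lambda>x. \<Gamma> x \<xi>) \<in> borel_measurable borel" for \<xi> using measurable_Pair1[OF \<Gamma>, of \<xi>] by simp
    define b where "b = (\<lambda>x. (\<integral>\<xi>. epow (H x \<xi>) q))"
    define g where "g = (\<lambda>x. (\<integral>\<xi>. epow (\<Gamma> x \<xi>) q))"
    have bm [measurable]: "b \<in> borel_measurable borel" unfolding b_def by measurable
    have gm [measurable]: "g \<in> borel_measurable borel" unfolding g_def by measurable
    \<comment> \<open>Slow variation in x survives the integration in \<xi> because its constant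
      does not depend on \<xi>.\<close>
    have gs: "slowly_varying (B powr q) g"
      unfolding slowly_varying_def
    proof (intro allI impI)
      fix z z' :: "real^'n" assume z: "norm (z - z') < 1"
      have "g z' \<le> (\<integral>\<xi>. ennreal (B powr q) * epow (\<Gamma> z \<xi>) q)"
        unfolding g_def using slowly_varyingD[OF slowly_varying_epow[OF sv B] z, of q] q by (intro nn_integral_mono) auto
      also have "\<dots> = ennreal (B powr q) * g z" unfolding g_def by (rule nn_integral_cmult) measurable
      finally show "g z' \<le> ennreal (B powr q) * g z" .
    qed
    have loc: "(\<integral>x. b x * indicator (ball z R) x) \<le> ennreal C1 * (\<integral>x. g x * indicator (ball z (3 * R)) x)" for z
    proof -
      have "(\<integral>x. b x * indicator (ball z R) x) = (\<integral>x. \<integral>\<xi>. epow (H x \<xi>) q * indicator (ball z R) x)"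
        unfolding b_def by (intro nn_integral_cong nn_integral_multc[symmetric]) measurable
      also have "\<dots> = (\<integral>\<xi>. \<integral>x. epow (H x \<xi>) q * indicator (ball z R) x)"
        unfolding indicator_ball_dist by (rule lborel_pair.Fubini'[symmetric]) measurable
      also have "\<dots> \<le> (\<integral>\<xi>. ennreal C1 * (\<integral>x. epow (\<Gamma> x \<xi>) q * indicator (ball z (3 * R)) x))"
        unfolding H_def by (intro nn_integral_mono C1(2) sv R) auto
      also have "\<dots> = ennreal C1 * (\<integral>\<xi>. \<integral>x. epow (\<Gamma> x \<xi>) q * indicator (ball z (3 * R)) x)"
        unfolding indicator_ball_dist by (rule nn_integral_cmult) measurable
      also have "(\<integral>\<xi>. \<integral>x. epow (\<Gamma> x \<xi>) q * indicator (ball z (3 * R)) x) = (\<integral>x. \<integral>\<xi>. epow (\<Gamma> x \<xi>) q * indicator (ball z (3 * R)) x)"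
        unfolding indicator_ball_dist by (rule lborel_pair.Fubini') measurable
      also have "\<dots> = (\<integral>x. g x * indicator (ball z (3 * R)) x)"
        unfolding g_def by (intro nn_integral_cong nn_integral_multc) measurable
      finally show ?thesis .
    qed
    define D where "D = ennreal (v powr (1 - \<rho>) * C1 powr \<rho> * c2 * R powr (real CARD('n) * (1 - \<rho>)))"
    have "(\<integral>x. epow (b x) \<rho> * indicator (ball z R) x) \<le> D * (\<integral>x. epow (g x) \<rho> * indicator (ball z (4 * R)) x)" for z
    proof -
      have "(\<integral>x. epow (b x) \<rho> * indicator (ball z R) x) \<le> epow (\<integral>x. b x * indicator (ball z R) x) \<rho> * epow (emeasure lborel (ball z R)) (1 - \<rho>)"
        by (rule nn_integral_Holder_set) (use \<rho> in auto)
      also have "\<dots> \<le> epow (ennreal C1 * (\<integral>x. g x * indicator (ball z (3 * R)) x)) \<rho> * epow (emeasure lborel (ball z R)) (1 - \<rho>)"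
        using \<rho> by (intro mult_right_mono epow_mono loc) auto
      also have "\<dots> = ennreal (C1 powr \<rho>) * epow (emeasure lborel (ball z R)) (1 - \<rho>) * epow (\<integral>x. g x * indicator (ball z (3 * R)) x) \<rho>"
        unfolding epow_mult using C1(1) by (simp add: mult_ac)
      also have "\<dots> \<le> ennreal (C1 powr \<rho>) * epow (emeasure lborel (ball z R)) (1 - \<rho>) * (ennreal c2 * (\<integral>x. epow (g x) \<rho> * indicator (ball z (4 * R)) x))"
      proof (rule mult_left_mono)
        \<comment> \<open>Since R >= 1, the radius 4 R leaves room for the unit collar around the
          ball of radius 3 R.\<close>
        have "ball y 1 \<subseteq> ball z (4 * R)" if "y \<in> ball z (3 * R)" for y
        proof
          fix u assume "u \<in> ball y 1"
          then show "u \<in> ball z (4 * R)" using that R dist_triangle[of z u y] by simp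
        qed
        then have "epow (\<integral>x. g x * indicator (ball z (3 * R)) x) \<rho> \<le> epow (ennreal ((B powr q) powr \<rho> / unit_ball_vol (real CARD('n)))) (1 - \<rho>) * (\<integral>x. epow (g x) \<rho> * indicator (ball z (4 * R)) x)"
          using \<rho> by (intro slowly_varying_embedding[OF gm gs]) auto
        moreover have "epow (ennreal ((B powr q) powr \<rho> / unit_ball_vol (real CARD('n)))) (1 - \<rho>) = ennreal c2"
          unfolding c2_def v_def[symmetric] using v by (intro epow_ennreal) simp
        ultimately show "epow (\<integral>x. g x * indicator (ball z (3 * R)) x) \<rho> \<le> ennreal c2 * (\<integral>x. epow (g x) \<rho> * indicator (ball z (4 * R)) x)" by simp
      qed simp
      also have "epow (emeasure lborel (ball z R)) (1 - \<rho>) = ennreal (v powr (1 - \<rho>) * R powr (real CARD('n) * (1 - \<rho>)))"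
        using R by (simp add: emeasure_ball_powr real_power_powr v_def)
      finally show ?thesis using c20 by (simp add: D_def ennreal_mult mult_ac)
    qed
    then have bd: "(\<integral>x. epow (b x) \<rho>) \<le> 4 ^ CARD('n) * D * (\<integral>x. epow (g x) \<rho>)"
      using R by (intro ball_average[of _ _ R]) auto
    also have "4 ^ CARD('n) * D \<le> ennreal ((4 ^ CARD('n) * (v powr (1 - \<rho>) * C1 powr \<rho> * c2) + 1) * R powr (real CARD('n) * (1 - \<rho>)))"
    proof -
      have "4 ^ CARD('n) * D = ennreal (4 ^ CARD('n) * (v powr (1 - \<rho>) * C1 powr \<rho> * c2 * R powr (real CARD('n) * (1 - \<rho>))))"
        unfolding D_def using c20 by (simp add: ennreal_mult ennreal_power[symmetric])
      also have "\<dots> \<le> ennreal ((4 ^ CARD('n) * (v powr (1 - \<rho>) * C1 powr \<rho> * c2) + 1) * R powr (real CARD('n) * (1 - \<rho>)))"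
        by (intro ennreal_leI) (simp add: distrib_right mult.assoc)
      finally show ?thesis .
    qed
    finally have bd': "(\<integral>x. epow (b x) \<rho>) \<le> ennreal ((4 ^ CARD('n) * (v powr (1 - \<rho>) * C1 powr \<rho> * c2) + 1) * R powr (real CARD('n) * (1 - \<rho>))) * (\<integral>x. epow (g x) \<rho>)"
      by (simp add: mult_right_mono)
    have mx: "mixed_norm (ereal p) (ereal q) \<Phi> = epow (\<integral>x. epow (\<integral>\<xi>. epow (\<Phi> x \<xi>) q) \<rho>) (1 / p)" for \<Phi> :: "real^'n \<Rightarrow> real^'n \<Rightarrow> ennreal"
      unfolding mixed_norm_def Lnorm_ereal epow_epow \<rho>_def by simp
    have ex: "real CARD('n) * (1 - \<rho>) * (1 / p) = real CARD('n) * (1 / p - 1 / q)" using pq q by (simp add: \<rho>_def field_simps)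
    have "mixed_norm (ereal p) (ereal q) H = epow (\<integral>x. epow (b x) \<rho>) (1 / p)" by (simp add: mx b_def)
    also have "\<dots> \<le> epow (ennreal ((4 ^ CARD('n) * (v powr (1 - \<rho>) * C1 powr \<rho> * c2) + 1) * R powr (real CARD('n) * (1 - \<rho>))) * (\<integral>x. epow (g x) \<rho>)) (1 / p)"
      using pq by (intro epow_mono bd') auto
    also have "\<dots> = ennreal (C * R powr (real CARD('n) * (1 / p - 1 / q))) * mixed_norm (ereal p) (ereal q) \<Gamma>"
      unfolding epow_mult mx g_def using c20 add_nonneg_pos[of "4 ^ CARD('n) * (v powr (1 - \<rho>) * C1 powr \<rho> * c2)" 1] by (simp add: C_def powr_mult powr_powr ex[symmetric])
    finally show ?thesis by (simp add: H_def)
  qed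
  have "0 \<le> 4 ^ CARD('n) * (v powr (1 - \<rho>) * C1 powr \<rho> * c2)" using c20 by simp
  then have "4 ^ CARD('n) * (v powr (1 - \<rho>) * C1 powr \<rho> * c2) + 1 \<noteq> 0" by linarith
  then have "0 < C" by (simp add: C_def)
  then show ?thesis using main by blast
qed

text \<open>Here the loss arises on the other side. Minkowski's inequality with P = p / q takes the
  local norm in x inside the \<xi>-integral; each fibre is estimated in L^p and embedded into L^q by
  slow variation; Hoelder's inequality on the ball of radius 4 R returns from L^1 to L^P and costs
  R^(n (P - 1)) in the P-th power.\<close>

lemma shell_q_less_p:
  fixes p q t B :: real
  assumes pq: "0 < q" "q < p" and t: "real CARD('n) < t * min 1 p" and B: "0 \<le> B"
  shows "\<exists>C>0. \<forall>(\<Gamma>::real^'n::finite \<Rightarrow> real^'n \<Rightarrow> ennreal) a R.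
    jointly_measurable \<Gamma> \<longrightarrow> (\<forall>\<xi>. slowly_varying B (\<lambda>x. \<Gamma> x \<xi>)) \<longrightarrow> a \<in> borel \<rightarrow>\<^sub>M borel \<longrightarrow> 1 \<le> R \<longrightarrow>
    mixed_norm (ereal p) (ereal q) (\<lambda>x \<xi>. local_smear (a \<xi>) t R (\<lambda>x. \<Gamma> x \<xi>) x)
      \<le> ennreal (C * R powr (real CARD('n) * (1 / q - 1 / p))) * mixed_norm (ereal p) (ereal q) \<Gamma>"
proof -
  have p: "0 < p" using pq by simp
  define P where "P = p / q"
  have P: "1 < P" using pq by (simp add: P_def)
  obtain C1 where C1: "C1 > 0" "\<And>(h::real^'n \<Rightarrow> ennreal) a R z. h \<in> borel_measurable borel \<Longrightarrow> slowly_varying B h \<Longrightarrow> 1 \<le> R \<Longrightarrow>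
    (\<integral>x. epow (local_smear a t R h x) p * indicator (ball z R) x)
      \<le> ennreal C1 * (\<integral>x. epow (h x) p * indicator (ball z (3 * R)) x)"
    using local_smear_local_norm[OF p t B] by blast
  define v where "v = unit_ball_vol (real CARD('n))"
  define c2 where "c2 = ((B powr p) powr (1 / P) / v) powr (1 - 1 / P)"
  have v: "0 < v" unfolding v_def by (rule unit_ball_vol_pos) simp
  have c20: "0 \<le> c2" by (simp add: c2_def)
  define c3 where "c3 = C1 * c2 powr P * (v powr (P - 1) * (4 ^ CARD('n)) powr (P - 1))"
  have c30: "0 \<le> c3" using C1(1) by (simp add: c3_def)
  define C where "C = (4 ^ CARD('n) * c3 + 1) powr (1 / p)"
  have main: "mixed_norm (ereal p) (ereal q) (\<lambda>x \<xi>. local_smear (a \<xi>) t R (\<lambda>x. \<Gamma> x \<xi>) x)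
      \<le> ennreal (C * R powr (real CARD('n) * (1 / q - 1 / p))) * mixed_norm (ereal p) (ereal q) \<Gamma>"
    if \<Gamma> [measurable]: "jointly_measurable \<Gamma>" and sv: "\<And>\<xi>. slowly_varying B (\<lambda>x. \<Gamma> x \<xi>)" and a: "a \<in> borel \<rightarrow>\<^sub>M borel" and R: "1 \<le> R" for \<Gamma> :: "real^'n \<Rightarrow> real^'n \<Rightarrow> ennreal" and a R
  proof -
    define H where "H = (\<lambda>x \<xi>. local_smear (a \<xi>) t R (\<lambda>x. \<Gamma> x \<xi>) x)"
    have Hm [measurable]: "jointly_measurable H" unfolding H_def by (rule local_smear_jm[OF \<Gamma> a])
    have \<Gamma>x [measurable]: "(\<lambda>x. \<Gamma> x \<xi>) \<in> borel_measurable borel" for \<xi> using measurable_Pair1[OF \<Gamma>, of \<xi>] by simp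
    define b where "b = (\<lambda>x. (\<integral>\<xi>. epow (H x \<xi>) q))"
    define g where "g = (\<lambda>x. (\<integral>\<xi>. epow (\<Gamma> x \<xi>) q))"
    have bm [measurable]: "b \<in> borel_measurable borel" unfolding b_def by measurable
    have gm [measurable]: "g \<in> borel_measurable borel" unfolding g_def by measurable
    define D where "D = ennreal (c3 * R powr (real CARD('n) * (P - 1)))"
    have "(\<integral>x. epow (b x) P * indicator (ball z R) x) \<le> D * (\<integral>x. epow (g x) P * indicator (ball z (4 * R)) x)" for z
    proof -
      let ?S = "ball z (4 * R)"
      have fm: "(\<lambda>(x, \<xi>). epow (H x \<xi>) q * indicator (ball z R) x) \<in> borel_measurable (borel \<Otimes>\<^sub>M lborel)"
        unfolding indicator_ball_dist by (rule jointly_measurable_lborel) measurable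
      have "epow (\<integral>x. epow (b x) P * indicator (ball z R) x) (1 / P) = Lnorm lborel (ereal P) (\<lambda>x. (\<integral>\<xi>. epow (H x \<xi>) q * indicator (ball z R) x))"
      proof -
        have "epow (\<integral>\<xi>. epow (H x \<xi>) q * indicator (ball z R) x) P = epow (b x) P * indicator (ball z R) x" for x
          unfolding b_def by (cases "x \<in> ball z R") simp_all
        then show ?thesis unfolding Lnorm_ereal by simp
      qed
      also have "\<dots> \<le> (\<integral>\<xi>. Lnorm lborel (ereal P) (\<lambda>x. epow (H x \<xi>) q * indicator (ball z R) x))"
        by (rule Minkowski_integral_real[OF sigma_finite_lborel _ fm]) (use P in simp)
      also have "\<dots> \<le> (\<integral>\<xi>. ennreal (C1 powr (1 / P) * c2) * (\<integral>x. epow (\<Gamma> x \<xi>) q * indicator ?S x))"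
      proof (intro nn_integral_mono)
        fix \<xi>
        have e: "epow (epow (H x \<xi>) q * indicator (ball z R) x) P = epow (H x \<xi>) p * indicator (ball z R) x" for x
          using pq by (cases "x \<in> ball z R") (simp_all add: epow_epow P_def)
        have "Lnorm lborel (ereal P) (\<lambda>x. epow (H x \<xi>) q * indicator (ball z R) x) = epow (\<integral>x. epow (H x \<xi>) p * indicator (ball z R) x) (1 / P)"
          unfolding Lnorm_ereal e ..
        also have "\<dots> \<le> epow (ennreal C1 * (\<integral>x. epow (\<Gamma> x \<xi>) p * indicator (ball z (3 * R)) x)) (1 / P)"
          unfolding H_def using P by (intro epow_mono C1(2) sv R) auto
        also have "\<dots> = ennreal (C1 powr (1 / P)) * epow (\<integral>x. epow (\<Gamma> x \<xi>) p * indicator (ball z (3 * R)) x) (1 / P)"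
          unfolding epow_mult using C1(1) by simp
        also have "\<dots> \<le> ennreal (C1 powr (1 / P)) * (ennreal c2 * (\<integral>x. epow (\<Gamma> x \<xi>) q * indicator ?S x))"
        proof (rule mult_left_mono)
          have "ball y 1 \<subseteq> ball z (4 * R)" if "y \<in> ball z (3 * R)" for y
          proof
            fix u assume "u \<in> ball y 1"
            then show "u \<in> ball z (4 * R)" using that R dist_triangle[of z u y] by simp
          qed
          then have "epow (\<integral>x. epow (\<Gamma> x \<xi>) p * indicator (ball z (3 * R)) x) (1 / P) \<le> epow (ennreal ((B powr p) powr (1 / P) / unit_ball_vol (real CARD('n)))) (1 - 1 / P) * (\<integral>x. epow (epow (\<Gamma> x \<xi>) p) (1 / P) * indicator (ball z (4 * R)) x)"
            using P p by (intro slowly_varying_embedding slowly_varying_epow sv B) auto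
          moreover have "epow (ennreal ((B powr p) powr (1 / P) / unit_ball_vol (real CARD('n)))) (1 - 1 / P) = ennreal c2"
            unfolding c2_def v_def[symmetric] using v by (intro epow_ennreal) simp
          moreover have "epow (epow (\<Gamma> x \<xi>) p) (1 / P) = epow (\<Gamma> x \<xi>) q" for x
            using p by (simp add: epow_epow P_def)
          ultimately show "epow (\<integral>x. epow (\<Gamma> x \<xi>) p * indicator (ball z (3 * R)) x) (1 / P) \<le> ennreal c2 * (\<integral>x. epow (\<Gamma> x \<xi>) q * indicator ?S x)" by simp
        qed simp
        finally show "Lnorm lborel (ereal P) (\<lambda>x. epow (H x \<xi>) q * indicator (ball z R) x) \<le> ennreal (C1 powr (1 / P) * c2) * (\<integral>x. epow (\<Gamma> x \<xi>) q * indicator ?S x)"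
          using c20 by (simp add: ennreal_mult mult.assoc)
      qed
      also have "\<dots> = ennreal (C1 powr (1 / P) * c2) * (\<integral>\<xi>. \<integral>x. epow (\<Gamma> x \<xi>) q * indicator ?S x)"
        unfolding indicator_ball_dist by (rule nn_integral_cmult) measurable
      also have "(\<integral>\<xi>. \<integral>x. epow (\<Gamma> x \<xi>) q * indicator ?S x) = (\<integral>x. \<integral>\<xi>. epow (\<Gamma> x \<xi>) q * indicator ?S x)"
        unfolding indicator_ball_dist by (rule lborel_pair.Fubini') measurable
      also have "\<dots> = (\<integral>x. epow (epow (g x) P) (1 / P) * indicator ?S x)"
        unfolding g_def using P by (intro nn_integral_cong) (simp add: epow_inverse nn_integral_multc)
      also have "\<dots> \<le> epow (\<integral>x. epow (g x) P * indicator ?S x) (1 / P) * epow (emeasure lborel ?S) (1 - 1 / P)"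
        by (rule nn_integral_Holder_set) (use P in auto)
      finally have "epow (\<integral>x. epow (b x) P * indicator (ball z R) x) (1 / P)
         \<le> ennreal (C1 powr (1 / P) * c2) * (epow (\<integral>x. epow (g x) P * indicator ?S x) (1 / P) * epow (emeasure lborel ?S) (1 - 1 / P))"
        by (simp add: mult_left_mono)
      then have "epow (epow (\<integral>x. epow (b x) P * indicator (ball z R) x) (1 / P)) P
         \<le> epow (ennreal (C1 powr (1 / P) * c2) * (epow (\<integral>x. epow (g x) P * indicator ?S x) (1 / P) * epow (emeasure lborel ?S) (1 - 1 / P))) P"
        using P by (intro epow_mono) auto
      also have "\<dots> = ennreal ((C1 powr (1 / P) * c2) powr P) * (epow (\<integral>x. epow (g x) P * indicator ?S x) (1 / P * P) * epow (emeasure lborel ?S) ((1 - 1 / P) * P))"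
        unfolding epow_mult epow_epow using c20 by (subst epow_ennreal) auto
      also have "(1 - 1 / P) * P = P - 1" using P by (simp add: left_diff_distrib)
      also have "1 / P * P = 1" using P by simp
      also have "(C1 powr (1 / P) * c2) powr P = C1 * c2 powr P"
        using P C1(1) c20 by (simp add: powr_mult powr_powr)
      also have "epow (emeasure lborel ?S) (P - 1) = ennreal (v powr (P - 1) * ((4 ^ CARD('n)) powr (P - 1) * R powr (real CARD('n) * (P - 1))))"
        using R by (simp add: emeasure_ball_powr power_mult_distrib powr_mult real_power_powr[OF R] v_def)
      finally show ?thesis using P C1(1)
        by (simp add: epow_inverse' D_def c3_def ennreal_mult mult_ac)
    qed
    then have bd: "(\<integral>x. epow (b x) P) \<le> 4 ^ CARD('n) * D * (\<integral>x. epow (g x) P)"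
      using R by (intro ball_average[of _ _ R]) auto
    also have "4 ^ CARD('n) * D \<le> ennreal ((4 ^ CARD('n) * c3 + 1) * R powr (real CARD('n) * (P - 1)))"
    proof -
      have "4 ^ CARD('n) * D = ennreal (4 ^ CARD('n) * (c3 * R powr (real CARD('n) * (P - 1))))"
        unfolding D_def using c30 by (simp add: ennreal_mult ennreal_power[symmetric])
      also have "\<dots> \<le> ennreal ((4 ^ CARD('n) * c3 + 1) * R powr (real CARD('n) * (P - 1)))"
        by (intro ennreal_leI) (simp add: distrib_right mult.assoc)
      finally show ?thesis .
    qed
    finally have bd': "(\<integral>x. epow (b x) P) \<le> ennreal ((4 ^ CARD('n) * c3 + 1) * R powr (real CARD('n) * (P - 1))) * (\<integral>x. epow (g x) P)"
      by (simp add: mult_right_mono)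
    have mx: "mixed_norm (ereal p) (ereal q) \<Phi> = epow (\<integral>x. epow (\<integral>\<xi>. epow (\<Phi> x \<xi>) q) P) (1 / p)" for \<Phi> :: "real^'n \<Rightarrow> real^'n \<Rightarrow> ennreal"
      unfolding mixed_norm_def Lnorm_ereal epow_epow P_def by simp
    have ex: "real CARD('n) * (P - 1) * (1 / p) = real CARD('n) * (1 / q - 1 / p)" using pq p by (simp add: P_def field_simps)
    have "mixed_norm (ereal p) (ereal q) H = epow (\<integral>x. epow (b x) P) (1 / p)" by (simp add: mx b_def)
    also have "\<dots> \<le> epow (ennreal ((4 ^ CARD('n) * c3 + 1) * R powr (real CARD('n) * (P - 1))) * (\<integral>x. epow (g x) P)) (1 / p)"
      using p by (intro epow_mono bd') auto
    also have "\<dots> = ennreal (C * R powr (real CARD('n) * (1 / q - 1 / p))) * mixed_norm (ereal p) (ereal q) \<Gamma>"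
      unfolding epow_mult mx g_def using c30 add_nonneg_pos[of "4 ^ CARD('n) * c3" 1] by (simp add: C_def powr_mult powr_powr ex[symmetric])
    finally show ?thesis by (simp add: H_def)
  qed
  have "0 \<le> 4 ^ CARD('n) * c3" using c30 by simp
  then have "4 ^ CARD('n) * c3 + 1 \<noteq> 0" by linarith
  then have "0 < C" by (simp add: C_def)
  then show ?thesis using main by blast
qed

section \<open>Exchange of norms when one exponent is infinite\<close>

lemma measurable_fst_section:
  assumes "jointly_measurable \<Phi>"
  shows "(\<lambda>x. \<Phi> x \<xi>) \<in> borel_measurable borel"
  using measurable_Pair1[OF assms, of \<xi>] by simp

lemma AE_swap_le:
  fixes \<Gamma> :: "real ^ 'n::finite \<Rightarrow> real ^ 'n \<Rightarrow> ennreal"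
  assumes \<Gamma> [measurable]: "jointly_measurable \<Gamma>" and g [measurable]: "g \<in> borel_measurable borel"
    and le: "AE x in lborel. AE \<xi> in lborel. \<Gamma> x \<xi> \<le> g x"
  shows "AE \<xi> in lborel. AE x in lborel. \<Gamma> x \<xi> \<le> g x"
  using le by (subst (asm) lborel_pair.AE_commute) measurable

lemma nn_integral_norm_less:
  fixes x :: "real^'n::finite"
  assumes "0 \<le> R"
  shows "(\<integral>y. indicator {u. u < R} (norm (y::real^'n))) = ennreal (unit_ball_vol (real CARD('n)) * R ^ CARD('n))"
  using assms unfolding indicator_ball_norm[symmetric] by (simp add: emeasure_ball)

text \<open>For almost every \<xi> the pointwise bound gives the same majorant, built from the
  integral \<open>W\<close> of g^p over a ball of radius 2 R. Integrating \<open>W\<close> in x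
  produces the volume R^n, and the p-th root R^(n/p).\<close>

lemma shell_q_PInf:
  fixes p t B :: real
  assumes p: "0 < p" and t: "real CARD('n) < t" and B: "0 \<le> B"
  shows "\<exists>C>0. \<forall>(\<Gamma>::real^'n::finite \<Rightarrow> real^'n \<Rightarrow> ennreal) a R.
    jointly_measurable \<Gamma> \<longrightarrow> (\<forall>\<xi>. slowly_varying B (\<lambda>x. \<Gamma> x \<xi>)) \<longrightarrow> a \<in> borel \<rightarrow>\<^sub>M borel \<longrightarrow> 1 \<le> R \<longrightarrow>
    mixed_norm (ereal p) \<infinity> (\<lambda>x \<xi>. local_smear (a \<xi>) t R (\<lambda>x. \<Gamma> x \<xi>) x)
      \<le> ennreal (C * R powr (real CARD('n) * (1 / p))) * mixed_norm (ereal p) \<infinity> \<Gamma>"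
proof -
  obtain C1 where C1: "C1 > 0" "\<And>(h::real^'n \<Rightarrow> ennreal) a R x. h \<in> borel_measurable borel \<Longrightarrow> slowly_varying B h \<Longrightarrow> 1 \<le> R \<Longrightarrow>
    epow (local_smear a t R h x) p \<le> ennreal C1 * (\<integral>y. epow (h (x + y)) p * indicator {v. v < 2 * R} (norm y))"
    using local_smear_pointwise[OF p t B] by blast
  define v where "v = unit_ball_vol (real CARD('n)) * 2 ^ CARD('n)"
  have v: "0 < v" unfolding v_def by (intro mult_pos_pos unit_ball_vol_pos) auto
  define C where "C = (C1 * v) powr (1 / p)"
  have main: "mixed_norm (ereal p) \<infinity> (\<lambda>x \<xi>. local_smear (a \<xi>) t R (\<lambda>x. \<Gamma> x \<xi>) x)
      \<le> ennreal (C * R powr (real CARD('n) * (1 / p))) * mixed_norm (ereal p) \<infinity> \<Gamma>"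
    if \<Gamma> [measurable]: "jointly_measurable \<Gamma>" and sv: "\<And>\<xi>. slowly_varying B (\<lambda>x. \<Gamma> x \<xi>)" and a: "a \<in> borel \<rightarrow>\<^sub>M borel" and R: "1 \<le> R"
    for \<Gamma> :: "real^'n \<Rightarrow> real^'n \<Rightarrow> ennreal" and a R
  proof -
    define H where "H = (\<lambda>x \<xi>. local_smear (a \<xi>) t R (\<lambda>x. \<Gamma> x \<xi>) x)"
    have Hm [measurable]: "jointly_measurable H" unfolding H_def by (rule local_smear_jm[OF \<Gamma> a])
    have [measurable]: "H x \<in> borel_measurable borel" for x by (rule measurable_section[OF Hm])
    note measurable_fst_section[OF \<Gamma>, measurable]
    define g where "g = (\<lambda>x. Lnorm lborel \<infinity> (\<Gamma> x))"
    have gm [measurable]: "g \<in> borel_measurable borel" unfolding g_def by (rule measurable_inner_norm[OF _ \<Gamma>]) simp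
    define W where "W = (\<lambda>x. (\<integral>y. epow (g (x + y)) p * indicator {u. u < 2 * R} (norm y)))"
    have Wm [measurable]: "W \<in> borel_measurable borel" unfolding W_def by measurable
    \<comment> \<open>After the exchange the bound holds, for almost every \<xi>, at almost every x.
      That suffices for a statement at every x about \<open>H\<close>, which is obtained by
      integrating in position.\<close>
    have "AE \<xi> in lborel. AE x in lborel. \<Gamma> x \<xi> \<le> g x"
      by (rule AE_swap_le[OF \<Gamma> gm]) (simp add: g_def Lnorm_PInf esssup_AE)
    then have AEH: "AE \<xi> in lborel. \<forall>x. H x \<xi> \<le> epow (ennreal C1 * W x) (1 / p)"
    proof eventually_elim
      fix \<xi> assume le: "AE x in lborel. \<Gamma> x \<xi> \<le> g x"
      show "\<forall>x. H x \<xi> \<le> epow (ennreal C1 * W x) (1 / p)"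
      proof
        fix x
        have "(\<integral>y. epow (\<Gamma> (x + y) \<xi>) p * indicator {u. u < 2 * R} (norm y))
          = (\<integral>y. epow (\<Gamma> y \<xi>) p * indicator {u. u < 2 * R} (norm (y - x)))"
          using nn_integral_shift[of "\<lambda>y. epow (\<Gamma> y \<xi>) p * indicator {u. u < 2 * R} (norm (y - x))" x] by simp
        also have "\<dots> \<le> (\<integral>y. epow (g y) p * indicator {u. u < 2 * R} (norm (y - x)))"
          using le p by (intro nn_integral_mono_AE) (auto elim!: eventually_mono intro!: mult_right_mono epow_mono)
        also have "\<dots> = W x"
          unfolding W_def using nn_integral_shift[of "\<lambda>y. epow (g y) p * indicator {u. u < 2 * R} (norm (y - x))" x] by simp
        finally have "epow (H x \<xi>) p \<le> ennreal C1 * W x"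
          unfolding H_def by (intro order_trans[OF C1(2)] mult_left_mono sv R) auto
        then show "H x \<xi> \<le> epow (ennreal C1 * W x) (1 / p)" by (rule epow_le_swap[OF p])
      qed
    qed
    have "Lnorm lborel \<infinity> (H x) \<le> epow (ennreal C1 * W x) (1 / p)" for x
      unfolding Lnorm_PInf using AEH by (intro esssup_I) (auto elim!: eventually_mono)
    then have "mixed_norm (ereal p) \<infinity> H \<le> Lnorm lborel (ereal p) (\<lambda>x. epow (ennreal C1 * W x) (1 / p))"
      unfolding mixed_norm_def using p measurable_inner_norm[OF _ Hm, of \<infinity>] by (intro Lnorm_mono) auto
    also have "\<dots> = epow (ennreal C1 * (\<integral>x. W x)) (1 / p)"
      using p by (simp add: Lnorm_ereal epow_inverse' nn_integral_cmult)
    also have "(\<integral>x. W x) = (\<integral>y. \<integral>x. epow (g (x + y)) p * indicator {u. u < 2 * R} (norm y))"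
      unfolding W_def by (rule lborel_pair.Fubini'[symmetric]) measurable
    also have "\<dots> = (\<integral>y. (\<integral>x. epow (g x) p) * indicator {u. u < 2 * R} (norm (y::real^'n)))"
    proof (intro nn_integral_cong)
      fix y
      show "(\<integral>x. epow (g (x + y)) p * indicator {u. u < 2 * R} (norm y)) = (\<integral>x. epow (g x) p) * indicator {u. u < 2 * R} (norm y)"
        using nn_integral_shift[of "\<lambda>x. epow (g x) p" y] by (simp add: nn_integral_multc add.commute)
    qed
    also have "\<dots> = (\<integral>x. epow (g x) p) * ennreal (v * R ^ CARD('n))"
      using R by (simp add: nn_integral_cmult nn_integral_norm_less v_def power_mult_distrib mult_ac)
    also have "epow (ennreal C1 * ((\<integral>x. epow (g x) p) * ennreal (v * R ^ CARD('n)))) (1 / p)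
       = ennreal (C * R powr (real CARD('n) * (1 / p))) * mixed_norm (ereal p) \<infinity> \<Gamma>"
    proof -
      have "ennreal C1 * ((\<integral>x. epow (g x) p) * ennreal (v * R ^ CARD('n))) = ennreal (C1 * v * R ^ CARD('n)) * (\<integral>x. epow (g x) p)"
        using C1(1) v R by (simp add: ennreal_mult mult_ac)
      moreover have "epow (ennreal (C1 * v * R ^ CARD('n))) (1 / p) = ennreal (C * R powr (real CARD('n) * (1 / p)))"
        using C1(1) v R by (simp add: powr_mult real_power_powr C_def)
      ultimately show ?thesis by (simp add: epow_mult mixed_norm_def Lnorm_ereal g_def)
    qed
    finally show ?thesis by (simp add: H_def)
  qed
  have "0 < C" unfolding C_def using C1(1) v by simp
  then show ?thesis using main by blast
qed

text \<open>The pointwise bound with exponent \<open>q\<close> is integrated in \<xi>. What remains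
  is the q-th power of the inner norm over a ball of radius 2 R, at most its supremum times the
  volume; hence R^(n/q).\<close>

lemma shell_p_PInf:
  fixes q t B :: real
  assumes q: "0 < q" and t: "real CARD('n) < t" and B: "0 \<le> B"
  shows "\<exists>C>0. \<forall>(\<Gamma>::real^'n::finite \<Rightarrow> real^'n \<Rightarrow> ennreal) a R.
    jointly_measurable \<Gamma> \<longrightarrow> (\<forall>\<xi>. slowly_varying B (\<lambda>x. \<Gamma> x \<xi>)) \<longrightarrow> a \<in> borel \<rightarrow>\<^sub>M borel \<longrightarrow> 1 \<le> R \<longrightarrow>
    mixed_norm \<infinity> (ereal q) (\<lambda>x \<xi>. local_smear (a \<xi>) t R (\<lambda>x. \<Gamma> x \<xi>) x)
      \<le> ennreal (C * R powr (real CARD('n) * (1 / q))) * mixed_norm \<infinity> (ereal q) \<Gamma>"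
proof -
  obtain C1 where C1: "C1 > 0" "\<And>(h::real^'n \<Rightarrow> ennreal) a R x. h \<in> borel_measurable borel \<Longrightarrow> slowly_varying B h \<Longrightarrow> 1 \<le> R \<Longrightarrow>
    epow (local_smear a t R h x) q \<le> ennreal C1 * (\<integral>y. epow (h (x + y)) q * indicator {v. v < 2 * R} (norm y))"
    using local_smear_pointwise[OF q t B] by blast
  define v where "v = unit_ball_vol (real CARD('n)) * 2 ^ CARD('n)"
  have v: "0 < v" unfolding v_def by (intro mult_pos_pos unit_ball_vol_pos) auto
  define C where "C = (C1 * v) powr (1 / q)"
  have main: "mixed_norm \<infinity> (ereal q) (\<lambda>x \<xi>. local_smear (a \<xi>) t R (\<lambda>x. \<Gamma> x \<xi>) x)
      \<le> ennreal (C * R powr (real CARD('n) * (1 / q))) * mixed_norm \<infinity> (ereal q) \<Gamma>"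
    if \<Gamma> [measurable]: "jointly_measurable \<Gamma>" and sv: "\<And>\<xi>. slowly_varying B (\<lambda>x. \<Gamma> x \<xi>)" and a: "a \<in> borel \<rightarrow>\<^sub>M borel" and R: "1 \<le> R"
    for \<Gamma> :: "real^'n \<Rightarrow> real^'n \<Rightarrow> ennreal" and a R
  proof -
    define H where "H = (\<lambda>x \<xi>. local_smear (a \<xi>) t R (\<lambda>x. \<Gamma> x \<xi>) x)"
    have Hm [measurable]: "jointly_measurable H" unfolding H_def by (rule local_smear_jm[OF \<Gamma> a])
    note measurable_fst_section[OF \<Gamma>, measurable]
    define G where "G = (\<lambda>x. (\<integral>\<xi>. epow (\<Gamma> x \<xi>) q))"
    have Gm [measurable]: "G \<in> borel_measurable borel" unfolding G_def by measurable
    define M where "M = mixed_norm \<infinity> (ereal q) \<Gamma>"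
    have "AE x in lborel. Lnorm lborel (ereal q) (\<Gamma> x) \<le> M"
      unfolding M_def mixed_norm_def Lnorm_PInf by (rule esssup_AE)
    then have GM: "AE x in lborel. G x \<le> epow M q"
      by eventually_elim (use q epow_mono[of q] in \<open>force simp: Lnorm_ereal epow_inverse' G_def\<close>)
    have "Lnorm lborel (ereal q) (H x) \<le> ennreal (C * R powr (real CARD('n) * (1 / q))) * M" for x
    proof -
      have jm: "(\<lambda>(\<xi>, y). epow (\<Gamma> (x + y) \<xi>) q * indicator {u. u < 2 * R} (norm y)) \<in> borel_measurable (lborel \<Otimes>\<^sub>M lborel)"
      proof -
        have "(\<lambda>w::(real^'n) \<times> (real^'n). (x + snd w, fst w)) \<in> (lborel \<Otimes>\<^sub>M lborel) \<rightarrow>\<^sub>M (borel \<Otimes>\<^sub>M borel)" by measurable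
        from measurable_compose[OF this \<Gamma>] have [measurable]: "(\<lambda>w. \<Gamma> (x + snd w) (fst w)) \<in> borel_measurable (lborel \<Otimes>\<^sub>M lborel)" by simp
        show ?thesis unfolding split_beta' by measurable
      qed
      have "(\<integral>\<xi>. epow (H x \<xi>) q) \<le> (\<integral>\<xi>. ennreal C1 * (\<integral>y. epow (\<Gamma> (x + y) \<xi>) q * indicator {u. u < 2 * R} (norm y)))"
        unfolding H_def by (intro nn_integral_mono C1(2) sv R) auto
      also have "\<dots> = ennreal C1 * (\<integral>\<xi>. \<integral>y. epow (\<Gamma> (x + y) \<xi>) q * indicator {u. u < 2 * R} (norm y))"
        by (rule nn_integral_cmult) (use lborel.borel_measurable_nn_integral_fst[OF jm] in simp)
      also have "(\<integral>\<xi>. \<integral>y. epow (\<Gamma> (x + y) \<xi>) q * indicator {u. u < 2 * R} (norm y))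
        = (\<integral>y. \<integral>\<xi>. epow (\<Gamma> (x + y) \<xi>) q * indicator {u. u < 2 * R} (norm y))"
        by (rule lborel_pair.Fubini'[symmetric, OF jm])
      also have "\<dots> = (\<integral>y. G (x + y) * indicator {u. u < 2 * R} (norm y))"
        unfolding G_def by (intro nn_integral_cong nn_integral_multc) measurable
      also have "\<dots> = (\<integral>y. G y * indicator {u. u < 2 * R} (norm (y - x)))"
        using nn_integral_shift[of "\<lambda>y. G y * indicator {u. u < 2 * R} (norm (y - x))" x] by simp
      also have "\<dots> \<le> (\<integral>y. epow M q * indicator {u. u < 2 * R} (norm (y - x)))"
        using GM by (intro nn_integral_mono_AE) (auto elim!: eventually_mono intro!: mult_right_mono)
      also have "\<dots> = (\<integral>y. epow M q * indicator {u. u < 2 * R} (norm (y::real^'n)))"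
        using nn_integral_shift[of "\<lambda>y. epow M q * indicator {u. u < 2 * R} (norm (y - x))" x] by simp
      also have "\<dots> = epow M q * ennreal (v * R ^ CARD('n))"
        using R by (simp add: nn_integral_cmult nn_integral_norm_less v_def power_mult_distrib mult_ac)
      finally have "Lnorm lborel (ereal q) (H x) \<le> epow (ennreal C1 * (epow M q * ennreal (v * R ^ CARD('n)))) (1 / q)"
        unfolding Lnorm_ereal using q by (intro epow_mono) (auto simp: mult_left_mono)
      also have "ennreal C1 * (epow M q * ennreal (v * R ^ CARD('n))) = ennreal (C1 * v * R ^ CARD('n)) * epow M q"
        using C1(1) v R by (simp add: ennreal_mult mult_ac)
      also have "epow (ennreal (C1 * v * R ^ CARD('n)) * epow M q) (1 / q) = ennreal (C * R powr (real CARD('n) * (1 / q))) * M"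
        unfolding epow_mult using C1(1) v R q by (simp add: powr_mult real_power_powr C_def epow_inverse)
      finally show ?thesis .
    qed
    then have "mixed_norm \<infinity> (ereal q) H \<le> ennreal (C * R powr (real CARD('n) * (1 / q))) * M"
      unfolding mixed_norm_def Lnorm_PInf using q measurable_inner_norm[OF _ Hm, of "ereal q"] by (intro esssup_I) auto
    then show ?thesis by (simp add: H_def M_def)
  qed
  have "0 < C" unfolding C_def using C1(1) v by simp
  then show ?thesis using main by blast
qed

text \<open>One hypothesis on \<open>dotexp p\<close> serves all orderings of the exponents: for p <
  q it implies the condition on min(1, q), and if one exponent is infinite its consequence t > n is
  enough.\<close>

lemma shell_bound:
  fixes p q :: ereal and t B :: real
  assumes pq: "0 < p" "0 < q" "p \<noteq> q" and t: "real CARD('n) < t * dotexp p" and B: "0 \<le> B"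
  shows "\<exists>C>0. \<forall>(\<Gamma>::real^'n::finite \<Rightarrow> real^'n \<Rightarrow> ennreal) a R.
    jointly_measurable \<Gamma> \<longrightarrow> (\<forall>\<xi>. slowly_varying B (\<lambda>x. \<Gamma> x \<xi>)) \<longrightarrow> a \<in> borel \<rightarrow>\<^sub>M borel \<longrightarrow> 1 \<le> R \<longrightarrow>
    mixed_norm p q (\<lambda>x \<xi>. local_smear (a \<xi>) t R (\<lambda>x. \<Gamma> x \<xi>) x)
      \<le> ennreal (C * R powr (real CARD('n) * \<bar>recip p - recip q\<bar>)) * mixed_norm p q \<Gamma>"
proof -
  have "0 < t * dotexp p" using t by (rule le_less_trans[rotated]) simp
  then have t0: "0 < t" using dotexp_pos[OF pq(1)] by (simp add: zero_less_mult_iff)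
  have "t * dotexp p \<le> t" using dotexp_le_1[OF pq(1)] t0 by (simp add: mult_left_le)
  then have tn: "real CARD('n) < t" using t by linarith
  show ?thesis
    using pq(1)
  proof (cases p rule: ereal_pos_cases)
    case p: PInf
    then obtain q' where q: "q = ereal q'" "0 < q'" using pq by (cases q) auto
    have "\<bar>recip p - recip q\<bar> = 1 / q'" using q(2) by (simp add: p q(1) recip_def)
    then show ?thesis using shell_p_PInf[OF q(2) tn B] by (simp only: p q(1))
  next
    case p: (real p')
    show ?thesis
      using pq(2)
    proof (cases q rule: ereal_pos_cases)
      case q: PInf
      have "\<bar>recip p - recip q\<bar> = 1 / p'" using p(2) by (simp add: p(1) q recip_def)
      then show ?thesis using shell_q_PInf[OF p(2) tn B] by (simp only: p(1) q)
    next
      case q: (real q')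
      have tp: "real CARD('n) < t * min 1 p'" using t p by (simp add: dotexp_ereal)
      show ?thesis
      proof (cases "p' < q'")
        case True
        have "t * min 1 p' \<le> t * min 1 q'" using True t0 by (intro mult_left_mono) auto
        then have "real CARD('n) < t * min 1 q'" using tp by linarith
        moreover have "\<bar>recip p - recip q\<bar> = 1 / p' - 1 / q'" using True p q by (simp add: recip_def frac_le)
        ultimately show ?thesis using shell_p_less_q[OF p(2) True _ B] by (simp add: p q)
      next
        case False
        then have lt: "q' < p'" using pq(3) p q by auto
        have "\<bar>recip p - recip q\<bar> = 1 / q' - 1 / p'" using lt p q by (simp add: recip_def frac_le)
        then show ?thesis using shell_q_less_p[OF q(2) lt tp B] by (simp add: p q)
      qed
    qed
  qed
qed

text \<open>At a fixed frequency the centre a(\<xi>) only translates the kernel in x and does not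
  affect the norm of the average; equal exponents allow the frequencies to be treated one at a time,
  so no power of the displacement is lost.\<close>

lemma smear_bound_eq:
  fixes p :: ereal and t B :: real
  assumes p: "0 < p" and t: "real CARD('n) < t * dotexp p" and B: "0 \<le> B"
  shows "\<exists>C>0. \<forall>(\<Gamma>::real^'n::finite \<Rightarrow> real^'n \<Rightarrow> ennreal) G a.
    jointly_measurable \<Gamma> \<longrightarrow> jointly_measurable G \<longrightarrow> (\<forall>\<xi>. slowly_varying B (\<lambda>x. \<Gamma> x \<xi>)) \<longrightarrow>
    (\<forall>x \<xi>. G x \<xi> \<le> (\<integral>y. ennreal (jbr (y - a \<xi>) powr (- t)) * \<Gamma> (x + y) \<xi>)) \<longrightarrow>
    mixed_norm p p G \<le> ennreal C * mixed_norm p p \<Gamma>"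
  using p
proof (cases p rule: ereal_pos_cases)
  case PInf
  have tn: "real CARD('n) < t" using t by (simp add: PInf)
  define I where "I = (LINT x|(lborel::(real^'n) measure). jbr x powr (- t))"
  have I0: "0 \<le> I" by (simp add: I_def)
  have "mixed_norm \<infinity> \<infinity> G \<le> ennreal (I + 1) * mixed_norm \<infinity> \<infinity> \<Gamma>"
    if \<Gamma> [measurable]: "jointly_measurable \<Gamma>" and Gm [measurable]: "jointly_measurable G"
      and G: "\<And>x \<xi>. G x \<xi> \<le> (\<integral>y. ennreal (jbr (y - a \<xi>) powr (- t)) * \<Gamma> (x + y) \<xi>)"
    for \<Gamma> G :: "real^'n \<Rightarrow> real^'n \<Rightarrow> ennreal" and a
  proof -
    define M where "M = mixed_norm \<infinity> \<infinity> \<Gamma>"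
    note measurable_fst_section[OF \<Gamma>, measurable] measurable_section[OF Gm, measurable]
    have "AE x in lborel. esssup lborel (\<Gamma> x) \<le> M"
      unfolding M_def mixed_norm_def Lnorm_PInf by (rule esssup_AE)
    then have "AE x in lborel. AE \<xi> in lborel. \<Gamma> x \<xi> \<le> M"
    proof eventually_elim
      fix x assume "esssup lborel (\<Gamma> x) \<le> M"
      then show "AE \<xi> in lborel. \<Gamma> x \<xi> \<le> M"
        using esssup_AE[of "\<Gamma> x" lborel] by (auto elim!: eventually_mono intro: order_trans)
    qed
    then have "AE \<xi> in lborel. AE x in lborel. \<Gamma> x \<xi> \<le> M" by (intro AE_swap_le[OF \<Gamma>]) auto
    then have AEG: "AE \<xi> in lborel. \<forall>x. G x \<xi> \<le> ennreal I * M"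
    proof eventually_elim
      fix \<xi> assume le: "AE x in lborel. \<Gamma> x \<xi> \<le> M"
      show "\<forall>x. G x \<xi> \<le> ennreal I * M"
      proof
        fix x
        have "G x \<xi> \<le> (\<integral>y. ennreal (jbr (y - a \<xi>) powr (- t)) * \<Gamma> (x + y) \<xi>)" by (rule G)
        also have "\<dots> = (\<integral>y. ennreal (jbr (y - (x + a \<xi>)) powr (- t)) * \<Gamma> y \<xi>)"
          using nn_integral_shift[of "\<lambda>y. ennreal (jbr (y - (x + a \<xi>)) powr (- t)) * \<Gamma> y \<xi>" x] by simp
        also have "\<dots> \<le> (\<integral>y. ennreal (jbr (y - (x + a \<xi>)) powr (- t)) * M)"
          using le by (intro nn_integral_mono_AE) (auto elim!: eventually_mono intro!: mult_left_mono)
        also have "\<dots> = ennreal I * M"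
          unfolding I_def kernel_integral[OF tn, of "x + a \<xi>", symmetric] by (rule nn_integral_multc) measurable
        finally show "G x \<xi> \<le> ennreal I * M" .
      qed
    qed
    have "esssup lborel (G x) \<le> ennreal I * M" for x
      using AEG by (intro esssup_I) (auto elim!: eventually_mono)
    then have "mixed_norm \<infinity> \<infinity> G \<le> ennreal I * M"
      unfolding mixed_norm_def Lnorm_PInf using measurable_inner_norm[OF _ Gm, of \<infinity>] by (intro esssup_I) (auto simp: Lnorm_PInf)
    also have "\<dots> \<le> ennreal (I + 1) * M" by (intro mult_right_mono ennreal_leI) auto
    finally show ?thesis by (simp add: M_def)
  qed
  moreover have "0 < I + 1" using I0 by simp
  ultimately show ?thesis unfolding PInf by blast
next
  case (real p')
  have p': "0 < p'" by fact
  have t': "real CARD('n) < t * min 1 p'" using t p' by (simp add: real dotexp_ereal)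
  obtain C1 where C1: "C1 > 0" "\<And>(h::real^'n \<Rightarrow> ennreal) a S S'. h \<in> borel_measurable borel \<Longrightarrow> slowly_varying B h \<Longrightarrow> S \<in> sets borel \<Longrightarrow> S' \<in> sets borel \<Longrightarrow> (\<forall>z\<in>S. ball z 1 \<subseteq> S') \<Longrightarrow>
    epow (\<integral>y. ennreal (jbr (y - a) powr (- t)) * h y * indicator S y) p'
      \<le> ennreal C1 * (\<integral>y. ennreal (jbr (y - a) powr (- (t * min 1 p'))) * epow (h y) p' * indicator S' y)"
    using kernel_power_bound[OF p' t' B] by blast
  define u where "u = t * min 1 p'"
  define I where "I = (LINT x|(lborel::(real^'n) measure). jbr x powr (- u))"
  have I0: "0 \<le> I" by (simp add: I_def)
  have "mixed_norm p p G \<le> ennreal ((C1 * I + 1) powr (1 / p')) * mixed_norm p p \<Gamma>"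
    if \<Gamma> [measurable]: "jointly_measurable \<Gamma>" and Gm [measurable]: "jointly_measurable G" and sv: "\<And>\<xi>. slowly_varying B (\<lambda>x. \<Gamma> x \<xi>)"
      and G: "\<And>x \<xi>. G x \<xi> \<le> (\<integral>y. ennreal (jbr (y - a \<xi>) powr (- t)) * \<Gamma> (x + y) \<xi>)"
    for \<Gamma> G :: "real^'n \<Rightarrow> real^'n \<Rightarrow> ennreal" and a
  proof -
    note measurable_fst_section[OF \<Gamma>, measurable]
    have mx: "mixed_norm p p \<Phi> = epow (\<integral>x. \<integral>\<xi>. epow (\<Phi> x \<xi>) p') (1 / p')" for \<Phi> :: "real^'n \<Rightarrow> real^'n \<Rightarrow> ennreal"
      unfolding mixed_norm_def real Lnorm_ereal using p' by (simp add: epow_inverse')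
    have fib: "(\<integral>x. epow (G x \<xi>) p') \<le> ennreal (C1 * I + 1) * (\<integral>x. epow (\<Gamma> x \<xi>) p')" for \<xi>
    proof -
      let ?k = "\<lambda>y. ennreal (jbr (y - a \<xi>) powr (- u))"
      have "(\<integral>x. epow (G x \<xi>) p') \<le> (\<integral>x. \<integral>y. ennreal C1 * (?k y * epow (\<Gamma> (x + y) \<xi>) p'))"
      proof (intro nn_integral_mono)
        fix x
        have "epow (G x \<xi>) p' \<le> epow (\<integral>y. ennreal (jbr (y - a \<xi>) powr (- t)) * \<Gamma> (x + y) \<xi> * indicator UNIV y) p'"
          using G p' by (intro epow_mono) auto
        also have "\<dots> \<le> ennreal C1 * (\<integral>y. ennreal (jbr (y - a \<xi>) powr (- (t * min 1 p'))) * epow (\<Gamma> (x + y) \<xi>) p' * indicator UNIV y)"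
          by (intro C1(2) slowly_varying_shift[OF sv]) auto
        also have "\<dots> = (\<integral>y. ennreal C1 * (?k y * epow (\<Gamma> (x + y) \<xi>) p'))"
          by (simp add: nn_integral_cmult u_def)
        finally show "epow (G x \<xi>) p' \<le> (\<integral>y. ennreal C1 * (?k y * epow (\<Gamma> (x + y) \<xi>) p'))" .
      qed
      also have "\<dots> = (\<integral>y. \<integral>x. ennreal C1 * (?k y * epow (\<Gamma> (x + y) \<xi>) p'))"
        by (rule lborel_pair.Fubini'[symmetric]) measurable
      also have "\<dots> = (\<integral>y. ennreal C1 * (?k y * (\<integral>x. epow (\<Gamma> x \<xi>) p')))"
      proof (intro nn_integral_cong)
        fix y
        have "(\<integral>x. ennreal C1 * (?k y * epow (\<Gamma> (x + y) \<xi>) p')) = ennreal C1 * (?k y * (\<integral>x. epow (\<Gamma> (x + y) \<xi>) p'))"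
          by (subst nn_integral_cmult, measurable, subst nn_integral_cmult, measurable)
        also have "(\<integral>x. epow (\<Gamma> (x + y) \<xi>) p') = (\<integral>x. epow (\<Gamma> x \<xi>) p')"
          using nn_integral_shift[of "\<lambda>x. epow (\<Gamma> x \<xi>) p'" y] by (simp add: add.commute)
        finally show "(\<integral>x. ennreal C1 * (?k y * epow (\<Gamma> (x + y) \<xi>) p')) = ennreal C1 * (?k y * (\<integral>x. epow (\<Gamma> x \<xi>) p'))" .
      qed
      also have "\<dots> = ennreal C1 * (integral\<^sup>N lborel ?k * (\<integral>x. epow (\<Gamma> x \<xi>) p'))"
        by (subst nn_integral_cmult, measurable, subst nn_integral_multc, measurable)
      also have "integral\<^sup>N lborel ?k = ennreal I" unfolding I_def by (rule kernel_integral) (use t' in \<open>simp add: u_def\<close>)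
      also have "ennreal C1 * (ennreal I * X) \<le> ennreal (C1 * I + 1) * X" for X
      proof -
        have "ennreal C1 * (ennreal I * X) = ennreal (C1 * I) * X" using C1(1) I0 by (simp add: ennreal_mult mult.assoc)
        then show ?thesis by (simp add: mult_right_mono ennreal_leI)
      qed
      finally show ?thesis .
    qed
    have "(\<integral>x. \<integral>\<xi>. epow (G x \<xi>) p') = (\<integral>\<xi>. \<integral>x. epow (G x \<xi>) p')"
      by (rule lborel_pair.Fubini'[symmetric]) measurable
    also have "\<dots> \<le> (\<integral>\<xi>. ennreal (C1 * I + 1) * (\<integral>x. epow (\<Gamma> x \<xi>) p'))"
      by (intro nn_integral_mono fib)
    also have "\<dots> = ennreal (C1 * I + 1) * (\<integral>\<xi>. \<integral>x. epow (\<Gamma> x \<xi>) p')"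
      by (rule nn_integral_cmult) measurable
    also have "(\<integral>\<xi>. \<integral>x. epow (\<Gamma> x \<xi>) p') = (\<integral>x. \<integral>\<xi>. epow (\<Gamma> x \<xi>) p')"
      by (rule lborel_pair.Fubini') measurable
    finally have "mixed_norm p p G \<le> epow (ennreal (C1 * I + 1) * (\<integral>x. \<integral>\<xi>. epow (\<Gamma> x \<xi>) p')) (1 / p')"
      unfolding mx using p' by (intro epow_mono) auto
    also have "\<dots> = ennreal ((C1 * I + 1) powr (1 / p')) * mixed_norm p p \<Gamma>"
      unfolding epow_mult mx using C1(1) I0 by (subst epow_ennreal) auto
    finally show ?thesis .
  qed
  moreover have "0 < (C1 * I + 1) powr (1 / p')"
  proof -
    have "0 \<le> C1 * I" using C1(1) I0 by simp
    then have "C1 * I + 1 \<noteq> 0" by linarith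
    then show ?thesis by simp
  qed
  ultimately show ?thesis by blast
qed

text \<open>At each frequency only piece 0 and one shell contribute, so \<open>H\<close> is at most
  twice the larger of them and its r-th power at most 2^r times the sum of all r-th powers.
  Minkowski's inequality for counting measure sums the norms.\<close>

lemma mixed_norm_pieces:
  fixes F :: "nat \<Rightarrow> real^'n::finite \<Rightarrow> real^'n \<Rightarrow> ennreal" and c :: "nat \<Rightarrow> real"
  assumes p: "0 < p" "0 < q" and F: "\<And>i. jointly_measurable (F i)" and H: "jointly_measurable H"
    and le: "\<And>\<xi>. \<exists>j. \<forall>x. H x \<xi> \<le> F 0 x \<xi> + F (Suc j) x \<xi>"
    and bd: "\<And>i. mixed_norm p q (F i) \<le> ennreal (c i) * M" and c: "\<And>i. 0 \<le> c i"
    and sm: "summable (\<lambda>i. c i powr quasi_exponent p q)"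
  shows "mixed_norm p q H \<le> ennreal (2 * (\<Sum>i. c i powr quasi_exponent p q) powr (1 / quasi_exponent p q)) * M"
proof -
  define r where "r = quasi_exponent p q"
  have r: "0 < r" "r \<le> dotexp p" "r \<le> dotexp q" using dotexp_pos p by (auto simp: r_def quasi_exponent_def)
  have pr: "1 \<le> p / ereal r" "1 \<le> q / ereal r" using divide_dotexp_ge_1 p r by auto
  have pr0: "0 < p / ereal r" "0 < q / ereal r" using ereal_ge_1_pos pr by auto
  let ?N = "count_space (UNIV :: nat set)"
  have jm3: "(\<lambda>(x, \<xi>, i). ennreal (2 powr r) * epow (F i x \<xi>) r) \<in> borel_measurable (borel \<Otimes>\<^sub>M (borel \<Otimes>\<^sub>M ?N))"
  proof -
    have "(\<lambda>w. ennreal (2 powr r) * epow (F i (fst w) (fst (snd w))) r) \<in> borel_measurable (borel \<Otimes>\<^sub>M (borel \<Otimes>\<^sub>M ?N))" for i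
    proof -
      have "(\<lambda>w::(real^'n) \<times> (real^'n) \<times> nat. (fst w, fst (snd w))) \<in> (borel \<Otimes>\<^sub>M (borel \<Otimes>\<^sub>M ?N)) \<rightarrow>\<^sub>M (borel \<Otimes>\<^sub>M borel)" by measurable
      from measurable_compose[OF this F[of i]]
      have [measurable]: "(\<lambda>w. F i (fst w) (fst (snd w))) \<in> borel_measurable (borel \<Otimes>\<^sub>M (borel \<Otimes>\<^sub>M ?N))" by simp
      show ?thesis by measurable
    qed
    moreover have "(\<lambda>w. snd (snd w)) \<in> (borel \<Otimes>\<^sub>M (borel \<Otimes>\<^sub>M ?N)) \<rightarrow>\<^sub>M ?N" by measurable
    ultimately show ?thesis unfolding split_beta' by (rule measurable_compose_countable)
  qed
  have pw: "epow (H x \<xi>) r \<le> (\<integral>\<^sup>+i. ennreal (2 powr r) * epow (F i x \<xi>) r \<partial>?N)" for x \<xi>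
  proof -
    obtain j where j: "H x \<xi> \<le> F 0 x \<xi> + F (Suc j) x \<xi>" using le by blast
    obtain i where i: "F 0 x \<xi> \<le> F i x \<xi>" "F (Suc j) x \<xi> \<le> F i x \<xi>" using linear[of "F 0 x \<xi>" "F (Suc j) x \<xi>"] by auto
    have "H x \<xi> \<le> ennreal 2 * F i x \<xi>" using order_trans[OF j add_mono[OF i]] by (simp add: mult_2)
    then have "epow (H x \<xi>) r \<le> epow (ennreal 2 * F i x \<xi>) r" using r by (intro epow_mono) auto
    also have "\<dots> = ennreal (2 powr r) * epow (F i x \<xi>) r" unfolding epow_mult by (subst epow_ennreal) auto
    also have "\<dots> \<le> (\<integral>\<^sup>+i. ennreal (2 powr r) * epow (F i x \<xi>) r \<partial>?N)" by (rule nn_integral_ge_point) simp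
    finally show ?thesis .
  qed
  have jmH: "jointly_measurable (\<lambda>x \<xi>. epow (H x \<xi>) r)" using H by measurable
  have jmF: "jointly_measurable (\<lambda>x \<xi>. epow (F i x \<xi>) r)" for i using F[of i] by measurable
  define S where "S = (\<Sum>i. c i powr r)"
  have sm': "summable (\<lambda>i. c i powr r)" using sm by (simp add: r_def)
  have S0: "0 \<le> S" unfolding S_def by (rule suminf_nonneg[OF sm']) simp
  have "epow (mixed_norm p q H) r = mixed_norm (p / ereal r) (q / ereal r) (\<lambda>x \<xi>. epow (H x \<xi>) r)"
    by (rule mixed_norm_power[OF p r(1) H])
  also have "\<dots> \<le> mixed_norm (p / ereal r) (q / ereal r) (\<lambda>x \<xi>. \<integral>\<^sup>+i. ennreal (2 powr r) * epow (F i x \<xi>) r \<partial>?N)"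
    by (intro mixed_norm_mono pr0 jmH pw)
  also have "\<dots> \<le> (\<integral>\<^sup>+i. mixed_norm (p / ereal r) (q / ereal r) (\<lambda>x \<xi>. ennreal (2 powr r) * epow (F i x \<xi>) r) \<partial>?N)"
    by (rule mixed_norm_Minkowski[OF sigma_finite_measure_count_space pr jm3])
  also have "\<dots> \<le> (\<integral>\<^sup>+i. ennreal (2 powr r) * (ennreal (c i powr r) * epow M r) \<partial>?N)"
  proof (intro nn_integral_mono)
    fix i
    have "mixed_norm (p / ereal r) (q / ereal r) (\<lambda>x \<xi>. ennreal (2 powr r) * epow (F i x \<xi>) r)
      \<le> ennreal (2 powr r) * mixed_norm (p / ereal r) (q / ereal r) (\<lambda>x \<xi>. epow (F i x \<xi>) r)"
      by (rule mixed_norm_cmult_le[OF pr0 jmF])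
    also have "\<dots> = ennreal (2 powr r) * epow (mixed_norm p q (F i)) r"
      by (simp only: mixed_norm_power[OF p r(1) F])
    also have "\<dots> \<le> ennreal (2 powr r) * epow (ennreal (c i) * M) r"
      using r by (intro mult_left_mono epow_mono bd) auto
    also have "\<dots> = ennreal (2 powr r) * (ennreal (c i powr r) * epow M r)"
      unfolding epow_mult using c by (subst epow_ennreal) auto
    finally show "mixed_norm (p / ereal r) (q / ereal r) (\<lambda>x \<xi>. ennreal (2 powr r) * epow (F i x \<xi>) r) \<le> ennreal (2 powr r) * (ennreal (c i powr r) * epow M r)" .
  qed
  also have "\<dots> = ennreal (2 powr r) * ((\<integral>\<^sup>+i. ennreal (c i powr r) \<partial>?N) * epow M r)"
    by (simp add: nn_integral_cmult nn_integral_multc)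
  also have "(\<integral>\<^sup>+i. ennreal (c i powr r) \<partial>?N) = ennreal S"
    unfolding S_def nn_integral_count_space_nat using sm' by (intro suminf_ennreal2) auto
  also have "ennreal (2 powr r) * (ennreal S * epow M r) = epow (ennreal (2 * S powr (1 / r)) * M) r"
    unfolding epow_mult using S0 r by (subst epow_ennreal) (auto simp: powr_mult powr_powr ennreal_mult mult.assoc)
  finally have "epow (mixed_norm p q H) r \<le> epow (ennreal (2 * S powr (1 / r)) * M) r" .
  then show ?thesis unfolding epow_le_iff[OF r(1)] by (simp add: S_def r_def)
qed

lemma smear_jm:
  fixes \<Gamma> :: "real ^ 'n::finite \<Rightarrow> real ^ 'n \<Rightarrow> ennreal"
  assumes \<Gamma>: "jointly_measurable \<Gamma>" and k [measurable]: "k \<in> borel_measurable borel"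
  shows "jointly_measurable (\<lambda>x \<xi>. (\<integral>y. k y * \<Gamma> (x + y) \<xi>))"
proof -
  have "(\<lambda>w::((real^'n) \<times> (real^'n)) \<times> (real^'n). (fst (fst w) + snd w, snd (fst w))) \<in> ((borel \<Otimes>\<^sub>M borel) \<Otimes>\<^sub>M lborel) \<rightarrow>\<^sub>M (borel \<Otimes>\<^sub>M borel)" by measurable
  from measurable_compose[OF this \<Gamma>]
  have 1: "(\<lambda>w. \<Gamma> (fst (fst w) + snd w) (snd (fst w))) \<in> borel_measurable ((borel \<Otimes>\<^sub>M borel) \<Otimes>\<^sub>M lborel)" by simp
  have 2: "(\<lambda>w::((real^'n) \<times> (real^'n)) \<times> (real^'n). k (snd w)) \<in> borel_measurable ((borel \<Otimes>\<^sub>M borel) \<Otimes>\<^sub>M lborel)"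
    by measurable
  have "(\<lambda>w. (\<integral>y. k y * \<Gamma> (fst w + y) (snd w))) \<in> borel_measurable (borel \<Otimes>\<^sub>M borel)"
    using borel_measurable_times_ennreal[OF 2 1]
    by (intro sigma_finite_measure.borel_measurable_nn_integral[OF sigma_finite_lborel]) (simp add: split_beta')
  then show ?thesis by (simp add: split_beta')
qed

text \<open>The kernel is centred at 0 for every \<xi>. After r-th powers, by
  \<open>kernel_power_bound\<close> with exponent r, it is a plain convolution in x with a function
  of order t r > n.\<close>

lemma mixed_norm_smear:
  fixes p q :: ereal and t B :: real
  assumes p: "0 < p" "0 < q" and t: "real CARD('n) < t * quasi_exponent p q" and B: "0 \<le> B"
  shows "\<exists>C>0. \<forall>\<Gamma>::real^'n::finite \<Rightarrow> real^'n \<Rightarrow> ennreal.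
    jointly_measurable \<Gamma> \<longrightarrow> (\<forall>\<xi>. slowly_varying B (\<lambda>x. \<Gamma> x \<xi>)) \<longrightarrow>
    mixed_norm p q (\<lambda>x \<xi>. (\<integral>y. ennreal (jbr y powr (- t)) * \<Gamma> (x + y) \<xi>)) \<le> ennreal C * mixed_norm p q \<Gamma>"
proof -
  define r where "r = quasi_exponent p q"
  have r: "0 < r" "r \<le> dotexp p" "r \<le> dotexp q" using dotexp_pos p by (auto simp: r_def quasi_exponent_def)
  have r1: "r \<le> 1" using r(2) dotexp_le_1[OF p(1)] by linarith
  have pr: "1 \<le> p / ereal r" "1 \<le> q / ereal r" using divide_dotexp_ge_1 p r by auto
  have pr0: "0 < p / ereal r" "0 < q / ereal r" using ereal_ge_1_pos pr by auto
  have t': "real CARD('n) < t * min 1 r" using t r1 by (simp add: r_def min_absorb2)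
  obtain C1 where C1: "C1 > 0" "\<And>(h::real^'n \<Rightarrow> ennreal) a S S'. h \<in> borel_measurable borel \<Longrightarrow> slowly_varying B h \<Longrightarrow> S \<in> sets borel \<Longrightarrow> S' \<in> sets borel \<Longrightarrow> (\<forall>z\<in>S. ball z 1 \<subseteq> S') \<Longrightarrow>
    epow (\<integral>y. ennreal (jbr (y - a) powr (- t)) * h y * indicator S y) r
      \<le> ennreal C1 * (\<integral>y. ennreal (jbr (y - a) powr (- (t * min 1 r))) * epow (h y) r * indicator S' y)"
    using kernel_power_bound[OF r(1) t' B] by blast
  define u where "u = t * min 1 r"
  define I where "I = (LINT x|(lborel::(real^'n) measure). jbr x powr (- u))"
  have I0: "0 \<le> I" by (simp add: I_def)
  define C where "C = (C1 * I + 1) powr (1 / r)"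
  have "mixed_norm p q (\<lambda>x \<xi>. (\<integral>y. ennreal (jbr y powr (- t)) * \<Gamma> (x + y) \<xi>)) \<le> ennreal C * mixed_norm p q \<Gamma>"
    if \<Gamma> [measurable]: "jointly_measurable \<Gamma>" and sv: "\<And>\<xi>. slowly_varying B (\<lambda>x. \<Gamma> x \<xi>)"
    for \<Gamma> :: "real^'n \<Rightarrow> real^'n \<Rightarrow> ennreal"
  proof -
    note measurable_fst_section[OF \<Gamma>, measurable]
    define H where "H = (\<lambda>x \<xi>. (\<integral>y. ennreal (jbr y powr (- t)) * \<Gamma> (x + y) \<xi>))"
    have Hm: "jointly_measurable H" unfolding H_def by (rule smear_jm[OF \<Gamma>]) measurable
    have Hr: "jointly_measurable (\<lambda>x \<xi>. epow (H x \<xi>) r)" using Hm by measurable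
    have Gr: "jointly_measurable (\<lambda>x \<xi>. epow (\<Gamma> x \<xi>) r)" using \<Gamma> by measurable
    let ?k = "\<lambda>y::real^'n. ennreal C1 * ennreal (jbr y powr (- u))"
    have pw: "epow (H x \<xi>) r \<le> (\<integral>z. ?k z * epow (\<Gamma> (z + x) (0 + \<xi>)) r)" for x \<xi>
    proof -
      have "epow (H x \<xi>) r \<le> epow (\<integral>y. ennreal (jbr (y - 0) powr (- t)) * \<Gamma> (x + y) \<xi> * indicator UNIV y) r"
        using r by (simp add: H_def)
      also have "\<dots> \<le> ennreal C1 * (\<integral>y. ennreal (jbr (y - 0) powr (- (t * min 1 r))) * epow (\<Gamma> (x + y) \<xi>) r * indicator UNIV y)"
        by (intro C1(2) slowly_varying_shift[OF sv]) auto
      also have "\<dots> = (\<integral>z. ?k z * epow (\<Gamma> (z + x) (0 + \<xi>)) r)"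
        by (simp add: nn_integral_cmult u_def add.commute mult.assoc)
      finally show ?thesis .
    qed
    have "epow (mixed_norm p q H) r = mixed_norm (p / ereal r) (q / ereal r) (\<lambda>x \<xi>. epow (H x \<xi>) r)"
      by (rule mixed_norm_power[OF p r(1) Hm])
    also have "\<dots> \<le> mixed_norm (p / ereal r) (q / ereal r) (\<lambda>x \<xi>. (\<integral>z. ?k z * epow (\<Gamma> (z + x) (0 + \<xi>)) r))"
      by (intro mixed_norm_mono pr0 Hr pw)
    also have "\<dots> \<le> (\<integral>z. ?k z) * mixed_norm (p / ereal r) (q / ereal r) (\<lambda>x \<xi>. epow (\<Gamma> x \<xi>) r)"
      by (rule mixed_norm_convolution[OF pr Gr, where A = "\<lambda>z. z" and B = "\<lambda>z. 0"]) measurable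
    also have "mixed_norm (p / ereal r) (q / ereal r) (\<lambda>x \<xi>. epow (\<Gamma> x \<xi>) r) = epow (mixed_norm p q \<Gamma>) r"
      by (rule mixed_norm_power[OF p r(1) \<Gamma>, symmetric])
    also have "(\<integral>z. ?k z) = ennreal (C1 * I)"
      using kernel_integral[of u "0::real^'n"] t' C1(1) I0 by (simp add: nn_integral_cmult I_def u_def ennreal_mult)
    also have "ennreal (C1 * I) * epow (mixed_norm p q \<Gamma>) r \<le> ennreal (C1 * I + 1) * epow (mixed_norm p q \<Gamma>) r"
      by (intro mult_right_mono ennreal_leI) auto
    also have "\<dots> = epow (ennreal C * mixed_norm p q \<Gamma>) r"
      unfolding epow_mult C_def using r C1(1) I0 by (simp add: powr_powr)
    finally show ?thesis unfolding epow_le_iff[OF r(1)] H_def .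
  qed
  moreover have "0 < C"
  proof -
    have "0 \<le> C1 * I" using C1(1) I0 by simp
    then have "C1 * I + 1 \<noteq> 0" by linarith
    then show ?thesis by (simp add: C_def)
  qed
  ultimately show ?thesis by blast
qed

section \<open>Dyadic decomposition in frequency\<close>

lemma ex_dyadic:
  assumes "1 \<le> (x::real)"
  shows "\<exists>j::nat. 2 powr real j \<le> x \<and> x < 2 powr (real j + 1)"
proof -
  have "0 \<le> log 2 x" using assms by simp
  then obtain k :: nat where "real k \<le> log 2 x" "log 2 x < real k + 1"
    using that[of "nat \<lfloor>log 2 x\<rfloor>"] by (auto simp: of_nat_floor)
  then have "2 powr real k \<le> x \<and> x < 2 powr (real k + 1)"
    using assms le_log_iff[of 2 x "real k"] log_less_iff[of 2 x "real k + 1"] by simp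
  then show ?thesis by blast
qed

text \<open>On shell j the near part is a \<open>local_smear\<close> of radius \<open>R j\<close>,
  costing (R j)^D with D = n |1/p - 1/q|, while the weight returns 2^(- j \<delta>). The far part
  carries the full weight <\<xi>>^\<delta> and falls under \<open>mixed_norm_smear\<close>.\<close>

lemma kernel_average_bound:
  fixes p q :: ereal and s t t' \<delta> B c0 Cf :: real and \<kappa> :: "real^'n::finite \<Rightarrow> real^'n \<Rightarrow> real"
  assumes pq: "0 < p" "0 < q" "p \<noteq> q" and t: "real CARD('n) < t * dotexp p" and t': "real CARD('n) < t' * quasi_exponent p q"
    and s: "0 \<le> s" and B: "0 \<le> B" and a: "a \<in> borel \<rightarrow>\<^sub>M borel" and c0: "0 \<le> c0" and Cf: "0 \<le> Cf"
    and \<delta>: "s * real CARD('n) * \<bar>recip p - recip q\<bar> < \<delta>"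
    and \<kappa>: "\<And>\<xi> y. \<kappa> \<xi> y \<le> jbr (y - a \<xi>) powr (- t) * indicator {u. u \<le> c0 * jbr \<xi> powr s} (norm y) + Cf * jbr \<xi> powr \<delta> * jbr y powr (- t')"
  shows "\<exists>C>0. \<forall>\<Gamma> G. jointly_measurable \<Gamma> \<longrightarrow> jointly_measurable G \<longrightarrow> (\<forall>\<xi>. slowly_varying B (\<lambda>x. \<Gamma> x \<xi>)) \<longrightarrow>
    (\<forall>x \<xi>. G x \<xi> \<le> (\<integral>y. ennreal (\<kappa> \<xi> y) * \<Gamma> (x + y) \<xi>)) \<longrightarrow>
    mixed_norm p q G \<le> ennreal C * mixed_norm p q (\<lambda>x \<xi>. ennreal (jbr \<xi> powr \<delta>) * \<Gamma> x \<xi>)"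
proof -
  define r where "r = quasi_exponent p q"
  have r: "0 < r" using dotexp_pos pq by (auto simp: r_def quasi_exponent_def)
  define D where "D = real CARD('n) * \<bar>recip p - recip q\<bar>"
  have D0: "0 \<le> D" by (simp add: D_def)
  have sD: "s * D < \<delta>" using \<delta> by (simp add: D_def mult.assoc)
  have \<delta>0: "0 < \<delta>" using sD mult_nonneg_nonneg[OF s D0] by linarith
  obtain C1 where C1: "C1 > 0" "\<And>(\<Gamma>::real^'n \<Rightarrow> real^'n \<Rightarrow> ennreal) a R. jointly_measurable \<Gamma> \<Longrightarrow> (\<forall>\<xi>. slowly_varying B (\<lambda>x. \<Gamma> x \<xi>)) \<Longrightarrow> a \<in> borel \<rightarrow>\<^sub>M borel \<Longrightarrow> 1 \<le> R \<Longrightarrow>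
    mixed_norm p q (\<lambda>x \<xi>. local_smear (a \<xi>) t R (\<lambda>x. \<Gamma> x \<xi>) x) \<le> ennreal (C1 * R powr D) * mixed_norm p q \<Gamma>"
    unfolding D_def using shell_bound[OF pq t B] by blast
  obtain C2 where C2: "C2 > 0" "\<And>\<Gamma>::real^'n \<Rightarrow> real^'n \<Rightarrow> ennreal. jointly_measurable \<Gamma> \<Longrightarrow> (\<forall>\<xi>. slowly_varying B (\<lambda>x. \<Gamma> x \<xi>)) \<Longrightarrow>
    mixed_norm p q (\<lambda>x \<xi>. (\<integral>y. ennreal (jbr y powr (- t')) * \<Gamma> (x + y) \<xi>)) \<le> ennreal C2 * mixed_norm p q \<Gamma>"
    using mixed_norm_smear[OF pq(1,2) t' B] by blast
  \<comment> \<open>2^s covers the width of a dyadic shell, and c0 + 1 in place of \<open>c0\<close>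
    keeps every radius at least 1, as \<open>shell_bound\<close> requires.\<close>
  define A where "A = (c0 + 1) * 2 powr s"
  have A0: "0 \<le> A" using c0 by (simp add: A_def)
  define R where "R = (\<lambda>j::nat. A * 2 powr (s * real j))"
  have R1: "1 \<le> R j" for j
  proof -
    have "1 * 1 * 1 \<le> (c0 + 1) * 2 powr s * 2 powr (s * real j)"
      using c0 s by (intro mult_mono ge_one_powr_ge_zero) auto
    then show ?thesis by (simp add: R_def A_def)
  qed
  define E where "E = (\<lambda>j::nat. {u::real. 2 powr real j \<le> u \<and> u < 2 powr (real j + 1)})"
  have Em [measurable]: "E j \<in> sets borel" for j unfolding E_def by measurable
  \<comment> \<open>Index 0 is the far part, index Suc j the near part on the j-th shell.\<close>
  define c where "c = (\<lambda>i. case i of 0 \<Rightarrow> Cf * C2 | Suc j \<Rightarrow> C1 * R j powr D * 2 powr (- (\<delta> * real j)))"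
  have cn: "0 \<le> c i" for i using Cf C1(1) C2(1) by (simp add: c_def split: nat.split)
  have cs: "c (Suc j) powr r = (C1 * A powr D) powr r * (2 powr (- ((\<delta> - s * D) * r))) ^ j" for j
  proof -
    have "c (Suc j) = (C1 * A powr D) * 2 powr (- ((\<delta> - s * D) * real j))"
      unfolding c_def R_def using A0 by (simp add: powr_mult powr_powr powr_add[symmetric] algebra_simps)
    then have "c (Suc j) powr r = (C1 * A powr D) powr r * 2 powr (- ((\<delta> - s * D) * real j) * r)"
      using C1(1) by (simp add: powr_mult powr_powr)
    also have "2 powr (- ((\<delta> - s * D) * real j) * r) = (2 powr (- ((\<delta> - s * D) * r))) ^ j"
      by (simp add: powr_realpow[symmetric] powr_powr mult_ac)
    finally show ?thesis .
  qed
  \<comment> \<open>The strict inequality s D < \<delta> is what makes the ratio smaller than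
    1.\<close>
  have "2 powr (- ((\<delta> - s * D) * r)) < 2 powr (0::real)" using sD r by (intro powr_less_mono) auto
  then have "summable (\<lambda>j. (C1 * A powr D) powr r * (2 powr (- ((\<delta> - s * D) * r))) ^ j)"
    by (intro summable_mult summable_geometric) simp
  then have sm: "summable (\<lambda>i. c i powr r)" unfolding cs[symmetric] using summable_Suc_iff[of "\<lambda>i. c i powr r"] by blast
  define C where "C = 2 * (\<Sum>i. c i powr r) powr (1 / r) + 1"
  have "mixed_norm p q G \<le> ennreal C * mixed_norm p q (\<lambda>x \<xi>. ennreal (jbr \<xi> powr \<delta>) * \<Gamma> x \<xi>)"
    if \<Gamma> [measurable]: "jointly_measurable \<Gamma>" and Gm: "jointly_measurable G" and sv: "\<And>\<xi>. slowly_varying B (\<lambda>x. \<Gamma> x \<xi>)"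
      and G: "\<And>x \<xi>. G x \<xi> \<le> (\<integral>y. ennreal (\<kappa> \<xi> y) * \<Gamma> (x + y) \<xi>)" for \<Gamma> G
  proof -
    note measurable_fst_section[OF \<Gamma>, measurable]
    define \<Gamma>\<delta> where "\<Gamma>\<delta> = (\<lambda>x \<xi>. ennreal (jbr \<xi> powr \<delta>) * \<Gamma> x \<xi>)"
    have \<Gamma>\<delta>m [measurable]: "jointly_measurable \<Gamma>\<delta>" unfolding \<Gamma>\<delta>_def by measurable
    have cmult: "slowly_varying B (\<lambda>x. d * \<Gamma> x \<xi>)" for d \<xi>
      using sv[of \<xi>] unfolding slowly_varying_def by (auto simp: mult.left_commute intro!: mult_left_mono)
    define \<Gamma>j where "\<Gamma>j = (\<lambda>j x \<xi>. indicator (E j) (jbr \<xi>) * \<Gamma> x \<xi>)"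
    have \<Gamma>jm: "jointly_measurable (\<Gamma>j j)" for j unfolding \<Gamma>j_def by measurable
    define F where "F = (\<lambda>i x \<xi>. case i of 0 \<Rightarrow> ennreal Cf * (\<integral>y. ennreal (jbr y powr (- t')) * \<Gamma>\<delta> (x + y) \<xi>)
       | Suc j \<Rightarrow> local_smear (a \<xi>) t (R j) (\<lambda>x. \<Gamma>j j x \<xi>) x)"
    have F0: "F 0 = (\<lambda>x \<xi>. ennreal Cf * (\<integral>y. ennreal (jbr y powr (- t')) * \<Gamma>\<delta> (x + y) \<xi>))"
      and FS: "F (Suc j) = (\<lambda>x \<xi>. local_smear (a \<xi>) t (R j) (\<lambda>x. \<Gamma>j j x \<xi>) x)" for j
      by (simp_all add: F_def)
    have sm\<delta>: "jointly_measurable (\<lambda>x \<xi>. (\<integral>y. ennreal (jbr y powr (- t')) * \<Gamma>\<delta> (x + y) \<xi>))"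
      by (rule smear_jm[OF \<Gamma>\<delta>m]) measurable
    have Fm: "jointly_measurable (F i)" for i
    proof (cases i)
      case 0 show ?thesis unfolding 0 F0 using sm\<delta> by measurable
    next
      case (Suc j) show ?thesis unfolding Suc FS by (rule local_smear_jm[OF \<Gamma>jm a])
    qed
    have bd: "mixed_norm p q (F i) \<le> ennreal (c i) * mixed_norm p q \<Gamma>\<delta>" for i
    proof (cases i)
      case 0
      have "mixed_norm p q (F 0) \<le> ennreal Cf * mixed_norm p q (\<lambda>x \<xi>. (\<integral>y. ennreal (jbr y powr (- t')) * \<Gamma>\<delta> (x + y) \<xi>))"
        unfolding F0 by (rule mixed_norm_cmult_le[OF pq(1,2) sm\<delta>])
      also have "\<dots> \<le> ennreal Cf * (ennreal C2 * mixed_norm p q \<Gamma>\<delta>)"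
        using C2(2)[OF \<Gamma>\<delta>m] cmult by (intro mult_left_mono) (auto simp: \<Gamma>\<delta>_def)
      finally show ?thesis using Cf C2(1) by (simp add: 0 c_def ennreal_mult mult.assoc)
    next
      case (Suc j)
      have "mixed_norm p q (F (Suc j)) \<le> ennreal (C1 * R j powr D) * mixed_norm p q (\<Gamma>j j)"
        unfolding FS using cmult by (intro C1(2) \<Gamma>jm a R1) (simp add: \<Gamma>j_def)
      also have "mixed_norm p q (\<Gamma>j j) \<le> mixed_norm p q (\<lambda>x \<xi>. ennreal (2 powr (- (\<delta> * real j))) * \<Gamma>\<delta> x \<xi>)"
      proof (intro mixed_norm_mono pq \<Gamma>jm)
        fix x \<xi> :: "real^'n"
        show "\<Gamma>j j x \<xi> \<le> ennreal (2 powr (- (\<delta> * real j))) * \<Gamma>\<delta> x \<xi>"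
        proof (cases "jbr \<xi> \<in> E j")
          case True
          then have "(2 powr real j) powr \<delta> \<le> jbr \<xi> powr \<delta>" using \<delta>0 by (intro powr_mono2) (auto simp: E_def)
          then have "2 powr (- (\<delta> * real j)) * 2 powr (\<delta> * real j) \<le> 2 powr (- (\<delta> * real j)) * jbr \<xi> powr \<delta>"
            by (intro mult_left_mono) (auto simp: powr_powr mult.commute)
          then have "1 \<le> 2 powr (- (\<delta> * real j)) * jbr \<xi> powr \<delta>" by (simp add: powr_add[symmetric])
          then have "1 * \<Gamma> x \<xi> \<le> ennreal (2 powr (- (\<delta> * real j)) * jbr \<xi> powr \<delta>) * \<Gamma> x \<xi>"
            by (intro mult_right_mono) (auto simp: ennreal_1[symmetric] simp del: ennreal_1 intro: ennreal_leI)
          then show ?thesis using True by (simp add: \<Gamma>j_def \<Gamma>\<delta>_def ennreal_mult mult.assoc)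
        qed (simp add: \<Gamma>j_def)
      qed
      also have "\<dots> \<le> ennreal (2 powr (- (\<delta> * real j))) * mixed_norm p q \<Gamma>\<delta>"
        by (rule mixed_norm_cmult_le[OF pq(1,2) \<Gamma>\<delta>m])
      finally show ?thesis using C1(1) by (simp add: Suc c_def ennreal_mult mult.assoc mult_left_mono)
    qed
    have le: "\<exists>j. \<forall>x. G x \<xi> \<le> F 0 x \<xi> + F (Suc j) x \<xi>" for \<xi>
    proof -
      obtain j where j: "2 powr real j \<le> jbr \<xi>" "jbr \<xi> < 2 powr (real j + 1)" using ex_dyadic[OF jbr_ge_1[of \<xi>]] by blast
      have jE: "jbr \<xi> \<in> E j" using j by (simp add: E_def)
      have cR: "c0 * jbr \<xi> powr s \<le> R j"
      proof -
        have "c0 * jbr \<xi> powr s \<le> (c0 + 1) * (2 powr (real j + 1)) powr s"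
          using j(2) c0 s jbr_pos[of \<xi>] by (intro mult_mono powr_mono2) auto
        also have "\<dots> = R j" unfolding R_def A_def mult.assoc powr_powr powr_add[symmetric] by (simp add: algebra_simps)
        finally show ?thesis .
      qed
      have "G x \<xi> \<le> F 0 x \<xi> + F (Suc j) x \<xi>" for x
      proof -
        have "G x \<xi> \<le> (\<integral>y. ennreal Cf * (ennreal (jbr y powr (- t')) * \<Gamma>\<delta> (x + y) \<xi>)
            + ennreal (jbr (y - a \<xi>) powr (- t)) * \<Gamma>j j (x + y) \<xi> * indicator {u. u \<le> R j} (norm y))"
        proof (intro order_trans[OF G] nn_integral_mono)
          fix y
          have "jbr (y - a \<xi>) powr (- t) * indicator {u. u \<le> c0 * jbr \<xi> powr s} (norm y) \<le> jbr (y - a \<xi>) powr (- t) * indicator {u. u \<le> R j} (norm y)"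
            using cR by (intro mult_left_mono) (auto simp: indicator_def)
          then have "\<kappa> \<xi> y \<le> jbr (y - a \<xi>) powr (- t) * indicator {u. u \<le> R j} (norm y) + Cf * jbr \<xi> powr \<delta> * jbr y powr (- t')"
            using \<kappa>[of \<xi> y] by linarith
          then have "ennreal (\<kappa> \<xi> y) \<le> ennreal (jbr (y - a \<xi>) powr (- t) * indicator {u. u \<le> R j} (norm y) + Cf * jbr \<xi> powr \<delta> * jbr y powr (- t'))"
            by (rule ennreal_leI)
          also have "\<dots> = ennreal (jbr (y - a \<xi>) powr (- t)) * indicator {u. u \<le> R j} (norm y) + ennreal Cf * ennreal (jbr \<xi> powr \<delta>) * ennreal (jbr y powr (- t'))"
            using Cf by (simp add: ennreal_plus ennreal_mult ennreal_indicator)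
          finally have "ennreal (\<kappa> \<xi> y) * \<Gamma> (x + y) \<xi> \<le> (ennreal (jbr (y - a \<xi>) powr (- t)) * indicator {u. u \<le> R j} (norm y) + ennreal Cf * ennreal (jbr \<xi> powr \<delta>) * ennreal (jbr y powr (- t'))) * \<Gamma> (x + y) \<xi>"
            by (rule mult_right_mono) simp
          then show "ennreal (\<kappa> \<xi> y) * \<Gamma> (x + y) \<xi> \<le> ennreal Cf * (ennreal (jbr y powr (- t')) * \<Gamma>\<delta> (x + y) \<xi>)
            + ennreal (jbr (y - a \<xi>) powr (- t)) * \<Gamma>j j (x + y) \<xi> * indicator {u. u \<le> R j} (norm y)"
            using jE by (simp add: \<Gamma>j_def \<Gamma>\<delta>_def distrib_left distrib_right add.commute mult_ac)
        qed
        also have "\<dots> = F 0 x \<xi> + F (Suc j) x \<xi>"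
        proof -
          have m1: "(\<lambda>y. \<Gamma>\<delta> (x + y) \<xi>) \<in> borel_measurable borel" unfolding \<Gamma>\<delta>_def by measurable
          have m2: "(\<lambda>y. \<Gamma>j j (x + y) \<xi>) \<in> borel_measurable borel" unfolding \<Gamma>j_def by measurable
          show ?thesis unfolding F0 FS local_smear_def
            using m1 m2 by (simp add: nn_integral_add nn_integral_cmult)
        qed
        finally show ?thesis .
      qed
      then show ?thesis by blast
    qed
    have "mixed_norm p q G \<le> ennreal (2 * (\<Sum>i. c i powr r) powr (1 / r)) * mixed_norm p q \<Gamma>\<delta>"
      unfolding r_def by (rule mixed_norm_pieces[OF pq(1,2) Fm Gm le bd cn]) (use sm in \<open>simp add: r_def\<close>)
    also have "\<dots> \<le> ennreal C * mixed_norm p q \<Gamma>\<delta>" unfolding C_def by (intro mult_right_mono ennreal_leI) auto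
    finally show ?thesis unfolding \<Gamma>\<delta>_def .
  qed
  moreover have "0 < C" unfolding C_def by (intro add_nonneg_pos) auto
  ultimately show ?thesis by blast
qed

section \<open>The multiplier theorem\<close>

lemma phase_velocity_le:
  fixes \<mu> :: "real ^ 'n::finite \<Rightarrow> real"
  assumes gb: "\<And>j. \<bar>pd j \<mu> x\<bar> \<le> c"
  shows "norm (phase_velocity \<mu> x) \<le> real CARD('n) * c"
proof -
  have "\<bar>phase_velocity \<mu> x $ j\<bar> * 1 \<le> c" for j
  proof -
    have "\<bar>phase_velocity \<mu> x $ j\<bar> = \<bar>pd j \<mu> x\<bar> / (2 * pi)" by (simp add: phase_velocity_def)
    also have "\<dots> \<le> \<bar>pd j \<mu> x\<bar> / 1" using pi_gt3 by (intro divide_left_mono) auto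
    finally show ?thesis using gb[of j] by simp
  qed
  from norm_le_of_components[OF this] show ?thesis by simp
qed

lemma phase_velocity_measurable:
  assumes "C2 \<mu>"
  shows "phase_velocity \<mu> \<in> borel \<rightarrow>\<^sub>M borel"
  unfolding phase_velocity_def[abs_def]
  by (intro borel_measurable_continuous_onI continuous_intros C2_derivatives(4)[OF assms]) simp

text \<open>Here |y| exceeds twice the norm of the stationary point a, so |y - a| >= |y| / 2. With W
  = <w>^s also 1 + |y| / W >= <y> / W, and the power -(t' - t) of this leaves the loss W^(t' -
  t).\<close>

lemma phase_kernel_far:
  assumes t: "0 \<le> t" "t \<le> t'" and s: "0 \<le> s"
    and a: "norm (phase_velocity \<mu> w) \<le> c * jbr w powr s" and y: "2 * c * jbr w powr s < norm y"
  shows "phase_kernel \<mu> s t t' w y \<le> 2 powr t * jbr w powr (s * (t' - t)) * jbr y powr (- t')"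
proof -
  let ?a = "phase_velocity \<mu> w" and ?W = "jbr w powr s"
  have W: "1 \<le> ?W" by (rule jbr_powr_ge_1[OF s])
  have "norm y \<le> 2 * norm (y - ?a)"
    using norm_triangle_ineq2[of y ?a] a y by (simp add: algebra_simps)
  then have "(norm y)\<^sup>2 \<le> (2 * norm (y - ?a))\<^sup>2" by (intro power_mono) auto
  then have "jbr y \<le> sqrt (4 * (1 + (norm (y - ?a))\<^sup>2))" unfolding jbr_def by (intro real_sqrt_le_mono) (simp add: power_mult_distrib)
  also have "\<dots> = 2 * jbr (y - ?a)" by (simp only: jbr_def real_sqrt_mult real_sqrt_four)
  finally have 1: "jbr (y - ?a) powr (- t) \<le> 2 powr t * jbr y powr (- t)"
    by (intro powr_minus_le_of_le) (use jbr_pos t in auto)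
  have "jbr y \<le> 1 + norm y" by (rule jbr_le_norm)
  also have "\<dots> \<le> ?W * (1 + norm y / ?W)" using W by (simp add: field_simps)
  finally have 2: "(1 + norm y / ?W) powr (- (t' - t)) \<le> ?W powr (t' - t) * jbr y powr (- (t' - t))"
    by (intro powr_minus_le_of_le) (use jbr_pos t W in \<open>auto intro!: add_pos_nonneg\<close>)
  have "phase_kernel \<mu> s t t' w y \<le> (2 powr t * jbr y powr (- t)) * (?W powr (t' - t) * jbr y powr (- (t' - t)))"
    unfolding phase_kernel_def by (intro mult_mono 1 2) auto
  also have "\<dots> = 2 powr t * ?W powr (t' - t) * (jbr y powr (- t) * jbr y powr (- (t' - t)))" by (simp only: mult_ac)
  also have "jbr y powr (- t) * jbr y powr (- (t' - t)) = jbr y powr (- t')" unfolding powr_add[symmetric] by simp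
  finally show ?thesis by (simp add: powr_powr)
qed

text \<open>Formulated on the frequency side for any integrable \<open>h\<close>; the substitution h
  = \<open>fourier f\<close> recovers the two Wiener norms.\<close>

lemma multiplier_bound:
  fixes p q :: ereal and \<mu> :: "real ^ 'n::finite \<Rightarrow> real" and s t t' \<delta> :: real
  assumes pq: "0 < p" "0 < q" and C2: "C2 \<mu>" and s: "0 \<le> s"
    and t: "real CARD('n) < t * dotexp p" "t \<le> t'" and t': "real CARD('n) < t' * quasi_exponent p q"
    and \<delta>: "0 \<le> \<delta>" "s * (t' - t) \<le> \<delta>" "p \<noteq> q \<Longrightarrow> s * real CARD('n) * \<bar>recip p - recip q\<bar> < \<delta>"
    and hb: "\<And>i j x. \<bar>pd i (pd j \<mu>) x\<bar> \<le> Ch"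
    and ht: "\<And>i j w x. norm (fourier (\<lambda>z. complex_of_real (pd i (pd j \<mu>) (w + z)) * cgau pi z) x) \<le> Ch * jbr x powr (- t)"
    and gb: "\<And>j x. \<bar>pd j \<mu> x\<bar> \<le> Cg * jbr x powr s"
    and gt: "\<And>j w x. norm (fourier (\<lambda>z. complex_of_real (pd j \<mu> (w + z)) * cgau pi z) x) \<le> Cg * jbr w powr s * jbr x powr (- t')"
  shows "\<exists>C. \<forall>h. integrable lborel h \<longrightarrow>
    mixed_norm p q (\<lambda>x \<xi>. ennreal (freq_stft (\<lambda>\<eta>. cis (\<mu> \<eta>) * h \<eta>) x \<xi>))
      \<le> ennreal C * mixed_norm p q (\<lambda>x \<xi>. ennreal (freq_stft h x \<xi> * jbr \<xi> powr \<delta>))"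
proof -
  let ?\<kappa> = "phase_kernel \<mu> s t t'" and ?a = "phase_velocity \<mu>"
  have "0 < t * dotexp p" using t(1) by (rule le_less_trans[rotated]) simp
  then have t0: "0 < t" using dotexp_pos[OF pq(1)] by (simp add: zero_less_mult_iff)
  have "t * dotexp p \<le> t" using dotexp_le_1[OF pq(1)] t0 by (simp add: mult_left_le)
  then have tn: "real CARD('n) < t" using t(1) by linarith
  have Ch0: "0 \<le> Ch" using order_trans[OF abs_ge_zero hb] by blast
  have Cg0: "0 \<le> Cg" using order_trans[OF abs_ge_zero gb[of undefined 0]] by (simp add: zero_le_mult_iff jbr_def)
  note a_lip = phase_velocity_lipschitz[OF C2 hb]
  have \<mu>c: "continuous_on UNIV \<mu>" by (rule C2_derivatives(3)[OF C2])
  have \<mu>m [measurable]: "\<mu> \<in> borel_measurable borel" by (rule borel_measurable_continuous_onI[OF \<mu>c])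
  obtain Ck where Ck: "0 < Ck" "\<And>w x. norm (fourier (\<lambda>z. cis (\<mu> (w + z)) * cgau pi z) x) \<le> Ck * ?\<kappa> w x"
    using phase_transform[OF C2 tn t(2) s hb ht gb gt] by blast
  obtain C1 where C1: "0 < C1" "\<And>h x \<xi>. integrable lborel h \<Longrightarrow> ennreal (freq_stft (\<lambda>\<eta>. cis (\<mu> \<eta>) * h \<eta>) x \<xi>)
      \<le> ennreal C1 * (\<integral>y. ennreal (?\<kappa> \<xi> y * peetre_max (freq_stft h) (x + y) \<xi>))"
    using freq_stft_phase_bound[OF \<mu>c tn t(2) s a_lip _ Ck] Ch0 by auto
  obtain C3 where C3: "0 < C3" "\<And>h::real^'n \<Rightarrow> complex. integrable lborel h \<Longrightarrow>
    mixed_norm p q (\<lambda>x \<xi>. ennreal (peetre_max (freq_stft h) x \<xi> * jbr \<xi> powr \<delta>))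
      \<le> ennreal C3 * mixed_norm p q (\<lambda>x \<xi>. ennreal (freq_stft h x \<xi> * jbr \<xi> powr \<delta>))"
    using mixed_norm_peetre[OF pq \<delta>(1)] by blast
  \<comment> \<open>The cases of equal and of distinct exponents are brought to one form, a bound
    for kernel averages of any slowly varying \<Gamma>.\<close>
  have "\<exists>C>0. \<forall>\<Gamma> G. jointly_measurable \<Gamma> \<longrightarrow> jointly_measurable G \<longrightarrow> (\<forall>\<xi>. slowly_varying (exp 1) (\<lambda>x. \<Gamma> x \<xi>)) \<longrightarrow>
    (\<forall>x \<xi>. G x \<xi> \<le> (\<integral>y. ennreal (?\<kappa> \<xi> y) * \<Gamma> (x + y) \<xi>)) \<longrightarrow>
    mixed_norm p q G \<le> ennreal C * mixed_norm p q (\<lambda>x \<xi>. ennreal (jbr \<xi> powr \<delta>) * \<Gamma> x \<xi>)"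
  proof (cases "p = q")
    case True
    obtain C where C: "0 < C" "\<And>(\<Gamma>::real^'n \<Rightarrow> real^'n \<Rightarrow> ennreal) G a. jointly_measurable \<Gamma> \<Longrightarrow> jointly_measurable G \<Longrightarrow> (\<forall>\<xi>. slowly_varying (exp 1) (\<lambda>x. \<Gamma> x \<xi>)) \<Longrightarrow>
      (\<forall>x \<xi>. G x \<xi> \<le> (\<integral>y. ennreal (jbr (y - a \<xi>) powr (- t)) * \<Gamma> (x + y) \<xi>)) \<Longrightarrow>
      mixed_norm p p G \<le> ennreal C * mixed_norm p p \<Gamma>"
      using smear_bound_eq[OF pq(1) t(1) exp_ge_zero[of 1]] by blast
    have "mixed_norm p q G \<le> ennreal C * mixed_norm p q (\<lambda>x \<xi>. ennreal (jbr \<xi> powr \<delta>) * \<Gamma> x \<xi>)"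
      if \<Gamma>: "jointly_measurable \<Gamma>" and Gm: "jointly_measurable G" and sv: "\<forall>\<xi>. slowly_varying (exp 1) (\<lambda>x. \<Gamma> x \<xi>)"
        and G: "\<forall>x \<xi>. G x \<xi> \<le> (\<integral>y. ennreal (?\<kappa> \<xi> y) * \<Gamma> (x + y) \<xi>)" for \<Gamma> G
    proof -
      \<comment> \<open>For p = q the second factor of the kernel is simply bounded by 1.\<close>
      have "(\<integral>y. ennreal (?\<kappa> \<xi> y) * \<Gamma> (x + y) \<xi>) \<le> (\<integral>y. ennreal (jbr (y - ?a \<xi>) powr (- t)) * \<Gamma> (x + y) \<xi>)" for x \<xi>
        by (intro nn_integral_mono mult_right_mono ennreal_leI phase_kernel_le[OF t(2)]) simp
      then have "mixed_norm p p G \<le> ennreal C * mixed_norm p p \<Gamma>"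
        using G by (intro C(2)[OF \<Gamma> Gm sv, of ?a]) (blast intro: order_trans)
      also have "mixed_norm p p \<Gamma> \<le> mixed_norm p p (\<lambda>x \<xi>. ennreal (jbr \<xi> powr \<delta>) * \<Gamma> x \<xi>)"
      proof (intro mixed_norm_mono pq \<Gamma>)
        fix x \<xi>
        have "1 * \<Gamma> x \<xi> \<le> ennreal (jbr \<xi> powr \<delta>) * \<Gamma> x \<xi>"
          using jbr_powr_ge_1[OF \<delta>(1), of \<xi>] by (intro mult_right_mono) (auto simp: ennreal_1[symmetric] simp del: ennreal_1 intro: ennreal_leI)
        then show "\<Gamma> x \<xi> \<le> ennreal (jbr \<xi> powr \<delta>) * \<Gamma> x \<xi>" by simp
      qed
      finally show ?thesis using True by (simp add: mult_left_mono)
    qed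
    then show ?thesis using C(1) by blast
  next
    case False
    \<comment> \<open>Ca <\<xi>>^s bounds the stationary point, and twice this is the threshold of
      \<open>phase_kernel_far\<close>.\<close>
    define Ca where "Ca = real CARD('n) * Cg"
    have Ca0: "0 \<le> Ca" using Cg0 by (simp add: Ca_def)
    have av: "norm (?a \<xi>) \<le> Ca * jbr \<xi> powr s" for \<xi> using phase_velocity_le[OF gb, of \<xi>] by (simp add: Ca_def mult.assoc)
    have kb: "?\<kappa> \<xi> y \<le> jbr (y - ?a \<xi>) powr (- t) * indicator {u. u \<le> 2 * Ca * jbr \<xi> powr s} (norm y) + 2 powr t * jbr \<xi> powr \<delta> * jbr y powr (- t')" for \<xi> y
    proof (cases "norm y \<le> 2 * Ca * jbr \<xi> powr s")
      case True
      then show ?thesis using phase_kernel_le[OF t(2), of \<mu> s \<xi> y] by (simp add: add_increasing2)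
    next
      case False
      have "?\<kappa> \<xi> y \<le> 2 powr t * jbr \<xi> powr (s * (t' - t)) * jbr y powr (- t')"
        by (rule phase_kernel_far[OF _ t(2) s av]) (use t0 False in auto)
      also have "\<dots> \<le> 2 powr t * jbr \<xi> powr \<delta> * jbr y powr (- t')"
        using \<delta>(2) jbr_ge_1 by (intro mult_right_mono mult_left_mono powr_mono) auto
      finally show ?thesis using False by simp
    qed
    show ?thesis
      by (rule kernel_average_bound[OF pq False t(1) t' s _ phase_velocity_measurable[OF C2] _ _ \<delta>(3)[OF False] kb]) (use Ca0 in auto)
  qed
  then obtain C where C: "0 < C" "\<And>(\<Gamma>::real^'n \<Rightarrow> real^'n \<Rightarrow> ennreal) G. jointly_measurable \<Gamma> \<Longrightarrow> jointly_measurable G \<Longrightarrow> (\<forall>\<xi>. slowly_varying (exp 1) (\<lambda>x. \<Gamma> x \<xi>)) \<Longrightarrow>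
    (\<forall>x \<xi>. G x \<xi> \<le> (\<integral>y. ennreal (?\<kappa> \<xi> y) * \<Gamma> (x + y) \<xi>)) \<Longrightarrow>
    mixed_norm p q G \<le> ennreal C * mixed_norm p q (\<lambda>x \<xi>. ennreal (jbr \<xi> powr \<delta>) * \<Gamma> x \<xi>)"
    by blast
  have "mixed_norm p q (\<lambda>x \<xi>. ennreal (freq_stft (\<lambda>\<eta>. cis (\<mu> \<eta>) * h \<eta>) x \<xi>))
      \<le> ennreal (C * C1 * C3) * mixed_norm p q (\<lambda>x \<xi>. ennreal (freq_stft h x \<xi> * jbr \<xi> powr \<delta>))"
    if h: "integrable lborel h" for h
  proof -
    have hm [measurable]: "h \<in> borel_measurable borel" using h by (auto dest: borel_measurable_integrable)
    define F where "F = freq_stft h"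
    interpret bounded_nonneg F "LINT \<eta>|lborel. norm (h \<eta>)"
      by standard (auto simp: F_def freq_stft_bounded[OF h])
    \<comment> \<open>The constant \<open>C1\<close> of the pointwise bound is put into \<Gamma>;
      slow variation, with constant e at distance below 1, comes from
      \<open>peetre_slow\<close>.\<close>
    define \<Gamma> where "\<Gamma> = (\<lambda>x \<xi>. ennreal C1 * ennreal (peetre_max F x \<xi>))"
    have pm [measurable]: "jointly_measurable (\<lambda>x \<xi>. ennreal (peetre_max F x \<xi>))"
      using measurable_compose[OF peetre_measurable measurable_ennreal] by (simp add: split_beta')
    have \<Gamma>m: "jointly_measurable \<Gamma>" unfolding \<Gamma>_def by measurable
    have sv: "slowly_varying (exp 1) (\<lambda>x. \<Gamma> x \<xi>)" for \<xi>
      unfolding slowly_varying_def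
    proof (intro allI impI)
      fix z z' :: "real^'n" assume "norm (z - z') < 1"
      then have "exp (norm (z - z') + norm (\<xi> - \<xi>)) * peetre_max F z \<xi> \<le> exp 1 * peetre_max F z \<xi>"
        by (intro mult_right_mono peetre_nonneg) auto
      then have "peetre_max F z' \<xi> \<le> exp 1 * peetre_max F z \<xi>" using peetre_slow[of z' \<xi> z \<xi>] by linarith
      then have "ennreal (peetre_max F z' \<xi>) \<le> ennreal (exp 1) * ennreal (peetre_max F z \<xi>)"
        by (subst ennreal_mult[symmetric]) (auto intro: ennreal_leI peetre_nonneg)
      then have "ennreal C1 * ennreal (peetre_max F z' \<xi>) \<le> ennreal C1 * (ennreal (exp 1) * ennreal (peetre_max F z \<xi>))"
        by (rule mult_left_mono) simp
      then show "\<Gamma> z' \<xi> \<le> ennreal (exp 1) * \<Gamma> z \<xi>" by (simp only: \<Gamma>_def mult_ac)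
    qed
    have Gm: "jointly_measurable (\<lambda>x \<xi>. ennreal (freq_stft (\<lambda>\<eta>. cis (\<mu> \<eta>) * h \<eta>) x \<xi>))"
    proof -
      have "(\<lambda>\<eta>. cis (\<mu> \<eta>) * h \<eta>) \<in> borel_measurable borel" unfolding cis_conv_exp by measurable
      from measurable_compose[OF freq_stft_measurable[OF this] measurable_ennreal] show ?thesis by (simp add: split_beta')
    qed
    have G: "ennreal (freq_stft (\<lambda>\<eta>. cis (\<mu> \<eta>) * h \<eta>) x \<xi>) \<le> (\<integral>y. ennreal (?\<kappa> \<xi> y) * \<Gamma> (x + y) \<xi>)" for x \<xi>
    proof -
      have [measurable]: "(\<lambda>y. ennreal (peetre_max F (x + y) \<xi>)) \<in> borel_measurable borel"
        using measurable_compose[OF _ measurable_fst_section[OF pm, of \<xi>], of "\<lambda>y. x + y" borel] by simp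
      have "(\<integral>y. ennreal (?\<kappa> \<xi> y) * \<Gamma> (x + y) \<xi>) = (\<integral>y. ennreal C1 * (ennreal (?\<kappa> \<xi> y) * ennreal (peetre_max F (x + y) \<xi>)))"
        by (simp only: \<Gamma>_def mult_ac)
      also have "\<dots> = ennreal C1 * (\<integral>y. ennreal (?\<kappa> \<xi> y) * ennreal (peetre_max F (x + y) \<xi>))"
        by (rule nn_integral_cmult) measurable
      finally show ?thesis using C1(2)[OF h, of x \<xi>] by (simp add: F_def[symmetric] ennreal_mult peetre_nonneg)
    qed
    have jm: "jointly_measurable (\<lambda>x \<xi>. ennreal (peetre_max F x \<xi> * jbr \<xi> powr \<delta>))"
      unfolding ennreal_mult''[OF powr_ge_zero] by measurable
    have "mixed_norm p q (\<lambda>x \<xi>. ennreal (freq_stft (\<lambda>\<eta>. cis (\<mu> \<eta>) * h \<eta>) x \<xi>))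
      \<le> ennreal C * mixed_norm p q (\<lambda>x \<xi>. ennreal (jbr \<xi> powr \<delta>) * \<Gamma> x \<xi>)"
      by (intro C(2) \<Gamma>m Gm allI sv G)
    also have "(\<lambda>x \<xi>. ennreal (jbr \<xi> powr \<delta>) * \<Gamma> x \<xi>) = (\<lambda>x \<xi>. ennreal C1 * ennreal (peetre_max F x \<xi> * jbr \<xi> powr \<delta>))"
      by (simp add: \<Gamma>_def fun_eq_iff ennreal_mult peetre_nonneg mult_ac)
    also have "mixed_norm p q \<dots> \<le> ennreal C1 * mixed_norm p q (\<lambda>x \<xi>. ennreal (peetre_max F x \<xi> * jbr \<xi> powr \<delta>))"
      by (rule mixed_norm_cmult_le[OF pq jm])
    also have "\<dots> \<le> ennreal C1 * (ennreal C3 * mixed_norm p q (\<lambda>x \<xi>. ennreal (F x \<xi> * jbr \<xi> powr \<delta>)))"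
      unfolding F_def by (intro mult_left_mono C3(2) h) simp
    finally show ?thesis using C(1) C1(1) C3(1) by (simp add: F_def ennreal_mult mult.assoc mult_left_mono)
  qed
  then show ?thesis by blast
qed

section \<open>Constants, exponents and the degenerate case\<close>

lemma uniform_constant:
  fixes Q :: "'a::finite \<Rightarrow> real \<Rightarrow> bool"
  assumes ex: "\<And>i. \<exists>C>0. Q i C" and mono: "\<And>i C C'. Q i C \<Longrightarrow> C \<le> C' \<Longrightarrow> Q i C'"
  shows "\<exists>C>0. \<forall>i. Q i C"
proof -
  obtain c where c: "\<And>i. 0 < c i \<and> Q i (c i)" using choice[of "\<lambda>i C. 0 < C \<and> Q i C"] ex by blast
  have "c i \<le> (\<Sum>i\<in>UNIV. c i)" for i
    by (rule member_le_sum) (use c in \<open>auto intro: less_imp_le\<close>)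
  then have "\<forall>i. Q i (\<Sum>i\<in>UNIV. c i)" using mono c by blast
  moreover have "0 < (\<Sum>i\<in>UNIV. c i)" using c by (intro sum_pos) auto
  ultimately show ?thesis by blast
qed

text \<open>The left side is nonzero only if dotexp q < dotexp p; then q < 1, so 1/q is attained
  exactly, while 1/p is at most 1 / dotexp p. It shows that the far-part loss, with exponent s (t' -
  t), never exceeds s n |1/p - 1/q|.\<close>

lemma inverse_exponent_gap:
  assumes "0 < p" and "0 < q"
  shows "1 / min (dotexp p) (dotexp q) - 1 / dotexp p \<le> \<bar>recip p - recip q\<bar>"
proof (cases "dotexp q < dotexp p")
  case True
  then obtain q' where q: "q = ereal q'" "0 < q'" "q' < 1"
    using assms(2) dotexp_le_1[OF assms(1)] by (cases q) (auto simp: dotexp_ereal min_def split: if_splits)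
  have "recip p \<le> 1 / dotexp p"
    using assms(1) by (cases p rule: ereal_pos_cases) (auto simp: recip_def dotexp_ereal intro!: divide_left_mono)
  then have "1 / q' - 1 / dotexp p \<le> \<bar>recip p - recip q\<bar>" using q by (simp add: recip_def)
  then show ?thesis using True q by (simp add: dotexp_ereal min_def)
qed (simp add: min_def)

text \<open>Complements the integrable case of the theorem: a Bochner integral without integrability
  is 0, and multiplying by a character or by e^{i \<mu>} neither creates nor destroys
  integrability.\<close>

lemma mult_op_eq_0:
  fixes f :: "real ^ 'n::finite \<Rightarrow> complex"
  assumes f: "f \<in> borel_measurable borel" and \<mu> [measurable]: "\<mu> \<in> borel_measurable borel"
    and ni: "\<not> (integrable lborel f \<and> integrable lborel (fourier f))"
  shows "mult_op \<mu> f x = 0"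
proof (cases "integrable lborel f")
  case False
  have "fourier f \<xi> = 0" for \<xi>
  proof -
    have "\<not> integrable lborel (\<lambda>x. f x * cis (- 2 * pi * (x \<bullet> \<xi>)))"
    proof
      assume "integrable lborel (\<lambda>x. f x * cis (- 2 * pi * (x \<bullet> \<xi>)))"
      from integrable_mult_cis[OF this, of "\<lambda>x. 2 * pi * (x \<bullet> \<xi>)"]
      have "integrable lborel f" by (simp add: mult.assoc cis_mult)
      then show False using False by simp
    qed
    then show ?thesis unfolding fourier_def by (rule not_integrable_integral_eq)
  qed
  then show ?thesis by (simp add: mult_op_def)
next
  case True
  have "\<not> integrable lborel (\<lambda>\<xi>. cis (\<mu> \<xi>) * fourier f \<xi> * cis (2 * pi * (x \<bullet> \<xi>)))"
  proof
    assume "integrable lborel (\<lambda>\<xi>. cis (\<mu> \<xi>) * fourier f \<xi> * cis (2 * pi * (x \<bullet> \<xi>)))"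
    from integrable_mult_cis[OF this, of "\<lambda>\<xi>. - \<mu> \<xi> - 2 * pi * (x \<bullet> \<xi>)"]
    have "integrable lborel (\<lambda>\<xi>. (cis (\<mu> \<xi>) * (cis (2 * pi * (x \<bullet> \<xi>)) * cis (- \<mu> \<xi> - 2 * pi * (x \<bullet> \<xi>)))) * fourier f \<xi>)"
      by (simp only: mult_ac) measurable
    then have "integrable lborel (fourier f)" by (simp add: cis_mult)
    then show False using ni True by simp
  qed
  then show ?thesis unfolding mult_op_def by (rule not_integrable_integral_eq)
qed

text \<open>Membership in the weighted spaces is converted into bounds at every point by
  \<open>in_Winf_bound\<close>, made uniform over the directions, freed of the weight by
  \<open>gradient_transform\<close>, and passed to \<open>multiplier_bound\<close>.\<close>

theorem theorem1p3:
  fixes p q :: ereal and \<mu> :: "real ^ 'n::finite \<Rightarrow> real" and s \<epsilon> :: real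
  assumes "0 < p" and "0 < q"
    and "C2 \<mu>"
    and "s > 0" and "\<epsilon> > 0"
    and "\<forall>j. in_Winf (real CARD('n) / min (dotexp p) (dotexp q) + \<epsilon>)
               (\<lambda>\<xi>. complex_of_real (jbr \<xi> powr (- s) * pd j \<mu> \<xi>))"
    and "\<forall>i j. in_Winf (real CARD('n) / dotexp p + \<epsilon>)
               (\<lambda>\<xi>. complex_of_real (pd i (pd j \<mu>) \<xi>))"
  shows "\<forall>\<delta>. (if p = q then \<delta> \<ge> s * real CARD('n) * \<bar>recip p - recip q\<bar>
              else \<delta> > s * real CARD('n) * \<bar>recip p - recip q\<bar>) \<longrightarrow>
           (\<exists>C. \<forall>f. schwartz f \<longrightarrow> Wnorm p q 0 (mult_op \<mu> f) \<le> ennreal C * Wnorm p q \<delta> f)"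
proof (intro allI impI)
  fix \<delta> :: real
  assume \<delta>: "if p = q then \<delta> \<ge> s * real CARD('n) * \<bar>recip p - recip q\<bar> else \<delta> > s * real CARD('n) * \<bar>recip p - recip q\<bar>"
  let ?r = "quasi_exponent p q"
  \<comment> \<open>The orders granted for the second derivatives (\<open>t\<close>) and for the
    gradient (\<open>t'\<close>). The margin \<epsilon> makes t times \<open>dotexp p\<close> and t'
    times the quasi-exponent exceed n strictly.\<close>
  define t where "t = real CARD('n) / dotexp p + \<epsilon>"
  define t' where "t' = real CARD('n) / ?r + \<epsilon>"
  have d: "0 < dotexp p" "dotexp p \<le> 1" "0 < dotexp q" using dotexp_pos dotexp_le_1 assms(1,2) by auto
  have r: "0 < ?r" "?r \<le> dotexp p" using d by (auto simp: quasi_exponent_def)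
  have t: "real CARD('n) < t * dotexp p" using d assms(5) by (simp add: t_def distrib_right)
  have t'r: "real CARD('n) < t' * ?r" using r assms(5) by (simp add: t'_def distrib_right)
  have tt': "t \<le> t'" unfolding t_def t'_def using r d by (intro add_mono divide_left_mono) auto
  have "real CARD('n) / 1 \<le> real CARD('n) / dotexp p" using d by (intro divide_left_mono) auto
  then have tn: "real CARD('n) < t" using assms(5) by (simp add: t_def)
  have t'n: "real CARD('n) < t'" using tn tt' by linarith
  have "s * (t' - t) = s * real CARD('n) * (1 / min (dotexp p) (dotexp q) - 1 / dotexp p)"
    by (simp add: t_def t'_def quasi_exponent_def algebra_simps)
  also have "\<dots> \<le> s * real CARD('n) * \<bar>recip p - recip q\<bar>"
    using inverse_exponent_gap[OF assms(1,2)] assms(4) by (intro mult_left_mono) auto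
  finally have gap: "s * (t' - t) \<le> \<delta>" using \<delta> by (auto split: if_splits)
  have "0 \<le> s * (t' - t)" using assms(4) tt' by simp
  then have \<delta>0: "0 \<le> \<delta>" using gap by linarith
  note dif = C2_derivatives[OF assms(3)]
  have [measurable]: "\<mu> \<in> borel_measurable borel" by (rule borel_measurable_continuous_onI[OF dif(3)])
  have "\<exists>C>0. \<forall>i. \<forall>j. (\<forall>x. \<bar>pd i (pd j \<mu>) x\<bar> \<le> C) \<and>
    (\<forall>\<omega> x. norm (fourier (\<lambda>\<zeta>. complex_of_real (pd i (pd j \<mu>) (\<omega> + \<zeta>)) * cgau pi \<zeta>) x) \<le> C * jbr x powr (- t))"
  proof (intro uniform_constant)
    fix i j
    have "in_Winf t (\<lambda>\<xi>. complex_of_real (pd i (pd j \<mu>) \<xi>))" using assms(7) by (simp add: t_def)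
    from in_Winf_bound[OF this _ tn] show "\<exists>C>0. (\<forall>x. \<bar>pd i (pd j \<mu>) x\<bar> \<le> C) \<and>
      (\<forall>\<omega> x. norm (fourier (\<lambda>\<zeta>. complex_of_real (pd i (pd j \<mu>) (\<omega> + \<zeta>)) * cgau pi \<zeta>) x) \<le> C * jbr x powr (- t))"
      using dif(5) by (simp add: continuous_on_of_real)
  qed (blast intro: order_trans mult_right_mono powr_ge_zero)+
  then obtain Ch where Ch: "\<And>i j x. \<bar>pd i (pd j \<mu>) x\<bar> \<le> Ch"
    "\<And>i j \<omega> x. norm (fourier (\<lambda>\<zeta>. complex_of_real (pd i (pd j \<mu>) (\<omega> + \<zeta>)) * cgau pi \<zeta>) x) \<le> Ch * jbr x powr (- t)"
    by blast
  have "\<exists>C>0. \<forall>j. (\<forall>x. \<bar>pd j \<mu> x\<bar> \<le> C * jbr x powr s) \<and>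
    (\<forall>\<omega> x. norm (fourier (\<lambda>\<zeta>. complex_of_real (pd j \<mu> (\<omega> + \<zeta>)) * cgau pi \<zeta>) x) \<le> C * jbr \<omega> powr s * jbr x powr (- t'))"
  proof (rule uniform_constant)
    fix j
    have "in_Winf t' (\<lambda>\<xi>. complex_of_real (jbr \<xi> powr (- s) * pd j \<mu> \<xi>))" using assms(6) by (simp add: t'_def quasi_exponent_def)
    from in_Winf_bound[OF this _ t'n] obtain C0 where C0: "0 < C0" "\<And>x. \<bar>jbr x powr (- s) * pd j \<mu> x\<bar> \<le> C0"
      "\<And>\<omega> x. norm (fourier (\<lambda>\<zeta>. complex_of_real (jbr (\<omega> + \<zeta>) powr (- s) * pd j \<mu> (\<omega> + \<zeta>)) * cgau pi \<zeta>) x) \<le> C0 * jbr x powr (- t')"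
    proof -
      have "continuous_on UNIV (\<lambda>\<xi>. complex_of_real (jbr \<xi> powr (- s) * pd j \<mu> \<xi>))"
        using jbr_pos unfolding jbr_def
        by (intro continuous_intros dif(4)) (auto simp: add_nonneg_eq_0_iff)
      then show ?thesis using in_Winf_bound[OF \<open>in_Winf t' _\<close> _ t'n] that by (simp only: norm_of_real) blast
    qed
    obtain C1 where C1: "0 < C1" "\<And>\<omega> x. norm (fourier (\<lambda>\<zeta>. complex_of_real (pd j \<mu> (\<omega> + \<zeta>)) * cgau pi \<zeta>) x) \<le> C1 * jbr \<omega> powr s * jbr x powr (- t')"
      using gradient_transform[OF t'n _ dif(4) C0(2,3)] assms(4) by auto
    have "\<bar>pd j \<mu> x\<bar> \<le> (C0 + C1) * jbr x powr s" for x
    proof -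
      have "\<bar>pd j \<mu> x\<bar> = \<bar>jbr x powr (- s) * pd j \<mu> x\<bar> * jbr x powr s"
        using jbr_pos[of x] by (simp add: abs_mult powr_minus field_simps)
      also have "\<dots> \<le> (C0 + C1) * jbr x powr s" using C0(2)[of x] C1(1) by (intro mult_right_mono) auto
      finally show ?thesis .
    qed
    moreover have "norm (fourier (\<lambda>\<zeta>. complex_of_real (pd j \<mu> (\<omega> + \<zeta>)) * cgau pi \<zeta>) x) \<le> (C0 + C1) * jbr \<omega> powr s * jbr x powr (- t')" for \<omega> x
      using C0(1) by (intro order_trans[OF C1(2)] mult_right_mono) auto
    ultimately show "\<exists>C>0. (\<forall>x. \<bar>pd j \<mu> x\<bar> \<le> C * jbr x powr s) \<and>
      (\<forall>\<omega> x. norm (fourier (\<lambda>\<zeta>. complex_of_real (pd j \<mu> (\<omega> + \<zeta>)) * cgau pi \<zeta>) x) \<le> C * jbr \<omega> powr s * jbr x powr (- t'))"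
      using C0(1) C1(1) by (intro exI[of _ "C0 + C1"]) auto
  qed (blast intro: order_trans mult_right_mono powr_ge_zero)
  then obtain Cg where Cg: "\<And>j x. \<bar>pd j \<mu> x\<bar> \<le> Cg * jbr x powr s"
    "\<And>j \<omega> x. norm (fourier (\<lambda>\<zeta>. complex_of_real (pd j \<mu> (\<omega> + \<zeta>)) * cgau pi \<zeta>) x) \<le> Cg * jbr \<omega> powr s * jbr x powr (- t')"
    by blast
  have strict: "s * real CARD('n) * \<bar>recip p - recip q\<bar> < \<delta>" if "p \<noteq> q" using \<delta> that by simp
  obtain C where C: "\<And>h. integrable lborel h \<Longrightarrow>
    mixed_norm p q (\<lambda>x \<xi>. ennreal (freq_stft (\<lambda>\<eta>. cis (\<mu> \<eta>) * h \<eta>) x \<xi>))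
      \<le> ennreal C * mixed_norm p q (\<lambda>x \<xi>. ennreal (freq_stft h x \<xi> * jbr \<xi> powr \<delta>))"
    using multiplier_bound[OF assms(1-3) less_imp_le[OF assms(4)] t tt' t'r \<delta>0 gap strict Ch Cg] by blast
  have W: "Wnorm p q \<delta> f = mixed_norm p q (\<lambda>x \<xi>. ennreal (norm (stft f x \<xi>) * jbr \<xi> powr \<delta>))" for f :: "real^'n \<Rightarrow> complex" and \<delta>
    by (simp add: Wnorm_def mixed_norm_def)
  have "Wnorm p q 0 (mult_op \<mu> f) \<le> ennreal C * Wnorm p q \<delta> f" if f: "schwartz f" for f
  \<comment> \<open>If both are integrable, the frequency-side identities for the two short-time
    transforms apply; otherwise the image of \<open>f\<close> is the zero function.\<close>
  proof (cases "integrable lborel f \<and> integrable lborel (fourier f)")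
    case True
    then have "norm (stft (mult_op \<mu> f) x \<xi>) * jbr \<xi> powr 0 = freq_stft (\<lambda>\<eta>. cis (\<mu> \<eta>) * fourier f \<eta>) x \<xi>" for x \<xi>
      using jbr_pos[of \<xi>] by (simp add: norm_stft_mult_op)
    then show ?thesis using C[of "fourier f"] True by (simp add: W norm_stft_freq)
  next
    case False
    have "continuous_on UNIV (pds [] f)" using f unfolding schwartz_def by blast
    then have "f \<in> borel_measurable borel" by (intro borel_measurable_continuous_onI) simp
    then have "mult_op \<mu> f = (\<lambda>x. 0)" using mult_op_eq_0[OF _ _ False, of \<mu>] by auto
    \<comment> \<open>Zero is written as 0 * 0 so that \<open>mixed_norm_cmult_le\<close> bounds the
      norm by 0.\<close>
    then have "Wnorm p q 0 (mult_op \<mu> f) = mixed_norm p q (\<lambda>x \<xi>::real^'n. 0 * 0)" by (simp add: W stft_def)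
    also have "\<dots> \<le> 0 * mixed_norm p q (\<lambda>x \<xi>::real^'n. 0)" by (rule mixed_norm_cmult_le[OF assms(1,2)]) simp
    finally show ?thesis by simp
  qed
  then show "\<exists>C. \<forall>f. schwartz f \<longrightarrow> Wnorm p q 0 (mult_op \<mu> f) \<le> ennreal C * Wnorm p q \<delta> f" by blast
qed

end
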